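(* Let $X\subseteq \mathbb P^r$ be an integral projective variety of dimension $3$. Let $D_1,\dots,D_l$ be pairwise distinct effective Cartier divisors of $X$, each an integral surface linearly equivalent to a multiple of the general hyperplane section $H$ of $X$, with degrees $s_1\leq s_2\leq\dots\leq s_l$; let $r_1,\dots,r_l$ be positive integers, and let $$S=r_1D_1+r_2D_2+\dots+r_lD_l.$$ Put $s=s_1$, let $\pi_1$ be the sectional genus of $D_1$, and put $\deg S=r_1s_1+\dots+r_ls_l$. Let $C\subset S$ be a curve of degree $d$ and arithmetic genus $p_a(C)$. Assume $d>30(\deg S)^7$. 1) If there exists a component $D_i$ of $S$ of minimal degree $s$ such that $C\cap D_i$ is a curve and $C$ and $C\cap D_i$ have the same degree, then $$p_a(C) \leq G^*(S,d) \leq \frac{d^2}{2s}+\frac{d}{2s}(2\pi_1-2-s)+s^4.$$ 2) Otherwise, $$p_a(C) \leq \frac{d^2}{2s}+\frac{d}{2s}\left(2\pi_1-2-s-\frac{1}{2}\right).$$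
   Context: The base field is $\mathbb C$. A curve is a projective scheme of dimension $1$ (not necessarily reduced, irreducible, or Cohen-Macaulay); its arithmetic genus is $p_a(C)=1-\chi(\mathcal O_C)$. Intersections are scheme-theoretic, and degrees are taken with respect to the given embedding in $\mathbb P^r$. Effective Cartier divisors of $X$ are identified with the associated closed subschemes of $X$. If $f_i$ is a local generator of the ideal sheaf of $D_i$ in $X$, then $S=r_1D_1+\dots+r_lD_l$ denotes the effective Cartier divisor with local generator $f_1^{r_1}f_2^{r_2}\cdots f_l^{r_l}$, regarded as a closed subscheme (a projective surface) of $X$; $C\subset S$ means that $C$ is a closed subscheme of $S$. The sectional genus of an integral surface in $\mathbb P^r$ is the arithmetic genus of its general hyperplane section (components $D_i$ of the same degree have the same sectional genus). For an integer $d>0$, $\mathcal C^*(S,d)$ is the set of all curves of degree $d$ contained in some integral component $D_i$ of $S$ of minimal degree $s$, and $G^*(S,d)=\max\{p_a(C): C\in\mathcal C^*(S,d)\}$. *)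

theory Defs
  imports
    Complex_Main
    "HOL-Library.Poly_Mapping"
    "HOL-Library.Function_Algebras"
    "HOL-Computational_Algebra.Polynomial"
    "HOL-Algebra.Ideal"
begin

section \<open>Homogeneous coordinate rings of projective spaces\<close>

text \<open>A polynomial assigns complex coefficients to monomials, a monomial being the finitely
  supported function from variable indices to exponents. Laurent polynomials allow negative
  exponents.\<close>

type_synonym mpoly = "(nat \<Rightarrow>\<^sub>0 nat) \<Rightarrow>\<^sub>0 complex"
type_synonym laurent = "(nat \<Rightarrow>\<^sub>0 int) \<Rightarrow>\<^sub>0 complex"

definition monom_deg :: "(nat \<Rightarrow>\<^sub>0 'a::comm_monoid_add) \<Rightarrow> 'a" where
  "monom_deg m = (\<Sum>i\<in>Poly_Mapping.keys m. Poly_Mapping.lookup m i)"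

text \<open>The ring \<open>\<complex>[x\<^sub>0,\<dots>,x\<^sub>r]\<close>.\<close>

definition coord_ring :: "nat \<Rightarrow> mpoly ring" where
  "coord_ring r =
    \<lparr>carrier = {p. \<forall>m\<in>Poly_Mapping.keys p. Poly_Mapping.keys m \<subseteq> {..r}},
     monoid.mult = (*), one = 1, zero = 0, add = (+)\<rparr>"

definition var :: "nat \<Rightarrow> mpoly" where
  "var i = Poly_Mapping.single (Poly_Mapping.single i 1) 1"

definition forms :: "nat \<Rightarrow> nat \<Rightarrow> mpoly set" where
  "forms r e = {p \<in> carrier (coord_ring r). \<forall>m\<in>Poly_Mapping.keys p. monom_deg m = e}"

definition homogeneous_ideal :: "nat \<Rightarrow> mpoly set \<Rightarrow> bool" where
  "homogeneous_ideal r I \<longleftrightarrow>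
    ideal I (coord_ring r) \<and> I = Idl\<^bsub>coord_ring r\<^esub> (I \<inter> (\<Union>e. forms r e))"

definition saturation :: "nat \<Rightarrow> mpoly set \<Rightarrow> mpoly set" where
  "saturation r I = {p \<in> carrier (coord_ring r). \<forall>i\<le>r. \<exists>N. var i ^ N * p \<in> I}"

lemma coord_ring_simps [simp]:
  "carrier (coord_ring r) = {p. \<forall>m\<in>Poly_Mapping.keys p. Poly_Mapping.keys m \<subseteq> {..r}}"
  "x \<otimes>\<^bsub>coord_ring r\<^esub> y = x * y" "x \<oplus>\<^bsub>coord_ring r\<^esub> y = x + y"
  "\<one>\<^bsub>coord_ring r\<^esub> = 1" "\<zero>\<^bsub>coord_ring r\<^esub> = 0"
  by (simp_all add: coord_ring_def)

lemma cring_coord_ring: "cring (coord_ring r)"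
proof (rule cringI)
  show "abelian_group (coord_ring r)"
  proof (rule abelian_groupI, goal_cases)
    case (1 x y) then show ?case using Poly_Mapping.keys_add[of x y] by auto
  next
    case (6 x) then show ?case by (auto intro!: exI[of _ "- x"])
  qed (auto simp: add.assoc add.commute)
  show "Group.comm_monoid (coord_ring r)"
  proof (rule comm_monoidI, goal_cases)
    case (1 x y)
    show ?case
    proof (clarsimp)
      fix m i assume "m \<in> Poly_Mapping.keys (x * y)" "i \<in> Poly_Mapping.keys m"
      then obtain a b where ab: "a \<in> Poly_Mapping.keys x" "b \<in> Poly_Mapping.keys y"
        and i: "i \<in> Poly_Mapping.keys (a + b)"
        using keys_mult[of x y] by blast
      have "Poly_Mapping.keys a \<subseteq> {..r}" "Poly_Mapping.keys b \<subseteq> {..r}"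
        using 1 ab by simp_all
      then show "i \<le> r" using i Poly_Mapping.keys_add[of a b] by blast
    qed
  qed (auto simp: mult.assoc mult.commute)
qed (auto simp: distrib_right)

section \<open>Closed subschemes of projective space\<close>

text \<open>A closed subscheme of \<open>\<P>\<^sup>r\<close> is represented by its ideal, the correspondence
  \<open>I \<mapsto> Proj(\<complex>[x\<^sub>0,\<dots>,x\<^sub>r]/I)\<close> being a bijection between saturated homogeneous ideals and closed
  subschemes. It reverses inclusions: \<open>Z\<close> is a closed subscheme of \<open>W\<close> iff \<open>I\<^sub>W \<subseteq> I\<^sub>Z\<close>.\<close>

definition closed_subscheme :: "nat \<Rightarrow> mpoly set \<Rightarrow> bool" where
  "closed_subscheme r I \<longleftrightarrow> homogeneous_ideal r I \<and> saturation r I = I"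

definition subscheme_of :: "mpoly set \<Rightarrow> mpoly set \<Rightarrow> bool" where
  "subscheme_of Z W \<longleftrightarrow> W \<subseteq> Z"

text \<open>Intersecting subschemes adds their ideals; the sum need not be saturated.\<close>

definition scheme_inter :: "nat \<Rightarrow> mpoly set \<Rightarrow> mpoly set \<Rightarrow> mpoly set" where
  "scheme_inter r I J = saturation r (I <+>\<^bsub>coord_ring r\<^esub> J)"

text \<open>A saturated proper ideal does not contain the irrelevant ideal, so integral subschemes
  are the relevant homogeneous primes. These are also the points of the scheme \<open>\<P>\<^sup>r\<close>.\<close>

definition integral_subscheme :: "nat \<Rightarrow> mpoly set \<Rightarrow> bool" where
  "integral_subscheme r I \<longleftrightarrow> closed_subscheme r I \<and> primeideal I (coord_ring r)"

definition points :: "nat \<Rightarrow> mpoly set \<Rightarrow> mpoly set set" where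
  "points r Z = {P. integral_subscheme r P \<and> Z \<subseteq> P}"

text \<open>Krull dimension, through chains of integral closed subschemes (that is, of irreducible
  closed subsets).\<close>

definition has_chain :: "nat \<Rightarrow> mpoly set \<Rightarrow> nat \<Rightarrow> bool" where
  "has_chain r Z n \<longleftrightarrow>
    (\<exists>P. (\<forall>i\<le>n. P i \<in> points r Z) \<and> (\<forall>i<n. P i \<subset> P (Suc i)))"

definition has_dim :: "nat \<Rightarrow> mpoly set \<Rightarrow> nat \<Rightarrow> bool" where
  "has_dim r Z n \<longleftrightarrow> has_chain r Z n \<and> \<not> has_chain r Z (Suc n)"

definition is_curve :: "nat \<Rightarrow> mpoly set \<Rightarrow> bool" where
  "is_curve r C \<longleftrightarrow> closed_subscheme r C \<and> has_dim r C 1"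

definition integral_surface :: "nat \<Rightarrow> mpoly set \<Rightarrow> bool" where
  "integral_surface r D \<longleftrightarrow> integral_subscheme r D \<and> has_dim r D 2"

section \<open>Degree and arithmetic genus\<close>

text \<open>The dimension of \<open>V/W\<close> for subspaces \<open>W \<subseteq> V\<close>, as the size of a basis of a complement of \<open>W\<close>
  in \<open>V\<close>. It is used only where the quotient has finite dimension.\<close>

definition quot_dim :: "(complex \<Rightarrow> 'b \<Rightarrow> 'b::ab_group_add) \<Rightarrow> 'b set \<Rightarrow> 'b set \<Rightarrow> nat" where
  "quot_dim scl V W = (THE n. \<exists>B. finite B \<and> card B = n \<and> B \<subseteq> V \<and> \<not> module.dependent scl B \<and>
     module.span scl B \<inter> W = {0} \<and> V \<subseteq> module.span scl (B \<union> W))"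

definition poly_scale :: "complex \<Rightarrow> ('a::comm_monoid_add \<Rightarrow>\<^sub>0 complex) \<Rightarrow> 'a \<Rightarrow>\<^sub>0 complex" where
  "poly_scale c p = Poly_Mapping.single 0 c * p"

definition cochain_scale :: "complex \<Rightarrow> (nat set \<Rightarrow> laurent) \<Rightarrow> nat set \<Rightarrow> laurent" where
  "cochain_scale c b = (\<lambda>\<sigma>. poly_scale c (b \<sigma>))"

lemma vector_space_poly_scale: "vector_space poly_scale"
  by unfold_locales
     (simp_all add: poly_scale_def algebra_simps single_add mult_single flip: mult.assoc)

lemma vector_space_cochain_scale: "vector_space cochain_scale"
proof -
  interpret vector_space "poly_scale :: complex \<Rightarrow> laurent \<Rightarrow> laurent"
    by (rule vector_space_poly_scale)
  show ?thesis
    by unfold_locales (simp_all add: cochain_scale_def fun_eq_iff scale_left_distrib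
        scale_right_distrib)
qed

definition hilbert_fun :: "nat \<Rightarrow> mpoly set \<Rightarrow> nat \<Rightarrow> nat" where
  "hilbert_fun r I t = quot_dim poly_scale (forms r t) (I \<inter> forms r t)"

definition hilbert_poly :: "nat \<Rightarrow> mpoly set \<Rightarrow> real poly" where
  "hilbert_poly r I =
    (THE p. \<forall>\<^sub>F t in sequentially. poly p (real t) = real (hilbert_fun r I t))"

definition scheme_degree :: "nat \<Rightarrow> mpoly set \<Rightarrow> real" where
  "scheme_degree r I =
    fact (degree (hilbert_poly r I)) * lead_coeff (hilbert_poly r I)"

text \<open>The cohomology of the structure sheaf is computed by the Cech complex of the standard affine
  cover. For \<open>\<sigma> \<subseteq> {0,\<dots>,r}\<close> and \<open>x\<^sub>\<sigma> = \<Prod>\<^sub>i\<^sub>\<in>\<^sub>\<sigma> x\<^sub>i\<close>, the sections over the open set \<open>x\<^sub>\<sigma> \<noteq> 0\<close> form the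
  quotient of the degree \<open>0\<close> part of \<open>\<complex>[x\<^sub>0,\<dots>,x\<^sub>r]\<close> localized at \<open>x\<^sub>\<sigma>\<close> by the degree \<open>0\<close> part of the
  extended ideal.\<close>

definition to_laurent :: "mpoly \<Rightarrow> laurent" where
  "to_laurent p = (\<Sum>m\<in>Poly_Mapping.keys p.
     Poly_Mapping.single (Poly_Mapping.map int m) (Poly_Mapping.lookup p m))"

definition chart_ring :: "nat \<Rightarrow> nat set \<Rightarrow> laurent set" where
  "chart_ring r \<sigma> = {g. \<forall>m\<in>Poly_Mapping.keys g. Poly_Mapping.keys m \<subseteq> {..r} \<and>
     (\<forall>i. Poly_Mapping.lookup m i < 0 \<longrightarrow> i \<in> \<sigma>) \<and> monom_deg m = 0}"

definition chart_ideal :: "nat \<Rightarrow> mpoly set \<Rightarrow> nat set \<Rightarrow> laurent set" where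
  "chart_ideal r I \<sigma> = {g \<in> chart_ring r \<sigma>.
     \<exists>N. \<exists>f\<in>I. to_laurent (\<Prod>i\<in>\<sigma>. var i) ^ N * g = to_laurent f}"

text \<open>Cochains are indexed by the number \<open>n = p + 1\<close> of charts, where \<open>p\<close> is the cohomological
  degree; they vanish for \<open>n = 0\<close>. Elements of the quotient rings are handled through
  representatives, so a class is trivial when its entries lie in the \<^const>\<open>chart_ideal\<close>s.\<close>

definition simplices :: "nat \<Rightarrow> nat \<Rightarrow> nat set set" where
  "simplices r n = {\<sigma>. \<sigma> \<subseteq> {..r} \<and> \<sigma> \<noteq> {} \<and> card \<sigma> = n}"

definition cochains :: "nat \<Rightarrow> nat \<Rightarrow> (nat set \<Rightarrow> laurent) set" where
  "cochains r n = {b. \<forall>\<sigma>. if \<sigma> \<in> simplices r n then b \<sigma> \<in> chart_ring r \<sigma> else b \<sigma> = 0}"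

definition ideal_cochains :: "nat \<Rightarrow> mpoly set \<Rightarrow> nat \<Rightarrow> (nat set \<Rightarrow> laurent) set" where
  "ideal_cochains r I n =
    {b. \<forall>\<sigma>. if \<sigma> \<in> simplices r n then b \<sigma> \<in> chart_ideal r I \<sigma> else b \<sigma> = 0}"

definition cech_diff :: "nat \<Rightarrow> (nat set \<Rightarrow> laurent) \<Rightarrow> nat set \<Rightarrow> laurent" where
  "cech_diff r b \<tau> =
    (if \<tau> \<subseteq> {..r} then \<Sum>i\<in>\<tau>. (- 1) ^ card {j\<in>\<tau>. j < i} * b (\<tau> - {i}) else 0)"

definition cocycles :: "nat \<Rightarrow> mpoly set \<Rightarrow> nat \<Rightarrow> (nat set \<Rightarrow> laurent) set" where
  "cocycles r I n = {b \<in> cochains r n. cech_diff r b \<in> ideal_cochains r I (Suc n)}"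

definition coboundaries :: "nat \<Rightarrow> mpoly set \<Rightarrow> nat \<Rightarrow> (nat set \<Rightarrow> laurent) set" where
  "coboundaries r I n =
    {cech_diff r b + e | b e. b \<in> cochains r (n - 1) \<and> e \<in> ideal_cochains r I n}"

definition cohomology_dim :: "nat \<Rightarrow> mpoly set \<Rightarrow> nat \<Rightarrow> nat" where
  "cohomology_dim r I p =
    quot_dim cochain_scale (cocycles r I (Suc p)) (coboundaries r I (Suc p))"

definition euler_char :: "nat \<Rightarrow> mpoly set \<Rightarrow> int" where
  "euler_char r I = (\<Sum>p\<le>r. (- 1) ^ p * int (cohomology_dim r I p))"

definition arith_genus :: "nat \<Rightarrow> mpoly set \<Rightarrow> int" where
  "arith_genus r C = 1 - euler_char r C"

section \<open>General hyperplane sections\<close>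

definition eval_at :: "(nat \<Rightarrow> complex) \<Rightarrow> mpoly \<Rightarrow> complex" where
  "eval_at c p = (\<Sum>m\<in>Poly_Mapping.keys p. Poly_Mapping.lookup p m *
     (\<Prod>i\<in>Poly_Mapping.keys m. c i ^ Poly_Mapping.lookup m i))"

definition linear_form :: "nat \<Rightarrow> (nat \<Rightarrow> complex) \<Rightarrow> mpoly" where
  "linear_form r c = (\<Sum>i\<le>r. poly_scale (c i) (var i))"

text \<open>A property holds for the general hyperplane if it holds on a nonempty basic open subset
  \<open>F \<noteq> 0\<close> of the dual projective space.\<close>

definition for_general_hyperplane :: "nat \<Rightarrow> (mpoly \<Rightarrow> bool) \<Rightarrow> bool" where
  "for_general_hyperplane r Q \<longleftrightarrow>
    (\<exists>e. \<exists>F\<in>forms r e. F \<noteq> 0 \<and> (\<forall>c. eval_at c F \<noteq> 0 \<longrightarrow> Q (linear_form r c)))"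

definition hyperplane_section :: "nat \<Rightarrow> mpoly set \<Rightarrow> mpoly \<Rightarrow> mpoly set" where
  "hyperplane_section r Z h = scheme_inter r Z (PIdl\<^bsub>coord_ring r\<^esub> h)"

definition sectional_genus :: "nat \<Rightarrow> mpoly set \<Rightarrow> int" where
  "sectional_genus r D = (THE g.
     for_general_hyperplane r (\<lambda>h. arith_genus r (hyperplane_section r D h) = g))"

section \<open>Effective Cartier divisors on an integral projective variety\<close>

text \<open>The elements of \<open>\<complex>[x\<^sub>0,\<dots>,x\<^sub>r]\<close> lying in the ideal generated by \<open>J\<close> in the homogeneous
  localization at the point \<open>P\<close>. Two homogeneous ideals have the same stalk at \<open>P\<close> iff
  they yield the same set.\<close>

definition stalk :: "nat \<Rightarrow> mpoly set \<Rightarrow> mpoly set \<Rightarrow> mpoly set" where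
  "stalk r P J = {g \<in> carrier (coord_ring r). \<exists>e. \<exists>h\<in>forms r e. h \<notin> P \<and> h * g \<in> J}"

text \<open>The ideal \<open>I\<^sub>X + (f)\<close>, which describes the principal ideal generated by \<open>f\<close> on \<open>X\<close>.\<close>

definition principal_on :: "nat \<Rightarrow> mpoly set \<Rightarrow> mpoly \<Rightarrow> mpoly set" where
  "principal_on r X f = X <+>\<^bsub>coord_ring r\<^esub> (PIdl\<^bsub>coord_ring r\<^esub> f)"

text \<open>A form \<open>f\<close> of degree \<open>e\<close> stands for the germ \<open>f/u\<close> at \<open>P\<close>, where \<open>u\<close> is any form of degree \<open>e\<close>
  with \<open>u \<notin> P\<close>; another choice of \<open>u\<close> changes the germ by a unit. Since \<open>X\<close> is integral,
  \<open>f \<notin> X\<close> says that the germ is not a zero divisor.\<close>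

definition local_generator ::
    "nat \<Rightarrow> mpoly set \<Rightarrow> mpoly set \<Rightarrow> mpoly set \<Rightarrow> mpoly \<Rightarrow> bool" where
  "local_generator r X D P f \<longleftrightarrow> (\<exists>e. f \<in> forms r e) \<and> f \<notin> X \<and>
     stalk r P D = stalk r P (principal_on r X f)"

definition effective_cartier :: "nat \<Rightarrow> mpoly set \<Rightarrow> mpoly set \<Rightarrow> bool" where
  "effective_cartier r X D \<longleftrightarrow> closed_subscheme r D \<and> subscheme_of D X \<and>
     (\<forall>P\<in>points r X. \<exists>f. local_generator r X D P f)"

text \<open>The ideal of the closed subscheme \<open>\<Sum>\<^sub>i\<^sub>\<in>\<^sub>J m\<^sub>i D\<^sub>i\<close> of \<open>X\<close>, for effective Cartier
  divisors \<open>D\<^sub>i\<close>: the elements that belong, at every point of \<open>X\<close>, to the ideal generated by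
  \<open>\<Prod>\<^sub>i\<^sub>\<in>\<^sub>J f\<^sub>i\<^bsup>m\<^sub>i\<^esup>\<close>.\<close>

definition divisor_sum ::
    "nat \<Rightarrow> mpoly set \<Rightarrow> ('i \<Rightarrow> mpoly set) \<Rightarrow> ('i \<Rightarrow> nat) \<Rightarrow> 'i set \<Rightarrow> mpoly set" where
  "divisor_sum r X D m J = {g \<in> carrier (coord_ring r).
     \<forall>P\<in>points r X. \<forall>f. (\<forall>i\<in>J. local_generator r X (D i) P (f i)) \<longrightarrow>
       g \<in> stalk r P (principal_on r X (\<Prod>i\<in>J. f i ^ m i))}"

text \<open>Linear equivalence \<open>A = B + div(a/b)\<close>, with a nonzero rational function \<open>a/b\<close> on \<open>X\<close> given by
  forms of the same degree.\<close>

definition lin_equiv :: "nat \<Rightarrow> mpoly set \<Rightarrow> mpoly set \<Rightarrow> mpoly set \<Rightarrow> bool" where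
  "lin_equiv r X A B \<longleftrightarrow> (\<exists>e. \<exists>a\<in>forms r e. \<exists>b\<in>forms r e. a \<notin> X \<and> b \<notin> X \<and>
     (\<forall>P\<in>points r X. \<forall>f g. local_generator r X A P f \<longrightarrow> local_generator r X B P g \<longrightarrow>
        stalk r P (principal_on r X (b * f)) = stalk r P (principal_on r X (a * g))))"

text \<open>A negative multiple of \<open>H\<close> cannot be linearly equivalent to an effective divisor when
  \<open>X\<close> has positive dimension, so natural number multiples suffice.\<close>

definition equiv_hyperplane_multiple :: "nat \<Rightarrow> mpoly set \<Rightarrow> mpoly set \<Rightarrow> bool" where
  "equiv_hyperplane_multiple r X D \<longleftrightarrow> (\<exists>k::nat. for_general_hyperplane r
     (\<lambda>h. lin_equiv r X D (divisor_sum r X (\<lambda>_. hyperplane_section r X h) (\<lambda>_. k) {()})))"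

section \<open>Curves on the components of minimal degree\<close>

text \<open>Here \<open>\<D>\<close> is the set of integral components of the divisor \<open>S\<close>.\<close>

definition min_component_curves :: "nat \<Rightarrow> mpoly set set \<Rightarrow> nat \<Rightarrow> mpoly set set" where
  "min_component_curves r \<D> d = {C. is_curve r C \<and> scheme_degree r C = real d \<and>
     (\<exists>D\<in>\<D>. (\<forall>E\<in>\<D>. scheme_degree r D \<le> scheme_degree r E) \<and> subscheme_of C D)}"

text \<open>The maximum of a possibly infinite set of integers, for which \<^const>\<open>Max\<close> is unsuitable.\<close>

definition G_star :: "nat \<Rightarrow> mpoly set set \<Rightarrow> nat \<Rightarrow> int" where
  "G_star r \<D> d = (GREATEST g. g \<in> arith_genus r ` min_component_curves r \<D> d)"

end

theory Submission
  imports Defs "HOL-Computational_Algebra.Polynomial_Factorial" "HOL-Library.Multiset"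
begin

text \<open>The Cech complex gives \<open>p\<^sub>a(C) = 1 - P(0)\<close> for the Hilbert polynomial \<open>P\<close> of \<open>C\<close>.
If \<open>C\<close> lies on an integral surface, the first difference of its Hilbert function is bounded below by the
Hilbert function of the generic member of a pencil of hyperplane sections, over the field \<open>\<complex>(\<lambda>)\<close>,
and Castelnuovo's count on the integral generic curve section bounds \<open>p\<^sub>a(C)\<close>. In general, residuation
along a divisor \<open>D\<close> cut out by forms of degree \<open>k\<close> relates the Hilbert polynomials by
\<open>P\<^sub>C(t) = P\<^bsub>C \<inter> D\<^esub>(t) + P\<^bsub>C : D\<^esub>(t - k)\<close>. Peeling off the components of \<open>S\<close> one at a time
splits \<open>C\<close> into curves on the \<open>D\<^sub>i\<close>; if no piece on a component of degree \<open>s\<close> carries the whole degree,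
convexity of the quadratic bound leaves a gain that absorbs the constants.\<close>

section \<open>Dimensions of quotient spaces\<close>

text \<open>Castelnuovo's count needs an integral curve section of the surface \<open>D\<close>. For
  a general hyperplane this would be Bertini's theorem. The generic member
  \<open>l2 = \<lambda> l1\<close> of a pencil avoids it: its ideal is the kernel of the
  substitution of \<open>l2 / l1\<close> for \<lambda>, hence prime as soon as no nonzero binary
  form in \<open>l1\<close>, \<open>l2\<close> vanishes on \<open>D\<close>. The price is that
  Hilbert functions are developed over arbitrary infinite fields and compared across the extension
  by \<lambda>. The count itself uses only that \<open>s\<close> points impose at least
  \<open>t + 1\<close> conditions in degree \<open>t\<close> until all \<open>s\<close> are reached,
  not general position; this leaves an error \<open>2 * s ^ 5\<close>, which becomes
  \<open>s ^ 4\<close> after division by \<open>2 * s\<close>. Curves and residuals may have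
  isolated or embedded points, so all estimates run through Hilbert functions of saturated ideals.
  The number 30 is 4 times 15/2. Here 15/2 = 1 + 3/2 + 5 collects the constant of the genus, the
  linear terms and the errors of the pieces, and 4 comes from the denominators \<open>4 * s\<close>
  and \<open>2 * s * (s + 1)\<close> of the two cases in the final estimate.\<close>

locale quot_space = vector_space scale
  for scale :: "'a::field => 'b::ab_group_add => 'b"
begin

text \<open>The dimension of a quotient is the length of a maximal flag between the two subspaces.\<close>

definition hyperplane :: "'b set => 'b set => bool" where
  "hyperplane U V \<longleftrightarrow> subspace U \<and> U \<subseteq> V \<and> (\<exists>v\<in>V. v \<notin> U \<and> (\<forall>x\<in>V. \<exists>k. x - scale k v \<in> U))"

primrec qd :: "'b set => 'b set => nat => bool" where
  "qd V W 0 \<longleftrightarrow> V = W"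
| "qd V W (Suc n) \<longleftrightarrow> (\<exists>U. hyperplane U V \<and> qd U W n)"

definition qdim :: "'b set => 'b set => nat" where
  "qdim V W = (THE n. qd V W n)"

definition finq :: "'b set => 'b set => bool" where
  "finq V W \<longleftrightarrow> (\<exists>n. qd V W n)"

definition cmb :: "('i => 'a) => ('i => 'b) => 'i set => 'b" where
  "cmb c b I = (\<Sum>i\<in>I. scale (c i) (b i))"

text \<open>Independence modulo \<open>W\<close> of a family rather than of a set, so that repeated
  vectors count as dependent.\<close>

definition qindep :: "'b set => ('i => 'b) => 'i set => bool" where
  "qindep W b I \<longleftrightarrow> (\<forall>c. cmb c b I \<in> W --> (\<forall>i\<in>I. c i = 0))"

lemma qindep_lessThan: "qindep W b {..<n} \<longleftrightarrow> (\<forall>c. cmb c b {..<n} \<in> W --> (\<forall>i<n. c i = 0))"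
  by (simp add: qindep_def Ball_def)

lemma cmb_in: "subspace V ==> (\<And>i. i \<in> I ==> b i \<in> V) ==> cmb c b I \<in> V"
  unfolding cmb_def by (intro subspace_sum subspace_scale) auto

lemma qd_sub: "qd V W n ==> W \<subseteq> V"
  by (induction n arbitrary: V) (auto simp: hyperplane_def)

lemma qd_trans: "qd U V m ==> qd V W n ==> qd U W (m + n)"
  by (induction m arbitrary: U) auto

lemma scale_cancel: "subspace U ==> scale k v \<in> U ==> v \<notin> U ==> k = 0"
  using subspace_scale[of U "scale k v" "inverse k"] by (cases "k = 0") auto

lemma hyperplane_exchange:
  assumes V: "hyperplane U V" and w: "w \<in> V" "w \<notin> U" and x: "x \<in> V"
  shows "\<exists>k. x - scale k w \<in> U"
proof -
  obtain v where U: "subspace U" and v: "\<And>x. x \<in> V ==> \<exists>k. x - scale k v \<in> U"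
    using V by (auto simp: hyperplane_def)
  obtain j k where j: "w - scale j v \<in> U" "x - scale k v \<in> U" using v w(1) x by meson
  have "j \<noteq> 0" using j(1) w(2) by auto
  hence "x - scale (k / j) w = (x - scale k v) - scale (k / j) (w - scale j v)"
    by (simp add: scale_right_diff_distrib)
  thus ?thesis using subspace_diff[OF U j(2) subspace_scale[OF U j(1)]] by metis
qed

end

locale quot_space_pair = vs1: quot_space s1 + vs2: quot_space s2
  for s1 :: "'a::field => 'b::ab_group_add => 'b" and s2 :: "'a => 'c::ab_group_add => 'c"
begin

text \<open>The assumptions say that \<open>f\<close> induces an isomorphism of \<open>V / W\<close>
  onto \<open>U' / W'\<close>. Flags are carried over by image plus \<open>W'\<close> in one
  direction and by preimage in the other. The isomorphisms used later, from the second isomorphism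
  theorem to connecting homomorphisms, are instances.\<close>

lemma qd_map:
  assumes f: "Vector_Spaces.linear s1 s2 f" and V: "vs1.subspace V" and W': "vs2.subspace W'" and U': "vs2.subspace U'"
    and fV: "\<And>v. v \<in> V ==> f v \<in> U'" and sur: "\<And>u. u \<in> U' ==> \<exists>v\<in>V. u - f v \<in> W'"
    and WW: "\<And>v. v \<in> V ==> v \<in> W \<longleftrightarrow> f v \<in> W'" and sub: "W \<subseteq> V" "W' \<subseteq> U'"
  shows "vs1.qd V W n \<longleftrightarrow> vs2.qd U' W' n"
proof -
  interpret module_hom s1 s2 f using f by (simp add: linear_iff_module_hom)
  note W'a = vs2.subspace_add[OF W'] and W'd = vs2.subspace_diff[OF W']
  show ?thesis using V U' fV sur WW sub
  proof (induction n arbitrary: V U')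
    case 0
    have "U' \<subseteq> W'" if "V = W"
    proof
      fix u assume "u \<in> U'"
      then obtain v where "v \<in> V" "u - f v \<in> W'" using 0(4) by blast
      thus "u \<in> W'" using 0(5) that W'a[of "u - f v" "f v"] by simp
    qed
    thus ?case using 0 by auto
  next
    case (Suc n)
    show ?case
    proof
      assume "vs1.qd V W (Suc n)"
      then obtain U v where U: "vs1.subspace U" "U \<subseteq> V" "v \<in> V" "v \<notin> U" "\<And>x. x \<in> V ==> \<exists>k. x - s1 k v \<in> U"
        and q: "vs1.qd U W n" by (auto simp: vs1.hyperplane_def)
      let ?U = "{u \<in> U'. \<exists>x\<in>U. u - f x \<in> W'}"
      have WU: "W \<subseteq> U" by (rule vs1.qd_sub[OF q])
      have sU: "vs2.subspace ?U"
      proof (rule vs2.subspaceI)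
        show "0 \<in> ?U" using vs1.subspace_0[OF U(1)] vs2.subspace_0 W' Suc.prems(2) zero by force
      next
        fix u w assume "u \<in> ?U" "w \<in> ?U"
        then obtain x y where "u \<in> U'" "w \<in> U'" "x \<in> U" "y \<in> U" "(u - f x) + (w - f y) \<in> W'" using W'a by blast
        thus "u + w \<in> ?U" using vs1.subspace_add[OF U(1)] vs2.subspace_add[OF Suc.prems(2)]
          by (auto intro!: bexI[of _ "x + y"] simp: add algebra_simps)
      next
        fix k u assume "u \<in> ?U"
        then obtain x where "u \<in> U'" "x \<in> U" "s2 k (u - f x) \<in> W'" using vs2.subspace_scale[OF W'] by blast
        thus "s2 k u \<in> ?U" using vs1.subspace_scale[OF U(1)] vs2.subspace_scale[OF Suc.prems(2)]
          by (auto intro!: bexI[of _ "s1 k x"] simp: scale vs2.scale_right_diff_distrib)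
      qed
      have "vs2.qd ?U W' n" using q
      proof (rule Suc.IH[THEN iffD1, rotated -1])
        show "f x \<in> ?U" if "x \<in> U" for x using that U(2) Suc.prems(3) vs2.subspace_0[OF W'] by (auto intro!: bexI[of _ x])
        show "W' \<subseteq> ?U" using Suc.prems(7) vs1.subspace_0[OF U(1)] by (auto simp: zero intro!: bexI[of _ 0])
      qed (use U Suc.prems(5) WU sU in auto)
      moreover have "f v \<notin> ?U"
      proof
        assume "f v \<in> ?U"
        then obtain x where "x \<in> U" "f (v - x) \<in> W'" by (auto simp: diff)
        thus False using U(1-4) Suc.prems(1,5) WU vs1.subspace_diff vs1.subspace_add[OF U(1), of "v - x" x]
          by (metis diff_add_cancel subsetD)
      qed
      moreover have "\<exists>k. u - s2 k (f v) \<in> ?U" if u: "u \<in> U'" for u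
      proof -
        obtain x k where "x \<in> V" "u - f x \<in> W'" "x - s1 k v \<in> U" using Suc.prems(4)[OF u] U(5) by blast
        thus ?thesis using u U(3) Suc.prems(2,3) vs2.subspace_diff vs2.subspace_scale
          by (intro exI[of _ k]) (auto intro!: bexI[of _ "x - s1 k v"] simp: diff scale)
      qed
      ultimately show "vs2.qd U' W' (Suc n)" unfolding vs2.qd.simps vs2.hyperplane_def using sU Suc.prems(3)[OF U(3)] by blast
    next
      assume "vs2.qd U' W' (Suc n)"
      then obtain U v where H: "vs2.hyperplane U U'" and q: "vs2.qd U W' n" by auto
      then obtain v where U: "vs2.subspace U" "U \<subseteq> U'" "v \<in> U'" "v \<notin> U" by (auto simp: vs2.hyperplane_def)
      let ?U = "{x \<in> V. f x \<in> U}"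
      have WU: "W' \<subseteq> U" by (rule vs2.qd_sub[OF q])
      obtain w where w: "w \<in> V" "v - f w \<in> U" using Suc.prems(4)[OF U(3)] WU by blast
      have fw: "f w \<notin> U" using vs2.subspace_add[OF U(1) w(2)] U(4) by force
      have sU: "vs1.subspace ?U"
        using Suc.prems(1) U(1) by (auto simp: vs1.subspace_def vs2.subspace_def add scale zero)
      have "vs1.qd ?U W n" using q
      proof (rule Suc.IH[THEN iffD2, rotated -1])
        show "\<exists>x\<in>?U. u - f x \<in> W'" if u: "u \<in> U" for u
        proof -
          obtain x where "x \<in> V" "u - f x \<in> W'" using Suc.prems(4)[of u] u U(2) by blast
          thus ?thesis using vs2.subspace_diff[OF U(1) u, of "u - f x"] WU by auto
        qed
        show "W \<subseteq> ?U" using Suc.prems(5,6) WU by blast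
      qed (use U Suc.prems WU sU in auto)
      moreover have "\<exists>k. x - s1 k w \<in> ?U" if x: "x \<in> V" for x
        using vs2.hyperplane_exchange[OF H Suc.prems(3)[OF w(1)] fw Suc.prems(3)[OF x]] x w(1) Suc.prems(1)
          vs1.subspace_diff vs1.subspace_scale by (auto simp: diff scale)
      ultimately show "vs1.qd V W (Suc n)" unfolding vs1.qd.simps vs1.hyperplane_def using sU w(1) fw by blast
    qed
  qed
qed

end

section \<open>Flags: splitting, uniqueness of the length, comparison with bases\<close>

context quot_space
begin

interpretation id: quot_space_pair scale scale
  by (simp add: quot_space_pair_def quot_space_axioms)

text \<open>The second isomorphism theorem: since \<open>V\<close> is not inside the hyperplane
  \<open>U\<close>, the two span \<open>X\<close>, so \<open>V / (V \<inter> U)\<close> and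
  \<open>U / (V \<inter> U)\<close> are \<open>X / U\<close> and \<open>X / V\<close>.\<close>

lemma hyperplane_meet:
  assumes H: "hyperplane U X" and V: "subspace V" "V \<subseteq> X" "\<not> V \<subseteq> U"
  shows "hyperplane (V \<inter> U) V" and "subspace X ==> qd U (V \<inter> U) n \<longleftrightarrow> qd X V n"
proof -
  have U: "subspace U" "U \<subseteq> X" using H by (auto simp: hyperplane_def)
  obtain v where v: "v \<in> V" "v \<notin> U" using V(3) by blast
  note ex = hyperplane_exchange[OF H subsetD[OF V(2) v(1)] v(2)]
  show "hyperplane (V \<inter> U) V" unfolding hyperplane_def
  proof (intro conjI bexI[OF _ v(1)] ballI)
    show "\<exists>k. x - scale k v \<in> V \<inter> U" if "x \<in> V" for x
      using ex[of x] that V(1,2) v(1) subspace_diff subspace_scale by blast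
  qed (use v V U subspace_inter in auto)
  assume X: "subspace X"
  show "qd U (V \<inter> U) n \<longleftrightarrow> qd X V n"
  proof (rule id.qd_map[where f="\<lambda>x. x"])
    show "Vector_Spaces.linear scale scale (\<lambda>x. x)" by (rule linear_ident)
    fix u assume "u \<in> X"
    then obtain k where "u - scale k v \<in> U" using ex by blast
    moreover have "u - (u - scale k v) \<in> V" using v(1) V(1) subspace_scale by simp
    ultimately show "\<exists>x\<in>U. u - x \<in> V" by blast
  qed (use U V X in auto)
qed

text \<open>Intersect the given flag with \<open>V\<close>. A step whose smaller space contains
  \<open>V\<close> is charged to \<open>U / V\<close>; any other step cuts \<open>V\<close> in a
  hyperplane and is charged to \<open>V / W\<close>.\<close>

lemma qd_split:
  assumes W: "subspace W" "subspace V" "subspace U" and VU: "V \<subseteq> U" and WV: "W \<subseteq> V"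
    and n: "qd U W n"
  shows "\<exists>a b. qd U V a \<and> qd V W b \<and> n = a + b"
  using W(2,3) VU WV n
proof (induction n arbitrary: U V)
  case 0
  thus ?case by auto
next
  case (Suc n)
  then obtain X where X: "hyperplane X U" "qd X W n" by auto
  have sX: "subspace X" "X \<subseteq> U" using X(1) by (auto simp: hyperplane_def)
  show ?case
  proof (cases "V \<subseteq> X")
    case True
    from Suc.IH[OF Suc.prems(1) sX(1) this Suc.prems(4) X(2)] obtain a b where "qd X V a" "qd V W b" "n = a + b" by blast
    thus ?thesis using X(1) by (intro exI[of _ "Suc a"] exI[of _ b]) auto
  next
    case False
    have "W \<subseteq> V \<inter> X" using Suc.prems(4) qd_sub[OF X(2)] by blast
    from Suc.IH[OF subspace_inter[OF Suc.prems(1) sX(1)] sX(1) _ this X(2)]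
    obtain a b where ab: "qd X (V \<inter> X) a" "qd (V \<inter> X) W b" "n = a + b" by blast
    have "qd U V a" using hyperplane_meet(2)[OF X(1) Suc.prems(1,3) False Suc.prems(2)] ab(1) by blast
    moreover have "qd V W (Suc b)" using hyperplane_meet(1)[OF X(1) Suc.prems(1,3) False] ab(2) by auto
    ultimately show ?thesis using ab(3) by (intro exI[of _ a] exI[of _ "Suc b"]) auto
  qed
qed

lemma hyperplane_qd: "hyperplane U V ==> qd V U n ==> n = 1"
proof (cases n)
  case (Suc m)
  assume H: "hyperplane U V" and "qd V U n"
  then obtain X where X: "hyperplane X V" "qd X U m" using Suc by auto
  obtain v where v: "v \<in> V" "v \<notin> X" "subspace X" "X \<subseteq> V" using X(1) by (auto simp: hyperplane_def)
  have UX: "U \<subseteq> X" using qd_sub[OF X(2)] .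
  have "x \<in> U" if x: "x \<in> X" for x
  proof (rule ccontr)
    assume "x \<notin> U"
    then obtain k where "v - scale k x \<in> X" using hyperplane_exchange[OF H _ _ v(1), of x] x v(4) UX by blast
    hence "v - scale k x + scale k x \<in> X" by (rule subspace_add[OF v(3) _ subspace_scale[OF v(3) x]])
    thus False using v(2) by simp
  qed
  hence "X = U" using UX by blast
  thus ?thesis using X(2) Suc by (cases m) (auto simp: hyperplane_def dest: qd_sub)
qed (auto simp: hyperplane_def)

text \<open>As in the Jordan-Hoelder theorem: the second flag is split at the top hyperplane of the
  first one, above which only a single step fits by \<open>hyperplane_qd\<close>.\<close>

lemma qd_unique: "subspace W ==> subspace V ==> qd V W n ==> qd V W m ==> n = m"
proof (induction n arbitrary: V m)
  case 0
  thus ?case by (cases m) (auto simp: hyperplane_def dest: qd_sub)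
next
  case (Suc n)
  then obtain X where X: "hyperplane X V" "qd X W n" "subspace X" "X \<subseteq> V" by (auto simp: hyperplane_def)
  obtain a b where ab: "qd V X a" "qd X W b" "m = a + b"
    using qd_split[OF Suc.prems(1) X(3) Suc.prems(2) X(4) qd_sub[OF X(2)] Suc.prems(4)] by blast
  show ?case using hyperplane_qd[OF X(1) ab(1)] Suc.IH[OF Suc.prems(1) X(3,2) ab(2)] ab(3) by simp
qed

lemma qdim_eq: "subspace W ==> subspace V ==> qd V W n ==> qdim V W = n"
  unfolding qdim_def by (rule the_equality) (auto intro: qd_unique)

lemma qd_qdim: "subspace W ==> subspace V ==> finq V W ==> qd V W (qdim V W)"
  by (metis finq_def qdim_eq)

lemma finq_trans_iff:
  assumes "subspace W" "subspace V" "subspace U" "V \<subseteq> U" "W \<subseteq> V"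
  shows "finq U W \<longleftrightarrow> finq U V \<and> finq V W"
  unfolding finq_def using qd_split[OF assms] qd_trans by meson

lemma qdim_trans:
  assumes "subspace W" "subspace V" "subspace U" "V \<subseteq> U" "W \<subseteq> V" "finq U W"
  shows "qdim U W = qdim U V + qdim V W"
  using assms qd_split[OF assms(1-5)] by (metis finq_def qdim_eq)

lemma finq_zero: "subspace W ==> subspace V ==> finq V W ==> qdim V W = 0 \<longleftrightarrow> V = W"
  by (metis qd.simps(1) qd_qdim qdim_eq)

lemma finq_self: "finq V V"
  unfolding finq_def by (rule exI[of _ 0]) simp

lemma qdim_self: "subspace V ==> qdim V V = 0"
  by (rule qdim_eq) auto

lemma qd_imp_qindep: "qd V W n ==> \<exists>b. (\<forall>i<n. b i \<in> V) \<and> qindep W b {..<n}"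
proof (induction n arbitrary: V)
  case (Suc n)
  then obtain U v where U: "subspace U" "U \<subseteq> V" "v \<in> V" "v \<notin> U" "qd U W n" unfolding qd.simps hyperplane_def by blast
  then obtain b where b: "\<forall>i<n. b i \<in> U" "qindep W b {..<n}" using Suc.IH by blast
  have "c i = 0" if c: "cmb c (b(n := v)) {..<Suc n} \<in> W" "i < Suc n" for c i
  proof -
    have e: "cmb c (b(n := v)) {..<Suc n} = cmb c b {..<n} + scale (c n) v" by (simp add: cmb_def)
    have "cmb c b {..<n} \<in> U" using b(1) by (intro cmb_in[OF U(1)]) simp
    moreover have "cmb c b {..<n} + scale (c n) v \<in> U" using c(1) qd_sub[OF U(5)] unfolding e by blast
    ultimately have "scale (c n) v \<in> U" using subspace_diff[OF U(1)] by fastforce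
    hence "c n = 0" using scale_cancel U by blast
    thus ?thesis using c e b(2) by (auto simp: qindep_def less_Suc_eq)
  qed
  thus ?case using b(1) U(2,3) by (intro exI[of _ "b(n := v)"]) (auto simp: qindep_def less_Suc_eq fun_upd_def)
qed (auto simp: qindep_def)

text \<open>Steinitz by elimination: a member \<open>b j\<close> outside the next space
  \<open>U\<close> of the flag is used to push all others into \<open>U\<close>, which costs one
  index and one step of the flag.\<close>

lemma qd_ge:
  assumes "subspace W" "finite I" "qd V W n" "qindep W b I" "\<forall>i\<in>I. b i \<in> V"
  shows "card I \<le> n"
  using assms(2-)
proof (induction n arbitrary: V I b)
  case 0
  have "I = {}"
  proof (rule ccontr)
    assume "I \<noteq> {}"
    then obtain i where i: "i \<in> I" by blast
    have "cmb (\<lambda>j. if j = i then 1 else 0) b I \<in> W"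
      using 0 by (intro cmb_in[OF assms(1)]) auto
    thus False using 0(3) i by (fastforce simp: qindep_def)
  qed
  thus ?case by simp
next
  case (Suc n)
  then obtain U where U: "hyperplane U V" "qd U W n" by auto
  show ?case
  proof (cases "\<forall>i\<in>I. b i \<in> U")
    case True
    thus ?thesis using Suc.IH[OF Suc.prems(1) U(2) Suc.prems(3)] by simp
  next
    case False
    then obtain j where j: "j \<in> I" "b j \<notin> U" by blast
    have "\<forall>i\<in>I. \<exists>k. b i - scale k (b j) \<in> U"
      using hyperplane_exchange[OF U(1) _ j(2)] Suc.prems(4) j(1) by blast
    then obtain k where k: "\<forall>i\<in>I. b i - scale (k i) (b j) \<in> U" by metis
    have "c i = 0" if c: "cmb c (\<lambda>i. b i - scale (k i) (b j)) (I - {j}) \<in> W" "i \<in> I - {j}" for c i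
    proof -
      let ?s = "\<Sum>i\<in>I - {j}. c i * k i"
      have "cmb c (\<lambda>i. b i - scale (k i) (b j)) (I - {j}) = cmb (c(j := - ?s)) b I"
        using Suc.prems(1) j(1) by (simp add: cmb_def sum.remove scale_right_diff_distrib sum_subtractf scale_sum_left)
      thus ?thesis using Suc.prems(3)[unfolded qindep_def, THEN spec, of "c(j := - ?s)"] c by auto
    qed
    hence "card (I - {j}) \<le> n"
      using Suc.prems(1) k by (intro Suc.IH[OF _ U(2)]) (auto simp: qindep_def)
    thus ?thesis using Suc.prems(1) j(1) by (simp add: card_Diff_singleton)
  qed
qed

lemma qd_span:
  assumes W: "subspace W" and B: "finite B" "independent B" "span B \<inter> W = {0}"
  shows "qd (span (B \<union> W)) W (card B)"
  using B
proof (induction B)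
  case empty
  thus ?case using W by (simp add: span_eq_iff)
next
  case (insert v B)
  have i: "independent B" "v \<notin> span B" using insert.prems(1) insert.hyps(2) by (auto simp: independent_insert)
  have "span B \<inter> W = {0}" using insert.prems(2) span_mono[of B "insert v B"] span_zero W subspace_0 by blast
  moreover have "v \<notin> span (B \<union> W)"
  proof
    assume "v \<in> span (B \<union> W)"
    then obtain x y where xy: "v = x + y" "x \<in> span B" "y \<in> W" using span_eq_iff[THEN iffD2, OF W] by (auto simp: span_Un)
    have "v - x \<in> span (insert v B)" using xy(2) span_mono[of B "insert v B"] by (intro span_diff) (auto intro: span_base)
    hence "v - x = 0" using insert.prems(2) xy by auto
    thus False using xy i(2) by simp
  qed
  moreover have "span (B \<union> W) \<subseteq> span (insert v (B \<union> W))" "v \<in> span (insert v (B \<union> W))"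
    by (auto intro: span_base subsetD[OF span_mono])
  ultimately have "hyperplane (span (B \<union> W)) (span (insert v (B \<union> W)))"
    unfolding hyperplane_def using subspace_span by (auto simp: span_insert)
  thus ?case using insert i(1) \<open>span B \<inter> W = {0}\<close> by auto
qed

lemma qd_basis:
  assumes "subspace W" "qd V W n"
  shows "\<exists>B. finite B \<and> card B = n \<and> B \<subseteq> V \<and> independent B \<and> span B \<inter> W = {0} \<and> V \<subseteq> span (B \<union> W)"
  using assms(2)
proof (induction n arbitrary: V)
  case 0
  thus ?case using subspace_0[OF assms(1)] by (intro exI[of _ "{}"]) (auto intro: span_base simp: independent_empty)
next
  case (Suc n)
  then obtain U v where U: "subspace U" "U \<subseteq> V" "v \<in> V" "v \<notin> U" "\<forall>x\<in>V. \<exists>k. x - scale k v \<in> U" "qd U W n"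
    unfolding qd.simps hyperplane_def by blast
  obtain B where B: "finite B" "card B = n" "B \<subseteq> U" "independent B" "span B \<inter> W = {0}" "U \<subseteq> span (B \<union> W)"
    using Suc.IH[OF U(6)] by (elim exE conjE)
  have sB: "span B \<subseteq> U" using span_minimal[OF B(3) U(1)] .
  have "span (insert v B) \<inter> W \<subseteq> {0}"
  proof
    fix x assume x: "x \<in> span (insert v B) \<inter> W"
    then obtain k where k: "x - scale k v \<in> span B" by (auto simp: span_insert)
    have "x - (x - scale k v) \<in> U"
      by (rule subspace_diff[OF U(1)]) (use k x sB qd_sub[OF U(6)] in blast)+
    hence "k = 0" using scale_cancel[OF U(1) _ U(4)] by simp
    thus "x \<in> {0}" using k x B(5) by auto
  qed
  moreover have "V \<subseteq> span (insert v B \<union> W)" using U(5) B(6) by (auto simp: span_insert)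
  ultimately show ?case using B U(2-4) sB span_zero subspace_0[OF assms(1)]
    by (intro exI[of _ "insert v B"]) (auto simp: independent_insert card_insert_if)
qed

text \<open>The bridge to \<open>quot_dim\<close>, which is phrased with a basis of a complement;
  everything later works with flags.\<close>

lemma qdim_sets:
  assumes W: "subspace W" and V: "subspace V" and WV: "W \<subseteq> V"
  shows "(THE n. \<exists>B. finite B \<and> card B = n \<and> B \<subseteq> V \<and> independent B \<and>
     span B \<inter> W = {0} \<and> V \<subseteq> span (B \<union> W)) = qdim V W"
proof -
  have "span (B \<union> W) = V" if "B \<subseteq> V" "V \<subseteq> span (B \<union> W)" for B
    using that span_minimal[of "B \<union> W" V] V WV by blast
  hence "(\<exists>B. finite B \<and> card B = n \<and> B \<subseteq> V \<and> independent B \<and>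
     span B \<inter> W = {0} \<and> V \<subseteq> span (B \<union> W)) \<longleftrightarrow> qd V W n" for n
    using qd_span[OF W] qd_basis[OF W] by metis
  thus ?thesis unfolding qdim_def by simp
qed

end

lemma quot_dim_qdim:
  assumes "quot_space scl" "module.subspace scl W" "module.subspace scl V" "W \<subseteq> V"
  shows "quot_dim scl V W = quot_space.qdim scl V W"
  using quot_space.qdim_sets[OF assms] unfolding quot_dim_def .

context quot_space_pair
begin

lemma finq_map:
  assumes "Vector_Spaces.linear s1 s2 f" "vs1.subspace V" "vs2.subspace W'" "vs2.subspace U'"
    "\<And>v. v \<in> V ==> f v \<in> U'" "\<And>u. u \<in> U' ==> \<exists>v\<in>V. u - f v \<in> W'"
    "\<And>v. v \<in> V ==> v \<in> W \<longleftrightarrow> f v \<in> W'" "W \<subseteq> V" "W' \<subseteq> U'"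
  shows "vs1.finq V W \<longleftrightarrow> vs2.finq U' W'" and "vs1.qdim V W = vs2.qdim U' W'"
  unfolding vs1.finq_def vs2.finq_def vs1.qdim_def vs2.qdim_def
  using qd_map[OF assms] by presburger+

end

section \<open>Graded ideals and Hilbert functions\<close>

type_synonym 'k mp = "(nat \<Rightarrow>\<^sub>0 nat) \<Rightarrow>\<^sub>0 'k"

abbreviation "pkeys \<equiv> Poly_Mapping.keys"
abbreviation "plookup \<equiv> Poly_Mapping.lookup"
abbreviation "psingle \<equiv> Poly_Mapping.single"

text \<open>This is \<open>poly_scale\<close> over an arbitrary field, since Hilbert functions are
  also needed over the field of rational functions.\<close>

definition sc :: "'k::field => ('a::comm_monoid_add \<Rightarrow>\<^sub>0 'k) => 'a \<Rightarrow>\<^sub>0 'k" where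
  "sc c p = psingle 0 c * p"

lemma vector_space_sc: "vector_space sc"
  by unfold_locales
     (simp_all add: sc_def algebra_simps single_add mult_single flip: mult.assoc)

interpretation pv: quot_space sc
  by (simp add: quot_space_def vector_space_sc)

interpretation pvp: quot_space_pair sc sc
  by (simp add: quot_space_pair_def quot_space_def vector_space_sc)

lemma lookup_sc: "plookup (sc c p) m = c * plookup p m"
proof -
  have "Poly_Mapping.map ((*) c) p = sc c p" unfolding sc_def by (rule mult_map_scale_conv_mult)
  thus ?thesis by (simp add: Poly_Mapping.map.rep_eq when_def flip: \<open>_ = sc c p\<close>)
qed

lemma sc_mult_left: "sc c p * q = sc c (p * q)" and sc_mult_right: "p * sc c q = sc c (p * q)"
  by (simp_all add: sc_def mult.assoc mult.left_commute)

lemma linear_mult: "Vector_Spaces.linear sc sc (\<lambda>g. f * g)"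
  unfolding Vector_Spaces.linear_def module_hom_def module_hom_axioms_def
  by (simp add: vector_space_sc distrib_left sc_mult_right module_iff_vector_space)

lemma linear_id_sc: "Vector_Spaces.linear sc sc (\<lambda>g. g)"
  unfolding Vector_Spaces.linear_def module_hom_def module_hom_axioms_def
  by (simp add: vector_space_sc module_iff_vector_space)

definition monoms :: "nat => nat => (nat \<Rightarrow>\<^sub>0 nat) set" where
  "monoms r t = {m. pkeys m \<subseteq> {..r} \<and> monom_deg m = t}"

definition hforms :: "nat => nat => 'k::field mp set" where
  "hforms r t = {p. pkeys p \<subseteq> monoms r t}"

definition xv :: "nat => 'k::field mp" where
  "xv i = psingle (psingle i 1) 1"

lemma monom_deg_superset:
  assumes "finite A" "pkeys m \<subseteq> A"
  shows "monom_deg m = (\<Sum>i\<in>A. plookup m i)"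
  unfolding monom_deg_def using assms by (intro sum.mono_neutral_left) (auto simp: in_keys_iff)

lemma monom_deg_add: "monom_deg (m + n) = monom_deg m + monom_deg n"
proof -
  let ?A = "pkeys m \<union> pkeys n"
  have "monom_deg (m + n) = (\<Sum>i\<in>?A. plookup (m + n) i)"
    using Poly_Mapping.keys_add[of m n] by (intro monom_deg_superset) auto
  also have "\<dots> = (\<Sum>i\<in>?A. plookup m i) + (\<Sum>i\<in>?A. plookup n i)"
    by (simp add: lookup_add sum.distrib)
  also have "\<dots> = monom_deg m + monom_deg n"
    by (simp add: monom_deg_superset[symmetric])
  finally show ?thesis .
qed

lemma monom_deg_0 [simp]: "monom_deg 0 = 0"
  by (simp add: monom_deg_def)

lemma monom_deg_single [simp]: "monom_deg (psingle i c) = c"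
  by (simp add: monom_deg_def)

lemma monoms_add: "m \<in> monoms r a ==> n \<in> monoms r b ==> m + n \<in> monoms r (a + b)"
  using Poly_Mapping.keys_add[of m n] by (auto simp: monoms_def monom_deg_add)

lemma finite_monoms: "finite (monoms r t)"
proof -
  let ?F = "{f. \<forall>x. (x \<in> {..r} --> f x \<in> {..t}) \<and> (x \<notin> {..r} --> f x = 0)}"
  have "finite ?F" by (rule finite_set_of_finite_funs) auto
  moreover have "plookup ` monoms r t \<subseteq> ?F"
  proof clarify
    fix m x assume m: "m \<in> monoms r t"
    have d: "t = (\<Sum>i\<le>r. plookup m i)" using m monom_deg_superset[of "{..r}" m] by (auto simp: monoms_def)
    have "plookup m x \<le> (\<Sum>i\<le>r. plookup m i)" if "x \<le> r" using that by (intro member_le_sum) auto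
    thus "(x \<in> {..r} --> plookup m x \<in> {..t}) \<and> (x \<notin> {..r} --> plookup m x = 0)"
      using m d by (auto simp: monoms_def in_keys_iff subset_iff)
  qed
  ultimately have "finite (plookup ` monoms r t)" using finite_subset by blast
  thus ?thesis by (rule finite_imageD) (simp add: inj_on_def poly_mapping_eqI)
qed

lemma hforms_iff: "p \<in> hforms r t \<longleftrightarrow> (\<forall>m. plookup p m \<noteq> 0 --> m \<in> monoms r t)"
  by (auto simp: hforms_def in_keys_iff)

lemma subspace_keys: "pv.subspace {p :: 'k::field mp. pkeys p \<subseteq> A}"
proof (rule pv.subspaceI)
  fix p q :: "'k mp" assume "p \<in> {p. pkeys p \<subseteq> A}" "q \<in> {p. pkeys p \<subseteq> A}"
  thus "p + q \<in> {p. pkeys p \<subseteq> A}" using keys_add[of p q] by blast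
qed (auto simp: in_keys_iff lookup_sc subset_iff)

lemma subspace_hforms [simp]: "pv.subspace (hforms r t)"
  unfolding hforms_def by (rule subspace_keys)

lemma hforms_0 [simp]: "0 \<in> hforms r t"
  by (simp add: hforms_def)

lemma hforms_add: "p \<in> hforms r t ==> q \<in> hforms r t ==> p + q \<in> hforms r t"
  using pv.subspace_add subspace_hforms by blast

lemma hforms_diff: "p \<in> hforms r t ==> q \<in> hforms r t ==> p - q \<in> hforms r t"
  using pv.subspace_diff subspace_hforms by blast

lemma hforms_mult: "p \<in> hforms r a ==> q \<in> hforms r b ==> p * q \<in> hforms r (a + b)"
  using keys_mult[of p q] monoms_add unfolding hforms_def by blast

lemma hforms_1 [simp]: "1 \<in> hforms r 0"
  by (auto simp: hforms_def monoms_def)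

lemma hforms_single: "m \<in> monoms r t ==> psingle m c \<in> hforms r t"
  by (auto simp: hforms_def)

lemma hforms_sc1: "sc c 1 \<in> hforms r 0"
  using pv.subspace_scale[OF subspace_hforms hforms_1] .

lemma hforms_power: "p \<in> hforms r a ==> p ^ n \<in> hforms r (n * a)"
  by (induction n) (simp_all add: hforms_mult)

lemma xv_hforms: "i \<le> r ==> xv i \<in> hforms r 1"
  unfolding xv_def by (rule hforms_single) (auto simp: monoms_def)

lemma poly_mapping_sum_single: "p = (\<Sum>m\<in>pkeys p. psingle m (plookup p m))"
proof (rule poly_mapping_eqI)
  fix k
  have "plookup (\<Sum>m\<in>pkeys p. psingle m (plookup p m)) k = (\<Sum>m\<in>pkeys p. if m = k then plookup p m else 0)"
    unfolding lookup_sum by (rule sum.cong) (auto simp: lookup_single when_def)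
  thus "plookup p k = plookup (\<Sum>m\<in>pkeys p. psingle m (plookup p m)) k"
    by (auto simp: in_keys_iff)
qed

lemma hom_multI:
  fixes h :: "'k::field mp => 'b::comm_ring_1"
  assumes sum: "\<And>f A. h (sum f A) = (\<Sum>m\<in>A. h (f (m :: nat \<Rightarrow>\<^sub>0 nat)))"
    and single: "\<And>m n a b. h (psingle (m + n) (a * b)) = h (psingle m a) * h (psingle n b)"
  shows "h (p * q) = h p * h q"
proof -
  have "p * q = (\<Sum>m\<in>pkeys p. \<Sum>n\<in>pkeys q. psingle (m + n) (plookup p m * plookup q n))"
    by (subst poly_mapping_sum_single[of p], subst poly_mapping_sum_single[of q])
      (simp add: sum_product mult_single)
  hence "h (p * q) = h (\<Sum>m\<in>pkeys p. psingle m (plookup p m)) * h (\<Sum>n\<in>pkeys q. psingle n (plookup q n))"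
    by (simp add: sum single sum_product)
  thus ?thesis by (simp flip: poly_mapping_sum_single)
qed

text \<open>The irrelevant ideal is generated by the variables. This turns statements about all
  forms into inductions on the degree.\<close>

lemma hforms_Suc_decomp:
  assumes "p \<in> hforms r (Suc t)"
  shows "\<exists>f. (\<forall>i. f i \<in> hforms r t) \<and> p = (\<Sum>i\<le>r. xv i * f i)"
proof -
  let ?D = "{p. \<exists>f. (\<forall>i. f i \<in> hforms r t) \<and> p = (\<Sum>i\<le>r. xv i * f i)} :: 'a mp set"
  have "psingle m c \<in> ?D" if m: "m \<in> monoms r (Suc t)" for m and c :: 'a
  proof -
    have "pkeys m \<noteq> {}" using m by (auto simp: monoms_def monom_deg_def)
    hence "\<exists>i. i \<in> pkeys m" by blast
    then obtain i where i: "i \<in> pkeys m" ..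
    let ?m = "m - psingle i 1"
    have mm: "m = psingle i 1 + ?m"
      using i by (intro poly_mapping_eqI) (auto simp: lookup_add lookup_minus lookup_single when_def in_keys_iff)
    have "monom_deg m = 1 + monom_deg ?m" by (subst mm) (simp add: monom_deg_add)
    moreover have "pkeys ?m \<subseteq> pkeys m" by (auto simp: in_keys_iff lookup_minus)
    ultimately have m': "?m \<in> monoms r t" using m by (auto simp: monoms_def)
    have ir: "i \<le> r" using i m by (auto simp: monoms_def)
    have "psingle m c = xv i * psingle ?m c" by (subst mm) (simp add: xv_def mult_single)
    also have "\<dots> = (\<Sum>j\<le>r. xv j * (if j = i then psingle ?m c else 0))"
      using ir by (simp add: if_distrib cong: if_cong)
    finally show ?thesis using hforms_single[OF m', of c]
      by (intro CollectI exI[of _ "\<lambda>j. if j = i then psingle ?m c else 0"]) auto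
  qed
  moreover have "sum g A \<in> ?D" if "finite A" "\<And>x. x \<in> A ==> g x \<in> ?D" for g and A :: "(nat \<Rightarrow>\<^sub>0 nat) set"
    using that
  proof (induction A)
    case empty
    show ?case by (auto intro!: exI[of _ "\<lambda>_. 0"])
  next
    case (insert x A)
    then obtain f1 f2 where "\<forall>i. f1 i \<in> hforms r t" "g x = (\<Sum>i\<le>r. xv i * f1 i)"
      "\<forall>i. f2 i \<in> hforms r t" "sum g A = (\<Sum>i\<le>r. xv i * f2 i)" by blast
    hence "\<forall>i. f1 i + f2 i \<in> hforms r t" "sum g (insert x A) = (\<Sum>i\<le>r. xv i * (f1 i + f2 i))"
      using insert(1,2) by (simp_all add: hforms_add sum.distrib distrib_left)
    thus ?case by (intro CollectI exI[of _ "\<lambda>i. f1 i + f2 i"]) simp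
  qed
  moreover have "m \<in> pkeys p ==> m \<in> monoms r (Suc t)" for m using assms unfolding hforms_def by blast
  ultimately have "(\<Sum>m\<in>pkeys p. psingle m (plookup p m)) \<in> ?D"
    by (meson finite_keys)
  thus ?thesis using poly_mapping_sum_single[of p] by simp
qed

lemma qd_hforms: "pv.qd (hforms r t :: 'k::field mp set) {0} (card (monoms r t))"
proof -
  let ?V = "\<lambda>A. {p :: 'k mp. pkeys p \<subseteq> A}"
  have "pv.qd (?V A) {0} (card A)" if "finite A" for A
    using that
  proof (induction A)
    case (insert m A)
    have "pv.hyperplane (?V A) (?V (insert m A))"
      unfolding pv.hyperplane_def
    proof (intro conjI subspace_keys bexI[of _ "psingle m 1"] ballI)
      show "\<exists>k. x - sc k (psingle m 1) \<in> ?V A" if "x \<in> ?V (insert m A)" for x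
        using that by (intro exI[of _ "plookup x m"]) (auto simp: in_keys_iff lookup_minus lookup_sc lookup_single when_def split: if_splits)
    qed (use insert(2) in \<open>auto simp: subset_iff\<close>)
    thus ?case using insert by auto
  qed auto
  thus ?thesis unfolding hforms_def using finite_monoms by blast
qed

lemma finq_hforms_0: "pv.finq (hforms r t :: 'k::field mp set) {0}"
  unfolding pv.finq_def using qd_hforms by blast

text \<open>A homogeneous ideal is encoded as the family of its graded pieces, so that inclusion is
  the pointwise order and each degree is a finite-dimensional space.\<close>

definition gideal :: "nat => (nat => 'k::field mp set) => bool" where
  "gideal r G \<longleftrightarrow> (\<forall>t. pv.subspace (G t) \<and> G t \<subseteq> hforms r t) \<and>
     (\<forall>k t. \<forall>q\<in>hforms r k. \<forall>g\<in>G t. q * g \<in> G (k + t))"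

lemma gideal_subspace: "gideal r G ==> pv.subspace (G t)"
  and gideal_forms: "gideal r G ==> G t \<subseteq> hforms r t"
  and gideal_mult: "gideal r G ==> q \<in> hforms r k ==> g \<in> G t ==> q * g \<in> G (k + t)"
  by (auto simp: gideal_def)

lemma gideal_0: "gideal r G ==> 0 \<in> G t"
  and gideal_add: "gideal r G ==> a \<in> G t ==> b \<in> G t ==> a + b \<in> G t"
  and gideal_diff: "gideal r G ==> a \<in> G t ==> b \<in> G t ==> a - b \<in> G t"
  using gideal_subspace pv.subspace_0 pv.subspace_add pv.subspace_diff by blast+

lemma gideal_sum: "gideal r G ==> (\<And>i. i \<in> A ==> f i \<in> G t) ==> sum f A \<in> G t"
  using gideal_subspace pv.subspace_sum by blast

lemma gideal_uminus: "gideal r G ==> a \<in> G t ==> - a \<in> G t"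
  using gideal_subspace pv.subspace_neg by blast

lemma gideal_sc: "gideal r G ==> a \<in> G t ==> sc c a \<in> G t"
  using gideal_subspace pv.subspace_scale by blast

lemma gideal_full_Suc:
  assumes G: "gideal r G" and f: "G t = hforms r t"
  shows "G (Suc t) = hforms r (Suc t)"
proof
  show "hforms r (Suc t) \<subseteq> G (Suc t)"
  proof
    fix p :: "'a mp" assume "p \<in> hforms r (Suc t)"
    then obtain g where g: "\<forall>i. g i \<in> hforms r t" "p = (\<Sum>i\<le>r. xv i * g i)"
      using hforms_Suc_decomp by blast
    have "xv i * g i \<in> G (1 + t)" if "i \<le> r" for i
      using g(1) f gideal_mult[OF G xv_hforms[OF that], of "g i"] by simp
    thus "p \<in> G (Suc t)" unfolding g(2) by (intro gideal_sum[OF G]) simp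
  qed
qed (rule gideal_forms[OF G])

lemma gideal_full_mono:
  assumes "gideal r G" "G t = hforms r t" "t \<le> u"
  shows "G u = hforms r u"
  using assms(3) by (induction rule: dec_induct) (simp_all add: assms gideal_full_Suc)

section \<open>Colon ideals, sums and multiples of graded ideals\<close>

definition gcolon :: "nat => (nat => 'k::field mp set) => 'k mp => nat => nat => 'k mp set" where
  "gcolon r G f k t = {g \<in> hforms r t. f * g \<in> G (k + t)}"

text \<open>The ideal \<open>G + (f)\<close> for \<open>f\<close> of degree \<open>k\<close>. Below
  degree \<open>k\<close> there are no multiples of \<open>f\<close>, which the truncated difference
  \<open>t - k\<close> would get wrong.\<close>

definition gadd :: "nat => (nat => 'k::field mp set) => 'k mp => nat => nat => 'k mp set" where
  "gadd r G f k t = {a + f * b | a b. a \<in> G t \<and> b \<in> (if k \<le> t then hforms r (t - k) else {0})}"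

lemma gideal_gcolon:
  assumes G: "gideal r G"
  shows "gideal r (gcolon r G f k)"
  unfolding gideal_def
proof (intro conjI allI ballI)
  fix t
  show "pv.subspace (gcolon r G f k t)"
    unfolding gcolon_def pv.subspace_def
    using G by (auto simp: hforms_add gideal_0 gideal_add distrib_left sc_mult_right gideal_sc
        intro: pv.subspace_scale[OF subspace_hforms])
  show "gcolon r G f k t \<subseteq> hforms r t" by (auto simp: gcolon_def)
next
  fix j t and q g :: "'a mp" assume "q \<in> hforms r j" "g \<in> gcolon r G f k t"
  thus "q * g \<in> gcolon r G f k (j + t)"
    using gideal_mult[OF G, of q j "f * g" "k + t"]
    hforms_mult[of q r j g t] by (auto simp: gcolon_def algebra_simps)
qed

lemma gcolon_ge:
  assumes "gideal r G" "f \<in> hforms r k"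
  shows "G \<le> gcolon r G f k"
  using assms gideal_forms gideal_mult by (fastforce simp: gcolon_def le_fun_def)

lemma gadd_ge:
  assumes "gideal r G"
  shows "G \<le> gadd r G f k"
proof -
  have "a \<in> gadd r G f k t" if "a \<in> G t" for a t
    unfolding gadd_def using that by (intro CollectI exI[of _ a] exI[of _ 0]) simp
  thus ?thesis by (auto simp: le_fun_def)
qed

lemma gadd_self: assumes "gideal r G" shows "f \<in> gadd r G f k k"
  unfolding gadd_def using gideal_0[OF assms] by (intro CollectI exI[of _ 0] exI[of _ 1]) simp

lemma gadd_least:
  assumes "gideal r H" "G \<le> H" "f \<in> H k"
  shows "gadd r G f k \<le> H"
  unfolding le_fun_def gadd_def
proof (intro allI subsetI, clarify)
  fix t and a b :: "'a mp" assume a: "a \<in> G t" and b: "b \<in> (if k \<le> t then hforms r (t - k) else {0})"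
  have "f * b \<in> H t" using b gideal_mult[OF assms(1), of b "t - k" f k] assms(3) gideal_0[OF assms(1)]
    by (auto split: if_splits simp: mult.commute)
  moreover have "a \<in> H t" using a assms(2) by (auto simp: le_fun_def)
  ultimately show "a + f * b \<in> H t" using gideal_add assms(1) by blast
qed

lemma gideal_hforms: "gideal r (hforms r)"
  by (simp add: gideal_def hforms_mult)

definition gsum :: "(nat => 'k::field mp set) => (nat => 'k mp set) => nat => 'k mp set" where
  "gsum G H t = {a + b | a b. a \<in> G t \<and> b \<in> H t}"

lemma gideal_gsum:
  assumes G: "gideal r G" and H: "gideal r H"
  shows "gideal r (gsum G H)"
  unfolding gideal_def
proof (intro conjI allI ballI)
  show "pv.subspace (gsum G H t)" for t
    unfolding gsum_def by (rule pv.subspace_sums[OF gideal_subspace[OF G] gideal_subspace[OF H]])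
  show "gsum G H t \<subseteq> hforms r t" for t
    using gideal_forms[OF G, of t] gideal_forms[OF H, of t] hforms_add[of _ r t] unfolding gsum_def by blast
  fix k t and q g :: "'a mp" assume q: "q \<in> hforms r k" and "g \<in> gsum G H t"
  then obtain a b where ab: "g = a + b" "a \<in> G t" "b \<in> H t" by (auto simp: gsum_def)
  have "q * g = q * a + q * b" by (simp add: ab distrib_left)
  thus "q * g \<in> gsum G H (k + t)"
    unfolding gsum_def using gideal_mult[OF G q ab(2)] gideal_mult[OF H q ab(3)] by blast
qed

definition gmul :: "'k::field mp => nat => (nat => 'k mp set) => nat => 'k mp set" where
  "gmul b e G t = {b * u | u. u \<in> (if e \<le> t then G (t - e) else {0})}"

lemma gideal_gmul:
  assumes G: "gideal r G" and b: "b \<in> hforms r e"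
  shows "gideal r (gmul b e G)"
  unfolding gideal_def
proof (intro conjI allI ballI)
  fix t
  let ?V = "if e \<le> t then G (t - e) else {0}"
  interpret l: Vector_Spaces.linear sc sc "\<lambda>u. b * u" by (rule linear_mult)
  have "pv.subspace ?V" using gideal_subspace[OF G] pv.subspace_single_0 by simp
  hence "pv.subspace ((\<lambda>u. b * u) ` ?V)" by (rule l.subspace_image)
  moreover have "gmul b e G t = (\<lambda>u. b * u) ` ?V" by (auto simp: gmul_def)
  ultimately show "pv.subspace (gmul b e G t)" by simp
  show "gmul b e G t \<subseteq> hforms r t"
    using gideal_forms[OF G, of "t - e"] hforms_mult[OF b, of _ "t - e"] unfolding gmul_def by (auto split: if_splits)
next
  fix k t and q g :: "'a mp" assume q: "q \<in> hforms r k" and "g \<in> gmul b e G t"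
  then obtain u where u: "g = b * u" "u \<in> (if e \<le> t then G (t - e) else {0})" by (auto simp: gmul_def)
  have "q * u \<in> (if e \<le> k + t then G (k + t - e) else {0})"
  proof (cases "e \<le> t")
    case True
    thus ?thesis using gideal_mult[OF G q, of u "t - e"] u(2) by simp
  next
    case False
    thus ?thesis using u(2) gideal_0[OF G] by simp
  qed
  moreover have "q * g = b * (q * u)" using u(1) by (simp add: mult_ac)
  ultimately show "q * g \<in> gmul b e G (k + t)" unfolding gmul_def by blast
qed

lemma gideal_gadd:
  assumes G: "gideal r G" and f: "f \<in> hforms r k"
  shows "gideal r (gadd r G f k)"
proof -
  have "gadd r G f k = gsum G (gmul f k (hforms r))" by (rule ext) (unfold gadd_def gsum_def gmul_def, blast)
  thus ?thesis using gideal_gsum[OF G gideal_gmul[OF gideal_hforms f]] by simp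
qed

lemma gadd_member: "a \<in> G (k + t) ==> b \<in> hforms r t ==> a + f * b \<in> gadd r G f k (k + t)"
  unfolding gadd_def by auto

lemma gadd_memberE:
  assumes "g \<in> gadd r G f k (k + t)"
  obtains a b where "g = a + f * b" "a \<in> G (k + t)" "b \<in> hforms r t"
  using assms unfolding gadd_def by auto

section \<open>Hilbert functions\<close>

definition hilb :: "nat => (nat => 'k::field mp set) => nat => nat" where
  "hilb r G t = pv.qdim (hforms r t) (G t)"

lemma finq_sub:
  assumes "pv.subspace V" "pv.subspace W" "W \<subseteq> V" "V \<subseteq> hforms r t"
  shows "pv.finq V W"
proof -
  have "pv.finq V {0}"
    using pv.finq_trans_iff[of "{0}" V "hforms r t"] finq_hforms_0 assms pv.subspace_0[OF assms(1)]
    by (metis pv.subspace_single_0 subspace_hforms empty_subsetI insert_subset)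
  thus ?thesis using pv.finq_trans_iff[of "{0}" W V] assms pv.subspace_0[OF assms(2)]
    by (metis pv.subspace_single_0 empty_subsetI insert_subset)
qed

lemma finq_gideal: "gideal r G ==> pv.finq (hforms r t) (G t)"
  using finq_sub[OF subspace_hforms] gideal_subspace gideal_forms by blast

lemma hilb_split:
  assumes G: "gideal r G" and H: "gideal r H" and le: "G t \<subseteq> H t"
  shows "hilb r G t = hilb r H t + pv.qdim (H t) (G t)"
  unfolding hilb_def
  by (rule pv.qdim_trans)
    (simp_all add: le gideal_subspace[OF G] gideal_subspace[OF H] gideal_forms[OF H] finq_gideal[OF G])

lemma hilb_mono:
  assumes "gideal r G" "gideal r H" "G t \<subseteq> H t"
  shows "hilb r H t \<le> hilb r G t"
  using hilb_split[OF assms] by simp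

lemma hilb_eq_iff:
  assumes "gideal r G" "gideal r H" "G t \<subseteq> H t"
  shows "hilb r G t = hilb r H t \<longleftrightarrow> G t = H t"
proof -
  have "pv.finq (H t) (G t)"
    using finq_sub[of "H t" "G t"] assms gideal_subspace gideal_forms by blast
  hence "pv.qdim (H t) (G t) = 0 \<longleftrightarrow> H t = G t"
    using pv.finq_zero[of "G t" "H t"] assms gideal_subspace by blast
  thus ?thesis using hilb_split[OF assms] by auto
qed

lemma hilb_0_iff: "gideal r G ==> hilb r G t = 0 \<longleftrightarrow> G t = hforms r t"
  unfolding hilb_def using pv.finq_zero[of "G t" "hforms r t"] finq_gideal gideal_subspace subspace_hforms
  by metis

text \<open>Multiplication by \<open>f\<close> identifies the quotient by \<open>G : f\<close>,
  shifted by \<open>k\<close>, with \<open>(G + (f)) / G\<close>. All recursions for Hilbert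
  functions rest on this exact sequence.\<close>

lemma hilb_colon_add:
  assumes G: "gideal r G" and f: "f \<in> hforms r k"
  shows "hilb r G (k + t) = hilb r (gcolon r G f k) t + hilb r (gadd r G f k) (k + t)"
proof -
  have le: "G (k + t) \<subseteq> gadd r G f k (k + t)" using gadd_ge[OF G] by (auto simp: le_fun_def)
  have "hilb r (gcolon r G f k) t = pv.qdim (gadd r G f k (k + t)) (G (k + t))"
    unfolding hilb_def
  proof (rule pvp.finq_map[OF linear_mult[of f]])
    show "f * v \<in> gadd r G f k (k + t)" if "v \<in> hforms r t" for v
      using gadd_member[of 0 G k t v r f] gideal_0[OF G] that by simp
    show "\<exists>v\<in>hforms r t. u - f * v \<in> G (k + t)" if "u \<in> gadd r G f k (k + t)" for u
      using that by (rule gadd_memberE) force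
    show "v \<in> gcolon r G f k t \<longleftrightarrow> f * v \<in> G (k + t)" if "v \<in> hforms r t" for v
      using that by (simp add: gcolon_def)
  qed (use le gideal_subspace[OF gideal_gadd[OF G f]] in \<open>auto simp: gideal_subspace[OF G] gcolon_def\<close>)
  thus ?thesis using hilb_split[OF G gideal_gadd[OF G f] le] by simp
qed

lemma gadd_low: "t < k ==> gadd r G f k t = G t"
  unfolding gadd_def by auto

lemma hilb_gadd_low: "t < k ==> hilb r (gadd r G f k) t = hilb r G t"
  by (simp add: hilb_def gadd_low)

section \<open>Ascending chains of graded ideals\<close>

lemma nat_mono_subseq:
  fixes s :: "nat => nat"
  obtains f :: "nat => nat" where "strict_mono f" "mono (s \<circ> f)"
proof -
  obtain f where f: "strict_mono f" "monoseq (\<lambda>n. s (f n))"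
    using seq_monosub by blast
  show ?thesis
  proof (cases "\<forall>m n. m \<le> n --> s (f m) \<le> s (f n)")
    case True
    thus ?thesis using that[OF f(1)] by (auto simp: mono_def)
  next
    case False
    hence dec: "\<And>m n. m \<le> n ==> s (f n) \<le> s (f m)" using f(2) unfolding monoseq_def by blast
    define N where "N = (LEAST k. \<exists>n. s (f n) = k)"
    have "\<exists>n. s (f n) = N" unfolding N_def by (rule LeastI_ex) blast
    then obtain n0 where n0: "s (f n0) = N" by blast
    have min: "N \<le> s (f n)" for n unfolding N_def by (rule Least_le) blast
    have "s (f (n0 + n)) = N" for n using dec[of n0 "n0 + n"] min[of "n0 + n"] n0 by simp
    hence "mono (s \<circ> (\<lambda>n. f (n0 + n)))" by (simp add: mono_def)
    moreover have "strict_mono (\<lambda>n. f (n0 + n))" using f(1) by (simp add: strict_mono_def)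
    ultimately show ?thesis using that by blast
  qed
qed

text \<open>Passing to subsequences makes one exponent after the other nondecreasing (Dickson's
  lemma).\<close>

lemma dickson:
  fixes m :: "nat => (nat \<Rightarrow>\<^sub>0 nat)"
  assumes keys: "\<And>i. pkeys (m i) \<subseteq> {..r}"
  shows "\<exists>i j. i < j \<and> (\<forall>k. plookup (m i) k \<le> plookup (m j) k)"
proof -
  have "\<exists>f :: nat => nat. strict_mono f \<and> (\<forall>k<n. mono (\<lambda>i. plookup (m (f i)) k))" for n
  proof (induction n)
    case 0
    show ?case by (intro exI[of _ id]) (simp add: strict_mono_def)
  next
    case (Suc n)
    then obtain f :: "nat => nat" where f: "strict_mono f" "\<forall>k<n. mono (\<lambda>i. plookup (m (f i)) k)" by blast
    obtain g :: "nat => nat" where g: "strict_mono g" "mono ((\<lambda>i. plookup (m (f i)) n) \<circ> g)"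
      by (rule nat_mono_subseq)
    have "strict_mono (f \<circ> g)" using f(1) g(1) by (simp add: strict_mono_def)
    moreover have "mono (\<lambda>i. plookup (m ((f \<circ> g) i)) k)" if k: "k < Suc n" for k
    proof (cases "k = n")
      case True
      thus ?thesis using g(2) by (simp add: comp_def)
    next
      case False
      hence "mono (\<lambda>i. plookup (m (f i)) k)" using f(2) k by simp
      thus ?thesis using strict_mono_mono[OF g(1)] by (simp add: mono_def)
    qed
    ultimately show ?case by blast
  qed
  then obtain f :: "nat => nat" where f: "strict_mono f" "\<forall>k<Suc r. mono (\<lambda>i. plookup (m (f i)) k)" by blast
  have "plookup (m (f 0)) k \<le> plookup (m (f 1)) k" for k
  proof (cases "k \<le> r")
    case True
    hence "mono (\<lambda>i. plookup (m (f i)) k)" using f(2) by simp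
    thus ?thesis by (rule monoD) simp
  next
    case False
    hence "k \<notin> pkeys (m (f 0))" using keys by fastforce
    thus ?thesis by (simp add: in_keys_iff)
  qed
  moreover have "f 0 < f 1" using f(1) by (simp add: strict_mono_def)
  ultimately show ?thesis by blast
qed

definition lm :: "'k::field mp => nat \<Rightarrow>\<^sub>0 nat" where
  "lm p = Max (pkeys p)"

lemma lm_in: "p \<noteq> 0 ==> lm p \<in> pkeys p"
  unfolding lm_def by (intro Max_in) auto

lemma lm_mult_single:
  assumes "p \<noteq> 0"
  shows "lm (psingle m 1 * p) = m + lm p" "psingle m 1 * p \<noteq> 0"
proof -
  have look: "plookup (psingle m 1 * p) (m + k) = plookup p k" for k
  proof -
    have "psingle m 1 * p = (\<Sum>n\<in>pkeys p. psingle (m + n) (plookup p n))"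
      by (subst poly_mapping_sum_single[of p]) (simp add: sum_distrib_left mult_single)
    hence "plookup (psingle m 1 * p) (m + k) = (\<Sum>n\<in>pkeys p. if n = k then plookup p n else 0)"
      by (auto simp: lookup_sum lookup_single when_def intro!: sum.cong)
    thus ?thesis by (auto simp: in_keys_iff)
  qed
  have sub: "pkeys (psingle m 1 * p) \<subseteq> (+) m ` pkeys p"
    using keys_mult[of "psingle m 1" p] by auto
  have eq: "pkeys (psingle m 1 * p) = (+) m ` pkeys p"
    using sub look by (auto simp: in_keys_iff)
  thus "psingle m 1 * p \<noteq> 0" using assms by auto
  have "mono ((+) m)" by (simp add: mono_def add_left_mono)
  hence "m + Max (pkeys p) = Max ((+) m ` pkeys p)"
    using assms by (intro mono_Max_commute) auto
  thus "lm (psingle m 1 * p) = m + lm p" by (simp add: lm_def eq)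
qed

definition lms :: "(nat => 'k::field mp set) => (nat \<Rightarrow>\<^sub>0 nat) set" where
  "lms G = {lm p | p t. p \<in> G t \<and> p \<noteq> 0}"

lemma lm_monoms: "p \<in> hforms r t ==> p \<noteq> 0 ==> lm p \<in> monoms r t"
  using lm_in[of p] by (auto simp: hforms_def)

lemma monoms_disjoint: "m \<in> monoms r t ==> m \<in> monoms r u ==> t = u"
  by (simp add: monoms_def)

text \<open>Division by leading monomials: subtracting a scalar multiple of an element of
  \<open>G\<close> with the same leading monomial lowers the leading monomial. The induction counts
  the monomials of degree \<open>t\<close> below it, so finiteness of \<open>monoms r t\<close> does
  the work of a well-founded monomial order.\<close>

lemma lms_eqD:
  assumes G: "gideal r G" and H: "gideal r H" and GH: "G \<le> H" and lms: "lms H \<subseteq> lms G"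
  shows "H t \<subseteq> G t"
proof
  fix p assume "p \<in> H t"
  thus "p \<in> G t"
  proof (induction "card {m \<in> monoms r t. p \<noteq> 0 \<and> m \<le> lm p}" arbitrary: p rule: less_induct)
    case less
    show ?case
    proof (cases "p = 0")
      case True
      thus ?thesis using gideal_0[OF G] by simp
    next
      case False
      hence "lm p \<in> lms G" using lms less.prems unfolding lms_def by blast
      then obtain q u where q: "q \<in> G u" "q \<noteq> 0" "lm q = lm p" unfolding lms_def by force
      have pm: "lm p \<in> monoms r t" using lm_monoms less.prems False gideal_forms[OF H] by blast
      have "lm q \<in> monoms r u" using lm_monoms q gideal_forms[OF G] by blast
      hence "u = t" using monoms_disjoint pm q(3) by metis
      hence qt: "q \<in> G t" using q by simp
      let ?c = "plookup p (lm p) / plookup q (lm p)"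
      have qn: "plookup q (lm p) \<noteq> 0" using lm_in[OF q(2)] q(3) by (simp add: in_keys_iff)
      let ?p = "p - sc ?c q"
      have pH: "?p \<in> H t"
      proof -
        have "q \<in> H t" using qt GH by (auto simp: le_fun_def)
        thus ?thesis using less.prems gideal_diff[OF H] gideal_sc[OF H] by blast
      qed
      have l0: "plookup ?p (lm p) = 0" using qn by (simp add: lookup_minus lookup_sc)
      have less': "lm ?p < lm p" if "?p \<noteq> 0"
      proof -
        have k: "lm ?p \<in> pkeys ?p" using lm_in that by blast
        hence "lm ?p \<noteq> lm p" using l0 by (auto simp: in_keys_iff)
        moreover have "lm ?p \<in> pkeys p \<union> pkeys q" using k by (auto simp: in_keys_iff lookup_minus lookup_sc)
        hence "lm ?p \<le> lm p"
          using q(3) unfolding lm_def by (metis Max_ge UnE finite_keys)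
        ultimately show ?thesis by simp
      qed
      have "{m \<in> monoms r t. ?p \<noteq> 0 \<and> m \<le> lm ?p} \<subset> {m \<in> monoms r t. p \<noteq> 0 \<and> m \<le> lm p}"
      proof
        show "{m \<in> monoms r t. ?p \<noteq> 0 \<and> m \<le> lm ?p} \<subseteq> {m \<in> monoms r t. p \<noteq> 0 \<and> m \<le> lm p}"
          using less' False by auto
        have "lm p \<in> {m \<in> monoms r t. p \<noteq> 0 \<and> m \<le> lm p}" using pm False by simp
        moreover have "lm p \<notin> {m \<in> monoms r t. ?p \<noteq> 0 \<and> m \<le> lm ?p}" using less' by auto
        ultimately show "{m \<in> monoms r t. ?p \<noteq> 0 \<and> m \<le> lm ?p} \<noteq> {m \<in> monoms r t. p \<noteq> 0 \<and> m \<le> lm p}"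
          by blast
      qed
      hence "card {m \<in> monoms r t. ?p \<noteq> 0 \<and> m \<le> lm ?p} < card {m \<in> monoms r t. p \<noteq> 0 \<and> m \<le> lm p}"
        using finite_monoms by (intro psubset_card_mono) auto
      hence "?p \<in> G t" using less.hyps pH by blast
      hence "?p + sc ?c q \<in> G t" using qt gideal_add[OF G] gideal_sc[OF G] by blast
      thus ?thesis by simp
    qed
  qed
qed

lemma lms_upward:
  assumes G: "gideal r G" and m: "m \<in> lms G" and m': "pkeys m' \<subseteq> {..r}"
    and le: "\<And>k. plookup m k \<le> plookup m' k"
  shows "m' \<in> lms G"
proof -
  obtain p t where p: "p \<in> G t" "p \<noteq> 0" "m = lm p" using m unfolding lms_def by blast
  let ?d = "m' - m"
  have eq: "?d + m = m'" using le by (intro poly_mapping_eqI) (simp add: lookup_add lookup_minus)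
  have "pkeys ?d \<subseteq> {..r}" using m' by (auto simp: in_keys_iff lookup_minus subset_iff)
  hence "psingle ?d 1 \<in> hforms r (monom_deg ?d)" by (intro hforms_single) (simp add: monoms_def)
  hence "psingle ?d 1 * p \<in> G (monom_deg ?d + t)" using gideal_mult[OF G _ p(1)] by blast
  moreover have "lm (psingle ?d 1 * p) = m'" "psingle ?d 1 * p \<noteq> 0"
    using lm_mult_single[OF p(2), of ?d] eq p(3) by auto
  ultimately show ?thesis unfolding lms_def by (metis (mono_tags, lifting) mem_Collect_eq)
qed

text \<open>The graded Hilbert basis theorem as a principle of noetherian induction: every strict
  step of an ascending chain brings a new leading monomial, and Dickson's lemma makes one of these
  divisible by an earlier one.\<close>

lemma wf_gideal: "wf {(J, I). gideal r J \<and> gideal r I \<and> I < (J :: nat => 'k::field mp set)}"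
proof (rule ccontr)
  assume "\<not> ?thesis"
  then obtain f :: "nat => nat => 'k mp set" where
    f: "\<And>i. gideal r (f (Suc i)) \<and> gideal r (f i) \<and> f i < f (Suc i)"
    unfolding wf_iff_no_infinite_down_chain by auto
  have mono: "f i \<le> f j" if "i \<le> j" for i j
    using that by (induction rule: dec_induct) (use f in \<open>auto intro: order_trans less_imp_le\<close>)
  have "\<exists>m. m \<in> lms (f (Suc i)) \<and> m \<notin> lms (f i)" for i
  proof (rule ccontr)
    assume "\<not> ?thesis"
    hence "lms (f (Suc i)) \<subseteq> lms (f i)" by blast
    hence "f (Suc i) \<le> f i"
      using lms_eqD[of r "f i" "f (Suc i)"] f[of i] by (auto simp: le_fun_def less_le)
    thus False using f[of i] by auto
  qed
  then obtain m where m: "\<And>i. m i \<in> lms (f (Suc i))" "\<And>i. m i \<notin> lms (f i)" by metis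
  have keys: "pkeys (m i) \<subseteq> {..r}" for i
  proof -
    obtain p t where "p \<in> f (Suc i) t" "p \<noteq> 0" "m i = lm p" using m(1)[of i] unfolding lms_def by blast
    thus ?thesis using lm_monoms[of p r t] f[of i] gideal_forms by (auto simp: monoms_def subset_iff)
  qed
  obtain i j where ij: "i < j" "\<forall>k. plookup (m i) k \<le> plookup (m j) k" using dickson[of m, OF keys] by blast
  have "m j \<in> lms (f (Suc i))" using lms_upward[OF _ m(1) keys] ij(2) f by blast
  moreover have "lms (f (Suc i)) \<subseteq> lms (f j)"
    using mono[of "Suc i" j] ij(1) unfolding lms_def le_fun_def by fastforce
  ultimately show False using m(2) by blast
qed

lemma gideal_induct [consumes 1, case_names step]:
  assumes "gideal r I"
    and step: "\<And>I. gideal r I ==> (\<And>J. gideal r J ==> I < J ==> Q J) ==> Q I"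
  shows "Q (I :: nat => 'k::field mp set)"
  using wf_gideal[of r] assms(1)
proof (induction I rule: wf_induct_rule)
  case (less I)
  thus ?case using step by blast
qed

lemma gadd_greater:
  assumes "gideal r I" "f \<notin> I k"
  shows "I < gadd r I f k"
  using gadd_ge[OF assms(1), of f k] gadd_self[OF assms(1), of f k] assms(2)
  by (metis order.not_eq_order_implies_strict)

section \<open>Hilbert polynomials\<close>

text \<open>Solve the binomial expansion of \<open>(x + 1) ^ Suc n - x ^ Suc n\<close> for the term
  with \<open>x ^ n\<close>; the lower powers are covered by the induction.\<close>

lemma antidiff_power: "\<exists>q :: real poly. \<forall>x. poly q (x + 1) - poly q x = x ^ n"
proof (induction n rule: less_induct)
  case (less n)
  obtain Q :: "nat => real poly" where Q: "\<And>k x. k < n ==> poly (Q k) (x + 1) - poly (Q k) x = x ^ k"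
    using less.IH by metis
  let ?q = "smult (1 / real (n + 1)) (monom 1 (n + 1) - (\<Sum>k<n. smult (real (Suc n choose k)) (Q k)))"
  have "poly ?q (x + 1) - poly ?q x = x ^ n" for x
  proof -
    have "(x + 1) ^ Suc n = (\<Sum>k\<le>Suc n. real (Suc n choose k) * x ^ k)"
      using binomial_ring[of x 1 "Suc n"] by simp
    also have "\<dots> = (\<Sum>k<n. real (Suc n choose k) * x ^ k) + real (Suc n) * x ^ n + x ^ Suc n"
      by (simp add: lessThan_Suc_atMost[symmetric] del: power_Suc binomial_Suc_Suc)
    finally have e: "(x + 1) ^ Suc n - x ^ Suc n - (\<Sum>k<n. real (Suc n choose k) * x ^ k) = real (Suc n) * x ^ n"
      by simp
    have "poly ?q (x + 1) - poly ?q x = (1 / real (n + 1)) * ((x + 1) ^ Suc n - x ^ Suc n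
        - (\<Sum>k<n. real (Suc n choose k) * (poly (Q k) (x + 1) - poly (Q k) x)))"
      by (simp add: poly_monom poly_sum right_diff_distrib sum_subtractf del: power_Suc binomial_Suc_Suc)
    also have "(\<Sum>k<n. real (Suc n choose k) * (poly (Q k) (x + 1) - poly (Q k) x)) =
        (\<Sum>k<n. real (Suc n choose k) * x ^ k)" by (rule sum.cong) (auto simp: Q)
    finally show ?thesis using e by simp
  qed
  thus ?case by blast
qed

lemma antidiff: "\<exists>q :: real poly. \<forall>x. poly q (x + 1) - poly q x = poly p x"
proof -
  obtain Q :: "nat => real poly" where Q: "\<And>k x. poly (Q k) (x + 1) - poly (Q k) x = x ^ k"
    using antidiff_power by metis
  let ?q = "\<Sum>i\<le>degree p. smult (coeff p i) (Q i)"
  have "poly ?q (x + 1) - poly ?q x = poly p x" for x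
  proof -
    have "poly ?q (x + 1) - poly ?q x = (\<Sum>i\<le>degree p. coeff p i * (poly (Q i) (x + 1) - poly (Q i) x))"
      by (simp add: poly_sum right_diff_distrib sum_subtractf)
    also have "\<dots> = poly p x" unfolding Q by (simp add: poly_altdef)
    finally show ?thesis .
  qed
  thus ?thesis by blast
qed

lemma gideal_vars_full:
  assumes I: "gideal r I" and v: "\<And>i. i \<le> r ==> xv i \<in> I 1" and t: "1 \<le> t"
  shows "I t = hforms r t"
proof -
  have "hforms r (Suc 0) \<subseteq> I (Suc 0)"
  proof
    fix p :: "'a mp" assume "p \<in> hforms r (Suc 0)"
    then obtain g where g: "\<forall>i. g i \<in> hforms r 0" "p = (\<Sum>i\<le>r. xv i * g i)"
      using hforms_Suc_decomp by blast
    have "xv i * g i \<in> I (Suc 0)" if "i \<le> r" for i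
      using gideal_mult[OF I, of "g i" 0 "xv i" 1] g(1) v[OF that] by (simp add: mult.commute)
    thus "p \<in> I (Suc 0)" unfolding g(2) by (intro gideal_sum[OF I]) simp
  qed
  hence "I 1 = hforms r 1" using gideal_forms[OF I, of 1] by auto
  thus ?thesis using gideal_full_mono[OF I _ t] by blast
qed

text \<open>Noetherian induction with a variable outside \<open>I\<close>. If its colon ideal is
  larger, the recursion adds two known polynomials. If the variable is a nonzerodivisor, the
  recursion gives the first difference of the Hilbert function, which is summed by
  \<open>antidiff\<close>.\<close>

lemma hilbert_poly_exists:
  assumes "gideal r I"
  shows "\<exists>p :: real poly. \<exists>t0. \<forall>t\<ge>t0. real (hilb r I t) = poly p (real t)"
  using assms
proof (induction I rule: gideal_induct)
  case (step I)
  note I = \<open>gideal r I\<close>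
  show ?case
  proof (cases "\<forall>i\<le>r. xv i \<in> I 1")
    case True
    hence "hilb r I t = 0" if "1 \<le> t" for t
      using gideal_vars_full[OF I _ that] hilb_0_iff[OF I] by blast
    thus ?thesis by (intro exI[of _ 0] exI[of _ 1]) simp
  next
    case False
    then obtain i where i: "i \<le> r" "xv i \<notin> I 1" by blast
    let ?x = "xv i :: 'a mp"
    let ?J = "gadd r I ?x 1" and ?K = "gcolon r I ?x 1"
    have x: "?x \<in> hforms r 1" using xv_hforms i by blast
    obtain p t0 where p: "\<And>t. t \<ge> t0 ==> real (hilb r ?J t) = poly p (real t)"
      using step(2)[OF gideal_gadd[OF I x] gadd_greater[OF I i(2)]] by blast
    have rel: "real (hilb r I (1 + t)) = real (hilb r ?K t) + real (hilb r ?J (1 + t))" for t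
      using hilb_colon_add[OF I x, of t] by simp
    show ?thesis
    proof (cases "?K = I")
      case False
      hence "I < ?K" using gcolon_ge[OF I x] by auto
      then obtain q t1 where q: "\<And>t. t \<ge> t1 ==> real (hilb r ?K t) = poly q (real t)"
        using step(2)[OF gideal_gcolon[OF I]] by blast
      have "real (hilb r I t) = poly (pcompose q [:-1, 1:] + p) (real t)" if t: "t \<ge> t0 + t1 + 1" for t
      proof -
        obtain u where u: "t = 1 + u" using t by (metis add.commute le_add_diff_inverse le_trans le_add2)
        have "real (hilb r I t) = poly q (real u) + poly p (real t)"
          using rel[of u] q[of u] p[of t] t u by simp
        thus ?thesis using u by (simp add: poly_pcompose)
      qed
      thus ?thesis by blast
    next
      case True
      obtain q where q: "\<And>x. poly q (x + 1) - poly q x = poly (pcompose p [:1, 1:]) x"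
        using antidiff by blast
      let ?c = "real (hilb r I t0) - poly q (real t0)"
      have "real (hilb r I t) = poly (q + [:?c:]) (real t)" if "t \<ge> t0" for t
        using that
      proof (induction rule: dec_induct)
        case (step t)
        have "real (hilb r I (Suc t)) = real (hilb r I t) + poly p (real (Suc t))"
          using rel[of t] True p[of "Suc t"] step by simp
        also have "poly p (real (Suc t)) = poly q (real t + 1) - poly q (real t)"
          unfolding q by (simp add: poly_pcompose add.commute)
        finally show ?case using step(3) by (simp add: add.commute)
      qed simp
      thus ?thesis by blast
    qed
  qed
qed

definition hpol :: "nat => (nat => 'k::field mp set) => real poly" where
  "hpol r I = (THE p. \<forall>\<^sub>F t in sequentially. poly p (real t) = real (hilb r I t))"

lemma poly_eq_eventually:
  fixes p q :: "real poly"
  assumes "\<forall>\<^sub>F t in sequentially. poly p (real t) = poly q (real t)"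
  shows "p = q"
proof (rule ccontr)
  assume "p \<noteq> q"
  hence fin: "finite {x. poly (p - q) x = 0}" by (intro poly_roots_finite) simp
  obtain N where N: "\<And>t. t \<ge> N ==> poly p (real t) = poly q (real t)"
    using assms unfolding eventually_sequentially by blast
  have "real ` {N..} \<subseteq> {x. poly (p - q) x = 0}" using N by auto
  hence "finite (real ` {N..})" using fin finite_subset by blast
  hence "finite {N..}" by (rule finite_imageD) (simp add: inj_on_def)
  thus False using infinite_Ici by blast
qed

lemma hpol_eqI:
  assumes "\<forall>\<^sub>F t in sequentially. poly p (real t) = real (hilb r I t)"
  shows "hpol r I = p"
  unfolding hpol_def
proof (rule the_equality)
  fix q assume "\<forall>\<^sub>F t in sequentially. poly q (real t) = real (hilb r I t)"
  hence "\<forall>\<^sub>F t in sequentially. poly q (real t) = poly p (real t)"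
    using assms by eventually_elim simp
  thus "q = p" by (rule poly_eq_eventually)
qed (rule assms)

lemma hpol_eventually:
  assumes "gideal r I"
  shows "\<forall>\<^sub>F t in sequentially. poly (hpol r I) (real t) = real (hilb r I t)"
proof -
  obtain p t0 where "\<forall>t\<ge>t0. real (hilb r I t) = poly p (real t)" using hilbert_poly_exists[OF assms] by blast
  hence "\<forall>\<^sub>F t in sequentially. poly p (real t) = real (hilb r I t)"
    unfolding eventually_sequentially by (metis)
  thus ?thesis using hpol_eqI by metis
qed

lemma hpol_bound:
  assumes "gideal r I"
  obtains t0 where "\<And>t. t \<ge> t0 ==> real (hilb r I t) = poly (hpol r I) (real t)"
  using hpol_eventually[OF assms] unfolding eventually_sequentially by metis

section \<open>Primes, saturation and avoidance\<close>

definition gprime :: "nat => (nat => 'k::field mp set) => bool" where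
  "gprime r P \<longleftrightarrow> gideal r P \<and> 1 \<notin> P 0 \<and>
     (\<forall>a b. \<forall>f\<in>hforms r a. \<forall>g\<in>hforms r b. f * g \<in> P (a + b) --> f \<in> P a \<or> g \<in> P b)"

definition relevant :: "nat => (nat => 'k::field mp set) => bool" where
  "relevant r P \<longleftrightarrow> \<not> hforms r 1 \<subseteq> P 1"

lemma gprimeD: "gprime r P ==> f \<in> hforms r a ==> g \<in> hforms r b ==> f * g \<in> P (a + b) ==> f \<in> P a \<or> g \<in> P b"
  and gprime_gideal: "gprime r P ==> gideal r P"
  by (auto simp: gprime_def)

lemma gprime_power:
  assumes P: "gprime r P" and f: "f \<in> hforms r a" "f \<notin> P a"
  shows "f ^ n \<notin> P (n * a)"
proof (induction n)
  case 0
  thus ?case using P by (simp add: gprime_def)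
next
  case (Suc n)
  thus ?case using gprimeD[OF P f(1) hforms_power[OF f(1)], of n] f(2) by auto
qed

lemma gideal_one_full: "gideal r I ==> 1 \<in> I 0 ==> I t = hforms r t"
  using gideal_mult[of r I _ t 1 0] gideal_forms[of r I t] by auto

text \<open>Stands in for primary decomposition. If \<open>I\<close> is not prime, some product
  \<open>f * g\<close> lies in \<open>I\<close> with neither factor in \<open>I\<close>, and the
  primes found for the larger ideals \<open>I : f\<close> and \<open>I + (f)\<close> together serve
  for \<open>I\<close>.\<close>

lemma gideal_associated_primes:
  assumes "gideal r I"
  shows "\<exists>PP. finite PP \<and> (\<forall>P\<in>PP. gprime r P \<and> relevant r P \<and> I \<le> P) \<and>
    (\<exists>t0. \<forall>t\<ge>t0. \<forall>g\<in>hforms r t. \<forall>e. \<forall>q\<in>hforms r e.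
       (\<forall>P\<in>PP. q \<notin> P e) --> q * g \<in> I (e + t) --> g \<in> I t)"
  using assms
proof (induction I rule: gideal_induct)
  case (step I)
  note I = \<open>gideal r I\<close>
  show ?case
  proof (cases "gprime r I")
    case True
    show ?thesis
    proof (cases "relevant r I")
      case r: True
      show ?thesis
      proof (intro exI[of _ "{I}"] exI[of _ 0] conjI ballI allI impI)
        fix t g e q assume "g \<in> hforms r t" "q \<in> hforms r e" "\<forall>P\<in>{I}. q \<notin> P e" "q * g \<in> I (e + t)"
        thus "g \<in> I t" using gprimeD[OF True, of q e g t] by blast
      qed (use True r in auto)
    next
      case False
      hence v: "\<And>i. i \<le> r ==> xv i \<in> I 1" using xv_hforms unfolding relevant_def by blast
      have "I t = hforms r t" if "t \<ge> 1" for t by (rule gideal_vars_full[OF I v that])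
      thus ?thesis by (intro exI[of _ "{}"] exI[of _ 1]) blast
    qed
  next
    case np: False
    show ?thesis
    proof (cases "1 \<in> I 0")
      case True
      hence "I t = hforms r t" for t by (rule gideal_one_full[OF I])
      thus ?thesis by (intro exI[of _ "{}"] exI[of _ 0]) blast
    next
      case False
      then obtain a b f g where fg: "f \<in> hforms r a" "g \<in> hforms r b" "f * g \<in> I (a + b)" "f \<notin> I a" "g \<notin> I b"
        using np I unfolding gprime_def by blast
      let ?J = "gcolon r I f a" and ?K = "gadd r I f a"
      have J: "gideal r ?J" "I \<le> ?J" and K: "gideal r ?K" "I \<le> ?K"
        using gideal_gcolon[OF I] gcolon_ge[OF I fg(1)] gideal_gadd[OF I fg(1)] gadd_ge[OF I] by auto
      have "g \<in> ?J b" using fg by (simp add: gcolon_def)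
      hence "I \<noteq> ?J" using fg(5) by metis
      hence "I < ?J" using J by simp
      from step(2)[OF J(1) this] obtain PJ tJ where PJ: "finite PJ" "\<forall>P\<in>PJ. gprime r P \<and> relevant r P \<and> ?J \<le> P"
        "\<forall>t\<ge>tJ. \<forall>g\<in>hforms r t. \<forall>e. \<forall>q\<in>hforms r e. (\<forall>P\<in>PJ. q \<notin> P e) --> q * g \<in> ?J (e + t) --> g \<in> ?J t"
        by blast
      from step(2)[OF K(1) gadd_greater[OF I fg(4)]] obtain PK tK where PK: "finite PK" "\<forall>P\<in>PK. gprime r P \<and> relevant r P \<and> ?K \<le> P"
        "\<forall>t\<ge>tK. \<forall>g\<in>hforms r t. \<forall>e. \<forall>q\<in>hforms r e. (\<forall>P\<in>PK. q \<notin> P e) --> q * g \<in> ?K (e + t) --> g \<in> ?K t"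
        by blast
      have "g \<in> I t" if t: "t \<ge> a + tJ + tK" and g: "g \<in> hforms r t" and q: "q \<in> hforms r e"
        and av: "\<forall>P\<in>PJ \<union> PK. q \<notin> P e" and qg: "q * g \<in> I (e + t)" for t g e q
      proof -
        have "q * g \<in> ?K (e + t)" using qg K(2) by (auto simp: le_fun_def)
        moreover have "t \<ge> tK" using t by simp
        moreover have "\<forall>P\<in>PK. q \<notin> P e" using av by simp
        ultimately have "g \<in> ?K t" using PK(3) g q by blast
        \<comment> \<open>With \<open>g = c + f * b\<close> the product \<open>q * b\<close> lands
          in \<open>I : f\<close>. The bound \<open>a + tJ + tK\<close> guarantees that the degree
          \<open>u\<close> of \<open>b\<close> is still at least \<open>tJ\<close>.\<close>
        moreover obtain u where u: "t = a + u" using t by (metis add.assoc le_Suc_ex)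
        ultimately obtain c b where cb: "g = c + f * b" "c \<in> I t" "b \<in> hforms r u"
          using gadd_memberE[of g r I f a u] by metis
        have "q * c \<in> I (e + t)" using gideal_mult[OF I q cb(2)] .
        hence "q * g - q * c \<in> I (e + t)" using qg gideal_diff[OF I] by blast
        moreover have "q * g - q * c = f * (q * b)" using cb(1) by (simp add: algebra_simps)
        ultimately have "f * (q * b) \<in> I (a + (e + u))" using u by (simp add: add.left_commute)
        hence qb: "q * b \<in> ?J (e + u)" using hforms_mult[OF q cb(3)] by (simp add: gcolon_def)
        have "u \<ge> tJ" using t u by simp
        moreover have "\<forall>P\<in>PJ. q \<notin> P e" using av by simp
        ultimately have "b \<in> ?J u" using PJ(3) cb(3) q qb by blast
        hence "f * b \<in> I t" using u by (simp add: gcolon_def)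
        thus "g \<in> I t" using cb gideal_add[OF I] by blast
      qed
      moreover have "\<forall>P\<in>PJ \<union> PK. gprime r P \<and> relevant r P \<and> I \<le> P"
        using PJ(2) PK(2) J(2) K(2) order_trans by blast
      ultimately show ?thesis using PJ(1) PK(1)
        by (intro exI[of _ "PJ \<union> PK"] conjI exI[of _ "a + tJ + tK"] allI impI ballI) auto
    qed
  qed
qed

text \<open>Saturation with one exponent \<open>N\<close> for all forms of that degree;
  \<open>saturation\<close> uses powers of one variable at a time, and
  \<open>saturation_gunion\<close> identifies the two.\<close>

definition gsat :: "nat => (nat => 'k::field mp set) => nat => 'k mp set" where
  "gsat r I t = {g \<in> hforms r t. \<exists>N. \<forall>q\<in>hforms r N. q * g \<in> I (N + t)}"

lemma absorb_Suc:
  assumes I: "gideal r I" and N: "\<forall>q\<in>hforms r N. q * g \<in> I (N + t)" and M: "N \<le> M"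
  shows "\<forall>q\<in>hforms r M. q * g \<in> I (M + t)"
  using M
proof (induction rule: dec_induct)
  case base
  show ?case by (rule N)
next
  case (step M)
  show ?case
  proof
    fix q :: "'a mp" assume "q \<in> hforms r (Suc M)"
    then obtain f where f: "\<forall>i. f i \<in> hforms r M" "q = (\<Sum>i\<le>r. xv i * f i)"
      using hforms_Suc_decomp by blast
    have "xv i * (f i * g) \<in> I (1 + (M + t))" if "i \<le> r" for i
      using gideal_mult[OF I xv_hforms[OF that]] step(3) f(1) by blast
    hence "(\<Sum>i\<le>r. xv i * (f i * g)) \<in> I (1 + (M + t))" by (intro gideal_sum[OF I]) simp
    thus "q * g \<in> I (Suc M + t)" unfolding f(2) by (simp add: sum_distrib_right mult.assoc)
  qed
qed

lemma gideal_gsat: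
  assumes I: "gideal r I"
  shows "gideal r (gsat r I)"
  unfolding gideal_def
proof (intro conjI allI ballI)
  fix t
  show "gsat r I t \<subseteq> hforms r t" by (auto simp: gsat_def)
  show "pv.subspace (gsat r I t)"
    unfolding pv.subspace_def
  proof (intro conjI ballI allI)
    show "0 \<in> gsat r I t" using gideal_0[OF I] by (simp add: gsat_def)
  next
    fix x y assume "x \<in> gsat r I t" "y \<in> gsat r I t"
    then obtain N M where xy: "x \<in> hforms r t" "y \<in> hforms r t"
      "\<forall>q\<in>hforms r N. q * x \<in> I (N + t)" "\<forall>q\<in>hforms r M. q * y \<in> I (M + t)"
      unfolding gsat_def by blast
    let ?L = "max N M"
    have "\<forall>q\<in>hforms r ?L. q * x \<in> I (?L + t)" "\<forall>q\<in>hforms r ?L. q * y \<in> I (?L + t)"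
      using absorb_Suc[OF I] xy(3,4) by (metis max.cobounded1, metis max.cobounded2)
    hence "\<forall>q\<in>hforms r ?L. q * (x + y) \<in> I (?L + t)"
      using gideal_add[OF I] by (simp add: distrib_left)
    thus "x + y \<in> gsat r I t" using xy hforms_add unfolding gsat_def by blast
  next
    fix c and x :: "'a mp" assume "x \<in> gsat r I t"
    then obtain N where x: "x \<in> hforms r t" "\<forall>q\<in>hforms r N. q * x \<in> I (N + t)"
      unfolding gsat_def by blast
    hence "\<forall>q\<in>hforms r N. q * sc c x \<in> I (N + t)" using gideal_sc[OF I] by (simp add: sc_mult_right)
    moreover have "sc c x \<in> hforms r t" using x(1) pv.subspace_scale[OF subspace_hforms] by blast
    ultimately show "sc c x \<in> gsat r I t" unfolding gsat_def by blast
  qed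
next
  fix k t and q g :: "'a mp" assume q: "q \<in> hforms r k" and "g \<in> gsat r I t"
  then obtain N where g: "g \<in> hforms r t" "\<forall>q\<in>hforms r N. q * g \<in> I (N + t)"
    unfolding gsat_def by blast
  have "p * (q * g) \<in> I (N + (k + t))" if "p \<in> hforms r N" for p
  proof -
    have "q * (p * g) \<in> I (k + (N + t))" using gideal_mult[OF I q] g(2) that by blast
    moreover have "p * (q * g) = q * (p * g)" "N + (k + t) = k + (N + t)" by simp_all
    ultimately show ?thesis by metis
  qed
  thus "q * g \<in> gsat r I (k + t)" using hforms_mult[OF q g(1)] unfolding gsat_def by blast
qed

lemma gsat_ge: assumes "gideal r I" shows "I \<le> gsat r I"
  unfolding le_fun_def
proof (intro allI subsetI)
  fix t x assume x: "x \<in> I t"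
  hence "\<forall>q\<in>hforms r 0. q * x \<in> I (0 + t)" using gideal_mult[OF assms] by blast
  thus "x \<in> gsat r I t" using x gideal_forms[OF assms] unfolding gsat_def by blast
qed

text \<open>A vector space over an infinite field is not a finite union of proper subspaces: the
  line \<open>v + a w\<close> meets each subspace that misses \<open>v\<close> at most once, so a
  suitable nonzero \<open>a\<close> avoids them all.\<close>

lemma avoid_subspaces:
  assumes inf: "infinite (UNIV :: 'k::field set)"
    and V: "pv.subspace (V :: 'k mp set)"
    and "finite UU" "\<And>U. U \<in> UU ==> pv.subspace U \<and> \<not> V \<subseteq> U"
  shows "\<exists>v\<in>V. \<forall>U\<in>UU. v \<notin> U"
  using assms(3,4)
proof (induction UU)
  case empty
  thus ?case using pv.subspace_0[OF V] by blast
next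
  case (insert U UU)
  then obtain v where v: "v \<in> V" "\<forall>U\<in>UU. v \<notin> U" by auto
  obtain w where w: "w \<in> V" "w \<notin> U" using insert by blast
  show ?case
  proof (cases "v \<in> U")
    case False
    thus ?thesis using v by auto
  next
    case True
    let ?bad = "\<lambda>U'. {a. v + sc a w \<in> U'}"
    have "a = b" if ab: "a \<in> ?bad U'" "b \<in> ?bad U'" and U': "U' \<in> UU" for U' a b
    proof (rule ccontr)
      assume "a \<noteq> b"
      have sU: "pv.subspace U'" using insert(4) U' by blast
      have "(v + sc a w) - (v + sc b w) \<in> U'" using ab by (intro pv.subspace_diff[OF sU]) auto
      hence "sc (a - b) w \<in> U'" by (simp add: pv.scale_left_diff_distrib)
      hence "w \<in> U'" using pv.scale_cancel[OF sU] \<open>a \<noteq> b\<close> by fastforce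
      hence "(v + sc a w) - sc a w \<in> U'" using ab(1) by (intro pv.subspace_diff[OF sU] pv.subspace_scale[OF sU]) auto
      thus False using v(2) U' by simp
    qed
    hence "\<exists>a. ?bad U' \<subseteq> {a}" if "U' \<in> UU" for U' using that by blast
    hence "finite (?bad U')" if "U' \<in> UU" for U' using that by (metis finite.simps finite_subset)
    hence "finite ({0} \<union> (\<Union>U'\<in>UU. ?bad U'))" using insert(1) by simp
    from ex_new_if_finite[OF inf this] obtain a where a: "a \<notin> {0} \<union> (\<Union>U'\<in>UU. ?bad U')" ..
    have sU: "pv.subspace U" using insert(4) by blast
    have "v + sc a w \<notin> U" using pv.subspace_diff[OF sU _ True, of "v + sc a w"] pv.scale_cancel[OF sU _ w(2), of a] a by auto
    moreover have "v + sc a w \<in> V" using pv.subspace_add[OF V v(1) pv.subspace_scale[OF V w(1)]] .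
    ultimately show ?thesis using a by blast
  qed
qed

text \<open>Regularity in a single degree, for all powers of \<open>l\<close> at once. An ideal that
  is not saturated admits such an \<open>l\<close> only in large degrees.\<close>

definition hreg :: "nat => (nat => 'k::field mp set) => 'k mp => nat => bool" where
  "hreg r I l t \<longleftrightarrow> (\<forall>j. \<forall>g\<in>hforms r t. l ^ j * g \<in> I (j + t) --> g \<in> I t)"

lemma regular_form_avoid:
  fixes I :: "nat => 'k::field mp set"
  assumes I: "gideal r I"
  shows "\<exists>UU. finite UU \<and> (\<forall>U\<in>UU. pv.subspace U \<and> \<not> hforms r 1 \<subseteq> U) \<and>
    (\<forall>l\<in>hforms r 1. (\<forall>U\<in>UU. l \<notin> U) --> (\<exists>t0. \<forall>t\<ge>t0. hreg r I l t))"
proof -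
  from gideal_associated_primes[OF I] obtain PP t0 where 1: "finite PP"
    and 2: "\<forall>P\<in>PP. gprime r P \<and> relevant r P \<and> I \<le> P"
    and 3: "\<forall>t\<ge>t0. \<forall>g\<in>hforms r t. \<forall>e. \<forall>q\<in>hforms r e.
       (\<forall>P\<in>PP. q \<notin> P e) --> q * g \<in> I (e + t) --> g \<in> I t"
    by (elim exE conjE)
  have "hreg r I l t" if l: "l \<in> hforms r 1" "\<forall>U\<in>(\<lambda>P. P 1) ` PP. l \<notin> U" and t: "t \<ge> t0" for l t
    unfolding hreg_def
  proof (intro allI ballI impI)
    fix j g assume g: "g \<in> hforms r t" "l ^ j * g \<in> I (j + t)"
    have "\<forall>P\<in>PP. l ^ j \<notin> P j" using 2 l gprime_power[of r _ l 1 j] by simp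
    thus "g \<in> I t" using 3 t g hforms_power[OF l(1), of j] by simp
  qed
  moreover have "pv.subspace U \<and> \<not> hforms r 1 \<subseteq> U" if U: "U \<in> (\<lambda>P. P 1) ` PP" for U
  proof -
    obtain P where "P \<in> PP" "U = P 1" using U by blast
    thus ?thesis using 2 gideal_subspace[of r P 1] by (auto simp: relevant_def gprime_def)
  qed
  ultimately show ?thesis using 1 by (intro exI[of _ "(\<lambda>P. P 1) ` PP"] conjI) blast+
qed

lemma exists_regular_form:
  assumes inf: "infinite (UNIV :: 'k::field set)" and fin: "finite II"
    and II: "\<And>I. I \<in> II ==> gideal r (I :: nat => 'k mp set)"
  shows "\<exists>l\<in>hforms r 1. \<forall>I\<in>II. \<exists>t0. \<forall>t\<ge>t0. hreg r I l t"
proof -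
  let ?Q = "\<lambda>I UU. finite UU \<and> (\<forall>U\<in>UU. pv.subspace U \<and> \<not> hforms r 1 \<subseteq> U) \<and>
    (\<forall>l\<in>hforms r 1. (\<forall>U\<in>UU. l \<notin> U) --> (\<exists>t0. \<forall>t\<ge>t0. hreg r I l t))"
  have "\<forall>I\<in>II. \<exists>UU. ?Q I UU" using regular_form_avoid[OF II] by (rule ballI)
  from bchoice[OF this] obtain W where W: "\<forall>I\<in>II. ?Q I (W I)" ..
  have "\<exists>l\<in>hforms r 1. \<forall>U\<in>\<Union> (W ` II). l \<notin> U"
    by (rule avoid_subspaces[OF inf subspace_hforms]) (use fin W in auto)
  then obtain l where "l \<in> hforms r 1" "\<forall>U\<in>\<Union> (W ` II). l \<notin> U" by blast
  thus ?thesis using W by (intro bexI[of _ l]) auto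
qed

text \<open>A power of a regular form detects membership in the saturation, so the saturation and
  \<open>I\<close> can differ only in low degrees.\<close>

lemma gsat_eventually:
  assumes inf: "infinite (UNIV :: 'k::field set)" and I: "gideal r (I :: nat => 'k mp set)"
  obtains t0 where "\<And>t. t \<ge> t0 ==> gsat r I t = I t"
proof -
  obtain l t0 where l: "l \<in> hforms r 1" "\<forall>t\<ge>t0. hreg r I l t"
    using exists_regular_form[OF inf, of "{I}" r] I by auto
  have "gsat r I t \<subseteq> I t" if t: "t \<ge> t0" for t
  proof
    fix g assume "g \<in> gsat r I t"
    then obtain N where g: "g \<in> hforms r t" "\<forall>q\<in>hforms r N. q * g \<in> I (N + t)" unfolding gsat_def by blast
    thus "g \<in> I t" using hforms_power[OF l(1), of N] l(2) t unfolding hreg_def by fastforce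
  qed
  thus ?thesis using that gsat_ge[OF I] by (metis le_fun_def subset_antisym)
qed

lemma gsat_idem:
  assumes inf: "infinite (UNIV :: 'k::field set)" and I: "gideal r (I :: nat => 'k mp set)"
  shows "gsat r (gsat r I) = gsat r I"
proof (rule antisym)
  obtain t0 where t0: "\<And>t. t \<ge> t0 ==> gsat r I t = I t" using gsat_eventually[OF inf I] by metis
  show "gsat r (gsat r I) \<le> gsat r I"
    unfolding le_fun_def
  proof (intro allI subsetI)
    fix t g assume "g \<in> gsat r (gsat r I) t"
    then obtain N where g: "g \<in> hforms r t" "\<forall>q\<in>hforms r N. q * g \<in> gsat r I (N + t)"
      unfolding gsat_def[of r "gsat r I"] by blast
    have "\<forall>q\<in>hforms r (max N t0). q * g \<in> gsat r I (max N t0 + t)"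
      using absorb_Suc[OF gideal_gsat[OF I] g(2)] by simp
    hence "\<forall>q\<in>hforms r (max N t0). q * g \<in> I (max N t0 + t)" using t0[of "max N t0 + t"] by simp
    thus "g \<in> gsat r I t" using g(1) unfolding gsat_def by blast
  qed
qed (rule gsat_ge[OF gideal_gsat[OF I]])

section \<open>Linear nonzerodivisors and growth of Hilbert functions\<close>

definition nzd :: "nat => (nat => 'k::field mp set) => 'k mp => bool" where
  "nzd r I l \<longleftrightarrow> (\<forall>t. \<forall>g\<in>hforms r t. l * g \<in> I (1 + t) --> g \<in> I t)"

lemma nzd_saturated:
  assumes I: "gideal r I" and sat: "gsat r I = I" and l: "\<forall>t\<ge>t0. hreg r I l t"
  shows "nzd r I l"
  unfolding nzd_def
proof (intro allI ballI impI)
  fix t g assume g: "g \<in> hforms r t" and lg: "l * g \<in> I (1 + t)"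
  have "q * g \<in> I (t0 + t)" if q: "q \<in> hforms r t0" for q
  proof -
    have "l ^ 1 * (q * g) \<in> I (1 + (t0 + t))" using gideal_mult[OF I q lg] by (simp add: mult.left_commute)
    moreover have "q * g \<in> hforms r (t0 + t)" using hforms_mult[OF q g] .
    ultimately show ?thesis using l unfolding hreg_def by (meson le_add1)
  qed
  hence "g \<in> gsat r I t" using g unfolding gsat_def by blast
  thus "g \<in> I t" using sat by simp
qed

lemma exists_nzd:
  assumes inf: "infinite (UNIV :: 'k::field set)" and fin: "finite II"
    and II: "\<And>I. I \<in> II ==> gideal r (I :: nat => 'k mp set) \<and> gsat r I = I"
  shows "\<exists>l\<in>hforms r 1. \<forall>I\<in>II. nzd r I l"
  using exists_regular_form[OF inf fin, of r] II nzd_saturated by meson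

lemma nzd_colon: "gideal r I ==> nzd r I l ==> l \<in> hforms r 1 ==> gcolon r I l 1 = I"
  using gcolon_ge[of r I l 1] unfolding nzd_def gcolon_def le_fun_def by (intro ext) fastforce

lemma hilb_nzd:
  assumes "gideal r I" "nzd r I l" "l \<in> hforms r 1"
  shows "hilb r I (Suc t) = hilb r I t + hilb r (gadd r I l 1) (Suc t)"
  using hilb_colon_add[OF assms(1,3), of t] nzd_colon[OF assms] by simp

text \<open>A linear nonzerodivisor \<open>l\<close> makes the first difference equal to the Hilbert
  function of \<open>I + (l)\<close>. Once that ideal is everything in one degree it stays so, hence
  a single equality freezes the Hilbert function.\<close>

lemma hilb_nondecreasing:
  assumes inf: "infinite (UNIV :: 'k::field set)" and I: "gideal r (I :: nat => 'k mp set)" "gsat r I = I"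
  shows "hilb r I t \<le> hilb r I (Suc t)" "hilb r I t = hilb r I (Suc t) ==> t \<le> u ==> hilb r I u = hilb r I t"
proof -
  obtain l where l: "l \<in> hforms r 1" "nzd r I l" using exists_nzd[OF inf, of "{I}" r] I by auto
  show "hilb r I t \<le> hilb r I (Suc t)" using hilb_nzd[OF I(1) l(2,1)] by simp
  assume eq: "hilb r I t = hilb r I (Suc t)" and tu: "t \<le> u"
  let ?J = "gadd r I l 1"
  have J: "gideal r ?J" using gideal_gadd[OF I(1) l(1)] .
  have "hilb r ?J (Suc t) = 0" using hilb_nzd[OF I(1) l(2,1), of t] eq by simp
  hence "?J (Suc t) = hforms r (Suc t)" using hilb_0_iff[OF J] by blast
  hence z: "hilb r ?J u = 0" if "Suc t \<le> u" for u
    using gideal_full_mono[OF J _ that] hilb_0_iff[OF J] by blast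
  show "hilb r I u = hilb r I t" using tu
  proof (induction rule: dec_induct)
    case (step n)
    thus ?case using hilb_nzd[OF I(1) l(2,1), of n] z[of "Suc n"] by simp
  qed simp
qed

lemma gprime_saturated:
  assumes P: "gprime r P" and rel: "relevant r P"
  shows "gsat r P = P"
proof (rule antisym)
  obtain l where l: "l \<in> hforms r 1" "l \<notin> P 1" using rel unfolding relevant_def by blast
  show "gsat r P \<le> P" unfolding le_fun_def
  proof (intro allI subsetI)
    fix t g assume "g \<in> gsat r P t"
    then obtain N where g: "g \<in> hforms r t" "\<forall>q\<in>hforms r N. q * g \<in> P (N + t)"
      unfolding gsat_def by blast
    have "l ^ N \<in> hforms r N" "l ^ N \<notin> P N"
      using hforms_power[OF l(1), of N] gprime_power[OF P l, of N] by auto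
    thus "g \<in> P t" using gprimeD[OF P _ g(1)] g(2) by blast
  qed
qed (rule gsat_ge[OF gprime_gideal[OF P]])

lemma gprime_colon:
  assumes P: "gprime r P" and f: "f \<in> hforms r k" "f \<notin> P k"
  shows "gcolon r P f k = P"
proof (rule antisym)
  show "gcolon r P f k \<le> P" unfolding le_fun_def gcolon_def using gprimeD[OF P f(1)] f(2) by blast
qed (rule gcolon_ge[OF gprime_gideal[OF P] f(1)])

lemma hilb_prime_add:
  assumes P: "gprime r P" and f: "f \<in> hforms r k" "f \<notin> P k"
  shows "hilb r P (k + t) = hilb r P t + hilb r (gadd r P f k) (k + t)"
  using hilb_colon_add[OF gprime_gideal[OF P] f(1), of t] gprime_colon[OF P f] by simp

section \<open>Hilbert functions on an integral curve\<close>

text \<open>An integral curve of degree \<open>s\<close> over an infinite field; \<open>v\<close> is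
  the constant term of its Hilbert polynomial, so its arithmetic genus is \<open>1 - v\<close>. It
  will be the generic hyperplane section of a surface.\<close>

locale integral_curve =
  fixes r :: nat and Y :: "nat => 'k::field mp set" and s :: nat and v :: int
  assumes inf: "infinite (UNIV :: 'k set)"
    and Y: "gprime r Y" and Y_rel: "relevant r Y"
    and Y_hilb: "\<exists>t0. \<forall>t\<ge>t0. int (hilb r Y t) = int s * int t + v"
    and s_pos: "0 < s"
begin

lemma gY: "gideal r Y" using Y gprime_gideal by blast

lemma hilb_Y_add:
  assumes "f \<in> hforms r k" "f \<notin> Y k"
  shows "\<exists>t0. \<forall>t\<ge>t0. hilb r (gadd r Y f k) t = s * k"
proof -
  obtain t0 where t0: "\<And>t. t \<ge> t0 ==> int (hilb r Y t) = int s * int t + v" using Y_hilb by blast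
  have "hilb r (gadd r Y f k) t = s * k" if "t \<ge> t0 + k" for t
  proof -
    obtain u where u: "t = k + u" using \<open>t \<ge> t0 + k\<close> by (metis add.commute le_Suc_ex add.assoc)
    have "int (hilb r (gadd r Y f k) t) = int (hilb r Y t) - int (hilb r Y u)"
      using hilb_prime_add[OF Y assms, of u] u by simp
    also have "\<dots> = int (s * k)" using t0[of t] t0[of u] u that by (simp add: algebra_simps)
    finally show ?thesis by (simp only: of_nat_eq_iff)
  qed
  thus ?thesis by blast
qed

text \<open>A form of degree \<open>j\<close> in \<open>Z\<close> but not in \<open>Y\<close> would
  confine \<open>Z\<close> to a scheme of \<open>s * j\<close> points on the curve.\<close>

lemma bezout:
  fixes Z :: "nat => 'k mp set"
  assumes Z: "gideal r Z" "Y \<le> Z" and d: "\<exists>t0. \<forall>t\<ge>t0. hilb r Z t = d" and sj: "s * j < d"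
  shows "Z j = Y j"
proof (rule ccontr)
  assume ne: "Z j \<noteq> Y j"
  then obtain f where f: "f \<in> Z j" "f \<notin> Y j" using Z(2) by (auto simp: le_fun_def)
  have fj: "f \<in> hforms r j" using f(1) gideal_forms[OF Z(1)] by blast
  obtain t0 where t0: "\<And>t. t \<ge> t0 ==> hilb r (gadd r Y f j) t = s * j" using hilb_Y_add[OF fj f(2)] by blast
  obtain t1 where t1: "\<And>t. t \<ge> t1 ==> hilb r Z t = d" using d by blast
  let ?t = "max t0 t1"
  have "gadd r Y f j ?t \<subseteq> Z ?t" using gadd_least[OF Z f(1)] by (simp add: le_fun_def)
  hence "hilb r Z ?t \<le> hilb r (gadd r Y f j) ?t"
    by (intro hilb_mono gideal_gadd gY fj Z)
  thus False using t0[of ?t] t1[of ?t] sj by simp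
qed

lemma linear_section:
  obtains l where "l \<in> hforms r 1" "l \<notin> Y 1"
  using Y_rel unfolding relevant_def by blast

text \<open>Cut \<open>Y\<close> by a power \<open>l ^ (t + 1)\<close>. The resulting scheme has
  degree \<open>s * (t + 1)\<close>, which exceeds \<open>s * t\<close>, so by \<open>bezout\<close>
  it imposes on forms of degree \<open>t\<close> the same conditions as \<open>Y\<close>.\<close>

lemma hilb_le: "hilb r Y t \<le> s * (t + 1)"
proof -
  obtain l where l: "l \<in> hforms r 1" "l \<notin> Y 1" by (rule linear_section)
  let ?f = "l ^ (t + 1)"
  have f: "?f \<in> hforms r (t + 1)" "?f \<notin> Y (t + 1)"
    using hforms_power[OF l(1), of "t + 1"] gprime_power[OF Y l, of "t + 1"] by simp_all
  let ?J = "gadd r Y ?f (t + 1)"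
  have J: "gideal r ?J" using gideal_gadd[OF gY f(1)] .
  let ?Z = "gsat r ?J"
  have Z: "gideal r ?Z" "gsat r ?Z = ?Z" using gideal_gsat[OF J] gsat_idem[OF inf J] by auto
  have YZ: "Y \<le> ?Z" using order_trans[OF gadd_ge[OF gY] gsat_ge[OF J]] .
  obtain t0 where t0: "\<And>u. u \<ge> t0 ==> gsat r ?J u = ?J u" using gsat_eventually[OF inf J] by metis
  obtain t1 where t1: "\<And>u. u \<ge> t1 ==> hilb r ?J u = s * (t + 1)" using hilb_Y_add[OF f] by blast
  have ev: "hilb r ?Z u = s * (t + 1)" if "u \<ge> max t0 t1" for u
    using t0[of u] t1[of u] that by (simp add: hilb_def)
  have "\<exists>t0. \<forall>u\<ge>t0. hilb r ?Z u = s * (t + 1)" using ev by blast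
  from bezout[OF Z(1) YZ this] have "?Z t = Y t" using s_pos by simp
  hence "hilb r Y t = hilb r ?Z t" by (simp add: hilb_def)
  also have "\<dots> \<le> hilb r ?Z (t + max t0 t1)"
    by (rule lift_Suc_mono_le[of "hilb r ?Z"]) (use hilb_nondecreasing(1)[OF inf Z] in auto)
  also have "\<dots> = s * (t + 1)" using ev[of "t + max t0 t1"] by linarith
  finally show ?thesis .
qed

lemma v_le: "v \<le> int s"
proof -
  obtain t0 where t0: "\<And>t. t \<ge> t0 ==> int (hilb r Y t) = int s * int t + v" using Y_hilb by blast
  have "int (hilb r Y t0) \<le> int (s * (t0 + 1))" unfolding of_nat_le_iff by (rule hilb_le)
  thus ?thesis using t0[of t0] by (simp add: algebra_simps)
qed

lemma strict_growth:
  fixes Z :: "nat => 'k mp set"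
  assumes Z: "gideal r Z" "gsat r Z = Z" and d: "\<exists>t0. \<forall>t\<ge>t0. hilb r Z t = d"
  shows "hilb r Z t \<le> d" "hilb r Z t = hilb r Z (Suc t) ==> hilb r Z t = d"
proof -
  obtain t1 where t1: "\<And>t. t \<ge> t1 ==> hilb r Z t = d" using d by blast
  have "hilb r Z t \<le> hilb r Z (t + t1)"
    by (rule lift_Suc_mono_le[of "hilb r Z"]) (use hilb_nondecreasing(1)[OF inf Z] in auto)
  thus "hilb r Z t \<le> d" using t1 by simp
  assume "hilb r Z t = hilb r Z (Suc t)"
  thus "hilb r Z t = d" using hilb_nondecreasing(2)[OF inf Z, of t "t + t1"] t1 by simp
qed

lemma growth_lower:
  fixes Z :: "nat => 'k mp set"
  assumes Z: "gideal r Z" "gsat r Z = Z" and d: "\<exists>t0. \<forall>t\<ge>t0. hilb r Z t = d" "0 < d"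
  shows "min d (t + 1) \<le> hilb r Z t"
proof (induction t)
  case 0
  have "hilb r Z 0 \<noteq> 0"
  proof
    assume "hilb r Z 0 = 0"
    hence "Z 0 = hforms r 0" using hilb_0_iff[OF Z(1)] by blast
    hence "hilb r Z t = 0" for t using gideal_full_mono[OF Z(1), of 0 t] hilb_0_iff[OF Z(1)] by blast
    thus False using d by auto
  qed
  thus ?case by simp
next
  case (Suc t)
  thus ?case using strict_growth[OF Z d(1), of t] hilb_nondecreasing(1)[OF inf Z, of t]
    strict_growth(1)[OF Z d(1), of "Suc t"] by (cases "hilb r Z t = hilb r Z (Suc t)") auto
qed

text \<open>The first difference of \<open>Y\<close> is the Hilbert function of its hyperplane
  section \<open>J\<close>, hence at least that of the saturation \<open>Z\<close>, which is a
  scheme of \<open>s\<close> points. For the third claim, \<open>J\<close> agrees with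
  \<open>Z\<close> in a degree where \<open>Z\<close> is regular, and this agreement passes to the
  next degree.\<close>

lemma difference_props:
  shows "min s (t + 2) \<le> hilb r Y (Suc t) - hilb r Y t" "hilb r Y t \<le> hilb r Y (Suc t)"
    "s \<le> Suc t ==> hilb r Y (Suc t) = hilb r Y t + s ==> hilb r Y (Suc (Suc t)) = hilb r Y (Suc t) + s"
proof -
  obtain l where l: "l \<in> hforms r 1" "l \<notin> Y 1" by (rule linear_section)
  let ?J = "gadd r Y l 1"
  have J: "gideal r ?J" using gideal_gadd[OF gY l(1)] .
  let ?Z = "gsat r ?J"
  have Z: "gideal r ?Z" "gsat r ?Z = ?Z" using gideal_gsat[OF J] gsat_idem[OF inf J] by auto
  have JZ: "?J u \<subseteq> ?Z u" for u using gsat_ge[OF J] by (simp add: le_fun_def)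
  obtain t0 where t0: "\<And>u. u \<ge> t0 ==> gsat r ?J u = ?J u" using gsat_eventually[OF inf J] by metis
  obtain t1 where t1: "\<And>u. u \<ge> t1 ==> hilb r ?J u = s * 1" using hilb_Y_add[OF l] by blast
  have ev: "\<exists>t0. \<forall>u\<ge>t0. hilb r ?Z u = s"
    using t0 t1 by (intro exI[of _ "max t0 t1"]) (simp add: hilb_def)
  have delta: "hilb r Y (Suc u) = hilb r Y u + hilb r ?J (Suc u)" for u
    using hilb_prime_add[OF Y l, of u] by simp
  have ge: "hilb r ?Z u \<le> hilb r ?J u" for u using hilb_mono[OF J Z(1) JZ] .
  have low: "min s (u + 1) \<le> hilb r ?Z u" for u using growth_lower[OF Z ev s_pos] .
  show "min s (t + 2) \<le> hilb r Y (Suc t) - hilb r Y t" "hilb r Y t \<le> hilb r Y (Suc t)"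
    using delta[of t] ge[of "Suc t"] low[of "Suc t"] by auto
  assume st: "s \<le> Suc t" and eq: "hilb r Y (Suc t) = hilb r Y t + s"
  have zs: "hilb r ?Z u = s" if "s \<le> Suc u" for u using low[of u] that strict_growth(1)[OF Z ev, of u] by simp
  have "hilb r ?J (Suc t) = s" using eq delta[of t] by simp
  hence full: "?J (Suc t) = ?Z (Suc t)" using hilb_eq_iff[OF J Z(1) JZ, of "Suc t"] zs[of "Suc t"] st by linarith
  \<comment> \<open>Castelnuovo-Mumford regularity by hand: \<open>Z + (l')\<close> is everything in
    degree \<open>Suc t\<close>. Write a form of \<open>Z\<close> of degree
    \<open>Suc (Suc t)\<close> through the variables and reduce the coefficients modulo
    \<open>l'\<close>; what is left comes from \<open>Z\<close> in degree \<open>Suc t\<close>,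
    where \<open>Z\<close> equals \<open>J\<close>.\<close>
  obtain l' where l': "l' \<in> hforms r 1" "nzd r ?Z l'" using exists_nzd[OF inf, of "{?Z}" r] Z by auto
  let ?L = "gadd r ?Z l' 1"
  have L: "gideal r ?L" using gideal_gadd[OF Z(1) l'(1)] .
  have "hilb r ?L (Suc t) = 0" using hilb_nzd[OF Z(1) l'(2,1), of t] zs[of t] zs[of "Suc t"] st by simp
  hence Lfull: "?L (Suc t) = hforms r (Suc t)" using hilb_0_iff[OF L] by blast
  have "?Z (Suc (Suc t)) \<subseteq> ?J (Suc (Suc t))"
  proof
    fix f assume f: "f \<in> ?Z (Suc (Suc t))"
    hence "f \<in> hforms r (Suc (Suc t))" using gideal_forms[OF Z(1)] by blast
    then obtain h where h: "\<forall>i. h i \<in> hforms r (Suc t)" "f = (\<Sum>i\<le>r. xv i * h i)"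
      using hforms_Suc_decomp by blast
    have "\<exists>a b. h i = a + l' * b \<and> a \<in> ?Z (1 + t) \<and> b \<in> hforms r t" for i
    proof -
      have "h i \<in> ?L (1 + t)" using h(1) Lfull by simp
      thus ?thesis by (rule gadd_memberE) blast
    qed
    then obtain a b where ab: "\<And>i. h i = a i + l' * b i" "\<And>i. a i \<in> ?Z (1 + t)" "\<And>i. b i \<in> hforms r t"
      by metis
    let ?c = "\<Sum>i\<le>r. xv i * b i" and ?d = "\<Sum>i\<le>r. xv i * a i"
    have fd: "f = ?d + l' * ?c" unfolding h(2) using ab(1)
      by (simp add: sum.distrib distrib_left sum_distrib_left mult.left_commute)
    have a': "a i \<in> ?J (1 + t)" for i using ab(2) full by simp
    have dJ: "?d \<in> ?J (1 + (1 + t))" using gideal_mult[OF J xv_hforms a'] by (intro gideal_sum[OF J]) auto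
    hence "?d \<in> ?Z (1 + (1 + t))" using JZ by blast
    hence "f - ?d \<in> ?Z (1 + (1 + t))" using f gideal_diff[OF Z(1)] by simp
    hence "l' * ?c \<in> ?Z (1 + (1 + t))" using fd by simp
    moreover have "?c \<in> hforms r (1 + t)"
      using hforms_mult[OF xv_hforms ab(3)] by (intro pv.subspace_sum[OF subspace_hforms]) auto
    ultimately have "?c \<in> ?Z (1 + t)" using l'(2) unfolding nzd_def by blast
    hence "?c \<in> ?J (1 + t)" using full by simp
    hence "l' * ?c \<in> ?J (1 + (1 + t))" using gideal_mult[OF J l'(1)] by blast
    thus "f \<in> ?J (Suc (Suc t))" using dJ fd gideal_add[OF J] by simp
  qed
  hence "hilb r ?J (Suc (Suc t)) = hilb r ?Z (Suc (Suc t))"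
    using hilb_eq_iff[OF J Z(1) JZ] JZ[of "Suc (Suc t)"] by blast
  thus "hilb r Y (Suc (Suc t)) = hilb r Y (Suc t) + s" using delta[of "Suc t"] zs[of "Suc (Suc t)"] st by simp
qed

lemma hilb_Y_0: "1 \<le> hilb r Y 0"
proof -
  have "Y 0 \<noteq> hforms r 0" using Y unfolding gprime_def by (metis hforms_1)
  hence "hilb r Y 0 \<noteq> 0" using hilb_0_iff[OF gY] by blast
  thus ?thesis by simp
qed

end

section \<open>Numerical estimates for Castelnuovo's count\<close>

lemma int_consecutive_nonneg: "0 \<le> b * (b - 1)" for b :: int
  by (cases "b \<le> 0") (auto simp: mult_nonpos_nonpos)

text \<open>Compare with the staircase \<open>b - 1, b - 2, ...\<close>, whose sum is half of
  \<open>b * (b - 1)\<close>; the index 0 itself is not summed.\<close>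

lemma sum_decreasing:
  fixes a :: "nat => int"
  assumes step: "\<And>i. a (Suc i) \<le> max 0 (a i - 1)" and a0: "0 \<le> b" "a 0 \<le> b"
  shows "2 * (\<Sum>i=1..n. a i) \<le> b * (b - 1)" "a i \<le> max 0 (b - int i)"
proof -
  show le: "a i \<le> max 0 (b - int i)" for i
  proof (induction i)
    case 0
    thus ?case using a0 by simp
  next
    case (Suc i)
    thus ?case using step[of i] by simp
  qed
  let ?m = "\<lambda>n. max 0 (b - int n)"
  have "2 * (\<Sum>i=1..n. ?m i) = b * (b - 1) - ?m n * (?m n - 1)"
  proof (induction n)
    case 0
    thus ?case using a0 by simp
  next
    case (Suc n)
    have "?m n * (?m n - 1) = 2 * ?m (Suc n) + ?m (Suc n) * (?m (Suc n) - 1)"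
    proof (cases "b - int n \<le> 0")
      case False
      hence "?m n = b - int n" "?m (Suc n) = b - int n - 1" by auto
      thus ?thesis by (simp only:) (simp add: algebra_simps)
    qed auto
    thus ?case using Suc by simp
  qed
  moreover have "(\<Sum>i=1..n. a i) \<le> (\<Sum>i=1..n. ?m i)" by (rule sum_mono) (rule le)
  ultimately show "2 * (\<Sum>i=1..n. a i) \<le> b * (b - 1)" using int_consecutive_nonneg[of "?m n"] by linarith
qed

text \<open>Here \<open>y\<close> and \<open>g\<close> are the Hilbert functions of an integral
  curve of degree \<open>s\<close> and of \<open>d\<close> points on it, and the sum of
  \<open>d - g j\<close> bounds the genus of any curve with this generic section. The first
  conclusion is the bound \<open>(s - 1) * (s - 2) / 2\<close> for the genus \<open>1 - v\<close> of
  the integral curve.\<close>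

lemma genus_count:
  fixes y g :: "nat => int" and s d v :: int
  assumes s: "1 \<le> s" and y0: "1 \<le> y 0"
    and dif: "\<And>t. min s (int t + 2) \<le> y (Suc t) - y t"
    and stab: "\<And>t. s \<le> int t + 1 ==> y (Suc t) - y t = s ==> y (Suc (Suc t)) - y (Suc t) = s"
    and ev: "\<exists>t0. \<forall>t\<ge>t0. y t = s * int t + v" and vs: "v \<le> s"
  shows "0 \<le> 2 * v + s * (s - 3)" (is ?A)
    and "[|\<And>t. s * int t < d ==> g t = y t; \<And>t. g t \<le> d; \<And>t. g t \<le> g (Suc t);
       \<And>t. g t = g (Suc t) ==> g t = d; s * (s + s * s) < d|] ==>
       \<exists>T0. \<forall>T\<ge>T0. 2 * s * (\<Sum>j=1..T. d - g j) \<le> d ^ 2 - d * (2 * v + s) + 2 * s ^ 5"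
proof -
  \<comment> \<open>The defect of \<open>y\<close> against its Hilbert polynomial. From degree
    \<open>s - 1\<close> on it is nonnegative and falls by at least one per step until it is
    0.\<close>
  define e where "e j = s * int j + v - y j" for j
  have eD: "e (Suc j) - e j = s - (y (Suc j) - y j)" for j by (simp add: e_def algebra_simps)
  obtain t0 where t0: "\<And>t. t \<ge> t0 ==> y t = s * int t + v" using ev by blast
  have e0: "e t = 0" if "t \<ge> t0" for t using t0[OF that] by (simp add: e_def)
  have edec: "e (Suc j) \<le> e j" if "s \<le> int j + 1" for j using dif[of j] eD[of j] that by simp
  have enn: "0 \<le> e j" if j: "s \<le> int j + 1" for j
  proof -
    have "e (j + k) \<le> e j" for k
    proof (induction k)
      case (Suc k)
      thus ?case using edec[of "j + k"] j by simp
    qed simp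
    from this[of t0] show ?thesis using e0[of "j + t0"] by simp
  qed
  have estr: "e (Suc j) \<le> max 0 (e j - 1)" if j: "s \<le> int j + 1" for j
  proof (cases "y (Suc j) - y j = s")
    case True
    \<comment> \<open>A difference equal to \<open>s\<close> persists by stability, so the defect is
      constant from here on; being 0 eventually, it is 0 already.\<close>
    have "y (Suc (j + k)) - y (j + k) = s" for k
    proof (induction k)
      case (Suc k)
      thus ?case using stab[of "j + k"] j by simp
    qed (use True in simp)
    hence const: "e (Suc (j + k)) = e (j + k)" for k using eD[of "j + k"] by simp
    have "e (j + k) = e j" for k by (induction k) (simp_all add: const)
    from this[of t0] have "e j = 0" using e0[of "j + t0"] by simp
    thus ?thesis using edec[OF j] by simp
  next
    case False
    thus ?thesis using dif[of j] eD[of j] j by simp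
  qed
  have ylow: "(int j + 1) * (int j + 2) \<le> 2 * y j" if "int j \<le> s - 1" for j
    using that
  proof (induction j)
    case 0
    thus ?case using y0 by simp
  next
    case (Suc j)
    hence "int j + 2 \<le> y (Suc j) - y j" using dif[of j] by simp
    thus ?case using Suc by (simp add: algebra_simps)
  qed
  \<comment> \<open>Twice the largest possible defect in degrees up to \<open>s - 1\<close>: by
    \<open>ylow\<close>, the difference \<open>E2 - 2 * e j\<close> is at least
    \<open>(s - 1 - j) * (s - 2 - j)\<close>.\<close>
  define E2 where "E2 = 2 * v + s * (s - 3)"
  have ebound: "2 * e j \<le> E2" if j: "int j \<le> s - 1" for j
  proof -
    have "0 \<le> (s - 1 - int j) * ((s - 1 - int j) - 1)" by (rule int_consecutive_nonneg)
    thus ?thesis using ylow[OF j] unfolding e_def E2_def by (simp add: algebra_simps)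
  qed
  obtain m where m: "int m = s - 1" using s by (metis diff_ge_0_iff_ge nonneg_int_cases)
  show A: ?A using ebound[of m] enn[of m] m unfolding E2_def by simp
  have ev2: "even E2" unfolding E2_def by simp
  then obtain E where E: "E2 = 2 * E" by blast
  have E0: "0 \<le> E" using A E unfolding E2_def by simp
  have eE: "e j \<le> E" if "int j \<le> s - 1" for j using ebound[OF that] E by simp
  have sumE: "2 * (\<Sum>i=1..k. e (m + i)) \<le> E * (E - 1)" and eEi: "e (m + i) \<le> max 0 (E - int i)" for k i
    using sum_decreasing[of "\<lambda>i. e (m + i)" E] estr E0 eE[of m] m by simp_all
  have E_le: "2 * E \<le> s * (s - 1)" using vs E unfolding E2_def by (simp add: algebra_simps)
  assume ge: "\<And>t. s * int t < d ==> g t = y t" and gle: "\<And>t. g t \<le> d" and gst: "\<And>t. g t \<le> g (Suc t)"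
    and gstab: "\<And>t. g t = g (Suc t) ==> g t = d" and big: "s * (s + s * s) < d"
  \<comment> \<open>The last degree with \<open>s * n < d\<close>, up to which \<open>g\<close>
    agrees with \<open>y\<close>. The remainder \<rho> is taken between 1 and \<open>s\<close>, not
    between 0 and \<open>s - 1\<close>.\<close>
  define n where "n = nat ((d - 1) div s)"
  have dpos: "1 \<le> d"
  proof -
    have "0 \<le> s * (s + s * s)" using s by simp
    thus ?thesis using big by linarith
  qed
  have nI: "int n = (d - 1) div s" using s dpos by (simp add: n_def pos_imp_zdiv_nonneg_iff)
  define \<rho> where "\<rho> = d - s * int n"
  have rho: "1 \<le> \<rho>" "\<rho> \<le> s"
  proof -
    have "d - 1 = s * int n + (d - 1) mod s" using nI by simp
    moreover have "0 \<le> (d - 1) mod s" "(d - 1) mod s < s" using s by simp_all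
    ultimately show "1 \<le> \<rho>" "\<rho> \<le> s" unfolding \<rho>_def by linarith+
  qed
  \<comment> \<open>This is what the largeness of \<open>d\<close> buys: the defect, at most
    \<open>E \<le> s * s\<close> in degree \<open>s - 1\<close>, has died out by degree
    \<open>n\<close>.\<close>
  have nbig: "s + s * s \<le> int n"
  proof (rule ccontr)
    assume "\<not> ?thesis"
    hence "int n + 1 \<le> s + s * s" by simp
    hence "s * (int n + 1) \<le> s * (s + s * s)" using s by (intro mult_left_mono) auto
    thus False using big rho unfolding \<rho>_def by (simp add: algebra_simps)
  qed
  have gy: "g j = y j" if "j \<le> n" for j
  proof (rule ge)
    have "s * int j \<le> s * int n" using that s by simp
    thus "s * int j < d" using rho unfolding \<rho>_def by linarith
  qed
  have mn: "m \<le> n" using m nbig s by (smt (verit) mult_nonneg_nonneg of_nat_le_iff)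
  have en: "e n = 0"
  proof -
    have "E \<le> int (n - m)"
    proof -
      have "int (n - m) = int n - (s - 1)" using mn m by simp
      moreover have "E \<le> s * s" using E_le s E0 by (smt (verit) mult_nonneg_nonneg right_diff_distrib mult.right_neutral)
      ultimately show ?thesis using nbig by simp
    qed
    hence "e n \<le> 0" using eEi[of "n - m"] mn by simp
    moreover have "0 \<le> e n" using enn[of n] m mn by simp
    ultimately show ?thesis by simp
  qed
  \<comment> \<open>The number of conditions still missing in degree \<open>n\<close>; from there on
    \<open>g\<close> grows strictly until it reaches \<open>d\<close>.\<close>
  define \<delta> where "\<delta> = \<rho> - v"
  have gn: "d - g n = \<delta>" using gy[of n] en unfolding e_def \<delta>_def \<rho>_def by simp
  have d0: "0 \<le> \<delta>" using gn gle[of n] by simp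
  have sumd: "2 * (\<Sum>i=1..k. d - g (n + i)) \<le> \<delta> * (\<delta> - 1)" for k
  proof (rule sum_decreasing(1))
    fix i
    show "d - g (n + Suc i) \<le> max 0 (d - g (n + i) - 1)"
    proof (cases "g (n + i) = g (Suc (n + i))")
      case True
      thus ?thesis using gstab[of "n + i"] by simp
    next
      case False
      thus ?thesis using gst[of "n + i"] by simp
    qed
  qed (use gn d0 in auto)
  have sum1: "(\<Sum>j=1..n. e j) \<le> (s - 1) * E + (\<Sum>i=1..n-m. e (m + i))"
  proof -
    have "(\<Sum>j=1..n. e j) = (\<Sum>j=1..m. e j) + (\<Sum>j=m+1..n. e j)"
      using mn sum.ub_add_nat[of 1 m e "n - m"] by simp
    also have "(\<Sum>j=m+1..n. e j) = (\<Sum>i=1..n-m. e (m + i))"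
      using sum.shift_bounds_cl_nat_ivl[of e 1 m "n - m"] mn by (simp add: add.commute)
    also have "(\<Sum>j=1..m. e j) \<le> (\<Sum>j=1..m. E)" using m by (intro sum_mono eE) simp
    also have "(\<Sum>j=1..m. E) = (s - 1) * E" using m by simp
    finally show ?thesis by simp
  qed
  have sumn: "2 * (\<Sum>j=1..n. d - g j) = 2 * int n * (d - v) - s * (int n * (int n + 1)) + 2 * (\<Sum>j=1..n. e j)"
  proof -
    have "2 * (\<Sum>j=1..k. d - (s * int j + v - e j)) = 2 * int k * (d - v) - s * (int k * (int k + 1)) + 2 * (\<Sum>j=1..k. e j)" for k
    proof (induction k)
      case (Suc k)
      have "(\<Sum>j=1..Suc k. f j) = (\<Sum>j=1..k. f j) + f (Suc k)" for f :: "nat => int" by simp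
      thus ?case using Suc by (simp add: algebra_simps)
    qed simp
    moreover have "(\<Sum>j=1..n. d - g j) = (\<Sum>j=1..n. d - (s * int j + v - e j))"
      using gy by (intro sum.cong) (auto simp: e_def)
    ultimately show ?thesis by simp
  qed
  have core: "2 * s * int n * (d - v) - s * (s * (int n * (int n + 1))) = d ^ 2 - d * (2 * v + s) - \<rho> ^ 2 + \<rho> * (2 * v + s)"
  proof -
    have sn: "s * int n = d - \<rho>" unfolding \<rho>_def by simp
    have "2 * s * int n * (d - v) - s * (s * (int n * (int n + 1))) = 2 * (s * int n) * (d - v) - (s * int n) * (s * int n + s)"
      by (simp add: algebra_simps)
    also have "\<dots> = d ^ 2 - d * (2 * v + s) - \<rho> ^ 2 + \<rho> * (2 * v + s)"
      unfolding sn by (simp add: algebra_simps power2_eq_square)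
    finally show ?thesis .
  qed
  have del: "2 * \<delta> \<le> s * (s - 1)"
    using rho A unfolding \<delta>_def by (simp add: algebra_simps)
  \<comment> \<open>These are the terms that do not grow with \<open>d\<close>. As both
    \<open>E\<close> and \<delta> are at most \<open>s * (s - 1) / 2\<close>, they sum up to order
    \<open>s ^ 5\<close>; the theorem's \<open>s ^ 4\<close> comes from here.\<close>
  have final: "- (\<rho> ^ 2) + \<rho> * (2 * v + s) + s * (2 * ((s - 1) * E) + E * (E - 1)) + s * (\<delta> * (\<delta> - 1)) \<le> 2 * s ^ 5"
  proof (cases "s = 1")
    case True
    hence "\<rho> = 1" "E = 0" "v = 1" "\<delta> = 0" using rho E_le E0 vs A d0 unfolding \<delta>_def by auto
    thus ?thesis using True by simp
  next
    case False
    hence s2: "2 \<le> s" using s by simp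
    let ?b = "s * (s - 1)"
    have b0: "0 \<le> ?b" using s by simp
    have q: "4 * (x * (x - 1)) \<le> ?b * ?b" if "0 \<le> x" "2 * x \<le> ?b" for x :: int
    proof -
      have "(2 * x) * (2 * x) \<le> ?b * ?b" by (rule mult_mono) (use that b0 in linarith)+
      thus ?thesis using that(1) by (simp add: algebra_simps)
    qed
    have r1: "\<rho> * (2 * v + s) \<le> s * (3 * s)"
    proof (cases "0 \<le> 2 * v + s")
      case True
      thus ?thesis using rho vs s by (intro mult_mono) auto
    next
      case False
      hence "\<rho> * (2 * v + s) \<le> 0" using rho by (simp add: mult_nonneg_nonpos)
      moreover have "0 \<le> s * (3 * s)" using s by simp
      ultimately show ?thesis by linarith
    qed
    have "(s - 1) * (2 * E) \<le> (s - 1) * ?b" by (rule mult_left_mono[OF E_le]) (use s in simp)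
    hence r2: "2 * ((s - 1) * E) \<le> (s - 1) * ?b" by (simp only: mult.left_commute)
    have e1: "4 * (E * (E - 1)) \<le> ?b * ?b" and e2: "4 * (\<delta> * (\<delta> - 1)) \<le> ?b * ?b"
      using q E0 E_le d0 del by auto
    have "s * (2 * ((s - 1) * E) + E * (E - 1)) + s * (\<delta> * (\<delta> - 1))
        = s * (2 * ((s - 1) * E)) + s * (E * (E - 1) + \<delta> * (\<delta> - 1))" by (simp add: algebra_simps)
    also have "\<dots> \<le> s * ((s - 1) * ?b) + s * (?b * ?b)"
      using r2 e1 e2 s int_consecutive_nonneg[of E] int_consecutive_nonneg[of \<delta>] b0
      by (intro add_mono mult_left_mono) (auto intro: order_trans)
    finally have "- (\<rho> ^ 2) + \<rho> * (2 * v + s) + s * (2 * ((s - 1) * E) + E * (E - 1)) + s * (\<delta> * (\<delta> - 1))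
      \<le> s * (3 * s) + (s * ((s - 1) * ?b) + s * (?b * ?b))" using r1 by (smt (verit) zero_le_power2)
    also have "\<dots> \<le> 2 * s ^ 5"
    proof -
      \<comment> \<open>After the shift \<open>s = x + 2\<close> all coefficients of the difference
        of the two sides are nonnegative.\<close>
      obtain x where x: "s = x + 2" "0 \<le> x" using s2 by (metis add.commute diff_add_cancel diff_ge_0_iff_ge)
      have "0 \<le> x ^ n" for n using x by simp
      hence nn: "0 \<le> x ^ 2" "0 \<le> x ^ 3" "0 \<le> x ^ 4" "0 \<le> x ^ 5" by blast+
      show ?thesis unfolding x(1) using nn x(2) by (simp add: algebra_simps eval_nat_numeral)
    qed
    finally show ?thesis .
  qed
  have "2 * s * (\<Sum>j=1..T. d - g j) \<le> d ^ 2 - d * (2 * v + s) + 2 * s ^ 5" if T: "T \<ge> n" for T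
  proof -
    have "(\<Sum>j=1..T. d - g j) = (\<Sum>j=1..n. d - g j) + (\<Sum>j=n+1..T. d - g j)"
      using T sum.ub_add_nat[of 1 n "\<lambda>j. d - g j" "T - n"] by simp
    also have "(\<Sum>j=n+1..T. d - g j) = (\<Sum>i=1..T-n. d - g (n + i))"
      using sum.shift_bounds_cl_nat_ivl[of "\<lambda>j. d - g j" 1 n "T - n"] T by (simp add: add.commute)
    finally have "2 * (\<Sum>j=1..T. d - g j) \<le> 2 * int n * (d - v) - s * (int n * (int n + 1))
       + (2 * ((s - 1) * E) + E * (E - 1)) + \<delta> * (\<delta> - 1)"
      using sumn sum1 sumE[of "n - m"] sumd[of "T - n"] by linarith
    hence "s * (2 * (\<Sum>j=1..T. d - g j)) \<le> s * (2 * int n * (d - v) - s * (int n * (int n + 1))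
       + (2 * ((s - 1) * E) + E * (E - 1)) + \<delta> * (\<delta> - 1))" using s by (intro mult_left_mono) auto
    also have "\<dots> = (2 * s * int n * (d - v) - s * (s * (int n * (int n + 1))))
       + s * (2 * ((s - 1) * E) + E * (E - 1)) + s * (\<delta> * (\<delta> - 1))" by (simp add: algebra_simps)
    finally have "s * (2 * (\<Sum>j=1..T. d - g j)) \<le> d ^ 2 - d * (2 * v + s) + 2 * s ^ 5"
      unfolding core using final by linarith
    thus ?thesis by (simp only: mult.assoc mult.left_commute[of s 2])
  qed
  thus "\<exists>T0. \<forall>T\<ge>T0. 2 * s * (\<Sum>j=1..T. d - g j) \<le> d ^ 2 - d * (2 * v + s) + 2 * s ^ 5" by blast
qed

section \<open>The generic member of a pencil of hyperplanes\<close>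

type_synonym ratfun = "complex poly fract"

lemma infinite_UNIV_ratfun: "infinite (UNIV :: ratfun set)"
proof
  assume "finite (UNIV :: ratfun set)"
  hence "finite ((\<lambda>c. to_fract [:c:]) ` (UNIV :: complex set))" by (rule finite_subset[rotated]) simp
  hence "finite (UNIV :: complex set)" by (rule finite_imageD) (simp add: inj_on_def)
  thus False using infinite_UNIV_char_0 by blast
qed

definition cemb :: "mpoly => ratfun mp" where
  "cemb p = Poly_Mapping.map (\<lambda>c. to_fract [:c:]) p"

lemma lookup_cemb: "plookup (cemb p) m = to_fract [:plookup p m:]"
  by (simp add: cemb_def Poly_Mapping.map.rep_eq when_def)

lemma cemb_0 [simp]: "cemb 0 = 0"
  by (rule poly_mapping_eqI) (simp add: lookup_cemb)

lemma cemb_add: "cemb (p + q) = cemb p + cemb q"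
  by (rule poly_mapping_eqI) (simp add: lookup_cemb lookup_add flip: to_fract_add)

lemma cemb_sum: "cemb (sum f A) = (\<Sum>x\<in>A. cemb (f x))"
  by (induction A rule: infinite_finite_induct) (simp_all add: cemb_add)

lemma cemb_single: "cemb (psingle m c) = psingle m (to_fract [:c:])"
  by (rule poly_mapping_eqI) (simp add: lookup_cemb lookup_single when_def)

lemma cemb_mult: "cemb (p * q) = cemb p * cemb q"
  by (rule hom_multI) (simp_all add: cemb_sum cemb_single mult_single mult.commute flip: to_fract_mult)

text \<open>Base change from polynomials in \<lambda> over the coordinate ring to polynomials over
  the field of rational functions in \<lambda>, the indeterminate being
  \<open>[:0, 1:]\<close>.\<close>

definition Lam :: "mpoly poly => ratfun mp" where
  "Lam f = poly (map_poly cemb f) (psingle 0 (to_fract [:0, 1:]))"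

lemma Lam_0 [simp]: "Lam 0 = 0"
  by (simp add: Lam_def)

lemma Lam_pCons: "Lam (pCons a f) = cemb a + psingle 0 (to_fract [:0, 1:]) * Lam f"
  by (simp add: Lam_def map_poly_pCons)

lemma lookup_Lam: "plookup (Lam f) m = to_fract (map_poly (\<lambda>p. plookup p m) f)"
proof (induction f)
  case (pCons a f)
  have "plookup (Lam (pCons a f)) m = to_fract [:plookup a m:] + to_fract [:0, 1:] * to_fract (map_poly (\<lambda>p. plookup p m) f)"
    unfolding Lam_pCons lookup_add lookup_cemb using lookup_sc[of "to_fract [:0, 1:]" "Lam f" m] pCons
    by (simp add: sc_def)
  also have "\<dots> = to_fract ([:plookup a m:] + [:0, 1:] * map_poly (\<lambda>p. plookup p m) f)"
    by (simp only: to_fract_add to_fract_mult)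
  finally show ?case by (simp add: map_poly_pCons)
qed simp

lemma Lam_add: "Lam (f + g) = Lam f + Lam g"
proof (rule poly_mapping_eqI)
  fix m
  have "map_poly (\<lambda>p. plookup p m) (f + g) = map_poly (\<lambda>p. plookup p m) f + map_poly (\<lambda>p. plookup p m) g"
    by (rule poly_eqI) (simp add: coeff_map_poly lookup_add)
  thus "plookup (Lam (f + g)) m = plookup (Lam f + Lam g) m"
    by (simp add: lookup_Lam lookup_add)
qed

lemma Lam_smult: "Lam (smult a g) = cemb a * Lam g"
  by (induction g) (simp_all add: Lam_pCons cemb_mult algebra_simps)

lemma Lam_mult: "Lam (f * g) = Lam f * Lam g"
proof (induction f)
  case (pCons a f)
  thus ?case by (simp add: Lam_add Lam_smult Lam_pCons algebra_simps)
qed simp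

lemma Lam_sum: "Lam (sum f A) = (\<Sum>x\<in>A. Lam (f x))"
  by (induction A rule: infinite_finite_induct) (simp_all add: Lam_add)

lemma Lam_inj: "Lam f = Lam g \<longleftrightarrow> f = g"
proof
  assume eq: "Lam f = Lam g"
  have "coeff f i = coeff g i" for i
  proof (rule poly_mapping_eqI)
    fix m
    have "map_poly (\<lambda>p. plookup p m) f = map_poly (\<lambda>p. plookup p m) g"
      using arg_cong[OF eq, of "\<lambda>p. plookup p m"] by (simp add: lookup_Lam)
    thus "plookup (coeff f i) m = plookup (coeff g i) m"
      by (metis coeff_map_poly lookup_zero)
  qed
  thus "f = g" by (rule poly_eqI)
qed simp

text \<open>Embeds denominators, which are polynomials in \<lambda> alone, among the polynomials in
  \<lambda> with coefficients in the coordinate ring.\<close>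

definition Bp :: "complex poly => mpoly poly" where
  "Bp b = map_poly (\<lambda>c. psingle 0 c) b"

lemma coeff_Bp: "coeff (Bp b) i = psingle 0 (coeff b i)"
  by (simp add: Bp_def coeff_map_poly)

lemma degree_Bp: "degree (Bp b) \<le> degree b"
  by (simp add: Bp_def map_poly_degree_leq)

lemma Lam_Bp: "Lam (Bp b) = psingle 0 (to_fract b)"
proof (rule poly_mapping_eqI)
  fix m
  have "map_poly (\<lambda>p. plookup p m) (Bp b) = (if m = 0 then b else 0)"
    by (rule poly_eqI) (auto simp: coeff_map_poly coeff_Bp lookup_single when_def)
  thus "plookup (Lam (Bp b)) m = plookup (psingle 0 (to_fract b)) m"
    by (simp add: lookup_Lam lookup_single when_def)
qed

lemma Lam_Bp_mult: "Lam (Bp b * f) = sc (to_fract b) (Lam f)"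
  by (simp add: Lam_mult Lam_Bp sc_def)

lemma Bp_mult: "Bp (b * c) = Bp b * Bp c"
  by (simp add: Lam_Bp Lam_mult mult_single flip: Lam_inj)

definition clears :: "complex poly => ratfun mp => mpoly poly => bool" where
  "clears b p f \<longleftrightarrow> b \<noteq> 0 \<and> sc (to_fract b) p = Lam f"

lemma clears_add:
  assumes "clears b p f" "clears c q g"
  shows "clears (b * c) (p + q) (Bp c * f + Bp b * g)"
proof -
  have "sc (to_fract (b * c)) (p + q) = sc (to_fract c) (sc (to_fract b) p) + sc (to_fract b) (sc (to_fract c) q)"
    by (simp add: pv.scale_right_distrib mult.commute)
  also have "\<dots> = Lam (Bp c * f + Bp b * g)" using assms by (simp add: clears_def Lam_add Lam_Bp_mult)
  finally show ?thesis using assms by (simp add: clears_def)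
qed

lemma clears_exists: "\<exists>b f. clears b p f"
proof -
  have single: "\<exists>b f. clears b (psingle m x) f" for m x
  proof -
    obtain a b where ab: "x = Fract a b" "b \<noteq> 0" by (cases x) auto
    have "sc (to_fract b) (psingle m x) = psingle m (to_fract a)"
      using ab by (simp add: sc_def mult_single Fract_conv_to_fract)
    also have "\<dots> = Lam (map_poly (\<lambda>c. psingle m c) a)"
    proof (rule poly_mapping_eqI)
      fix n
      have "map_poly (\<lambda>p. plookup p n) (map_poly (\<lambda>c. psingle m c) a) = (if m = n then a else 0)"
        by (rule poly_eqI) (auto simp: coeff_map_poly lookup_single when_def)
      thus "plookup (psingle m (to_fract a)) n = plookup (Lam (map_poly (\<lambda>c. psingle m c) a)) n"
        by (simp add: lookup_Lam lookup_single when_def)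
    qed
    finally show ?thesis unfolding clears_def using ab(2) by blast
  qed
  have "\<exists>b f. clears b (\<Sum>m\<in>A. psingle m (plookup p m)) f" if "finite A" for A
    using that
  proof (induction A)
    case empty
    show ?case unfolding clears_def by (intro exI[of _ 1] exI[of _ 0]) simp
  next
    case (insert m A)
    obtain b1 f1 where 1: "clears b1 (\<Sum>m\<in>A. psingle m (plookup p m)) f1" using insert by blast
    obtain b2 f2 where 2: "clears b2 (psingle m (plookup p m)) f2" using single by blast
    show ?case using clears_add[OF 2 1] insert(1,2) by auto
  qed
  thus ?thesis using poly_mapping_sum_single[of p] by (metis finite_keys)
qed

lemma clears_coeff:
  assumes "clears b p f" "p \<in> hforms r t"
  shows "coeff f i \<in> hforms r t"
  unfolding hforms_iff
proof (intro allI impI)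
  fix m assume "plookup (coeff f i) m \<noteq> 0"
  hence "map_poly (\<lambda>p. plookup p m) f \<noteq> 0" by (metis coeff_0 coeff_map_poly lookup_zero)
  hence "plookup (Lam f) m \<noteq> 0" by (simp add: lookup_Lam)
  hence "plookup p m \<noteq> 0" using assms(1) unfolding clears_def by (metis lookup_sc mult_zero_right)
  thus "m \<in> monoms r t" using assms(2) by (simp add: hforms_iff)
qed

lemma Lam_hforms:
  assumes "\<And>i. coeff f i \<in> hforms r t"
  shows "Lam f \<in> hforms r t"
  unfolding hforms_iff
proof (intro allI impI)
  fix m assume "plookup (Lam f) m \<noteq> 0"
  hence "map_poly (\<lambda>p. plookup p m) f \<noteq> 0" by (simp add: lookup_Lam)
  then obtain i where "coeff (map_poly (\<lambda>p. plookup p m) f) i \<noteq> 0" by (metis leading_coeff_neq_0)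
  hence "plookup (coeff f i) m \<noteq> 0" by (simp add: coeff_map_poly)
  thus "m \<in> monoms r t" using assms by (simp add: hforms_iff)
qed

lemma common_denominator:
  fixes c :: "nat => ratfun"
  shows "\<exists>b g. b \<noteq> 0 \<and> (\<forall>i<n. to_fract b * c i = to_fract (g i))"
proof (induction n)
  case 0
  show ?case by (intro exI[of _ 1]) simp
next
  case (Suc n)
  then obtain b g where bg: "b \<noteq> 0" "\<forall>i<n. to_fract b * c i = to_fract (g i)" by blast
  obtain x y where xy: "c n = Fract x y" "y \<noteq> 0" by (cases "c n") auto
  have "to_fract (b * y) * c i = to_fract (if i = n then b * x else y * g i)" if "i < Suc n" for i
    using that bg(2) xy by (auto simp: Fract_conv_to_fract less_Suc_eq mult.left_commute mult.commute[of "to_fract b"])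
  thus ?case using bg(1) xy(2) by (intro exI[of _ "b * y"] exI[of _ "\<lambda>i. if i = n then b * x else y * g i"]) simp
qed

text \<open>This is \<open>l1 ^ k * f (l2 / l1)\<close>: the ratio \<open>l2 / l1\<close> is
  substituted for \<lambda> and its denominators are cleared.\<close>

definition hmg :: "mpoly => mpoly => nat => mpoly poly => mpoly" where
  "hmg l1 l2 k f = (\<Sum>i\<le>k. coeff f i * l2 ^ i * l1 ^ (k - i))"

lemma hmg_add: "hmg l1 l2 k (f + g) = hmg l1 l2 k f + hmg l1 l2 k g"
  by (simp add: hmg_def sum.distrib distrib_right)

lemma hmg_smult: "hmg l1 l2 k (smult a f) = a * hmg l1 l2 k f"
  by (simp add: hmg_def sum_distrib_left mult.assoc)

lemma hmg_pCons: "hmg l1 l2 (Suc k) (pCons a f) = a * l1 ^ Suc k + l2 * hmg l1 l2 k f"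
  unfolding hmg_def by (subst sum.atMost_Suc_shift) (simp add: sum_distrib_left ac_simps)

lemma hmg_raise:
  assumes "degree f \<le> k"
  shows "hmg l1 l2 (j + k) f = l1 ^ j * hmg l1 l2 k f"
proof -
  have "hmg l1 l2 (j + k) f = (\<Sum>i\<le>k. coeff f i * l2 ^ i * l1 ^ (j + k - i))"
    unfolding hmg_def using assms
    by (intro sum.mono_neutral_right) (auto simp: coeff_eq_0)
  also have "\<dots> = (\<Sum>i\<le>k. l1 ^ j * (coeff f i * l2 ^ i * l1 ^ (k - i)))"
    by (rule sum.cong) (simp_all add: power_add ac_simps flip: Nat.add_diff_assoc)
  finally show ?thesis by (simp add: hmg_def sum_distrib_left)
qed

lemma hmg_mult:
  assumes "degree f \<le> k" "degree g \<le> j"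
  shows "hmg l1 l2 (k + j) (f * g) = hmg l1 l2 k f * hmg l1 l2 j g"
  using assms(1)
proof (induction f arbitrary: k)
  case 0
  thus ?case by (simp add: hmg_def)
next
  case (pCons a f)
  show ?case
  proof (cases "f = 0")
    case True
    have "hmg l1 l2 k [:a:] = a * l1 ^ k"
      using hmg_raise[of "[:a:]" 0 l1 l2 k] by (simp add: hmg_def)
    thus ?thesis using True hmg_raise[OF assms(2), of l1 l2 k] by (simp add: hmg_smult add.commute)
  next
    case False
    then obtain k' where k': "k = Suc k'" "degree f \<le> k'" using pCons.prems by (cases k) auto
    have "hmg l1 l2 (k + j) (pCons a f * g) = hmg l1 l2 (Suc k' + j) (smult a g) + hmg l1 l2 (Suc (k' + j)) (pCons 0 (f * g))"
      using k' by (simp add: hmg_add)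
    also have "\<dots> = a * (l1 ^ Suc k' * hmg l1 l2 j g) + l2 * (hmg l1 l2 k' f * hmg l1 l2 j g)"
      unfolding hmg_smult hmg_raise[OF assms(2)] hmg_pCons pCons.IH[OF k'(2)] by simp
    also have "\<dots> = hmg l1 l2 k (pCons a f) * hmg l1 l2 j g"
      unfolding k'(1) hmg_pCons by (simp add: algebra_simps)
    finally show ?thesis .
  qed
qed

lemma hmg_hforms:
  assumes "l1 \<in> hforms r 1" "l2 \<in> hforms r 1" "\<And>i. coeff f i \<in> hforms r t"
  shows "hmg l1 l2 k f \<in> hforms r (k + t)"
  unfolding hmg_def
proof (rule pv.subspace_sum[OF subspace_hforms])
  fix i assume "i \<in> {..k}"
  hence "t + i * 1 + (k - i) * 1 = k + t" by simp
  moreover have "coeff f i * l2 ^ i * l1 ^ (k - i) \<in> hforms r (t + i * 1 + (k - i) * 1)"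
    by (intro hforms_mult hforms_power assms)
  ultimately show "coeff f i * l2 ^ i * l1 ^ (k - i) \<in> hforms r (k + t)" by (simp add: add.commute)
qed

lemma clears_mult:
  assumes "clears b p f" "clears c q g"
  shows "clears (b * c) (p * q) (f * g)"
proof -
  have "sc (to_fract (b * c)) (p * q) = sc (to_fract b) p * sc (to_fract c) q"
    by (simp add: sc_mult_left sc_mult_right)
  thus ?thesis using assms by (simp add: clears_def Lam_mult)
qed

lemma clears_Bp:
  assumes "clears b p f" "c \<noteq> 0"
  shows "clears (c * b) p (Bp c * f)"
  using assms by (simp add: clears_def Lam_Bp_mult flip: pv.scale_scale)

lemma clears_unique:
  assumes "clears b p f" "clears c p g"
  shows "Bp c * f = Bp b * g"
proof -
  have "Lam (Bp c * f) = sc (to_fract c) (sc (to_fract b) p)" using assms by (simp add: clears_def Lam_Bp_mult)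
  also have "\<dots> = sc (to_fract b) (sc (to_fract c) p)" by (simp add: mult.commute)
  also have "\<dots> = Lam (Bp b * g)" using assms by (simp add: clears_def Lam_Bp_mult)
  finally show ?thesis by (simp add: Lam_inj)
qed

lemma single_0_hforms: "psingle 0 c \<in> hforms r 0"
  by (rule hforms_single) (simp add: monoms_def)

lemma hmg_top: "hmg l1 l2 (Suc n) f = coeff f (Suc n) * l2 ^ Suc n + l1 * hmg l1 l2 n f"
proof -
  have "(\<Sum>i\<le>n. coeff f i * l2 ^ i * l1 ^ (Suc n - i)) = l1 * hmg l1 l2 n f"
    unfolding hmg_def sum_distrib_left by (rule sum.cong) (simp_all add: Suc_diff_le ac_simps)
  thus ?thesis by (simp add: hmg_def)
qed

section \<open>The ideal of the generic member of the pencil\<close>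

context
  fixes r :: nat and l1 l2 :: mpoly
  assumes l: "l1 \<in> hforms r 1" "l2 \<in> hforms r 1"
begin

text \<open>The section of \<open>I\<close> by \<open>l2 = \<lambda> l1\<close> with \<lambda>
  indeterminate: forms over the rational function field that fall into \<open>I\<close> when
  \<lambda> becomes \<open>l2 / l1\<close>. The exponent \<open>k\<close> is left open, so any power
  of \<open>l1\<close> may be multiplied in.\<close>

definition pencil :: "(nat => mpoly set) => nat => ratfun mp set" where
  "pencil I t = {p \<in> hforms r t. \<exists>b f k. clears b p f \<and> degree f \<le> k \<and> hmg l1 l2 k f \<in> I (k + t)}"

lemma hmg_Bp_hforms: "hmg l1 l2 k (Bp b) \<in> hforms r k"
proof -
  have "coeff (Bp b) i \<in> hforms r 0" for i using single_0_hforms by (simp add: coeff_Bp)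
  hence "hmg l1 l2 k (Bp b) \<in> hforms r (k + 0)" by (rule hmg_hforms[OF l])
  thus ?thesis by simp
qed

text \<open>Enlarging the denominator and raising the exponent keep membership; this brings several
  elements of the pencil to a common denominator.\<close>

lemma hmg_Bp_mult_in:
  assumes I: "gideal r I" and f: "degree f \<le> k" "hmg l1 l2 k f \<in> I (k + t)" and n: "degree b + k \<le> n"
  shows "degree (Bp b * f) \<le> n" "hmg l1 l2 n (Bp b * f) \<in> I (n + t)"
proof -
  have deg: "degree (Bp b * f) \<le> degree b + k"
    using degree_mult_le[of "Bp b" f] degree_Bp[of b] f(1) by simp
  thus "degree (Bp b * f) \<le> n" using n by simp
  have "hmg l1 l2 (degree b) (Bp b) * hmg l1 l2 k f \<in> I (degree b + (k + t))"
    using gideal_mult[OF I hmg_Bp_hforms f(2)] .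
  hence h: "hmg l1 l2 (degree b + k) (Bp b * f) \<in> I (degree b + (k + t))"
    by (simp add: hmg_mult[OF degree_Bp f(1)])
  let ?j = "n - (degree b + k)"
  have "l1 ^ ?j \<in> hforms r ?j" using hforms_power[OF l(1), of ?j] by simp
  hence "l1 ^ ?j * hmg l1 l2 (degree b + k) (Bp b * f) \<in> I (?j + (degree b + (k + t)))"
    using gideal_mult[OF I _ h] by blast
  moreover have "l1 ^ ?j * hmg l1 l2 (degree b + k) (Bp b * f) = hmg l1 l2 n (Bp b * f)"
    using hmg_raise[OF deg, of l1 l2 ?j] n by simp
  moreover have "?j + (degree b + (k + t)) = n + t" using n by simp
  ultimately show "hmg l1 l2 n (Bp b * f) \<in> I (n + t)" by metis
qed

lemma gideal_pencil:
  assumes I: "gideal r I"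
  shows "gideal r (pencil I)"
proof -
  have mult: "q * p \<in> pencil I (j + t)" if q: "q \<in> hforms r j" and p: "p \<in> pencil I t" for q p j t
  proof -
    obtain b f k where p': "p \<in> hforms r t" "clears b p f" "degree f \<le> k" "hmg l1 l2 k f \<in> I (k + t)"
      using p unfolding pencil_def by blast
    obtain c g where g: "clears c q g" using clears_exists by blast
    have "hmg l1 l2 (degree g) g \<in> hforms r (degree g + j)"
      by (rule hmg_hforms[OF l]) (rule clears_coeff[OF g q])
    hence "hmg l1 l2 (degree g) g * hmg l1 l2 k f \<in> I (degree g + j + (k + t))"
      using gideal_mult[OF I _ p'(4)] by blast
    moreover have "degree g + j + (k + t) = degree g + k + (j + t)" by simp
    ultimately have "hmg l1 l2 (degree g + k) (g * f) \<in> I (degree g + k + (j + t))"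
      by (metis hmg_mult[OF order_refl p'(3)])
    moreover have "degree (g * f) \<le> degree g + k" using degree_mult_le[of g f] p'(3) by simp
    ultimately show ?thesis unfolding pencil_def
      using clears_mult[OF g p'(2)] hforms_mult[OF q p'(1)] by blast
  qed
  show ?thesis
    unfolding gideal_def
  proof (intro conjI allI ballI)
    fix t
    show "pencil I t \<subseteq> hforms r t" by (auto simp: pencil_def)
    show "pv.subspace (pencil I t)"
      unfolding pv.subspace_def
    proof (intro conjI ballI allI)
      have "clears 1 0 0" by (simp add: clears_def)
      thus "0 \<in> pencil I t" unfolding pencil_def using gideal_0[OF I, of t]
        by (intro CollectI conjI exI[of _ 1] exI[of _ 0]) (auto simp: hmg_def)
    next
      fix p q assume "p \<in> pencil I t" "q \<in> pencil I t"
      then obtain b f k c g j where pq: "p \<in> hforms r t" "clears b p f" "degree f \<le> k" "hmg l1 l2 k f \<in> I (k + t)"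
        "q \<in> hforms r t" "clears c q g" "degree g \<le> j" "hmg l1 l2 j g \<in> I (j + t)"
        unfolding pencil_def by blast
      let ?n = "degree b + degree c + k + j"
      have 1: "degree (Bp c * f) \<le> ?n" "hmg l1 l2 ?n (Bp c * f) \<in> I (?n + t)"
        using hmg_Bp_mult_in[OF I pq(3,4), of c ?n] by simp_all
      have 2: "degree (Bp b * g) \<le> ?n" "hmg l1 l2 ?n (Bp b * g) \<in> I (?n + t)"
        using hmg_Bp_mult_in[OF I pq(7,8), of b ?n] by simp_all
      have "degree (Bp c * f + Bp b * g) \<le> ?n" using 1(1) 2(1) by (rule degree_add_le)
      moreover have "hmg l1 l2 ?n (Bp c * f + Bp b * g) \<in> I (?n + t)"
        unfolding hmg_add using gideal_add[OF I 1(2) 2(2)] .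
      ultimately show "p + q \<in> pencil I t" unfolding pencil_def
        using clears_add[OF pq(2,6)] hforms_add[OF pq(1,5)] by blast
    next
      fix c x assume "x \<in> pencil I t"
      hence "sc c 1 * x \<in> pencil I (0 + t)" using mult[OF hforms_sc1] by blast
      thus "sc c x \<in> pencil I t" by (simp add: sc_mult_left)
    qed
  qed (rule mult)
qed

lemma pencil_mono: "I \<le> J ==> pencil I \<le> pencil J"
  unfolding le_fun_def pencil_def by blast

text \<open>Powers of \<open>l1\<close> cancel modulo a prime that does not contain
  \<open>l1\<close>, so the exponent of the homogenization does not matter.\<close>

lemma hmg_raise_in_prime:
  assumes P: "gprime r P" and l1: "l1 \<notin> P 1" and f: "\<And>i. coeff f i \<in> hforms r t"
    and k: "degree f \<le> k" "hmg l1 l2 k f \<in> P (k + t)" and n: "degree f \<le> n"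
  shows "hmg l1 l2 n f \<in> P (n + t)"
proof -
  have "l1 ^ n * hmg l1 l2 k f \<in> P (n * 1 + (k + t))"
    using gideal_mult[OF gprime_gideal[OF P] hforms_power[OF l(1)] k(2)] .
  hence "l1 ^ k * hmg l1 l2 n f \<in> P (k * 1 + (n + t))"
    using hmg_raise[OF k(1), of l1 l2 n] hmg_raise[OF n, of l1 l2 k] by (simp add: add.commute add.left_commute)
  moreover have "l1 ^ k \<notin> P (k * 1)" by (rule gprime_power[OF P l(1) l1])
  ultimately show ?thesis
    using gprimeD[OF P hforms_power[OF l(1)] hmg_hforms[OF l f]] by blast
qed

text \<open>Substitution turns a product over the rational function field into a product of forms
  times a binary form in \<open>l1\<close>, \<open>l2\<close>. Assumption \<open>B\<close> keeps
  these binary forms out of \<open>P\<close>, so they cancel and primality of \<open>P\<close>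
  decides. This takes the place of Bertini's theorem.\<close>

lemma gprime_pencil:
  assumes P: "gprime r P" and l1: "l1 \<notin> P 1"
    and B: "\<And>b. b \<noteq> 0 ==> hmg l1 l2 (degree b) (Bp b) \<notin> P (degree b)"
  shows "gprime r (pencil P)"
  unfolding gprime_def
proof (intro conjI allI ballI impI)
  note I = gprime_gideal[OF P]
  show "gideal r (pencil P)" using gideal_pencil[OF I] .
  show "1 \<notin> pencil P 0"
  proof
    assume "1 \<in> pencil P 0"
    then obtain b f k where f: "clears b 1 f" "degree f \<le> k" "hmg l1 l2 k f \<in> P (k + 0)"
      unfolding pencil_def by blast
    have "Lam f = Lam (Bp b)" using f(1) by (simp add: clears_def Lam_Bp sc_def)
    hence fb: "f = Bp b" by (simp add: Lam_inj)
    have "hmg l1 l2 (degree b) f \<in> P (degree b + 0)"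
      using hmg_raise_in_prime[OF P l1 _ f(2,3), of "degree b"] degree_Bp[of b] single_0_hforms
      unfolding fb coeff_Bp by blast
    thus False using B[of b] f(1) fb by (simp add: clears_def)
  qed
  fix a c p q assume p: "p \<in> hforms r a" and q: "q \<in> hforms r c" and pq: "p * q \<in> pencil P (a + c)"
  obtain b h k where h: "clears b (p * q) h" "degree h \<le> k" "hmg l1 l2 k h \<in> P (k + (a + c))"
    using pq unfolding pencil_def by blast
  obtain b1 f where f: "clears b1 p f" using clears_exists by blast
  obtain b2 g where g: "clears b2 q g" using clears_exists by blast
  have eq: "Bp (b1 * b2) * h = Bp b * (f * g)" using clears_unique[OF h(1) clears_mult[OF f g]] .
  let ?F = "hmg l1 l2 (degree f) f" and ?G = "hmg l1 l2 (degree g) g"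
  have Fh: "?F \<in> hforms r (degree f + a)" using hmg_hforms[OF l] clears_coeff[OF f p] by blast
  have Gh: "?G \<in> hforms r (degree g + c)" using hmg_hforms[OF l] clears_coeff[OF g q] by blast
  let ?e = "Bp b * (f * g)"
  have ce: "coeff ?e i \<in> hforms r (a + c)" for i
  proof -
    have "coeff (f * g) j \<in> hforms r (a + c)" for j unfolding coeff_mult
      using hforms_mult[OF clears_coeff[OF f p] clears_coeff[OF g q]]
      by (intro pv.subspace_sum[OF subspace_hforms]) blast
    hence "coeff (Bp b) u * coeff (f * g) j \<in> hforms r (0 + (a + c))" for u j
      using hforms_mult[OF single_0_hforms] unfolding coeff_Bp by blast
    thus ?thesis unfolding coeff_mult[of "Bp b"] by (intro pv.subspace_sum[OF subspace_hforms]) simp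
  qed
  have "degree ?e \<le> degree (b1 * b2) + k" "hmg l1 l2 (degree (b1 * b2) + k) ?e \<in> P (degree (b1 * b2) + k + (a + c))"
    using hmg_Bp_mult_in[OF I h(2,3), of "b1 * b2" "degree (b1 * b2) + k"] eq by simp_all
  moreover have dfg: "degree (f * g) \<le> degree f + degree g" by (rule degree_mult_le)
  moreover have "degree ?e \<le> degree b + (degree f + degree g)"
    using degree_mult_le[of "Bp b" "f * g"] degree_Bp[of b] dfg by simp
  ultimately have "hmg l1 l2 (degree b + (degree f + degree g)) ?e \<in> P (degree b + (degree f + degree g) + (a + c))"
    using hmg_raise_in_prime[OF P l1 ce] by blast
  hence "hmg l1 l2 (degree b) (Bp b) * (?F * ?G) \<in> P (degree b + (degree f + degree g) + (a + c))"
    by (simp only: hmg_mult[OF degree_Bp dfg] hmg_mult[OF order_refl order_refl])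
  moreover have "degree b + (degree f + degree g) + (a + c) = degree b + ((degree f + a) + (degree g + c))" by simp
  ultimately have "hmg l1 l2 (degree b) (Bp b) * (?F * ?G) \<in> P (degree b + ((degree f + a) + (degree g + c)))"
    by metis
  hence "?F * ?G \<in> P ((degree f + a) + (degree g + c))"
    using gprimeD[OF P hmg_Bp_hforms hforms_mult[OF Fh Gh]] B[of b] h(1) by (auto simp: clears_def)
  hence "?F \<in> P (degree f + a) \<or> ?G \<in> P (degree g + c)" using gprimeD[OF P Fh Gh] by blast
  thus "p \<in> pencil P a \<or> q \<in> pencil P c" unfolding pencil_def using f g p q by blast
qed

text \<open>Membership in the saturation is tested on the finitely many monomials of one degree, so
  a single denominator and a single exponent suffice; the substituted form then lies in the
  saturation of \<open>I\<close>.\<close>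

lemma gsat_pencil:
  assumes I: "gideal r I" and sat: "gsat r I = I"
  shows "gsat r (pencil I) = pencil I"
proof (rule antisym)
  show "gsat r (pencil I) \<le> pencil I"
    unfolding le_fun_def
  proof (intro allI subsetI)
    fix t p assume "p \<in> gsat r (pencil I) t"
    then obtain N where p: "p \<in> hforms r t" "\<forall>q\<in>hforms r N. q * p \<in> pencil I (N + t)"
      unfolding gsat_def by blast
    have "\<exists>b f k. clears b p f \<and> degree f \<le> k \<and> (\<forall>m\<in>M. hmg l1 l2 k (smult (psingle m 1) f) \<in> I (k + (N + t)))"
      if "finite M" "M \<subseteq> monoms r N" for M
      using that
    proof (induction M)
      case empty
      thus ?case using clears_exists[of p] by blast
    next
      case (insert m M)
      then obtain b f k where f: "clears b p f" "degree f \<le> k"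
        "\<forall>m\<in>M. hmg l1 l2 k (smult (psingle m 1) f) \<in> I (k + (N + t))" by blast
      have "psingle m 1 * p \<in> pencil I (N + t)" using p(2) insert.prems hforms_single by blast
      then obtain c g j where g: "clears c (psingle m 1 * p) g" "degree g \<le> j" "hmg l1 l2 j g \<in> I (j + (N + t))"
        unfolding pencil_def by blast
      have "cemb (psingle m 1) = psingle m 1"
        by (simp add: cemb_single flip: one_pCons)
      hence "clears b (psingle m 1 * p) (smult (psingle m 1) f)"
        using f(1) sc_mult_right[of "psingle m 1" "to_fract b" p] by (simp add: clears_def Lam_smult)
      from clears_unique[OF this g(1)] have eq: "smult (psingle m 1) (Bp c * f) = Bp b * g" by simp
      let ?n = "degree b + degree c + k + j"
      have c0: "c \<noteq> 0" using g(1) by (simp add: clears_def)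
      have "degree (Bp c * f) \<le> ?n"
        using degree_mult_le[of "Bp c" f] degree_Bp[of c] f(2) by simp
      moreover have "hmg l1 l2 ?n (smult (psingle m 1) (Bp c * f)) \<in> I (?n + (N + t))"
        unfolding eq by (rule hmg_Bp_mult_in(2)[OF I g(2,3)]) simp
      moreover have "hmg l1 l2 ?n (smult (psingle m' 1) (Bp c * f)) \<in> I (?n + (N + t))" if "m' \<in> M" for m'
      proof -
        have "degree (smult (psingle m' 1) f) \<le> k" using degree_smult_le[of "psingle m' 1" f] f(2) by simp
        moreover have "hmg l1 l2 k (smult (psingle m' 1) f) \<in> I (k + (N + t))" using f(3) that by blast
        ultimately have "hmg l1 l2 ?n (Bp c * smult (psingle m' 1) f) \<in> I (?n + (N + t))"
          by (rule hmg_Bp_mult_in(2)[OF I]) simp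
        thus ?thesis by simp
      qed
      ultimately show ?case using clears_Bp[OF f(1) c0] by blast
    qed
    from this[OF finite_monoms order_refl] obtain b f k where f: "clears b p f" "degree f \<le> k"
      "\<forall>m\<in>monoms r N. hmg l1 l2 k (smult (psingle m 1) f) \<in> I (k + (N + t))" by blast
    let ?h = "hmg l1 l2 k f"
    have hh: "?h \<in> hforms r (k + t)" using hmg_hforms[OF l clears_coeff[OF f(1) p(1)]] .
    have "q * ?h \<in> I (N + (k + t))" if q: "q \<in> hforms r N" for q
    proof -
      have "psingle m (plookup q m) * ?h \<in> I (k + (N + t))" if m: "m \<in> pkeys q" for m
      proof -
        have "m \<in> monoms r N" using m q by (auto simp: hforms_def)
        hence "psingle m 1 * ?h \<in> I (k + (N + t))" using f(3) by (simp add: hmg_smult)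
        hence "sc (plookup q m) (psingle m 1 * ?h) \<in> I (k + (N + t))" by (rule gideal_sc[OF I])
        thus ?thesis by (simp add: sc_def mult_single flip: mult.assoc)
      qed
      hence "(\<Sum>m\<in>pkeys q. psingle m (plookup q m) * ?h) \<in> I (k + (N + t))" by (intro gideal_sum[OF I])
      hence "(\<Sum>m\<in>pkeys q. psingle m (plookup q m)) * ?h \<in> I (k + (N + t))" by (simp add: sum_distrib_right)
      thus ?thesis by (simp add: add.left_commute flip: poly_mapping_sum_single)
    qed
    hence "?h \<in> gsat r I (k + t)" using hh unfolding gsat_def by blast
    thus "p \<in> pencil I t" using sat f p(1) unfolding pencil_def by auto
  qed
qed (rule gsat_ge[OF gideal_pencil[OF I]])

lemma clear_combination:
  fixes f :: "nat => mpoly poly"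
  shows "\<exists>b g. clears b (pv.cmb c (\<lambda>i. Lam (f i)) {..<n}) (\<Sum>i<n. Bp (g i) * f i) \<and> (\<forall>i<n. g i = 0 --> c i = 0)"
proof -
  obtain b g where bg: "b \<noteq> 0" "\<forall>i<n. to_fract b * c i = to_fract (g i)"
    using common_denominator by blast
  have "sc (to_fract b) (pv.cmb c (\<lambda>i. Lam (f i)) {..<n}) = (\<Sum>i<n. sc (to_fract b * c i) (Lam (f i)))"
    by (simp add: pv.cmb_def pv.scale_sum_right)
  also have "\<dots> = (\<Sum>i<n. Lam (Bp (g i) * f i))" using bg(2) by (simp add: Lam_Bp_mult)
  finally have "clears b (pv.cmb c (\<lambda>i. Lam (f i)) {..<n}) (\<Sum>i<n. Bp (g i) * f i)"
    using bg(1) by (simp add: clears_def Lam_sum)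
  moreover have "\<forall>i<n. g i = 0 --> c i = 0" using bg by auto
  ultimately show ?thesis by blast
qed

text \<open>Semicontinuity: \<open>l1 = 0\<close> is the member of the pencil at infinity. An
  element \<open>u = e + l1 * g\<close> of \<open>I + (l1)\<close> deforms to
  \<open>\<lambda> u - l2 g\<close>, and independent \<open>u\<close> have independent deformations
  because they are the leading coefficients in \<lambda>.\<close>

lemma hilb_pencil_le:
  assumes I: "gideal r I"
  shows "hilb r (pencil I) t \<le> hilb r (gadd r I l1 1) t"
proof -
  let ?J = "gadd r I l1 1" and ?n = "card (monoms r t)"
  have J: "gideal r ?J" using gideal_gadd[OF I l(1)] .
  have z: "pv.subspace {0}" by simp
  obtain x a where x: "pv.qd (hforms r t) (?J t) x" "pv.qd (?J t) {0} a" "?n = x + a"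
    using pv.qd_split[OF z gideal_subspace[OF J] subspace_hforms gideal_forms[OF J] _ qd_hforms] gideal_0[OF J] by (metis empty_subsetI insert_subset)
  have Y: "gideal r (pencil I)" using gideal_pencil[OF I] .
  obtain x' a' where x': "pv.qd (hforms r t) (pencil I t) x'" "pv.qd (pencil I t) {0} a'" "?n = x' + a'"
    using pv.qd_split[OF z gideal_subspace[OF Y] subspace_hforms gideal_forms[OF Y] _ qd_hforms] gideal_0[OF Y] by (metis empty_subsetI insert_subset)
  obtain u where u: "\<forall>i<a. u i \<in> ?J t" "pv.qindep {0} u {..<a}" using pv.qd_imp_qindep[OF x(2)] by blast
  have "\<forall>i. \<exists>g. i < a --> u i - l1 * g \<in> I t \<and> l2 * g \<in> hforms r t"
  proof
    fix i
    show "\<exists>g. i < a --> u i - l1 * g \<in> I t \<and> l2 * g \<in> hforms r t"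
    proof (cases "i < a")
      case True
      then obtain e g where eg: "u i = e + l1 * g" "e \<in> I t" "g \<in> (if 1 \<le> t then hforms r (t - 1) else {0})"
        using u(1) unfolding gadd_def by blast
      hence "l2 * g \<in> hforms r t" using hforms_mult[OF l(2), of g "t - 1"] by (auto split: if_splits)
      thus ?thesis using eg by (intro exI[of _ g]) simp
    qed auto
  qed
  then obtain g where g: "\<And>i. i < a ==> u i - l1 * g i \<in> I t" "\<And>i. i < a ==> l2 * g i \<in> hforms r t"
    by metis
  let ?f = "\<lambda>i. [: - l2 * g i, u i :]"
  have uh: "u i \<in> hforms r t" if "i < a" for i using u(1) that gideal_forms[OF J] by blast
  have inY: "Lam (?f i) \<in> pencil I t" if i: "i < a" for i
  proof -
    have "coeff (?f i) j \<in> hforms r t" for j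
      using uh[OF i] pv.subspace_neg[OF subspace_hforms g(2)[OF i]]
      by (auto simp: coeff_pCons split: nat.split)
    hence "Lam (?f i) \<in> hforms r t" by (rule Lam_hforms)
    moreover have "clears 1 (Lam (?f i)) (?f i)" by (simp add: clears_def)
    moreover have "degree (?f i) \<le> 1" by simp
    moreover have "hmg l1 l2 1 (?f i) \<in> I (1 + t)"
    proof -
      have "hmg l1 l2 1 (?f i) = l2 * (u i - l1 * g i)" by (simp add: hmg_def algebra_simps)
      thus ?thesis using gideal_mult[OF I l(2) g(1)[OF i]] by simp
    qed
    ultimately show ?thesis unfolding pencil_def by blast
  qed
  have "pv.qindep {0} (\<lambda>i. Lam (?f i)) {..<a}"
    unfolding pv.qindep_lessThan
  proof (intro allI impI)
    fix c i assume c: "pv.cmb c (\<lambda>i. Lam (?f i)) {..<a} \<in> {0}" and i: "i < a"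
    obtain b h where h: "clears b (pv.cmb c (\<lambda>i. Lam (?f i)) {..<a}) (\<Sum>i<a. Bp (h i) * ?f i)"
      "\<forall>i<a. h i = 0 --> c i = 0" using clear_combination[of c ?f a] by blast
    have s0: "(\<Sum>i<a. Bp (h i) * ?f i) = 0" using h(1) c Lam_inj[of _ 0] by (simp add: clears_def)
    have "\<forall>i<a. h i = 0"
    proof (rule ccontr)
      assume ne: "\<not> ?thesis"
      let ?A = "{degree (h i) | i. i < a \<and> h i \<noteq> 0}"
      have fin: "finite ?A" by simp
      have "?A \<noteq> {}" using ne by blast
      define d where "d = Max ?A"
      have "d \<in> ?A" unfolding d_def using fin \<open>?A \<noteq> {}\<close> by (rule Max_in)
      then obtain i0 where i0: "i0 < a" "h i0 \<noteq> 0" "degree (h i0) = d" by blast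
      have high: "coeff (h i) (Suc d) = 0" if "i < a" for i
      proof (cases "h i = 0")
        case False
        hence "degree (h i) \<le> d" unfolding d_def using fin that by (intro Max_ge) auto
        thus ?thesis by (simp add: coeff_eq_0)
      qed simp
      \<comment> \<open>In degree \<open>Suc d\<close> of \<lambda> only the top coefficients of the
        \<open>h i\<close> meet the leading coefficients \<open>u i\<close>.\<close>
      have "coeff (Bp (h i) * ?f i) (Suc d) = sc (coeff (h i) d) (u i)" if "i < a" for i
        using high[OF that] by (simp add: coeff_Bp sc_def coeff_pCons mult.commute[of "Bp _"])
      hence "pv.cmb (\<lambda>i. coeff (h i) d) u {..<a} = coeff (\<Sum>i<a. Bp (h i) * ?f i) (Suc d)"
        unfolding pv.cmb_def coeff_sum by (intro sum.cong) auto
      hence "pv.cmb (\<lambda>i. coeff (h i) d) u {..<a} \<in> {0}" unfolding s0 by simp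
      hence "\<forall>i<a. coeff (h i) d = 0" using u(2) unfolding pv.qindep_lessThan by blast
      thus False using i0 by (metis leading_coeff_0_iff)
    qed
    thus "c i = 0" using h(2) i by blast
  qed
  hence "a \<le> a'" using pv.qd_ge[OF z finite_lessThan x'(2)] inY by fastforce
  moreover have "hilb r ?J t = x" "hilb r (pencil I) t = x'"
    unfolding hilb_def using x(1) x'(1) gideal_subspace[OF J] gideal_subspace[OF Y] pv.qdim_eq[OF _ subspace_hforms] by blast+
  ultimately show ?thesis using x(3) x'(3) by simp
qed

lemma nzd_power:
  assumes "nzd r I l1" "g \<in> hforms r t" "l1 ^ j * g \<in> I (j + t)"
  shows "g \<in> I t"
  using assms(3)
proof (induction j)
  case (Suc j)
  have "l1 ^ j * g \<in> hforms r (j * 1 + t)" by (rule hforms_mult[OF hforms_power[OF l(1)] assms(2)])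
  hence "l1 ^ j * g \<in> I (j + t)" using assms(1) Suc.prems unfolding nzd_def by (simp add: mult.assoc)
  thus ?case by (rule Suc.IH)
qed simp

text \<open>Modulo \<open>l1\<close> only the summand with the highest power of \<open>l2\<close>
  survives.\<close>

lemma hmg_top_coeff:
  assumes I: "gideal r I" and f: "\<And>i. coeff f i \<in> hforms r t" and h: "hmg l1 l2 n f \<in> I (n + t)"
  shows "l2 ^ n * coeff f n \<in> gadd r I l1 1 (n + t)"
proof (cases n)
  case 0
  thus ?thesis using h gadd_ge[OF I, of l1 1] by (auto simp: hmg_def le_fun_def)
next
  case (Suc m)
  have "hmg l1 l2 m f \<in> hforms r (m + t)" by (rule hmg_hforms[OF l f])
  hence "- hmg l1 l2 m f \<in> hforms r (m + t)" using pv.subspace_neg[OF subspace_hforms] by blast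
  hence "hmg l1 l2 n f + l1 * - hmg l1 l2 m f \<in> gadd r I l1 1 (1 + (m + t))"
    using gadd_member[of "hmg l1 l2 n f" I 1 "m + t" "- hmg l1 l2 m f" r l1] h Suc by simp
  thus ?thesis unfolding Suc hmg_top by (simp add: mult.commute)
qed

text \<open>If \<open>l1\<close>, \<open>l2\<close> behave like a regular sequence, the generic
  member has no smaller Hilbert function than the one at infinity. A relation modulo the generic
  member is cleared to \<open>F\<close>; \<open>hmg_top_coeff\<close> and regularity put the leading
  coefficient of \<open>F\<close> in \<lambda> into \<open>I + (l1)\<close>, modulo which the
  \<open>w i\<close> are independent, so \<open>F\<close> is 0.\<close>

lemma hilb_pencil_ge:
  assumes I: "gideal r I" and nz: "nzd r I l1"
    and reg: "hreg r (gadd r I l1 1) l2 t"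
  shows "hilb r (gadd r I l1 1) t \<le> hilb r (pencil I) t"
proof -
  let ?J = "gadd r I l1 1"
  have J: "gideal r ?J" using gideal_gadd[OF I l(1)] .
  have Y: "gideal r (pencil I)" using gideal_pencil[OF I] .
  let ?n = "hilb r ?J t"
  obtain w where w: "\<forall>i<?n. w i \<in> hforms r t" "pv.qindep (?J t) w {..<?n}"
    using pv.qd_imp_qindep[OF pv.qd_qdim[OF gideal_subspace[OF J] subspace_hforms finq_gideal[OF J]]] unfolding hilb_def by blast
  let ?f = "\<lambda>i. [: w i :]"
  have wh: "Lam (?f i) \<in> hforms r t" if "i < ?n" for i
    using w(1) that by (intro Lam_hforms) (auto simp: coeff_pCons split: nat.split)
  have "pv.qindep (pencil I t) (\<lambda>i. Lam (?f i)) {..<?n}"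
    unfolding pv.qindep_lessThan
  proof (intro allI impI)
    fix c i assume c: "pv.cmb c (\<lambda>i. Lam (?f i)) {..<?n} \<in> pencil I t" and i: "i < ?n"
    let ?p = "pv.cmb c (\<lambda>i. Lam (?f i)) {..<?n}"
    obtain b h where h: "clears b ?p (\<Sum>i<?n. Bp (h i) * ?f i)" "\<forall>i<?n. h i = 0 --> c i = 0"
      using clear_combination[of c ?f ?n] by blast
    obtain b' f' k where f': "clears b' ?p f'" "degree f' \<le> k" "hmg l1 l2 k f' \<in> I (k + t)"
      using c unfolding pencil_def by blast
    define F where "F = Bp b * f'"
    have Feq: "F = Bp b' * (\<Sum>i<?n. Bp (h i) * ?f i)" unfolding F_def using clears_unique[OF h(1) f'(1)] by simp
    have Fc: "coeff F d = pv.cmb (\<lambda>i. coeff (b' * h i) d) w {..<?n}" for d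
    proof -
      have "F = (\<Sum>i<?n. Bp (b' * h i) * ?f i)" unfolding Feq by (simp add: sum_distrib_left Bp_mult mult.assoc)
      hence "coeff F d = (\<Sum>i<?n. coeff (Bp (b' * h i) * ?f i) d)" by (simp add: coeff_sum)
      also have "\<dots> = (\<Sum>i<?n. sc (coeff (b' * h i) d) (w i))"
        by (rule sum.cong) (simp_all add: coeff_Bp sc_def mult.commute[of "Bp _"])
      finally show ?thesis by (simp add: pv.cmb_def)
    qed
    have Fh: "coeff F d \<in> hforms r t" for d unfolding Fc using w(1) by (intro pv.cmb_in subspace_hforms) auto
    have zero: "\<forall>i<?n. coeff (b' * h i) d = 0" if "coeff F d \<in> ?J t" for d
      using that w(2) unfolding Fc pv.qindep_lessThan by blast
    have k: "degree F \<le> degree b + k" "hmg l1 l2 (degree b + k) F \<in> I (degree b + k + t)"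
      unfolding F_def using hmg_Bp_mult_in[OF I f'(2,3) order_refl] by auto
    let ?m = "degree F"
    let ?j = "degree b + k - ?m"
    have "l1 ^ ?j * hmg l1 l2 ?m F \<in> I (?j + (?m + t))"
      using k hmg_raise[of F ?m l1 l2 ?j] by (simp add: add.assoc)
    hence "hmg l1 l2 ?m F \<in> I (?m + t)" by (rule nzd_power[OF nz hmg_hforms[OF l Fh]])
    hence "l2 ^ ?m * coeff F ?m \<in> ?J (?m + t)" by (rule hmg_top_coeff[OF I Fh])
    hence "coeff F ?m \<in> ?J t" using reg Fh unfolding hreg_def by blast
    hence "\<forall>i<?n. coeff (b' * h i) ?m = 0" by (rule zero)
    hence "coeff F ?m = 0" unfolding Fc by (simp add: pv.cmb_def)
    hence "F = 0" by simp
    hence "coeff F d \<in> ?J t" for d using gideal_0[OF J] by simp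
    hence "coeff (b' * h i) d = 0" for d using zero i by blast
    hence "b' * h i = 0" by (intro poly_eqI) simp
    hence "h i = 0" using f'(1) by (simp add: clears_def)
    thus "c i = 0" using h(2) i by blast
  qed
  moreover have "pv.qd (hforms r t) (pencil I t) (hilb r (pencil I) t)"
    unfolding hilb_def by (rule pv.qd_qdim[OF gideal_subspace[OF Y] subspace_hforms finq_gideal[OF Y]])
  ultimately show ?thesis using pv.qd_ge[OF gideal_subspace[OF Y] finite_lessThan] wh by fastforce
qed

end

section \<open>Curves on integral surfaces\<close>

lemma infinite_UNIV_complex: "infinite (UNIV :: complex set)"
  by (rule infinite_UNIV_char_0)

lemma hilb_full: "gideal r I ==> I t = hforms r t ==> t \<le> u ==> hilb r I u = 0"
  using gideal_full_mono[of r I t u] hilb_0_iff[of r I u] by simp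

lemma linear_not_full:
  assumes I: "gideal r I" and s: "1 \<le> s" and h: "\<And>t. t \<ge> t0 ==> int (hilb r I t) = int s * int t + v"
  shows "I t \<noteq> hforms r t"
proof
  assume full: "I t = hforms r t"
  let ?u = "max t t0 + nat (\<bar>v\<bar> + 1)"
  have "int (hilb r I ?u) = 0" using hilb_full[OF I full, of ?u] by simp
  hence "int s * int ?u + v = 0" using h[of ?u] by simp
  moreover have "\<bar>v\<bar> + 1 \<le> int ?u" by simp
  ultimately show False using mult_right_mono[of 1 "int s" "int ?u"] s by simp
qed

text \<open>Modulo \<open>l1\<close> a binary form becomes a multiple of \<open>l2 ^ n\<close>. If
  it vanished on \<open>D\<close>, regularity of \<open>l2\<close> would make
  \<open>D + (l1)\<close> everything in degree \<open>t\<close>.\<close>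

lemma binary_form_not_in:
  assumes l: "l1 \<in> hforms r 1" "l2 \<in> hforms r 1" and I: "gideal r D"
    and ne: "gadd r D l1 1 t \<noteq> hforms r t"
    and reg: "hreg r (gadd r D l1 1) l2 t"
    and b: "b \<noteq> 0"
  shows "hmg l1 l2 (degree b) (Bp b) \<notin> D (degree b)"
proof
  let ?J = "gadd r D l1 1" and ?n = "degree b"
  have J: "gideal r ?J" using gideal_gadd[OF I l(1)] .
  assume "hmg l1 l2 ?n (Bp b) \<in> D ?n"
  hence "hmg l1 l2 ?n (Bp b) \<in> D (?n + 0)" by simp
  hence "l2 ^ ?n * coeff (Bp b) ?n \<in> ?J (?n + 0)"
    by (rule hmg_top_coeff[OF l I, rotated]) (simp add: coeff_Bp single_0_hforms)
  hence "sc (coeff b ?n) (l2 ^ ?n) \<in> ?J ?n" by (simp add: coeff_Bp sc_def mult.commute)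
  hence "sc (1 / coeff b ?n) (sc (coeff b ?n) (l2 ^ ?n)) \<in> ?J ?n" by (rule gideal_sc[OF J])
  hence l2: "l2 ^ ?n \<in> ?J ?n" using b by simp
  have "g \<in> ?J t" if g: "g \<in> hforms r t" for g
  proof -
    have "g * l2 ^ ?n \<in> ?J (t + ?n)" using gideal_mult[OF J g l2] .
    thus ?thesis using reg g unfolding hreg_def by (metis add.commute mult.commute)
  qed
  hence "?J t = hforms r t" using gideal_forms[OF J] by blast
  thus False using ne by simp
qed

text \<open>Here \<open>1 - c\<close> is the arithmetic genus of \<open>C\<close>, and
  \<open>1 - v\<close> that of a hyperplane section of \<open>D\<close>. The last conclusion is the
  bound for plane curves, kept for degrees too small for the third.\<close>

lemma curve_on_surface:
  fixes C D :: "nat => mpoly set" and s d :: nat and c v :: int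
  assumes D: "gprime r D" "relevant r D" and C: "gideal r C" "gsat r C = C" and DC: "D \<le> C"
    and hD: "\<exists>t0. \<forall>t\<ge>t0. int (hilb r D (Suc t)) - int (hilb r D t) = int s * int (Suc t) + v"
    and hC: "\<exists>t0. \<forall>t\<ge>t0. int (hilb r C t) = int d * int t + c"
    and s: "1 \<le> s" and d: "1 \<le> d"
  shows "v \<le> int s" "0 \<le> 2 * v + int s * (int s - 3)"
    "int s * (int s + int s * int s) < int d ==>
      2 * int s * (1 - c) \<le> int d ^ 2 - int d * (2 * v + int s) + 2 * int s ^ 5"
    "2 * (1 - c) \<le> (int d - 1) * (int d - 2)"
proof -
  note inf = infinite_UNIV_complex
  have gD: "gideal r D" using gprime_gideal[OF D(1)] .
  have satD: "gsat r D = D" using gprime_saturated[OF D] .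
  \<comment> \<open>One pencil has to serve \<open>C\<close> and \<open>D\<close> at once:
    \<open>l1\<close> is a nonzerodivisor for both, and \<open>l2\<close> is regular in large
    degrees on both sections by \<open>l1\<close>.\<close>
  have "\<exists>l\<in>hforms r 1. \<forall>I\<in>{C, D}. nzd r I l" by (rule exists_nzd[OF inf]) (use C gD satD in auto)
  then obtain l1 where l1: "l1 \<in> hforms r 1" and nzC: "nzd r C l1" and nzD: "nzd r D l1" by auto
  have l1D: "l1 \<notin> D 1"
  proof
    assume "l1 \<in> D 1"
    hence "l1 * 1 \<in> D (1 + 0)" by simp
    hence "1 \<in> D 0" using nzD hforms_1 unfolding nzd_def by blast
    thus False using D(1) by (simp add: gprime_def)
  qed
  let ?JD = "gadd r D l1 1" and ?JC = "gadd r C l1 1"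
  have JD: "gideal r ?JD" and JC: "gideal r ?JC" using gideal_gadd[OF _ l1] gD C(1) by auto
  have "\<exists>l\<in>hforms r 1. \<forall>I\<in>{?JC, ?JD}. \<exists>t0. \<forall>t\<ge>t0. hreg r I l t"
    by (rule exists_regular_form[OF inf]) (use JC JD in auto)
  then obtain l2 tC tD where l2: "l2 \<in> hforms r 1"
    and regC: "\<And>t. t \<ge> tC ==> hreg r ?JC l2 t" and regD: "\<And>t. t \<ge> tD ==> hreg r ?JD l2 t" by auto
  note l = l1 l2
  obtain uD where uD: "\<And>t. t \<ge> uD ==> int (hilb r D (Suc t)) - int (hilb r D t) = int s * int (Suc t) + v"
    using hD by blast
  obtain uC where uC: "\<And>t. t \<ge> uC ==> int (hilb r C t) = int d * int t + c" using hC by blast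
  have hJD: "int (hilb r ?JD t) = int s * int t + v" if t: "t \<ge> Suc uD" for t
  proof -
    obtain u where u: "t = Suc u" "u \<ge> uD" using t by (cases t) auto
    thus ?thesis using hilb_nzd[OF gD nzD l1, of u] uD[of u] by simp
  qed
  have hJC: "hilb r ?JC t = d" if t: "t \<ge> Suc uC" for t
  proof -
    obtain u where u: "t = Suc u" "u \<ge> uC" using t by (cases t) auto
    hence "int (hilb r ?JC t) = int d"
      using hilb_nzd[OF C(1) nzC l1, of u] uC[of u] uC[of "Suc u"] by (simp add: algebra_simps)
    thus ?thesis by simp
  qed
  have JDne: "?JD t \<noteq> hforms r t" for t by (rule linear_not_full[OF JD s]) (erule hJD)
  define Y where "Y = pencil r l1 l2 D"
  define Z where "Z = pencil r l1 l2 C"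
  have Yp: "gprime r Y" unfolding Y_def
    by (rule gprime_pencil[OF l D(1) l1D]) (rule binary_form_not_in[OF l gD JDne[of tD] regD[OF order_refl]])
  have Zg: "gideal r Z" unfolding Z_def by (rule gideal_pencil[OF l C(1)])
  have Zs: "gsat r Z = Z" unfolding Z_def by (rule gsat_pencil[OF l C])
  have YZ: "Y \<le> Z" unfolding Y_def Z_def by (rule pencil_mono[OF l DC])
  have hY: "int (hilb r Y t) = int s * int t + v" if "t \<ge> max tD (Suc uD)" for t
  proof -
    have "hilb r Y t = hilb r ?JD t" unfolding Y_def
      by (rule antisym[OF hilb_pencil_le[OF l gD] hilb_pencil_ge[OF l gD nzD regD]]) (use that in simp)
    thus ?thesis using hJD[of t] that by simp
  qed
  have hZ: "hilb r Z t = d" if "t \<ge> max tC (Suc uC)" for t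
  proof -
    have "hilb r Z t = hilb r ?JC t" unfolding Z_def
      by (rule antisym[OF hilb_pencil_le[OF l C(1)] hilb_pencil_ge[OF l C(1) nzC regC]]) (use that in simp)
    thus ?thesis using hJC[of t] that by simp
  qed
  have Zev: "\<exists>t0. \<forall>t\<ge>t0. hilb r Z t = d" using hZ by blast
  have Yrel: "relevant r Y"
    using linear_not_full[OF gprime_gideal[OF Yp] s, of "max tD (Suc uD)" v 1, OF hY] gideal_forms[OF gprime_gideal[OF Yp], of 1]
    by (auto simp: relevant_def)
  have Yev: "\<exists>t0. \<forall>t\<ge>t0. int (hilb r Y t) = int s * int t + v" using hY by blast
  interpret Y: integral_curve r Y s v
    by unfold_locales (use infinite_UNIV_ratfun Yp Yrel s Yev in auto)
  let ?y = "\<lambda>t. int (hilb r Y t)" and ?g = "\<lambda>t. int (hilb r Z t)"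
  have props: "1 \<le> int s" "1 \<le> ?y 0" "\<And>t. min (int s) (int t + 2) \<le> ?y (Suc t) - ?y t"
    "\<And>t. int s \<le> int t + 1 ==> ?y (Suc t) - ?y t = int s ==> ?y (Suc (Suc t)) - ?y (Suc t) = int s"
    "\<exists>t0. \<forall>t\<ge>t0. ?y t = int s * int t + v"
  proof -
    show "min (int s) (int t + 2) \<le> ?y (Suc t) - ?y t" for t
      using Y.difference_props(1,2)[of t] by linarith
    show "?y (Suc (Suc t)) - ?y (Suc t) = int s" if "int s \<le> int t + 1" "?y (Suc t) - ?y t = int s" for t
    proof -
      have "hilb r Y (Suc t) = hilb r Y t + s" using that(2) by linarith
      moreover have "s \<le> Suc t" using that(1) by linarith
      ultimately show ?thesis using Y.difference_props(3)[of t] by simp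
    qed
  qed (use s Y.hilb_Y_0 Y.Y_hilb in auto)
  show vs: "v \<le> int s" by (rule Y.v_le)
  show "0 \<le> 2 * v + int s * (int s - 3)" by (rule genus_count(1)[OF props vs])
  have gle: "?g t \<le> int d" and gst: "?g t = ?g (Suc t) ==> ?g t = int d" and
    gmono: "?g t \<le> ?g (Suc t)" for t
    using Y.strict_growth[OF Zg Zs Zev, of t] hilb_nondecreasing(1)[OF Y.inf Zg Zs, of t] by auto
  have glow: "min (int d) (int t + 1) \<le> ?g t" for t
    using Y.growth_lower[OF Zg Zs Zev, of t] d by linarith
  \<comment> \<open>Sum up first differences of the Hilbert function of \<open>C\<close>: each is at
    least the Hilbert function of the generic section, and degree 0 contributes at least 1.
    Comparison with \<open>d * T + c\<close> bounds \<open>c\<close> from below.\<close>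
  have lower: "c \<ge> 1 - (\<Sum>j=1..T. int d - ?g j)" if T: "T \<ge> uC" for T
  proof -
    have "int (hilb r C T) = int (hilb r C 0) + (\<Sum>j=1..T. int (hilb r ?JC j))" for T
      by (induction T) (simp_all add: hilb_nzd[OF C(1) nzC l1])
    moreover have "(\<Sum>j=1..T. ?g j) \<le> (\<Sum>j=1..T. int (hilb r ?JC j))"
      unfolding Z_def using hilb_pencil_le[OF l C(1)] by (intro sum_mono) simp
    moreover have "?g 0 \<le> int (hilb r C 0)"
      using hilb_pencil_le[OF l C(1), of 0] unfolding Z_def by (simp add: hilb_gadd_low)
    moreover have "1 \<le> ?g 0" using glow[of 0] d by simp
    ultimately have "1 + (\<Sum>j=1..T. ?g j) \<le> int d * int T + c" using uC[OF T] by (smt (verit))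
    thus ?thesis by (simp add: sum_subtractf mult.commute)
  qed
  show "2 * (1 - c) \<le> (int d - 1) * (int d - 2)"
  proof -
    have "2 * (\<Sum>j=1..uC. int d - ?g j) \<le> (int d - 1) * (int d - 1 - 1)"
    proof (rule sum_decreasing(1))
      fix i show "int d - ?g (Suc i) \<le> max 0 (int d - ?g i - 1)"
        using gmono[of i] gst[of i] gle[of i] by (cases "?g i = ?g (Suc i)") auto
    qed (use glow[of 0] d in auto)
    thus ?thesis using lower[OF order_refl] by simp
  qed
  assume big: "int s * (int s + int s * int s) < int d"
  have "\<exists>T0. \<forall>T\<ge>T0. 2 * int s * (\<Sum>j=1..T. int d - ?g j) \<le> int d ^ 2 - int d * (2 * v + int s) + 2 * int s ^ 5"
  proof (rule genus_count(2)[where s = "int s" and y = ?y and g = ?g and v = v and d = "int d",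
        OF props vs _ gle gmono gst big])
    fix t assume "int s * int t < int d"
    hence "int (s * t) < int d" by simp
    hence "s * t < d" by (simp only: of_nat_less_iff)
    hence "Z t = Y t" by (rule Y.bezout[OF Zg YZ Zev])
    thus "?g t = ?y t" by (simp add: hilb_def)
  qed
  then obtain T0 where T0: "\<And>T. T \<ge> T0 ==> 2 * int s * (\<Sum>j=1..T. int d - ?g j) \<le> int d ^ 2 - int d * (2 * v + int s) + 2 * int s ^ 5"
    by blast
  let ?T = "max T0 uC"
  have "1 - c \<le> (\<Sum>j=1..?T. int d - ?g j)" using lower[of ?T] by simp
  hence "2 * int s * (1 - c) \<le> 2 * int s * (\<Sum>j=1..?T. int d - ?g j)" by (rule mult_left_mono) simp
  thus "2 * int s * (1 - c) \<le> int d ^ 2 - int d * (2 * v + int s) + 2 * int s ^ 5"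
    using T0[of ?T] by simp
qed

section \<open>Long exact sequences of filtered complexes\<close>

context quot_space
begin

text \<open>Cocycles, and in \<open>bdy\<close> coboundaries, of the quotient complex
  \<open>A / B\<close>, represented by subspaces of \<open>A\<close>. Nothing maps into degree 0, so
  there only \<open>B\<close> is divided out.\<close>

definition cyc :: "('b => 'b) => (nat => 'b set) => (nat => 'b set) => nat => 'b set" where
  "cyc d A B n = {v \<in> A n. d v \<in> B (Suc n)}"

definition bdy :: "('b => 'b) => (nat => 'b set) => (nat => 'b set) => nat => 'b set" where
  "bdy d A B n = (if n = 0 then B 0 else {d x + b | x b. x \<in> A (n - 1) \<and> b \<in> B n})"

lemma bdy_0: "bdy d A B 0 = B 0"
  by (simp add: bdy_def)

lemma bdy_Suc: "bdy d A B (Suc n) = {d x + b | x b. x \<in> A n \<and> b \<in> B (Suc n)}"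
  by (simp add: bdy_def)

end

text \<open>The indices 1, 2 and 3 below belong to the quotient complexes \<open>J / I\<close>,
  \<open>X / I\<close> and \<open>X / J\<close>, whose cohomology forms a long exact
  sequence.\<close>

locale filtered_complex = quot_space scale
  for scale :: "'a::field => 'b::ab_group_add => 'b" +
  fixes d :: "'b => 'b" and X J I :: "nat => 'b set"
  assumes lin: "Vector_Spaces.linear scale scale d"
    and sub: "subspace (X n)" "subspace (J n)" "subspace (I n)"
    and IJ: "I n \<subseteq> J n" and JX: "J n \<subseteq> X n"
    and dX: "x \<in> X n ==> d x \<in> X (Suc n)" and dJ: "x \<in> J n ==> d x \<in> J (Suc n)"
    and dI: "x \<in> I n ==> d x \<in> I (Suc n)" and dd: "x \<in> X n ==> d (d x) = 0"
begin

sublocale pair: quot_space_pair scale scale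
  by (simp add: quot_space_pair_def quot_space_axioms)

sublocale hom: module_hom scale scale d
  using lin by (simp add: linear_iff_module_hom)

lemma d_simps: "d (x + y) = d x + d y" "d (x - y) = d x - d y" "d 0 = 0" "d (scale c x) = scale c (d x)"
  by (simp_all add: hom.add hom.diff hom.scale)

lemma lin_id: "Vector_Spaces.linear scale scale (\<lambda>x. x)"
  unfolding Vector_Spaces.linear_def module_hom_def module_hom_axioms_def
  using vector_space_axioms by (simp add: module_iff_vector_space)

lemma plus_ge:
  assumes "subspace S" "subspace T"
  shows "S \<subseteq> {x + y | x y. x \<in> S \<and> y \<in> T}" "T \<subseteq> {x + y | x y. x \<in> S \<and> y \<in> T}"
  using subspace_0[OF assms(1)] subspace_0[OF assms(2)] by (force, force)

lemma subspace_cyc: "subspace (A n) ==> subspace (B (Suc n)) ==> subspace (cyc d A B n)"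
  unfolding cyc_def subspace_def by (auto simp: d_simps)

lemma subspace_bdy:
  assumes "\<And>n. subspace (A n)" "\<And>n. subspace (B n)"
  shows "subspace (bdy d A B n)"
proof (cases n)
  case 0
  thus ?thesis using assms by (simp add: bdy_0)
next
  case (Suc m)
  have "subspace (d ` A m)" using hom.subspace_image assms by blast
  hence "subspace {x + y | x y. x \<in> d ` A m \<and> y \<in> B n}" using assms by (intro subspace_sums)
  moreover have "{x + y | x y. x \<in> d ` A m \<and> y \<in> B n} = bdy d A B n" unfolding Suc bdy_Suc by blast
  ultimately show ?thesis by simp
qed

abbreviation "Z1 n \<equiv> cyc d J I n"
abbreviation "B1 n \<equiv> bdy d J I n"
abbreviation "Z2 n \<equiv> cyc d X I n"
abbreviation "B2 n \<equiv> bdy d X I n"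
abbreviation "Z3 n \<equiv> cyc d X J n"
abbreviation "B3 n \<equiv> bdy d X J n"
text \<open>Intermediate terms of the long exact sequence: \<open>M1\<close> represents the kernel
  of the map out of the cohomology of \<open>J / I\<close>, while \<open>M2\<close> and
  \<open>M3\<close> represent the images in the cohomology of \<open>X / I\<close> and
  \<open>X / J\<close>.\<close>

definition "M1 n = Z1 n \<inter> B2 n"
definition "M2 n = {x + y | x y. x \<in> B2 n \<and> y \<in> Z1 n}"
definition "M3 n = {x + y | x y. x \<in> Z2 n \<and> y \<in> B3 n}"

lemma subs: "subspace (Z1 n)" "subspace (B1 n)" "subspace (Z2 n)" "subspace (B2 n)" "subspace (Z3 n)" "subspace (B3 n)"
  using sub subspace_cyc subspace_bdy by simp_all

lemma subsM: "subspace (M1 n)" "subspace (M2 n)" "subspace (M3 n)"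
  unfolding M1_def M2_def M3_def using subs subspace_sums subspace_inter by blast+

lemma bdy_cyc:
  assumes A: "\<And>n x. x \<in> A n ==> x \<in> X n" "\<And>n x. x \<in> A n ==> d x \<in> A (Suc n)" "\<And>n. subspace (A n)"
    and B: "\<And>n x. x \<in> B n ==> x \<in> A n" "\<And>n x. x \<in> B n ==> d x \<in> B (Suc n)" "\<And>n. subspace (B n)"
  shows "bdy d A B n \<subseteq> cyc d A B n"
proof (cases n)
  case 0
  thus ?thesis using B by (auto simp: bdy_0 cyc_def)
next
  case (Suc m)
  show ?thesis
  proof
    fix v assume "v \<in> bdy d A B n"
    then obtain x b where xb: "v = d x + b" "x \<in> A m" "b \<in> B n" unfolding Suc bdy_Suc by blast
    have "d x \<in> A n" using A(2) xb Suc by blast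
    hence "v \<in> A n" using xb B(1) A(3) subspace_add by blast
    moreover have "d v = d b" using xb(1) dd[OF A(1)[OF xb(2)]] by (simp add: d_simps)
    ultimately show "v \<in> cyc d A B n" using xb B(2) by (simp add: cyc_def)
  qed
qed

lemma BZ: "B1 n \<subseteq> Z1 n" "B2 n \<subseteq> Z2 n" "B3 n \<subseteq> Z3 n"
  by (rule bdy_cyc; (use IJ JX dX dJ dI sub in blast))+

lemma bdy_right: "0 \<in> A (n - 1) ==> B n \<subseteq> bdy d A B n"
proof
  fix x assume "0 \<in> A (n - 1)" "x \<in> B n"
  moreover have "x = d 0 + x" using d_simps(3) by simp
  ultimately have "\<exists>y b. x = d y + b \<and> y \<in> A (n - 1) \<and> b \<in> B n" by blast
  thus "x \<in> bdy d A B n" unfolding bdy_def using \<open>x \<in> B n\<close> by auto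
qed

lemma zero_in: "0 \<in> X n" "0 \<in> J n" "0 \<in> I n"
  using sub subspace_0 by blast+

lemma inc1: "B1 n \<subseteq> M1 n" and inc1': "M1 n \<subseteq> Z1 n"
proof -
  have "B1 n \<subseteq> B2 n" unfolding bdy_def using JX by auto
  thus "B1 n \<subseteq> M1 n" "M1 n \<subseteq> Z1 n" unfolding M1_def using BZ by blast+
qed

lemma inc2: "B2 n \<subseteq> M2 n" and inc2a: "Z1 n \<subseteq> M2 n" and inc3: "B3 n \<subseteq> M3 n" and inc3a: "Z2 n \<subseteq> M3 n"
  unfolding M2_def M3_def by (rule plus_ge[OF subs(4,1)] plus_ge[OF subs(3,6)])+

lemma inc2': "M2 n \<subseteq> Z2 n" and inc3': "M3 n \<subseteq> Z3 n"
proof -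
  have "Z1 n \<subseteq> Z2 n" "Z2 n \<subseteq> Z3 n" unfolding cyc_def using JX IJ by auto
  thus "M2 n \<subseteq> Z2 n" "M3 n \<subseteq> Z3 n" unfolding M2_def M3_def using BZ subs subspace_add by blast+
qed

lemma iso_a: "finq (Z1 n) (M1 n) \<longleftrightarrow> finq (M2 n) (B2 n)" "qdim (Z1 n) (M1 n) = qdim (M2 n) (B2 n)"
proof -
  have 1: "\<And>v. v \<in> Z1 n ==> v \<in> M2 n" using inc2a by blast
  have 2: "\<exists>v\<in>Z1 n. u - v \<in> B2 n" if u: "u \<in> M2 n" for u
  proof -
    obtain x y where "u = x + y" "x \<in> B2 n" "y \<in> Z1 n" using u unfolding M2_def by blast
    thus ?thesis by (intro bexI[of _ y]) simp_all
  qed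
  have 3: "\<And>v. v \<in> Z1 n ==> v \<in> M1 n \<longleftrightarrow> v \<in> B2 n" by (simp add: M1_def)
  show "finq (Z1 n) (M1 n) \<longleftrightarrow> finq (M2 n) (B2 n)" "qdim (Z1 n) (M1 n) = qdim (M2 n) (B2 n)"
    using pair.finq_map[OF lin_id subs(1,4) subsM(2) 1 2 3 inc1' inc2] by blast+
qed

lemma iso_b: "finq (Z2 n) (M2 n) \<longleftrightarrow> finq (M3 n) (B3 n)" "qdim (Z2 n) (M2 n) = qdim (M3 n) (B3 n)"
proof -
  have 1: "\<And>v. v \<in> Z2 n ==> v \<in> M3 n" using inc3a by blast
  have 2: "\<exists>v\<in>Z2 n. u - v \<in> B3 n" if u: "u \<in> M3 n" for u
  proof -
    obtain x y where "u = x + y" "x \<in> Z2 n" "y \<in> B3 n" using u unfolding M3_def by blast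
    thus ?thesis by (intro bexI[of _ x]) simp_all
  qed
  have 3: "v \<in> M2 n \<longleftrightarrow> v \<in> B3 n" if v: "v \<in> Z2 n" for v
  proof
    assume "v \<in> M2 n"
    then obtain x y where xy: "v = x + y" "x \<in> B2 n" "y \<in> Z1 n" unfolding M2_def by blast
    have "B2 n \<subseteq> B3 n" unfolding bdy_def using IJ by auto
    moreover have "Z1 n \<subseteq> B3 n" using bdy_right[of X n J] zero_in by (auto simp: cyc_def)
    ultimately show "v \<in> B3 n" using xy subs(6) subspace_add by blast
  next
    assume vB: "v \<in> B3 n"
    show "v \<in> M2 n"
    proof (cases n)
      case 0
      hence "v \<in> Z1 n" using vB v by (simp add: bdy_0 cyc_def)
      thus ?thesis using inc2a by blast
    next
      case (Suc m)
      then obtain x b where xb: "v = d x + b" "x \<in> X m" "b \<in> J n" using vB unfolding Suc bdy_Suc by blast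
      have "d v = d b" using xb dd by (simp add: d_simps)
      hence "b \<in> Z1 n" using xb v by (simp add: cyc_def)
      moreover have "d x + 0 \<in> B2 n" unfolding Suc bdy_Suc using xb(2) zero_in by blast
      ultimately show ?thesis unfolding M2_def using xb(1) by auto
    qed
  qed
  show "finq (Z2 n) (M2 n) \<longleftrightarrow> finq (M3 n) (B3 n)" "qdim (Z2 n) (M2 n) = qdim (M3 n) (B3 n)"
    using pair.finq_map[OF lin_id subs(3,6) subsM(3) 1 2 3 inc2' inc3] by blast+
qed

text \<open>The connecting homomorphism, which on representatives is \<open>d\<close>
  itself.\<close>

lemma iso_c: "finq (Z3 n) (M3 n) \<longleftrightarrow> finq (M1 (Suc n)) (B1 (Suc n))"
  "qdim (Z3 n) (M3 n) = qdim (M1 (Suc n)) (B1 (Suc n))"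
proof -
  have 1: "d v \<in> M1 (Suc n)" if v: "v \<in> Z3 n" for v
  proof -
    have vX: "v \<in> X n" and dv: "d v \<in> J (Suc n)" using v by (simp_all add: cyc_def)
    have "d v \<in> Z1 (Suc n)" using dv dd[OF vX] zero_in by (simp add: cyc_def)
    moreover have "d v + 0 \<in> B2 (Suc n)" unfolding bdy_Suc using vX zero_in by blast
    ultimately show ?thesis by (simp add: M1_def)
  qed
  have 2: "\<exists>v\<in>Z3 n. u - d v \<in> B1 (Suc n)" if u: "u \<in> M1 (Suc n)" for u
  proof -
    obtain x i where xi: "u = d x + i" "x \<in> X n" "i \<in> I (Suc n)" using u unfolding M1_def bdy_Suc by blast
    have "u \<in> J (Suc n)" using u by (simp add: M1_def cyc_def)
    hence "u - i \<in> J (Suc n)" using xi(3) IJ sub(2) subspace_diff by blast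
    hence "x \<in> Z3 n" using xi by (simp add: cyc_def)
    moreover have "u - d x \<in> B1 (Suc n)" using xi bdy_right[of J "Suc n" I] zero_in by auto
    ultimately show ?thesis by blast
  qed
  have 3: "v \<in> M3 n \<longleftrightarrow> d v \<in> B1 (Suc n)" if v: "v \<in> Z3 n" for v
  proof
    assume "v \<in> M3 n"
    then obtain x y where xy: "v = x + y" "x \<in> Z2 n" "y \<in> B3 n" unfolding M3_def by blast
    have dx: "d x \<in> B1 (Suc n)" using xy(2) bdy_right[of J "Suc n" I] zero_in by (auto simp: cyc_def)
    have dy: "d y \<in> B1 (Suc n)"
    proof -
      have "\<exists>j\<in>J n. d y = d j"
      proof (cases n)
        case 0
        thus ?thesis using xy(3) by (auto simp: bdy_0)
      next
        case (Suc m)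
        then obtain a b where "y = d a + b" "a \<in> X m" "b \<in> J n" using xy(3) unfolding Suc bdy_Suc by blast
        thus ?thesis using dd by (intro bexI[of _ b]) (simp_all add: d_simps)
      qed
      then obtain j where "j \<in> J n" "d y = d j + 0" by auto
      thus ?thesis unfolding bdy_Suc using zero_in by blast
    qed
    show "d v \<in> B1 (Suc n)" unfolding xy(1) d_simps using dx dy subs(2) subspace_add by blast
  next
    assume "d v \<in> B1 (Suc n)"
    then obtain j i where ji: "d v = d j + i" "j \<in> J n" "i \<in> I (Suc n)" unfolding bdy_Suc by blast
    have "v - j \<in> X n" using v ji(2) JX sub(1) subspace_diff unfolding cyc_def by blast
    moreover have "d (v - j) = i" using ji(1) by (simp add: d_simps)
    ultimately have "v - j \<in> Z2 n" using ji(3) by (simp add: cyc_def)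
    moreover have "j \<in> B3 n" using bdy_right[of X n J] zero_in ji(2) by auto
    ultimately have "(v - j) + j \<in> M3 n" unfolding M3_def by blast
    thus "v \<in> M3 n" by simp
  qed
  show "finq (Z3 n) (M3 n) \<longleftrightarrow> finq (M1 (Suc n)) (B1 (Suc n))"
  "qdim (Z3 n) (M3 n) = qdim (M1 (Suc n)) (B1 (Suc n))"
    using pair.finq_map[OF lin subs(5,2) subsM(1) 1 2 3 inc3' inc1] by blast+
qed

lemma fin_split:
  shows "finq (Z1 n) (B1 n) \<longleftrightarrow> finq (Z1 n) (M1 n) \<and> finq (M1 n) (B1 n)"
    "finq (Z2 n) (B2 n) \<longleftrightarrow> finq (Z2 n) (M2 n) \<and> finq (M2 n) (B2 n)"
    "finq (Z3 n) (B3 n) \<longleftrightarrow> finq (Z3 n) (M3 n) \<and> finq (M3 n) (B3 n)"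
  using finq_trans_iff[OF subs(2) subsM(1) subs(1) inc1' inc1, of n]
    finq_trans_iff[OF subs(4) subsM(2) subs(3) inc2' inc2, of n]
    finq_trans_iff[OF subs(6) subsM(3) subs(5) inc3' inc3, of n] by blast+

lemma M1_0: "M1 0 = B1 0"
proof -
  have "I 0 \<subseteq> Z1 0" using IJ dI by (auto simp: cyc_def)
  thus ?thesis by (auto simp: M1_def bdy_0)
qed

lemma fin_M1_0: "finq (M1 0) (B1 0)" "qdim (M1 0) (B1 0) = 0"
  unfolding M1_0 using finq_self qdim_self subs by blast+

lemma fin_middle: "finq (Z1 n) (B1 n) ==> finq (Z3 n) (B3 n) ==> finq (Z2 n) (B2 n)"
  using fin_split iso_a(1) iso_b(1) by blast

lemma fin_first:
  assumes "finq (Z2 n) (B2 n)" "\<And>m. n = Suc m ==> finq (Z3 m) (B3 m)"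
  shows "finq (Z1 n) (B1 n)"
proof -
  have "finq (M1 n) (B1 n)"
  proof (cases n)
    case 0
    thus ?thesis using fin_M1_0 by simp
  next
    case (Suc m)
    thus ?thesis using assms(2) fin_split(3) iso_c(1) by blast
  qed
  thus ?thesis using assms(1) fin_split(1,2) iso_a(1) by blast
qed

lemma exact_first:
  assumes "\<And>m. n = Suc m ==> Z3 m = B3 m"
  shows "Z1 n \<inter> B2 n \<subseteq> B1 n"
proof (cases n)
  case 0
  thus ?thesis using M1_0 by (simp add: M1_def)
next
  case (Suc m)
  have "M3 m = Z3 m" using assms[OF Suc] inc3 inc3' by blast
  hence z: "finq (Z3 m) (M3 m)" "qdim (Z3 m) (M3 m) = 0" using finq_self qdim_self subs(5) by simp_all
  hence "finq (M1 n) (B1 n)" "qdim (M1 n) (B1 n) = 0" using iso_c Suc by simp_all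
  hence "M1 n = B1 n" using finq_zero[OF subs(2) subsM(1)] by blast
  thus ?thesis by (simp add: M1_def)
qed

text \<open>Each of the three dimensions splits into two neighbouring ranks of the long exact
  sequence. What remains are the ranks of the connecting maps, which telescope.\<close>

lemma euler_additive:
  assumes fin1: "\<And>n. finq (Z1 n) (B1 n)" and fin3: "\<And>n. finq (Z3 n) (B3 n)"
    and top: "\<And>n. L < n ==> X n = {0}"
  shows "(\<Sum>n\<le>L. (- 1) ^ n * int (qdim (Z2 n) (B2 n))) =
    (\<Sum>n\<le>L. (- 1) ^ n * int (qdim (Z1 n) (B1 n))) + (\<Sum>n\<le>L. (- 1) ^ n * int (qdim (Z3 n) (B3 n)))"
proof -
  let ?e = "\<lambda>n. int (qdim (M1 n) (B1 n))"
  have fin2: "finq (Z2 n) (B2 n)" for n using fin_middle fin1 fin3 by blast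
  have q1: "qdim (Z1 n) (B1 n) = qdim (M2 n) (B2 n) + qdim (M1 n) (B1 n)" for n
    using qdim_trans[OF subs(2) subsM(1) subs(1) inc1' inc1 fin1] iso_a(2) by simp
  have q2: "qdim (Z2 n) (B2 n) = qdim (Z2 n) (M2 n) + qdim (M2 n) (B2 n)" for n
    using qdim_trans[OF subs(4) subsM(2) subs(3) inc2' inc2 fin2] .
  have q3: "qdim (Z3 n) (B3 n) = qdim (M1 (Suc n)) (B1 (Suc n)) + qdim (Z2 n) (M2 n)" for n
    using qdim_trans[OF subs(6) subsM(3) subs(5) inc3' inc3 fin3] iso_b(2) iso_c(2) by simp
  have "(\<Sum>n\<le>K. (- 1) ^ n * (?e n + ?e (Suc n))) = (- 1) ^ K * ?e (Suc K)" for K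
    by (induction K) (simp_all add: fin_M1_0(2) algebra_simps)
  moreover have "?e (Suc L) = 0"
  proof -
    have "M1 (Suc L) \<subseteq> X (Suc L)" using JX by (auto simp: M1_def cyc_def)
    hence "M1 (Suc L) \<subseteq> {0}" using top[of "Suc L"] by simp
    hence "M1 (Suc L) = B1 (Suc L)" using inc1[of "Suc L"] subspace_0[OF subs(2), of "Suc L"] by blast
    thus ?thesis using qdim_self[OF subs(2)] by simp
  qed
  ultimately have z: "(\<Sum>n\<le>L. (- 1) ^ n * (?e n + ?e (Suc n))) = 0" by simp
  have "(\<Sum>n\<le>L. (- 1) ^ n * int (qdim (Z1 n) (B1 n))) + (\<Sum>n\<le>L. (- 1) ^ n * int (qdim (Z3 n) (B3 n)))
     = (\<Sum>n\<le>L. (- 1) ^ n * int (qdim (Z2 n) (B2 n)) + (- 1) ^ n * (?e n + ?e (Suc n)))"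
    unfolding sum.distrib[symmetric] q1 q2 q3 by (rule sum.cong) (simp_all add: algebra_simps)
  thus ?thesis using z by (simp add: sum.distrib)
qed

end

section \<open>Localizations of graded ideals\<close>

lemma poly_scale_sc: "poly_scale = sc"
  by (simp add: fun_eq_iff poly_scale_def sc_def)

definition intm :: "(nat \<Rightarrow>\<^sub>0 nat) => (nat \<Rightarrow>\<^sub>0 int)" where
  "intm m = Poly_Mapping.map int m"

lemma lookup_intm: "plookup (intm m) i = int (plookup m i)"
  by (simp add: intm_def Poly_Mapping.map.rep_eq when_def)

lemma intm_add: "intm (m + n) = intm m + intm n"
  by (rule poly_mapping_eqI) (simp add: lookup_intm lookup_add)

lemma intm_eq_iff [simp]: "intm m = intm n \<longleftrightarrow> m = n"
  by (metis lookup_intm of_nat_eq_iff poly_mapping_eqI)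

lemma keys_intm: "pkeys (intm m) = pkeys m"
  by (auto simp: in_keys_iff lookup_intm)

lemma intm_0 [simp]: "intm 0 = 0"
  by (rule poly_mapping_eqI) (simp add: lookup_intm)

lemma monom_deg_intm: "monom_deg (intm m) = int (monom_deg m)"
  by (simp add: monom_deg_def keys_intm lookup_intm)

lemma toL_sum: "to_laurent p = (\<Sum>m\<in>pkeys p. psingle (intm m) (plookup p m))"
  by (simp add: to_laurent_def intm_def)

lemma lookup_toL: "plookup (to_laurent p) (intm m) = plookup p m"
proof -
  have "plookup (to_laurent p) (intm m) = (\<Sum>n\<in>pkeys p. if n = m then plookup p n else 0)"
    unfolding toL_sum lookup_sum by (rule sum.cong) (auto simp: lookup_single when_def)
  thus ?thesis by (auto simp: in_keys_iff)
qed

lemma lookup_toL_outside: "k \<notin> range intm ==> plookup (to_laurent p) k = 0"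
  unfolding toL_sum lookup_sum by (rule sum.neutral) (auto simp: lookup_single when_def)

lemma toL_eqI:
  assumes "\<And>m. plookup g (intm m) = plookup p m" "\<And>k. k \<notin> range intm ==> plookup g k = 0"
  shows "g = to_laurent p"
proof (rule poly_mapping_eqI)
  fix k show "plookup g k = plookup (to_laurent p) k"
    using assms lookup_toL[of p] lookup_toL_outside[of k p] by (cases "k \<in> range intm") auto
qed

lemma toL_add: "to_laurent (p + q) = to_laurent p + to_laurent q"
  by (rule toL_eqI[symmetric]) (simp_all add: lookup_add lookup_toL lookup_toL_outside)

lemma toL_0 [simp]: "to_laurent 0 = 0"
  by (simp add: to_laurent_def)

lemma toL_finite_sum: "to_laurent (sum f A) = (\<Sum>x\<in>A. to_laurent (f x))"
  by (induction A rule: infinite_finite_induct) (simp_all add: toL_add)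

lemma toL_inj [simp]: "to_laurent p = to_laurent q \<longleftrightarrow> p = q"
  by (metis lookup_toL poly_mapping_eqI)

lemma toL_single: "to_laurent (psingle m c) = psingle (intm m) c"
  by (rule toL_eqI[symmetric]) (auto simp: lookup_single when_def)

lemma toL_1 [simp]: "to_laurent 1 = 1"
  using toL_single[of 0 1] by simp

lemma toL_mult: "to_laurent (p * q) = to_laurent p * to_laurent q"
  by (rule hom_multI) (simp_all add: toL_finite_sum toL_single mult_single intm_add)

lemma toL_sc: "to_laurent (sc c p) = sc c (to_laurent p)"
  by (simp add: sc_def toL_mult toL_single)

text \<open>Degrees run over all integers, with 0 in negative ones, because the twist
  \<open>t\<close> later descends without bound.\<close>

definition gz :: "(nat => mpoly set) => int => mpoly set" where
  "gz I k = (if 0 \<le> k then I (nat k) else {0})"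

definition Lm :: "(nat \<Rightarrow>\<^sub>0 nat) => laurent" where
  "Lm m = psingle (intm m) 1"

text \<open>The degree \<open>t\<close> part of the localization of the graded ideal \<open>I\<close> at the variables in \<open>fc\<close>.\<close>

definition Lid :: "nat => (nat => mpoly set) => int => nat set => laurent set" where
  "Lid r I t fc = {g. \<exists>u. \<exists>m\<in>monoms r u. pkeys m \<subseteq> fc \<and> (\<exists>f\<in>gz I (int u + t). Lm m * g = to_laurent f)}"

abbreviation "Lring r \<equiv> Lid r (hforms r)"

lemma gz_nat [simp]: "gz I (int u) = I u"
  by (simp add: gz_def)

lemma subspace_gz: "gideal r I ==> pv.subspace (gz I k)"
  by (simp add: gz_def gideal_subspace)

lemma gz_mult: "gideal r I ==> q \<in> hforms r j ==> f \<in> gz I k ==> q * f \<in> gz I (int j + k)"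
  using gideal_mult[of r I q j f "nat k"] gideal_0[of r I]
  by (auto simp: gz_def nat_add_distrib split: if_splits)

lemma gz_mono: "I \<le> J ==> gz I k \<subseteq> gz J k"
  by (auto simp: gz_def le_fun_def)

lemma gideal_le_hforms: "gideal r I ==> I \<le> hforms r"
  using gideal_forms by (auto simp: le_fun_def)

lemma Lm_toL: "Lm m = to_laurent (psingle m 1)"
  by (simp add: Lm_def toL_single)

lemma Lm_add: "Lm (m + n) = Lm m * Lm n"
  by (simp add: Lm_def mult_single intm_add)

lemma Lm_cancel: "psingle (- intm m) 1 * (Lm m * g) = g" "Lm m * (psingle (- intm m) 1 * g) = g"
  by (simp_all add: Lm_def mult_single flip: mult.assoc)

lemma keys_Lm: "pkeys (Lm m * g) = (\<lambda>n. intm m + n) ` pkeys g"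
proof -
  have "pkeys (psingle a (1::complex) * h) \<subseteq> (\<lambda>n. a + n) ` pkeys h" for a and h :: laurent
    using keys_mult[of "psingle a 1" h] by auto
  from this[of "intm m" g] this[of "- intm m" "Lm m * g"] show ?thesis unfolding Lm_cancel(1) by (force simp: Lm_def)
qed

lemma LidI: "m \<in> monoms r u ==> pkeys m \<subseteq> fc ==> f \<in> gz I (int u + t) ==> Lm m * g = to_laurent f ==> g \<in> Lid r I t fc"
  unfolding Lid_def by blast

lemma LidE:
  assumes "g \<in> Lid r I t fc"
  obtains u m f where "m \<in> monoms r u" "pkeys m \<subseteq> fc" "f \<in> gz I (int u + t)" "Lm m * g = to_laurent f"
  using assms unfolding Lid_def by blast

lemma keys_add_subset: "pkeys m \<subseteq> fc ==> pkeys n \<subseteq> fc ==> pkeys (m + n) \<subseteq> fc"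
  using Poly_Mapping.keys_add[of m n] by blast

lemma Lid_raise:
  assumes I: "gideal r I" and n: "n \<in> monoms r v" and f: "f \<in> gz I (int u + t)" "Lm m * g = to_laurent f"
  shows "psingle n 1 * f \<in> gz I (int (v + u) + t)" "Lm (n + m) * g = to_laurent (psingle n 1 * f)"
  using gz_mult[OF I hforms_single[OF n] f(1)] unfolding Lm_add toL_mult Lm_toL[symmetric] mult.assoc f(2)
  by (simp_all add: add.assoc)

lemma subspace_Lid:
  assumes I: "gideal r I"
  shows "pv.subspace (Lid r I t fc)"
proof (rule pv.subspaceI)
  note sub = subspace_gz[OF I]
  show "0 \<in> Lid r I t fc" by (rule LidI[of 0 r 0 _ 0]) (simp_all add: monoms_def pv.subspace_0[OF sub])
  fix x assume "x \<in> Lid r I t fc"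
  then obtain u m f where m: "m \<in> monoms r u" "pkeys m \<subseteq> fc" "f \<in> gz I (int u + t)" "Lm m * x = to_laurent f" by (rule LidE)
  show "sc c x \<in> Lid r I t fc" for c
    by (rule LidI[OF m(1,2) pv.subspace_scale[OF sub m(3), of c]]) (simp add: sc_mult_right toL_sc m(4))
  fix y assume "y \<in> Lid r I t fc"
  then obtain v n g where n: "n \<in> monoms r v" "pkeys n \<subseteq> fc" "g \<in> gz I (int v + t)" "Lm n * y = to_laurent g" by (rule LidE)
  note f' = Lid_raise[OF I n(1) m(3,4)] and g' = Lid_raise[OF I m(1) n(3,4)]
  show "x + y \<in> Lid r I t fc"
    by (rule LidI[OF monoms_add[OF n(1) m(1)] keys_add_subset[OF n(2) m(2)] pv.subspace_add[OF sub f'(1)]])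
      (use g' f'(2) in \<open>simp_all add: distrib_left toL_add add.commute\<close>)
qed


lemma Lid_mono: "I \<le> J ==> Lid r I t fc \<subseteq> Lid r J t fc"
  using gz_mono unfolding Lid_def by blast

lemma Lid_face: "fc \<subseteq> tq ==> Lid r I t fc \<subseteq> Lid r I t tq"
  unfolding Lid_def by blast

definition Xl :: "nat => nat => laurent" where
  "Xl k N = to_laurent (xv k ^ N)"

lemma xv_power: "xv k ^ N = psingle (psingle k N) (1 :: 'k::field)"
  by (induction N) (simp_all add: xv_def mult_single flip: single_add)

lemma Xl_Lm: "Xl k N = Lm (psingle k N)"
  by (simp add: Xl_def xv_power Lm_toL)

lemma Xl_add: "Xl k (N + M) = Xl k N * Xl k M"
  by (simp add: Xl_def power_add toL_mult)

lemma Xl_Lid: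
  assumes I: "gideal r I" and k: "k \<le> r" and g: "g \<in> Lid r I t fc"
  shows "Xl k N * g \<in> Lid r I (int N + t) fc"
  using g
proof (rule LidE)
  fix u m f assume m: "m \<in> monoms r u" "pkeys m \<subseteq> fc" and f: "f \<in> gz I (int u + t)" "Lm m * g = to_laurent f"
  show ?thesis
    by (rule LidI[OF m, of "xv k ^ N * f"])
      (use gz_mult[OF I hforms_power[OF xv_hforms[OF k]] f(1), of N] f(2) in \<open>simp_all add: add.left_commute toL_mult Xl_def mult.left_commute\<close>)
qed

text \<open>Together with \<open>Lid_gadd\<close> and \<open>Lid_gadd_mult\<close> this says that
  localization preserves the exact sequence of multiplication by a variable.\<close>

lemma Lid_gcolon:
  assumes I: "gideal r I" and g: "g \<in> Lring r t fc"
  shows "Xl k 1 * g \<in> Lid r I (1 + t) fc \<longleftrightarrow> g \<in> Lid r (gcolon r I (xv k) 1) t fc"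
proof
  obtain v n p where n: "n \<in> monoms r v" "pkeys n \<subseteq> fc" and p: "p \<in> gz (hforms r) (int v + t)" "Lm n * g = to_laurent p"
    using g by (rule LidE)
  assume "Xl k 1 * g \<in> Lid r I (1 + t) fc"
  then obtain u m f where m: "m \<in> monoms r u" "pkeys m \<subseteq> fc" and f: "f \<in> gz I (int u + (1 + t))" "Lm m * (Xl k 1 * g) = to_laurent f"
    by (rule LidE)
  note p' = Lid_raise[OF gideal_hforms m(1) p] and f' = Lid_raise[OF I n(1) f]
  have "to_laurent (xv k * (psingle m 1 * p)) = to_laurent (psingle n 1 * f)"
    unfolding f'(2)[symmetric] toL_mult[of "xv k"] p'(2)[symmetric] by (simp add: Xl_def mult.left_commute add.commute)
  hence "xv k * (psingle m 1 * p) \<in> gz I (1 + (int (u + v) + t))" using f'(1) by (simp add: add_ac)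
  hence "psingle m 1 * p \<in> gz (gcolon r I (xv k) 1) (int (u + v) + t)"
    using p'(1) by (auto simp: gz_def gcolon_def nat_add_distrib split: if_splits)
  thus "g \<in> Lid r (gcolon r I (xv k) 1) t fc"
    by (rule LidI[OF monoms_add[OF m(1) n(1)] keys_add_subset[OF m(2) n(2)] _ p'(2)])
next
  assume "g \<in> Lid r (gcolon r I (xv k) 1) t fc"
  then obtain u m f where m: "m \<in> monoms r u" "pkeys m \<subseteq> fc" and f: "f \<in> gz (gcolon r I (xv k) 1) (int u + t)" "Lm m * g = to_laurent f"
    by (rule LidE)
  have "xv k * f \<in> gz I (int u + (1 + t))"
    using f(1) gideal_0[OF I] by (auto simp: gz_def gcolon_def nat_add_distrib algebra_simps split: if_splits)
  thus "Xl k 1 * g \<in> Lid r I (1 + t) fc"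
    by (rule LidI[OF m]) (use f(2) in \<open>simp add: toL_mult Xl_def mult.left_commute\<close>)
qed

lemma gz_gadd:
  assumes I: "gideal r I"
  shows "f \<in> gz (gadd r I (xv k) 1) u \<longleftrightarrow> (\<exists>a b. f = a + xv k * b \<and> a \<in> gz I u \<and> b \<in> gz (hforms r) (u - 1))"
proof (cases "0 \<le> u")
  case True
  hence "gz (hforms r) (u - 1) = (if 1 \<le> nat u then hforms r (nat u - 1) else {0})"
    by (auto simp: gz_def nat_diff_distrib)
  thus ?thesis using True unfolding gz_def[of _ u] gadd_def by auto
qed (auto simp: gz_def)

lemma Lid_gadd:
  assumes I: "gideal r I" and g: "g \<in> Lid r (gadd r I (xv k) 1) (1 + t) fc"
  shows "\<exists>h\<in>Lring r t fc. g - Xl k 1 * h \<in> Lid r I (1 + t) fc"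
proof -
  obtain u m f where m: "m \<in> monoms r u" "pkeys m \<subseteq> fc" and f: "f \<in> gz (gadd r I (xv k) 1) (int u + (1 + t))" "Lm m * g = to_laurent f"
    using g by (rule LidE)
  obtain a b where ab: "f = a + xv k * b" "a \<in> gz I (int u + (1 + t))" "b \<in> gz (hforms r) (int u + t)"
    using f(1) unfolding gz_gadd[OF I] by auto
  define h where "h = psingle (- intm m) 1 * to_laurent b"
  have h: "Lm m * h = to_laurent b" unfolding h_def by (rule Lm_cancel(2))
  have "Lm m * (g - Xl k 1 * h) = Lm m * g - Xl k 1 * (Lm m * h)" by (simp add: algebra_simps)
  also have "\<dots> = to_laurent a" unfolding f(2) h ab(1) by (simp add: toL_add toL_mult Xl_def)
  finally have "g - Xl k 1 * h \<in> Lid r I (1 + t) fc" by (rule LidI[OF m ab(2)])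
  thus ?thesis using LidI[OF m ab(3) h] by blast
qed

lemma Lid_gadd_mult:
  assumes I: "gideal r I" and h: "h \<in> Lring r t fc"
  shows "Xl k 1 * h \<in> Lid r (gadd r I (xv k) 1) (1 + t) fc"
  using h
proof (rule LidE)
  fix u m p assume m: "m \<in> monoms r u" "pkeys m \<subseteq> fc" and p: "p \<in> gz (hforms r) (int u + t)" "Lm m * h = to_laurent p"
  have "xv k * p \<in> gz (gadd r I (xv k) 1) (int u + (1 + t))"
    unfolding gz_gadd[OF I] using pv.subspace_0[OF subspace_gz[OF I]] p(1) by (intro exI[of _ 0] exI[of _ p]) simp
  thus ?thesis by (rule LidI[OF m]) (simp add: p(2) toL_mult Xl_def mult.left_commute)
qed

text \<open>Poles along the variable \<open>k\<close> disappear after multiplication by a high power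
  of it. The claim covers all larger powers too, because several faces will have to share one
  exponent.\<close>

lemma Lid_delete:
  assumes I: "gideal r I" and k: "k \<le> r" and g: "g \<in> Lid r I t (insert k fc)"
  shows "\<exists>N. \<forall>M\<ge>N. Xl k M * g \<in> Lid r I (int M + t) fc"
proof -
  obtain u m f where m: "m \<in> monoms r u" "pkeys m \<subseteq> insert k fc" and f: "f \<in> gz I (int u + t)" "Lm m * g = to_laurent f"
    using g by (rule LidE)
  define a where "a = plookup m k"
  define n where "n = m - psingle k a"
  have mn: "m = psingle k a + n"
    by (rule poly_mapping_eqI) (simp add: n_def a_def lookup_add lookup_minus lookup_single when_def)
  have "plookup n x = (if x = k then 0 else plookup m x)" for x
    by (simp add: n_def a_def lookup_minus lookup_single when_def)
  hence "pkeys n = pkeys m - {k}" by (auto simp: set_eq_iff in_keys_iff)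
  hence nk: "pkeys n \<subseteq> pkeys m" "pkeys n \<subseteq> fc" using m(2) by blast+
  have u: "u = a + monom_deg n" using m(1) monom_deg_add[of "psingle k a" n] by (simp add: monoms_def flip: mn)
  have n: "n \<in> monoms r (monom_deg n)" using nk(1) m(1) by (auto simp: monoms_def)
  have "Xl k M * g \<in> Lid r I (int M + t) fc" if M: "M \<ge> a" for M
  proof (rule LidI[OF n nk(2)])
    show "xv k ^ (M - a) * f \<in> gz I (int (monom_deg n) + (int M + t))"
      using gz_mult[OF I hforms_power[OF xv_hforms[OF k]] f(1), of "M - a"] M by (simp add: u of_nat_diff algebra_simps)
    have "Lm n * (Xl k M * g) = Xl k (M - a) * (Lm m * g)"
      using Xl_add[of k "M - a" a] M unfolding mn Lm_add by (simp add: Xl_Lm mult_ac)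
    thus "Lm n * (Xl k M * g) = to_laurent (xv k ^ (M - a) * f)" by (simp add: f(2) toL_mult Xl_def)
  qed
  thus ?thesis by blast
qed

text \<open>A denominator supported on a nonempty set can absorb further powers of one of its
  variables until the numerator has positive degree, where \<open>I\<close> is everything.\<close>

lemma Lid_full:
  assumes I: "gideal r I" and v: "\<And>i. i \<le> r ==> xv i \<in> I 1" and fc: "fc \<subseteq> {..r}" "fc \<noteq> {}"
  shows "Lid r I t fc = Lring r t fc"
proof
  show "Lring r t fc \<subseteq> Lid r I t fc"
  proof
    fix g assume "g \<in> Lring r t fc"
    then obtain u m p where m: "m \<in> monoms r u" "pkeys m \<subseteq> fc" and p: "p \<in> gz (hforms r) (int u + t)" "Lm m * g = to_laurent p"
      by (rule LidE)
    obtain i where i: "i \<in> fc" using fc by blast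
    let ?n = "psingle i (nat (1 - t))"
    have n: "?n \<in> monoms r (nat (1 - t))" "pkeys ?n \<subseteq> fc" using i fc by (auto simp: monoms_def split: if_splits)
    note p' = Lid_raise[OF gideal_hforms n(1) p]
    have "1 \<le> int (nat (1 - t) + u) + t" by simp
    hence "psingle ?n 1 * p \<in> gz I (int (nat (1 - t) + u) + t)"
      using p'(1) gideal_vars_full[OF I v, of "nat (int (nat (1 - t) + u) + t)"] by (simp add: gz_def)
    thus "g \<in> Lid r I t fc" by (rule LidI[OF monoms_add[OF n(1) m(1)] keys_add_subset[OF n(2) m(2)] _ p'(2)])
  qed
qed (rule Lid_mono[OF gideal_le_hforms[OF I]])

lemma Lid_empty: "Lid r I t {} = to_laurent ` gz I t"
proof -
  have "Lm 0 = 1" by (simp add: Lm_def)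
  moreover have "0 \<in> monoms r 0" by (simp add: monoms_def)
  ultimately have "to_laurent f \<in> Lid r I t {}" if "f \<in> gz I t" for f using that by (intro LidI[of 0 r 0 _ f]) simp_all
  moreover have "g \<in> to_laurent ` gz I t" if "g \<in> Lid r I t {}" for g
    using that by (rule LidE) (use \<open>Lm 0 = 1\<close> in \<open>auto simp: monoms_def\<close>)
  ultimately show ?thesis by blast
qed

section \<open>The Cech complex and the Hilbert polynomial\<close>

interpretation cv: quot_space cochain_scale
  by (simp add: quot_space_def vector_space_cochain_scale)

interpretation cvp: quot_space_pair cochain_scale cochain_scale
  by (simp add: quot_space_pair_def quot_space_def vector_space_cochain_scale)

interpretation pcv: quot_space_pair "sc :: complex => mpoly => mpoly" cochain_scale
  by (simp add: quot_space_pair_def quot_space_def vector_space_cochain_scale vector_space_sc)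

lemma cochain_scale_apply: "cochain_scale c b fc = sc c (b fc)"
  by (simp add: cochain_scale_def poly_scale_sc)

lemma plus_apply: "(f + g) x = f x + g x" and zero_apply: "(0 :: 'a => 'b::ab_group_add) x = 0"
  for f g :: "'a => 'b::ab_group_add"
  by (simp_all add: plus_fun_def zero_fun_def)

text \<open>The empty face is included, unlike in \<open>simplices\<close>: the complex is augmented
  by the degree \<open>t\<close> part of the coordinate ring in index 0.\<close>

definition faces :: "nat => nat => nat set set" where
  "faces r n = {fc. fc \<subseteq> {..r} \<and> card fc = n}"

definition fam :: "nat => nat => (nat set => laurent set) => (nat set => laurent) set" where
  "fam r n L = {b. \<forall>fc. if fc \<in> faces r n then b fc \<in> L fc else b fc = 0}"

definition icoch :: "nat => (nat => mpoly set) => int => nat => (nat set => laurent) set" where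
  "icoch r I t n = fam r n (Lid r I t)"

abbreviation "coch r \<equiv> icoch r (hforms r)"

lemma faces_sub: "fc \<in> faces r n ==> fc \<subseteq> {..r}" and faces_fin: "fc \<in> faces r n ==> finite fc"
  using finite_subset[of fc "{..r}"] by (auto simp: faces_def)

lemma famD: "b \<in> fam r n L ==> fc \<in> faces r n ==> b fc \<in> L fc"
  and famD0: "b \<in> fam r n L ==> fc \<notin> faces r n ==> b fc = 0"
  unfolding fam_def by (auto dest: spec[of _ fc])

lemma famI: "(\<And>fc. fc \<in> faces r n ==> b fc \<in> L fc) ==> (\<And>fc. fc \<notin> faces r n ==> b fc = 0) ==> b \<in> fam r n L"
  unfolding fam_def by simp

lemma fam_mono: "(\<And>fc. L fc \<subseteq> M fc) ==> fam r n L \<subseteq> fam r n M"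
proof
  fix b assume LM: "\<And>fc. L fc \<subseteq> M fc" and b: "b \<in> fam r n L"
  show "b \<in> fam r n M"
    by (rule famI) (use famD[OF b] famD0[OF b] LM in blast)+
qed

lemma subspace_fam:
  assumes "\<And>fc. fc \<in> faces r n ==> pv.subspace (L fc)"
  shows "cv.subspace (fam r n L)"
  unfolding cv.subspace_def
proof (intro conjI ballI allI)
  show "0 \<in> fam r n L" unfolding fam_def using pv.subspace_0[OF assms] by (simp add: zero_apply)
next
  fix x y assume "x \<in> fam r n L" "y \<in> fam r n L"
  thus "x + y \<in> fam r n L" unfolding fam_def using pv.subspace_add[OF assms] by (auto simp: plus_apply split: if_splits)
next
  fix c x assume "x \<in> fam r n L"
  thus "cochain_scale c x \<in> fam r n L" unfolding fam_def using pv.subspace_scale[OF assms]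
    by (auto simp: cochain_scale_apply split: if_splits)
qed

lemma subspace_icoch: "gideal r I ==> cv.subspace (icoch r I t n)"
  unfolding icoch_def by (rule subspace_fam) (rule subspace_Lid)

lemmas subspace_coch = subspace_icoch[OF gideal_hforms]

lemma icoch_mono: "I \<le> J ==> icoch r I t n \<subseteq> icoch r J t n"
  unfolding icoch_def by (rule fam_mono) (rule Lid_mono)

lemma icoch_coch: "gideal r I ==> icoch r I t n \<subseteq> coch r t n"
  by (rule icoch_mono[OF gideal_le_hforms])

definition sg :: "nat set => nat => laurent" where
  "sg tq i = (- 1) ^ card {j \<in> tq. j < i}"

lemma cech_diff_sg: "cech_diff r b tq = (if tq \<subseteq> {..r} then \<Sum>i\<in>tq. sg tq i * b (tq - {i}) else 0)"
  by (simp add: cech_diff_def sg_def)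

lemma sg_cases: "sg tq i = 1 \<or> sg tq i = - 1"
  unfolding sg_def using neg_one_even_power neg_one_odd_power by blast

lemma sg_sq: "sg tq i * sg tq i = 1"
  using sg_cases[of tq i] by auto

lemma sg_mult_mem: "pv.subspace V ==> g \<in> V ==> sg tq i * g \<in> V"
  using sg_cases[of tq i] pv.subspace_neg by auto

lemma sg_delete: "finite tq ==> i \<in> tq ==> sg (tq - {i}) j = (if i < j then - sg tq j else sg tq j)"
proof -
  assume f: "finite tq" and i: "i \<in> tq"
  show ?thesis
  proof (cases "i < j")
    case True
    have "{k \<in> tq. k < j} = insert i {k \<in> tq - {i}. k < j}" using True i by auto
    moreover have "finite {k \<in> tq - {i}. k < j}" using f by simp
    ultimately have "card {k \<in> tq. k < j} = Suc (card {k \<in> tq - {i}. k < j})" by simp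
    thus ?thesis using True by (simp add: sg_def)
  next
    case False
    hence "{k \<in> tq - {i}. k < j} = {k \<in> tq. k < j}" by auto
    thus ?thesis using False by (simp add: sg_def)
  qed
qed

lemma cech_add: "cech_diff r (b + c) = cech_diff r b + cech_diff r c"
  by (rule ext) (simp add: cech_diff_sg plus_apply distrib_left sum.distrib)

lemma cech_scale: "cech_diff r (cochain_scale k b) = cochain_scale k (cech_diff r b)"
  by (rule ext) (simp add: cech_diff_sg cochain_scale_apply sc_mult_right pv.scale_sum_right)

lemma linear_cech: "Vector_Spaces.linear cochain_scale cochain_scale (cech_diff r)"
  unfolding Vector_Spaces.linear_def module_hom_def module_hom_axioms_def
  by (simp add: vector_space_cochain_scale module_iff_vector_space cech_add cech_scale)

lemma cech_fam:
  assumes b: "b \<in> fam r n L" and sub: "\<And>tq. pv.subspace (L tq)" and mono: "\<And>fc tq. fc \<subseteq> tq ==> L fc \<subseteq> L tq"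
  shows "cech_diff r b \<in> fam r (Suc n) L"
proof (rule famI)
  fix tq
  have card: "tq \<in> faces r (Suc n) \<longleftrightarrow> tq - {i} \<in> faces r n" if "tq \<subseteq> {..r}" "i \<in> tq" for i
    using that finite_subset[of tq "{..r}"] by (auto simp: faces_def card_Suc_Diff1 dest: card_Suc_Diff1)
  show "cech_diff r b tq \<in> L tq" if tq: "tq \<in> faces r (Suc n)"
  proof -
    have "sg tq i * b (tq - {i}) \<in> L tq" if i: "i \<in> tq" for i
      using famD[OF b] card[OF faces_sub[OF tq] i] tq mono[of "tq - {i}" tq] by (intro sg_mult_mem[OF sub]) blast
    thus ?thesis using faces_sub[OF tq] by (simp add: cech_diff_sg pv.subspace_sum[OF sub])
  qed
  show "cech_diff r b tq = 0" if "tq \<notin> faces r (Suc n)"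
    using that card famD0[OF b] by (auto simp: cech_diff_sg intro!: sum.neutral)
qed

lemma cech_icoch: "gideal r I ==> b \<in> icoch r I t n ==> cech_diff r b \<in> icoch r I t (Suc n)"
  unfolding icoch_def by (erule cech_fam) (simp_all add: subspace_Lid Lid_face)

lemmas cech_coch = cech_icoch[OF gideal_hforms]

lemma cech_cech: "cech_diff r (cech_diff r b) = 0"
proof (rule ext)
  fix tq
  show "cech_diff r (cech_diff r b) tq = 0 tq"
  proof (cases "tq \<subseteq> {..r}")
    case True
    hence fin: "finite tq" using finite_subset by blast
    let ?P = "{(i, j). i \<in> tq \<and> j \<in> tq \<and> i \<noteq> j}"
    let ?F = "\<lambda>(i, j). sg tq i * sg (tq - {i}) j * b (tq - {i} - {j})"
    have finP: "finite ?P" by (rule finite_subset[of _ "tq \<times> tq"]) (use fin in auto)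
    have "cech_diff r (cech_diff r b) tq = (\<Sum>i\<in>tq. \<Sum>j\<in>tq - {i}. ?F (i, j))"
      using True by (auto simp: cech_diff_sg sum_distrib_left mult.assoc intro!: sum.cong)
    also have "\<dots> = sum ?F (Sigma tq (\<lambda>i. tq - {i}))" using fin by (subst sum.Sigma) auto
    also have "Sigma tq (\<lambda>i. tq - {i}) = ?P" by auto
    finally have S: "cech_diff r (cech_diff r b) tq = sum ?F ?P" .
    have "sum ?F ?P = (\<Sum>p\<in>?P. ?F (prod.swap p))"
      by (rule sum.reindex_bij_betw[symmetric]) (auto simp: bij_betw_def inj_on_def image_iff)
    also have "\<dots> = (\<Sum>p\<in>?P. - ?F p)"
    proof (rule sum.cong[OF refl])
      fix p assume "p \<in> ?P"
      then obtain i j where p: "p = (i, j)" "i \<in> tq" "j \<in> tq" "i \<noteq> j" by blast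
      have "tq - {j} - {i} = tq - {i} - {j}" by blast
      thus "?F (prod.swap p) = - ?F p"
        using p sg_delete[OF fin p(2), of j] sg_delete[OF fin p(3), of i] by (auto simp: mult.commute)
    qed
    finally have e: "sum ?F ?P = - sum ?F ?P" by (simp add: sum_negf)
    have "plookup (sum ?F ?P) k = plookup 0 k" for k using arg_cong[OF e, of "\<lambda>g. plookup g k"] by simp
    hence "sum ?F ?P = 0" by (rule poly_mapping_eqI)
    thus ?thesis using S by (simp add: zero_apply)
  qed (simp add: cech_diff_sg zero_apply)
qed

abbreviation "cocyc r I t \<equiv> cv.cyc (cech_diff r) (coch r t) (icoch r I t)"
abbreviation "cobdy r I t \<equiv> cv.bdy (cech_diff r) (coch r t) (icoch r I t)"

lemma filtered_cech:
  assumes "gideal r I" "gideal r J" "I \<le> J"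
  shows "filtered_complex cochain_scale (cech_diff r) (coch r t) (icoch r J t) (icoch r I t)"
  by unfold_locales (simp_all add: linear_cech cech_add cech_scale subspace_icoch gideal_hforms assms icoch_mono icoch_coch
      cech_icoch cech_cech)

definition mulX :: "nat => nat => (nat set => laurent) => nat set => laurent" where
  "mulX k N b = (\<lambda>fc. Xl k N * b fc)"

lemma linear_mulX: "Vector_Spaces.linear cochain_scale cochain_scale (mulX k N)"
  unfolding Vector_Spaces.linear_def module_hom_def module_hom_axioms_def
  by (simp add: vector_space_cochain_scale module_iff_vector_space mulX_def fun_eq_iff plus_apply
      cochain_scale_apply distrib_left sc_mult_right)

lemma mulX_add: "mulX k N (b + c) = mulX k N b + mulX k N c"
  and mulX_diff: "mulX k N (b - c) = mulX k N b - mulX k N c"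
  by (simp_all add: mulX_def fun_eq_iff plus_apply distrib_left right_diff_distrib)

lemma mulX_cech: "cech_diff r (mulX k N b) = mulX k N (cech_diff r b)"
  by (rule ext) (simp add: cech_diff_sg mulX_def sum_distrib_left mult.left_commute)

lemma mulX_Suc: "mulX k 1 (mulX k N b) = mulX k (Suc N) b"
  using Xl_add[of k 1 N] by (simp add: mulX_def fun_eq_iff mult.assoc)

lemma mulX_icoch: "gideal r I ==> k \<le> r ==> b \<in> icoch r I t n ==> mulX k N b \<in> icoch r I (int N + t) n"
  using Xl_Lid[of r I k] unfolding icoch_def fam_def mulX_def by (auto split: if_splits)

lemmas mulX_coch = mulX_icoch[OF gideal_hforms]

lemma mulX_gcolon:
  assumes I: "gideal r I" and b: "b \<in> coch r t n"
  shows "mulX k 1 b \<in> icoch r I (1 + t) n \<longleftrightarrow> b \<in> icoch r (gcolon r I (xv k) 1) t n"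
  using Lid_gcolon[OF I] b unfolding icoch_def fam_def mulX_def by (auto split: if_splits)

lemma mulX_gadd:
  assumes I: "gideal r I" and b: "b \<in> icoch r (gadd r I (xv k) 1) (1 + t) n"
  shows "\<exists>c\<in>coch r t n. b - mulX k 1 c \<in> icoch r I (1 + t) n"
proof -
  have "\<forall>fc\<in>faces r n. \<exists>h. h \<in> Lring r t fc \<and> b fc - Xl k 1 * h \<in> Lid r I (1 + t) fc"
    using Lid_gadd[OF I famD[OF b[unfolded icoch_def]]] by blast
  from bchoice[OF this] obtain h where h: "\<And>fc. fc \<in> faces r n ==> h fc \<in> Lring r t fc \<and> b fc - Xl k 1 * h fc \<in> Lid r I (1 + t) fc"
    by blast
  let ?c = "\<lambda>fc. if fc \<in> faces r n then h fc else 0"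
  have "?c \<in> coch r t n" unfolding icoch_def by (rule famI) (simp_all add: h)
  moreover have "b - mulX k 1 ?c \<in> icoch r I (1 + t) n"
    using famD0[OF b[unfolded icoch_def]] h unfolding icoch_def by (intro famI) (simp_all add: mulX_def)
  ultimately show ?thesis by blast
qed

lemma mulX_gadd_in:
  assumes I: "gideal r I" and b: "b \<in> coch r t n"
  shows "mulX k 1 b \<in> icoch r (gadd r I (xv k) 1) (1 + t) n"
  using Lid_gadd_mult[OF I] b unfolding icoch_def fam_def mulX_def by (auto split: if_splits)

text \<open>The usual contraction by inserting the vertex \<open>k\<close>. The value on the larger
  face may have poles along the variable \<open>k\<close>, and the factor \<open>Xl k N\<close> is
  there to remove them.\<close>

definition htp :: "nat => nat => nat => (nat set => laurent) => nat set => laurent" where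
  "htp r k N b = (\<lambda>fc. if k \<notin> fc \<and> fc \<subseteq> {..r} then sg (insert k fc) k * (Xl k N * b (insert k fc)) else 0)"

lemma homotopy:
  assumes k: "k \<le> r" and b: "\<And>fc. \<not> fc \<subseteq> {..r} ==> b fc = 0"
  shows "cech_diff r (htp r k N b) + htp r k N (cech_diff r b) = mulX k N b"
proof (rule ext)
  fix fc
  show "(cech_diff r (htp r k N b) + htp r k N (cech_diff r b)) fc = mulX k N b fc"
  proof (cases "fc \<subseteq> {..r}")
    case False
    thus ?thesis using b by (simp add: plus_apply cech_diff_sg htp_def mulX_def)
  next
    case sub: True
    hence fin: "finite fc" using finite_subset by blast
    show ?thesis
    proof (cases "k \<in> fc")
      case True
      have "sg fc i * htp r k N b (fc - {i}) = (if i = k then Xl k N * b fc else 0)" if i: "i \<in> fc" for i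
      proof (cases "i = k")
        case True
        have "insert k (fc - {k}) = fc" using \<open>k \<in> fc\<close> by blast
        moreover have "sg fc k * (sg fc k * g) = g" for g using sg_sq[of fc k] by (simp flip: mult.assoc)
        moreover have "fc - {k} \<subseteq> {..r}" using sub by blast
        ultimately show ?thesis using True by (simp add: htp_def)
      next
        case False
        thus ?thesis using \<open>k \<in> fc\<close> by (simp add: htp_def)
      qed
      hence "cech_diff r (htp r k N b) fc = (\<Sum>i\<in>fc. if i = k then Xl k N * b fc else 0)"
        using sub by (simp add: cech_diff_sg)
      thus ?thesis using True fin by (simp add: plus_apply htp_def mulX_def)
    next
      case False
      let ?tq = "insert k fc"
      have sub': "?tq \<subseteq> {..r}" using sub k by simp
      have fin': "finite ?tq" using fin by simp
      have split: "cech_diff r b ?tq = sg ?tq k * b fc + (\<Sum>i\<in>fc. sg ?tq i * b (?tq - {i}))"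
        using sub' fin False by (simp add: cech_diff_sg)
      have h: "htp r k N (cech_diff r b) fc = Xl k N * b fc + (\<Sum>i\<in>fc. sg ?tq k * sg ?tq i * (Xl k N * b (?tq - {i})))"
      proof -
        have "htp r k N (cech_diff r b) fc = sg ?tq k * (Xl k N * cech_diff r b ?tq)"
          using False sub by (simp add: htp_def)
        also have "\<dots> = (sg ?tq k * sg ?tq k) * (Xl k N * b fc) + (\<Sum>i\<in>fc. sg ?tq k * sg ?tq i * (Xl k N * b (?tq - {i})))"
          unfolding split by (simp add: distrib_left sum_distrib_left ac_simps)
        finally show ?thesis by (simp add: sg_sq)
      qed
      have "sg fc i * htp r k N b (fc - {i}) = - (sg ?tq k * sg ?tq i * (Xl k N * b (?tq - {i})))" if i: "i \<in> fc" for i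
      proof -
        have ne: "i \<noteq> k" using i False by blast
        have e1: "insert k (fc - {i}) = ?tq - {i}" using ne by blast
        have e2: "?tq - {k} = fc" using False by blast
        have s1: "sg fc i = (if k < i then - sg ?tq i else sg ?tq i)" using sg_delete[OF fin', of k i] e2 by simp
        have s2: "sg (?tq - {i}) k = (if i < k then - sg ?tq k else sg ?tq k)" using sg_delete[OF fin', of i k] i by simp
        have "fc - {i} \<subseteq> {..r}" "k \<notin> fc - {i}" using sub False by auto
        hence "sg fc i * htp r k N b (fc - {i}) = sg fc i * sg (?tq - {i}) k * (Xl k N * b (?tq - {i}))"
          unfolding htp_def e1 by (simp add: mult.assoc)
        thus ?thesis unfolding s1 s2 using ne by (auto simp: mult.commute)
      qed
      hence "cech_diff r (htp r k N b) fc = (\<Sum>i\<in>fc. - (sg ?tq k * sg ?tq i * (Xl k N * b (?tq - {i}))))"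
        using sub by (simp add: cech_diff_sg)
      thus ?thesis using h by (simp add: plus_apply mulX_def sum_negf)
    qed
  qed
qed

lemma htp_icoch:
  assumes I: "gideal r I" and k: "k \<le> r" and b: "b \<in> icoch r I t (Suc n)"
  shows "\<exists>N. \<forall>M\<ge>N. htp r k M b \<in> icoch r I (int M + t) n"
proof -
  note b' = b[unfolded icoch_def]
  have "\<exists>N. \<forall>M\<ge>N. Xl k M * b (insert k fc) \<in> Lid r I (int M + t) fc" for fc
    using Lid_delete[OF I k, of "b (insert k fc)" t fc] famD[OF b'] famD0[OF b'] pv.subspace_0[OF subspace_Lid[OF I]] by metis
  then obtain f where f: "\<And>fc M. f fc \<le> M ==> Xl k M * b (insert k fc) \<in> Lid r I (int M + t) fc" by metis
  have "htp r k M b \<in> icoch r I (int M + t) n" if M: "M \<ge> (\<Sum>fc\<in>Pow {..r}. f fc)" for M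
    unfolding icoch_def
  proof (rule famI)
    fix fc
    have "f fc \<le> M" if "fc \<subseteq> {..r}" using M that by (intro order_trans[OF member_le_sum[of fc "Pow {..r}" f]]) auto
    thus "htp r k M b fc \<in> Lid r I (int M + t) fc"
      using f sg_mult_mem[OF subspace_Lid[OF I]] pv.subspace_0[OF subspace_Lid[OF I]] by (simp add: htp_def)
    have "insert k fc \<in> faces r (Suc n) ==> k \<notin> fc ==> fc \<subseteq> {..r} ==> fc \<in> faces r n"
      using finite_subset[of fc "{..r}"] by (simp add: faces_def)
    thus "htp r k M b fc = 0" if "fc \<notin> faces r n" using that famD0[OF b', of "insert k fc"] by (auto simp: htp_def)
  qed
  thus ?thesis by blast
qed

text \<open>The homotopy contracts multiplication by the \<open>N\<close>-th power of a variable
  once \<open>N\<close> clears all poles, so every cohomology class is torsion with respect to each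
  variable.\<close>

lemma cech_torsion:
  assumes I: "gideal r I" and k: "k \<le> r" and b: "b \<in> cocyc r I t n"
  shows "\<exists>N. mulX k N b \<in> cobdy r I (int N + t) n"
proof -
  have bX: "b \<in> coch r t n" and db: "cech_diff r b \<in> icoch r I t (Suc n)" using b by (simp_all add: cv.cyc_def)
  have out: "b fc = 0" if "\<not> fc \<subseteq> {..r}" for fc using famD0[OF bX[unfolded icoch_def]] that by (simp add: faces_def)
  have hom: "cech_diff r (htp r k N b) + htp r k N (cech_diff r b) = mulX k N b" for N by (rule homotopy[OF k out])
  obtain N1 where N1: "\<And>M. M \<ge> N1 ==> htp r k M (cech_diff r b) \<in> icoch r I (int M + t) n"
    using htp_icoch[OF I k db] by blast
  show ?thesis
  proof (cases n)
    case 0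
    have "htp r k N1 b = 0"
      using famD0[OF bX[unfolded icoch_def 0]] by (auto simp: htp_def faces_def fun_eq_iff zero_apply dest: finite_subset[OF _ finite_atMost])
    hence "mulX k N1 b = htp r k N1 (cech_diff r b)"
      using hom[of N1] cech_add[of r 0 0] by simp
    thus ?thesis using N1 0 by (metis cv.bdy_0 order_refl)
  next
    case (Suc m)
    obtain N2 where N2: "\<And>M. M \<ge> N2 ==> htp r k M b \<in> coch r (int M + t) m"
      using htp_icoch[OF gideal_hforms k bX[unfolded Suc]] by blast
    have "mulX k (N1 + N2) b \<in> cobdy r I (int (N1 + N2) + t) n"
      unfolding hom[symmetric] Suc cv.bdy_Suc using N1[of "N1 + N2"] N2[of "N1 + N2"] Suc by auto
    thus ?thesis by blast
  qed
qed

context filtered_complex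
begin

lemma vanish_middle:
  assumes "Z1 n = B1 n" "Z3 n = B3 n"
  shows "Z2 n = B2 n"
proof -
  have "Z1 n = M1 n" using assms(1) inc1 inc1' by blast
  with qdim_self[of "Z1 n"] finq_self[of "Z1 n"] subs(1)[of n]
  have "qdim (Z1 n) (M1 n) = 0" "finq (Z1 n) (M1 n)" by metis+
  hence "finq (M2 n) (B2 n)" "qdim (M2 n) (B2 n) = 0" using iso_a by simp_all
  hence 1: "M2 n = B2 n" using finq_zero[OF subs(4) subsM(2)] by blast
  have "M3 n = B3 n" using assms(2) inc3 inc3' by blast
  with qdim_self[of "B3 n"] finq_self[of "B3 n"] subs(6)[of n]
  have "qdim (M3 n) (B3 n) = 0" "finq (M3 n) (B3 n)" by metis+
  hence "finq (Z2 n) (M2 n)" "qdim (Z2 n) (M2 n) = 0" using iso_b by simp_all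
  hence "Z2 n = M2 n" using finq_zero[OF subsM(2) subs(3)] by blast
  thus ?thesis using 1 by simp
qed

end

lemma cocyc_subspaces:
  assumes I: "gideal r I"
  shows "cv.subspace (cocyc r I t n)" "cv.subspace (cobdy r I t n)" "cobdy r I t n \<subseteq> cocyc r I t n" "icoch r I t n \<subseteq> cobdy r I t n"
proof -
  interpret F: filtered_complex cochain_scale "cech_diff r" "coch r t" "icoch r I t" "icoch r I t"
    by (rule filtered_cech[OF I I order_refl])
  show "cv.subspace (cocyc r I t n)" "cv.subspace (cobdy r I t n)" "cobdy r I t n \<subseteq> cocyc r I t n" "icoch r I t n \<subseteq> cobdy r I t n"
    using F.subs F.BZ F.bdy_right F.zero_in(1) by blast+
qed

section \<open>Multiplication by a variable on Cech cohomology\<close>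

context
  fixes r k :: nat and I :: "nat => mpoly set"
  assumes I: "gideal r I" and k: "k \<le> r"
begin

abbreviation (input) "KK \<equiv> gcolon r I (xv k) 1"
abbreviation (input) "JJ \<equiv> gadd r I (xv k) 1"
abbreviation (input) "ZJ t \<equiv> cv.cyc (cech_diff r) (icoch r JJ t) (icoch r I t)"
abbreviation (input) "BJ t \<equiv> cv.bdy (cech_diff r) (icoch r JJ t) (icoch r I t)"

lemma gJJ: "gideal r JJ" and gKK: "gideal r KK" and IJJ: "I \<le> JJ"
  using gideal_gadd[OF I xv_hforms[OF k]] gideal_gcolon[OF I] gadd_ge[OF I] by auto

lemma filt: "filtered_complex cochain_scale (cech_diff r) (coch r t) (icoch r JJ t) (icoch r I t)"
  by (rule filtered_cech[OF I gJJ IJJ])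

lemma mulX_cyc: "v \<in> cocyc r KK t n ==> mulX k 1 v \<in> ZJ (1 + t) n"
  using mulX_gadd_in[OF I] mulX_gcolon[OF I cech_coch] by (simp add: cv.cyc_def mulX_cech)

lemma mulX_bdy:
  assumes v: "v \<in> cocyc r KK t n"
  shows "v \<in> cobdy r KK t n \<longleftrightarrow> mulX k 1 v \<in> BJ (1 + t) n"
proof -
  have vX: "v \<in> coch r t n" using v by (simp add: cv.cyc_def)
  show ?thesis
  proof (cases n)
    case 0
    thus ?thesis using mulX_gcolon[OF I vX] by (simp add: cv.bdy_0)
  next
    case (Suc m)
    show ?thesis
    proof
      assume "v \<in> cobdy r KK t n"
      then obtain x y where xy: "v = cech_diff r x + y" "x \<in> coch r t m" "y \<in> icoch r KK t n"
        unfolding Suc cv.bdy_Suc by blast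
      have "y \<in> coch r t n" using xy(3) icoch_coch[OF gKK] by blast
      hence "mulX k 1 y \<in> icoch r I (1 + t) n" using mulX_gcolon[OF I] xy(3) by blast
      moreover have "mulX k 1 v = cech_diff r (mulX k 1 x) + mulX k 1 y" unfolding xy(1) by (simp add: mulX_add mulX_cech)
      ultimately show "mulX k 1 v \<in> BJ (1 + t) n"
        unfolding Suc cv.bdy_Suc using mulX_gadd_in[OF I xy(2)] by blast
    next
      assume "mulX k 1 v \<in> BJ (1 + t) n"
      then obtain j i where ji: "mulX k 1 v = cech_diff r j + i" "j \<in> icoch r JJ (1 + t) m" "i \<in> icoch r I (1 + t) n"
        unfolding Suc cv.bdy_Suc by blast
      obtain c where c: "c \<in> coch r t m" "j - mulX k 1 c \<in> icoch r I (1 + t) m" using mulX_gadd[OF I ji(2)] by blast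
      have "cech_diff r (j - mulX k 1 c) + i \<in> icoch r I (1 + t) n"
        using cech_icoch[OF I c(2)] ji(3) cv.subspace_add[OF subspace_icoch[OF I]] Suc by blast
      moreover have "cech_diff r ((j - mulX k 1 c) + mulX k 1 c) = cech_diff r (j - mulX k 1 c) + cech_diff r (mulX k 1 c)"
        by (rule cech_add)
      hence "mulX k 1 (v - cech_diff r c) = cech_diff r (j - mulX k 1 c) + i"
        unfolding mulX_diff ji(1) by (simp add: mulX_cech)
      ultimately have "mulX k 1 (v - cech_diff r c) \<in> icoch r I (1 + t) n" by simp
      moreover have "v - cech_diff r c \<in> coch r t n"
        using cv.subspace_diff[OF subspace_coch vX] cech_coch[OF c(1)] Suc by blast
      ultimately have "v - cech_diff r c \<in> icoch r KK t n" using mulX_gcolon[OF I] by blast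
      moreover have "v = cech_diff r c + (v - cech_diff r c)" by simp
      ultimately show "v \<in> cobdy r KK t n" unfolding Suc cv.bdy_Suc using c(1) by blast
    qed
  qed
qed

text \<open>Multiplication by the variable carries the complex of the quotient by \<open>KK\<close>,
  in twist \<open>t\<close>, onto the complex of \<open>JJ / I\<close> in twist
  \<open>1 + t\<close>. This is the first term of the long exact sequence of
  \<open>I \<subseteq> JJ\<close>.\<close>

lemma shift_iso:
  "cv.finq (cocyc r KK t n) (cobdy r KK t n) \<longleftrightarrow> cv.finq (ZJ (1 + t) n) (BJ (1 + t) n)"
  "cv.qdim (cocyc r KK t n) (cobdy r KK t n) = cv.qdim (ZJ (1 + t) n) (BJ (1 + t) n)"
proof -
  interpret F: filtered_complex cochain_scale "cech_diff r" "coch r (1 + t)" "icoch r JJ (1 + t)" "icoch r I (1 + t)"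
    by (rule filt)
  have sur: "\<exists>v\<in>cocyc r KK t n. u - mulX k 1 v \<in> BJ (1 + t) n" if u: "u \<in> ZJ (1 + t) n" for u
  proof -
    have u': "u \<in> icoch r JJ (1 + t) n" "cech_diff r u \<in> icoch r I (1 + t) (Suc n)" using u by (simp_all add: cv.cyc_def)
    obtain c where c: "c \<in> coch r t n" "u - mulX k 1 c \<in> icoch r I (1 + t) n" using mulX_gadd[OF I u'(1)] by blast
    have "cech_diff r ((u - mulX k 1 c) + mulX k 1 c) = cech_diff r (u - mulX k 1 c) + cech_diff r (mulX k 1 c)"
      by (rule cech_add)
    hence "mulX k 1 (cech_diff r c) = cech_diff r u - cech_diff r (u - mulX k 1 c)" by (simp add: mulX_cech)
    hence "mulX k 1 (cech_diff r c) \<in> icoch r I (1 + t) (Suc n)"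
      using u'(2) cech_icoch[OF I c(2)] cv.subspace_diff[OF subspace_icoch[OF I]] by metis
    hence "cech_diff r c \<in> icoch r KK t (Suc n)" using mulX_gcolon[OF I cech_coch[OF c(1)]] by blast
    hence "c \<in> cocyc r KK t n" using c(1) by (simp add: cv.cyc_def)
    moreover have "u - mulX k 1 c \<in> BJ (1 + t) n"
      using F.bdy_right[of "icoch r JJ (1 + t)" n "icoch r I (1 + t)"] F.zero_in(2) c(2) by blast
    ultimately show ?thesis by blast
  qed
  show "cv.finq (cocyc r KK t n) (cobdy r KK t n) \<longleftrightarrow> cv.finq (ZJ (1 + t) n) (BJ (1 + t) n)"
    "cv.qdim (cocyc r KK t n) (cobdy r KK t n) = cv.qdim (ZJ (1 + t) n) (BJ (1 + t) n)"
    using cvp.finq_map[OF linear_mulX cocyc_subspaces(1)[OF gKK] F.subs(2,1) mulX_cyc sur mulX_bdy cocyc_subspaces(3)[OF gKK] F.BZ(1)] by blast+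
qed

end

section \<open>Euler characteristics, Hilbert functions and Hilbert polynomials\<close>

definition euler :: "nat => (nat => mpoly set) => int => int" where
  "euler r I t = (\<Sum>n\<le>Suc r. (- 1) ^ n * int (cv.qdim (cocyc r I t n) (cobdy r I t n)))"

definition hz :: "nat => (nat => mpoly set) => int => nat" where
  "hz r I t = (if 0 \<le> t then hilb r I (nat t) else 0)"

lemma hz_add:
  assumes I: "gideal r I" and k: "k \<le> r"
  shows "hz r I (1 + t) = hz r (gcolon r I (xv k) 1) t + hz r (gadd r I (xv k) 1) (1 + t)"
proof -
  consider "0 \<le> t" | "t = - 1" | "t < - 1" by linarith
  thus ?thesis
  proof cases
    case 1
    hence "nat (1 + t) = 1 + nat t" by simp
    thus ?thesis using 1 hilb_colon_add[OF I xv_hforms[OF k], of "nat t"] by (simp add: hz_def)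
  next
    case 2
    thus ?thesis by (simp add: hz_def hilb_gadd_low)
  qed (simp add: hz_def)
qed

lemma hpol_shift_add:
  fixes I J K :: "nat => 'k::field mp set"
  assumes "gideal r I" "gideal r J" "gideal r K" and t0: "\<And>t. t \<ge> t0 ==> hilb r I (k + t) = hilb r K t + hilb r J (k + t)"
  shows "poly (hpol r I) (x + real k) = poly (hpol r K) x + poly (hpol r J) (x + real k)"
proof -
  note ev = hpol_eventually[unfolded eventually_sequentially]
  obtain a b c where a: "\<And>t. t \<ge> a ==> poly (hpol r I) (real t) = real (hilb r I t)"
    and b: "\<And>t. t \<ge> b ==> poly (hpol r J) (real t) = real (hilb r J t)"
    and c: "\<And>t. t \<ge> c ==> poly (hpol r K) (real t) = real (hilb r K t)"
    using ev[OF assms(1)] ev[OF assms(2)] ev[OF assms(3)] by blast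
  have "pcompose (hpol r I) [:real k, 1:] = hpol r K + pcompose (hpol r J) [:real k, 1:]"
    by (rule poly_eq_eventually, unfold eventually_sequentially, rule exI[of _ "t0 + a + b + c"], intro allI impI)
      (use t0 a b c in \<open>simp add: poly_pcompose flip: of_nat_add\<close>)
  from arg_cong[OF this, of "\<lambda>p. poly p x"] show ?thesis by (simp add: poly_pcompose add.commute)
qed

lemma hpol_add:
  assumes I: "gideal r I" and f: "f \<in> hforms r k"
  shows "poly (hpol r I) (x + real k) = poly (hpol r (gcolon r I f k)) x + poly (hpol r (gadd r I f k)) (x + real k)"
  by (rule hpol_shift_add[OF I gideal_gadd[OF I f] gideal_gcolon[OF I]]) (rule hilb_colon_add[OF I f])

lemma coch_0:
  assumes I: "gideal r I"
  shows "cv.finq (coch r t 0) (icoch r I t 0)" "cv.qdim (coch r t 0) (icoch r I t 0) = hz r I t"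
proof -
  let ?f = "\<lambda>p fc. if fc = {} then to_laurent p else 0"
  have lin: "Vector_Spaces.linear sc cochain_scale ?f"
    unfolding Vector_Spaces.linear_def module_hom_def module_hom_axioms_def
    by (simp add: vector_space_sc vector_space_cochain_scale module_iff_vector_space fun_eq_iff plus_apply
        cochain_scale_apply toL_add toL_sc)
  have f0: "fc \<in> faces r 0 \<longleftrightarrow> fc = {}" for fc using finite_subset[of fc "{..r}"] by (auto simp: faces_def)
  have 1: "?f v \<in> coch r t 0" if "v \<in> gz (hforms r) t" for v
    unfolding icoch_def using that by (intro famI) (auto simp: f0 Lid_empty)
  have 2: "\<exists>v\<in>gz (hforms r) t. u - ?f v \<in> icoch r I t 0" if u: "u \<in> coch r t 0" for u
  proof -
    have "u {} \<in> Lring r t {}" using u f0 unfolding icoch_def by (auto dest: famD)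
    then obtain p where p: "p \<in> gz (hforms r) t" "u {} = to_laurent p" unfolding Lid_empty by blast
    have "u - ?f p = 0" using p(2) famD0[OF u[unfolded icoch_def]] f0 by (auto simp: fun_eq_iff zero_apply)
    thus ?thesis using p(1) cv.subspace_0[OF subspace_icoch[OF I]] by (intro bexI[of _ p]) simp_all
  qed
  have 3: "v \<in> gz I t \<longleftrightarrow> ?f v \<in> icoch r I t 0" if "v \<in> gz (hforms r) t" for v
  proof
    assume "v \<in> gz I t"
    thus "?f v \<in> icoch r I t 0" unfolding icoch_def by (intro famI) (auto simp: f0 Lid_empty)
  next
    assume "?f v \<in> icoch r I t 0"
    hence "?f v \<in> fam r 0 (Lid r I t)" unfolding icoch_def .
    from famD[OF this] f0 have "?f v {} \<in> Lid r I t {}" by simp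
    hence "to_laurent v \<in> to_laurent ` gz I t" using Lid_empty[of r I t] by simp
    then obtain w where "w \<in> gz I t" "to_laurent v = to_laurent w" by (elim imageE)
    thus "v \<in> gz I t" by simp
  qed
  have fin: "pv.finq (gz (hforms r) t) (gz I t)"
    using finq_gideal[OF I] pv.finq_self by (auto simp: gz_def)
  have q: "pv.qdim (gz (hforms r) t) (gz I t) = hz r I t"
    using pv.qdim_self[OF pv.subspace_single_0] by (auto simp: gz_def hz_def hilb_def)
  show "cv.finq (coch r t 0) (icoch r I t 0)" "cv.qdim (coch r t 0) (icoch r I t 0) = hz r I t"
    using pcv.finq_map[OF lin subspace_gz[OF gideal_hforms] subspace_icoch[OF I] subspace_coch 1 2 3 gz_mono[OF gideal_le_hforms[OF I]] icoch_coch[OF I]] fin q by auto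
qed

text \<open>The third clause is the Grothendieck-Serre formula, with the sign of an augmented
  complex. Finiteness and vanishing are carried along, the one to add Euler characteristics, the
  other to start the descent from large twists.\<close>

definition good :: "nat => (nat => mpoly set) => bool" where
  "good r I \<longleftrightarrow> (\<forall>t n. cv.finq (cocyc r I t n) (cobdy r I t n)) \<and>
     (\<exists>T. \<forall>t\<ge>T. \<forall>n. cocyc r I t n = cobdy r I t n) \<and>
     (\<forall>t. real_of_int (euler r I t) = real (hz r I t) - poly (hpol r I) (real_of_int t))"

lemma cocyc_eq_iff:
  assumes "gideal r I" "cv.finq (cocyc r I t n) (cobdy r I t n)"
  shows "cocyc r I t n = cobdy r I t n \<longleftrightarrow> cv.qdim (cocyc r I t n) (cobdy r I t n) = 0"
  using cv.finq_zero[OF cocyc_subspaces(2,1)[OF assms(1)] assms(2)] by simp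

text \<open>The quotient dies in every localization at a nonempty face, so only the augmentation
  term is left, and the Hilbert polynomial is 0.\<close>

lemma good_vars:
  assumes I: "gideal r I" and v: "\<And>i. i \<le> r ==> xv i \<in> I 1"
  shows "good r I"
proof -
  have pos: "cocyc r I t n = cobdy r I t n" if n: "n \<noteq> 0" for t n
  proof -
    have "fc \<noteq> {}" if "fc \<in> faces r n" for fc using that n by (auto simp: faces_def)
    hence "Lid r I t fc = Lring r t fc" if "fc \<in> faces r n" for fc
      using Lid_full[OF I v faces_sub[OF that]] that by blast
    hence "icoch r I t n = coch r t n" unfolding icoch_def fam_def by auto
    hence "cocyc r I t n \<subseteq> icoch r I t n" by (auto simp: cv.cyc_def)
    thus ?thesis using cocyc_subspaces(3,4)[OF I] by blast
  qed
  have zero: "cocyc r I t 0 = coch r t 0" for t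
  proof -
    have ne: "fc \<noteq> {}" if "fc \<in> faces r (Suc 0)" for fc using that by (auto simp: faces_def)
    have "Lid r I t fc = Lring r t fc" if "fc \<in> faces r (Suc 0)" for fc
      using Lid_full[OF I v faces_sub[OF that]] ne[OF that] by simp
    hence "icoch r I t (Suc 0) = coch r t (Suc 0)" unfolding icoch_def fam_def by auto
    thus ?thesis using cech_coch by (auto simp: cv.cyc_def)
  qed
  have fin: "cv.finq (cocyc r I t n) (cobdy r I t n)" for t n
    using pos coch_0(1)[OF I] cv.finq_self cocyc_subspaces(2)[OF I] by (cases "n = 0") (simp_all add: zero cv.bdy_0)
  have q0: "cv.qdim (cocyc r I t 0) (cobdy r I t 0) = hz r I t" for t
    using coch_0(2)[OF I] by (simp add: zero cv.bdy_0)
  have qn: "cv.qdim (cocyc r I t n) (cobdy r I t n) = 0" if "n \<noteq> 0" for t n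
    using pos[OF that] cv.qdim_self cocyc_subspaces(2)[OF I] by simp
  have hil: "hilb r I t = 0" if "t \<ge> 1" for t
    using gideal_vars_full[OF I v that] hilb_0_iff[OF I] by blast
  have "cocyc r I t n = cobdy r I t n" if "t \<ge> 1" for t n
    using cocyc_eq_iff[OF I fin] q0 qn hil[of "nat t"] that by (cases "n = 0") (auto simp: hz_def)
  moreover have "euler r I t = int (hz r I t)" for t
  proof -
    have "euler r I t = (\<Sum>n\<le>Suc r. if n = 0 then int (hz r I t) else 0)"
      unfolding euler_def by (rule sum.cong) (simp_all add: q0 qn)
    thus ?thesis by simp
  qed
  moreover have "hpol r I = 0"
    by (rule hpol_eqI) (use hil in \<open>auto simp: eventually_sequentially intro!: exI[of _ 1]\<close>)
  ultimately show ?thesis unfolding good_def using fin by (auto intro!: exI[of _ 1])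
qed

lemma coch_top: "Suc r < n ==> coch r t n = {0}"
proof -
  assume n: "Suc r < n"
  have "fc \<notin> faces r n" for fc
  proof
    assume "fc \<in> faces r n"
    hence "fc \<subseteq> {..r}" "card fc = n" by (auto simp: faces_def)
    thus False using card_mono[of "{..r}" fc] n by simp
  qed
  thus ?thesis unfolding icoch_def fam_def by (auto simp: fun_eq_iff zero_apply)
qed

lemma euler_add:
  assumes I: "gideal r I" and k: "k \<le> r"
    and K: "\<And>t n. cv.finq (cocyc r (gcolon r I (xv k) 1) t n) (cobdy r (gcolon r I (xv k) 1) t n)"
    and J: "\<And>t n. cv.finq (cocyc r (gadd r I (xv k) 1) t n) (cobdy r (gadd r I (xv k) 1) t n)"
  shows "euler r I (1 + t) = euler r (gcolon r I (xv k) 1) t + euler r (gadd r I (xv k) 1) (1 + t)"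
proof -
  interpret F: filtered_complex cochain_scale "cech_diff r" "coch r (1 + t)" "icoch r (gadd r I (xv k) 1) (1 + t)" "icoch r I (1 + t)"
    by (rule filt[OF I k])
  have "cv.finq (F.Z1 n) (F.B1 n)" for n using K shift_iso(1)[OF I k, of t n] by blast
  from F.euler_additive[OF this J coch_top, of "Suc r"]
  show ?thesis unfolding euler_def shift_iso(2)[OF I k, of t, symmetric] by simp
qed

lemma good_zero_divisor:
  assumes I: "gideal r I" and k: "k \<le> r" and K: "good r (gcolon r I (xv k) 1)" and J: "good r (gadd r I (xv k) 1)"
  shows "good r I"
proof -
  let ?K = "gcolon r I (xv k) 1" and ?J = "gadd r I (xv k) 1"
  note gK = gKK[OF I k] and gJ = gJJ[OF I k]
  have finK: "cv.finq (cocyc r ?K t n) (cobdy r ?K t n)" and finJ: "cv.finq (cocyc r ?J t n) (cobdy r ?J t n)" for t n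
    using K J by (auto simp: good_def)
  obtain T1 where T1: "\<And>t n. t \<ge> T1 ==> cocyc r ?K t n = cobdy r ?K t n" using K unfolding good_def by blast
  obtain T2 where T2: "\<And>t n. t \<ge> T2 ==> cocyc r ?J t n = cobdy r ?J t n" using J unfolding good_def by blast
  have fin': "cv.finq (cocyc r I (1 + t) n) (cobdy r I (1 + t) n)" for t n
  proof -
    interpret F: filtered_complex cochain_scale "cech_diff r" "coch r (1 + t)" "icoch r ?J (1 + t)" "icoch r I (1 + t)"
      by (rule filt[OF I k])
    have "cv.finq (F.Z1 n) (F.B1 n)" using finK shift_iso(1)[OF I k, of t n] by blast
    thus ?thesis using F.fin_middle finJ by blast
  qed
  have fin: "cv.finq (cocyc r I t n) (cobdy r I t n)" for t n using fin'[of "t - 1" n] by simp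
  have van': "cocyc r I (1 + t) n = cobdy r I (1 + t) n" if t: "t \<ge> max T1 T2" for t n
  proof -
    interpret F: filtered_complex cochain_scale "cech_diff r" "coch r (1 + t)" "icoch r ?J (1 + t)" "icoch r I (1 + t)"
      by (rule filt[OF I k])
    have "cv.qdim (cocyc r ?K t n) (cobdy r ?K t n) = 0" using T1[of t n] t cocyc_eq_iff[OF gK finK, of t n] by simp
    hence "cv.qdim (F.Z1 n) (F.B1 n) = 0" using shift_iso(2)[OF I k, of t n] by metis
    moreover have "cv.finq (F.Z1 n) (F.B1 n)" using shift_iso(1)[OF I k, of t n] finK by metis
    ultimately have "cv.qdim (F.Z1 n) (F.B1 n) = 0" "cv.finq (F.Z1 n) (F.B1 n)" .
    hence "F.Z1 n = F.B1 n" using cv.finq_zero[OF F.subs(2,1)] by blast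
    thus ?thesis using F.vanish_middle T2[of "1 + t" n] t by simp
  qed
  have van: "cocyc r I t n = cobdy r I t n" if "t \<ge> max T1 T2 + 1" for t n using van'[of "t - 1" n] that by (simp del: max_less_iff_conj)
  have "real_of_int (euler r I (1 + t)) = real (hz r I (1 + t)) - poly (hpol r I) (real_of_int (1 + t))" for t
    using euler_add[OF I k finK finJ, of t] hz_add[OF I k, of t] hpol_add[OF I xv_hforms[OF k], of "real_of_int t"] K J
    by (simp add: good_def add.commute)
  from this[of "t - 1" for t] have "real_of_int (euler r I t) = real (hz r I t) - poly (hpol r I) (real_of_int t)" for t
    by simp
  thus ?thesis unfolding good_def using fin van by blast
qed

lemma int_downward:
  fixes T t :: int
  assumes up: "\<And>t. t \<ge> T ==> P t" and down: "\<And>t. P (1 + t) ==> P t"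
  shows "P t"
proof (cases "T \<le> t")
  case False
  hence "t \<le> T" by simp
  thus ?thesis
  proof (induction t rule: int_le_induct)
    case (step i)
    thus ?case using down[of "i - 1"] by simp
  qed (rule up[OF order_refl])
qed (rule up)

text \<open>The colon ideal is \<open>I\<close> again, so the exact sequence compares twist
  \<open>t\<close> with twist \<open>1 + t\<close>. In large twists the variable acts injectively on
  cohomology while \<open>cech_torsion\<close> makes every class torsion, hence cohomology vanishes
  there. Finiteness then descends from large twists, and the error \<open>D\<close> in the formula
  does not depend on the twist.\<close>

lemma good_nzd:
  assumes I: "gideal r I" and k: "k \<le> r" and K: "gcolon r I (xv k) 1 = I" and J: "good r (gadd r I (xv k) 1)"
  shows "good r I"
proof -
  let ?J = "gadd r I (xv k) 1"
  have finJ: "cv.finq (cocyc r ?J t n) (cobdy r ?J t n)" for t n using J by (auto simp: good_def)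
  obtain T where T: "\<And>t n. t \<ge> T ==> cocyc r ?J t n = cobdy r ?J t n" using J unfolding good_def by blast
  have step: "b \<in> cobdy r I t n" if t: "1 + t \<ge> T" and b: "b \<in> cocyc r I t n" and m: "mulX k 1 b \<in> cobdy r I (1 + t) n" for b t n
  proof -
    interpret F: filtered_complex cochain_scale "cech_diff r" "coch r (1 + t)" "icoch r ?J (1 + t)" "icoch r I (1 + t)"
      by (rule filt[OF I k])
    have "mulX k 1 b \<in> F.Z1 n" using mulX_cyc[OF I k, of b t n] b unfolding K by blast
    hence "mulX k 1 b \<in> F.B1 n" using F.exact_first[of n] T t m by blast
    thus ?thesis using mulX_bdy[OF I k, of b t n] b unfolding K by blast
  qed
  have mulX_cocyc: "mulX k N b \<in> cocyc r I (int N + t) n" if "b \<in> cocyc r I t n" for N b t n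
    using that mulX_coch[OF k] mulX_icoch[OF I k] by (simp add: cv.cyc_def mulX_cech)
  have van: "cocyc r I t n = cobdy r I t n" if t: "1 + t \<ge> T" for t n
  proof
    show "cocyc r I t n \<subseteq> cobdy r I t n"
    proof
      fix b assume b: "b \<in> cocyc r I t n"
      obtain N where N: "mulX k N b \<in> cobdy r I (int N + t) n" using cech_torsion[OF I k b] by blast
      thus "b \<in> cobdy r I t n"
      proof (induction N)
        case 0
        thus ?case by (simp add: mulX_def Xl_def)
      next
        case (Suc N)
        have "mulX k 1 (mulX k N b) \<in> cobdy r I (1 + (int N + t)) n" using Suc.prems mulX_Suc[of k N b] by (simp add: add.assoc del: One_nat_def)
        hence "mulX k N b \<in> cobdy r I (int N + t) n" using step[OF _ mulX_cocyc[OF b]] t by simp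
        thus ?case by (rule Suc.IH)
      qed
    qed
  qed (rule cocyc_subspaces(3)[OF I])
  have findown: "cv.finq (cocyc r I t n) (cobdy r I t n)" if fin: "\<And>n. cv.finq (cocyc r I (1 + t) n) (cobdy r I (1 + t) n)" for t n
  proof -
    interpret F: filtered_complex cochain_scale "cech_diff r" "coch r (1 + t)" "icoch r ?J (1 + t)" "icoch r I (1 + t)"
      by (rule filt[OF I k])
    have "cv.finq (F.Z1 n) (F.B1 n)" using F.fin_first fin finJ by blast
    thus ?thesis using shift_iso(1)[OF I k, of t n] unfolding K by blast
  qed
  have fin: "cv.finq (cocyc r I t n) (cobdy r I t n)" for t n
  proof (rule int_downward[of T "\<lambda>t. \<forall>n. cv.finq (cocyc r I t n) (cobdy r I t n)", THEN spec])
    show "\<forall>n. cv.finq (cocyc r I t n) (cobdy r I t n)" if "t \<ge> T" for t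
      using van[of t] cv.finq_self cocyc_subspaces(2)[OF I] that by simp
  qed (use findown in blast)
  define D where "D t = real_of_int (euler r I t) - (real (hz r I t) - poly (hpol r I) (real_of_int t))" for t
  have D1: "D (1 + t) = D t" for t
    using euler_add[OF I k _ finJ, of t] hz_add[OF I k, of t] hpol_add[OF I xv_hforms[OF k], of "real_of_int t"] J fin
    unfolding K by (simp add: D_def good_def add.commute)
  have "\<exists>M. \<forall>t\<ge>M. D t = 0"
  proof -
    obtain t1 where t1: "\<And>t. t \<ge> t1 ==> real (hilb r I t) = poly (hpol r I) (real t)" using hpol_bound[OF I] by blast
    have "D t = 0" if t: "t \<ge> max T (int t1)" for t
    proof -
      have "cv.qdim (cocyc r I t n) (cobdy r I t n) = 0" for n
        using van[of t n] t cocyc_eq_iff[OF I fin] by simp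
      hence "euler r I t = 0" by (simp add: euler_def)
      moreover have "real (hz r I t) = poly (hpol r I) (real_of_int t)" using t1[of "nat t"] t by (simp add: hz_def le_nat_iff)
      ultimately show ?thesis by (simp add: D_def)
    qed
    thus ?thesis by blast
  qed
  then obtain M where M: "\<And>t. t \<ge> M ==> D t = 0" by blast
  have D0: "D t = 0" for t
  proof (rule int_downward[of M "\<lambda>t. D t = 0"])
    show "D u = 0" if "D (1 + u) = 0" for u using D1[of u] that by simp
  qed (rule M)
  show ?thesis unfolding good_def using fin van[of "t" for t] D0
    by (auto simp: D_def intro!: exI[of _ T])
qed

lemma good_gideal: "gideal r I ==> good r I"
proof (induction I rule: gideal_induct)
  case (step I)
  show ?case
  proof (cases "\<forall>i\<le>r. xv i \<in> I 1")
    case True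
    thus ?thesis using good_vars[OF step(1)] by blast
  next
    case False
    then obtain k where k: "k \<le> r" "xv k \<notin> I 1" by blast
    have J: "good r (gadd r I (xv k) 1)"
      using step(2)[OF gJJ[OF step(1) k(1)] gadd_greater[OF step(1) k(2)]] .
    show ?thesis
    proof (cases "gcolon r I (xv k) 1 = I")
      case True
      thus ?thesis using good_nzd[OF step(1) k(1) _ J] by blast
    next
      case False
      hence "I < gcolon r I (xv k) 1" using gcolon_ge[OF step(1) xv_hforms[OF k(1)]] by auto
      thus ?thesis using good_zero_divisor[OF step(1) k(1) step(2)[OF gKK[OF step(1) k(1)]] J] by blast
    qed
  qed
qed

lemma forms_hforms: "forms r t = hforms r t"
  by (auto simp: forms_def hforms_def monoms_def)

section \<open>The arithmetic genus and the Hilbert polynomial\<close>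

lemma var_xv: "var i = xv i"
  by (simp add: var_def xv_def)

lemma prod_var_power:
  "finite fc ==> to_laurent (\<Prod>i\<in>fc. var i) ^ N = Lm (\<Sum>i\<in>fc. psingle i N)"
proof -
  assume "finite fc"
  hence "(\<Prod>i\<in>fc. var i ^ N) = psingle (\<Sum>i\<in>fc. psingle i N) 1"
    unfolding var_xv xv_power by (induction fc rule: finite_induct) (simp_all add: mult_single)
  moreover have "to_laurent p ^ N = to_laurent (p ^ N)" for p by (induction N) (simp_all add: toL_mult)
  ultimately show ?thesis by (simp add: Lm_toL prod_power_distrib)
qed

lemma lookup_exponents: "finite fc ==> plookup (\<Sum>i\<in>fc. psingle i N) j = (if j \<in> fc then N else 0)"
  by (simp add: lookup_sum lookup_single when_def)

lemma exponents_monoms: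
  assumes "fc \<subseteq> {..r}"
  shows "(\<Sum>i\<in>fc. psingle i N) \<in> monoms r (card fc * N)" "pkeys (\<Sum>i\<in>fc. psingle i N) \<subseteq> fc"
proof -
  have fin: "finite fc" using assms finite_subset by blast
  show k: "pkeys (\<Sum>i\<in>fc. psingle i N) \<subseteq> fc" using lookup_exponents[OF fin, of N] by (auto simp: in_keys_iff split: if_splits)
  show "(\<Sum>i\<in>fc. psingle i N) \<in> monoms r (card fc * N)"
    using k assms by (auto simp: monoms_def monom_deg_superset[OF fin k] lookup_exponents[OF fin])
qed

context
  fixes r :: nat and S :: "mpoly set" and G :: "nat => mpoly set"
  assumes G: "gideal r G" and SG: "\<And>t. S \<inter> hforms r t = G t"
begin

lemma chart_key:
  assumes g: "g \<in> chart_ring r fc" and m: "m \<in> monoms r u" and f: "Lm m * g = to_laurent f"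
  shows "f \<in> hforms r u"
  unfolding hforms_iff
proof (intro allI impI)
  fix n assume "plookup f n \<noteq> 0"
  hence "intm n \<in> pkeys (Lm m * g)" unfolding f by (simp add: in_keys_iff lookup_toL)
  then obtain n' where n': "n' \<in> pkeys g" "intm n = intm m + n'" unfolding keys_Lm by blast
  have "pkeys (intm n) \<subseteq> {..r}" "monom_deg (intm n) = int u"
    using Poly_Mapping.keys_add[of "intm m" n'] g m n'(1) unfolding n'(2)
    by (auto simp: chart_ring_def monoms_def monom_deg_add monom_deg_intm keys_intm)
  thus "n \<in> monoms r u" by (simp add: monoms_def keys_intm monom_deg_intm)
qed

lemma chart_ring_Lring:
  assumes fc: "fc \<subseteq> {..r}"
  shows "chart_ring r fc = Lring r 0 fc"
proof
  have fin: "finite fc" using fc finite_subset by blast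
  show "Lring r 0 fc \<subseteq> chart_ring r fc"
  proof
    fix g assume "g \<in> Lring r 0 fc"
    then obtain u m f where m: "m \<in> monoms r u" "pkeys m \<subseteq> fc" and f: "f \<in> hforms r u" "Lm m * g = to_laurent f"
      by (auto elim: LidE)
    show "g \<in> chart_ring r fc" unfolding chart_ring_def
    proof (intro CollectI ballI)
      fix n assume "n \<in> pkeys g"
      hence k: "intm m + n \<in> pkeys (to_laurent f)" unfolding f(2)[symmetric] keys_Lm by blast
      then obtain n' where n': "intm m + n = intm n'" using lookup_toL_outside[of "intm m + n" f] by (auto simp: in_keys_iff)
      hence "n' \<in> monoms r u" using k f(1) by (auto simp: in_keys_iff lookup_toL hforms_iff)
      hence d: "pkeys (intm n') \<subseteq> {..r}" "monom_deg (intm n') = int u" by (auto simp: monoms_def keys_intm monom_deg_intm)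
      have n: "n = intm n' - intm m" using n' by (metis add_diff_cancel_left')
      have "pkeys n \<subseteq> {..r}" unfolding n using Poly_Mapping.keys_diff[of "intm n'" "intm m"] d(1) m(1)
        by (auto simp: monoms_def keys_intm)
      moreover have "i \<in> fc" if "plookup n i < 0" for i
        using that m(2) unfolding n by (auto simp: lookup_minus lookup_intm in_keys_iff subset_iff)
      moreover have "monom_deg n = 0" using d(2) m(1) by (simp add: monoms_def monom_deg_intm monom_deg_add flip: n')
      ultimately show "pkeys n \<subseteq> {..r} \<and> (\<forall>i. plookup n i < 0 --> i \<in> fc) \<and> monom_deg n = 0" by blast
    qed
  qed
  show "chart_ring r fc \<subseteq> Lring r 0 fc"
  proof
    fix g assume g: "g \<in> chart_ring r fc"
    \<comment> \<open>An exponent that dominates every negative exponent of \<open>g\<close> in the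
      variables of \<open>fc\<close>.\<close>
    define N where "N = (\<Sum>n\<in>pkeys g. \<Sum>i\<in>fc. nat (- plookup n i))"
    let ?m = "\<Sum>i\<in>fc. psingle i N"
    have "\<exists>n'. intm n' = n" if n: "n \<in> pkeys (Lm ?m * g)" for n
    proof -
      obtain n' where n': "n' \<in> pkeys g" "n = intm ?m + n'" using n unfolding keys_Lm by blast
      have "0 \<le> plookup n i" for i
      proof (cases "i \<in> fc")
        case True
        have "nat (- plookup n' i) \<le> (\<Sum>i\<in>fc. nat (- plookup n' i))" using True fin by (intro member_le_sum) auto
        also have "\<dots> \<le> N" unfolding N_def using n'(1) by (intro member_le_sum[of n' _ "\<lambda>n. \<Sum>i\<in>fc. nat (- plookup n i)"]) auto
        finally show ?thesis unfolding n'(2) using True by (simp add: lookup_add lookup_intm lookup_exponents[OF fin])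
      next
        case False
        hence "0 \<le> plookup n' i" using g n'(1) by (force simp: chart_ring_def)
        thus ?thesis unfolding n'(2) by (simp add: lookup_add lookup_intm)
      qed
      hence "intm (Poly_Mapping.map nat n) = n"
        by (intro poly_mapping_eqI) (simp add: lookup_intm Poly_Mapping.map.rep_eq when_def)
      thus ?thesis by blast
    qed
    then obtain \<phi> where \<phi>: "\<And>n. n \<in> pkeys (Lm ?m * g) ==> intm (\<phi> n) = n" by metis
    define f where "f = (\<Sum>n\<in>pkeys (Lm ?m * g). psingle (\<phi> n) (plookup (Lm ?m * g) n))"
    have "to_laurent f = (\<Sum>n\<in>pkeys (Lm ?m * g). psingle n (plookup (Lm ?m * g) n))"
      unfolding f_def using \<phi> by (simp add: toL_finite_sum toL_single)
    hence f: "Lm ?m * g = to_laurent f" by (simp flip: poly_mapping_sum_single)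
    show "g \<in> Lring r 0 fc"
      using LidI[OF exponents_monoms[OF fc, of N] _ f] chart_key[OF g exponents_monoms(1)[OF fc] f] by (simp del: of_nat_mult)
  qed
qed

lemma chart_ideal_Lid:
  assumes fc: "fc \<subseteq> {..r}"
  shows "chart_ideal r S fc = Lid r G 0 fc"
proof
  have fin: "finite fc" using fc finite_subset by blast
  have SGf: "f \<in> S" if "f \<in> G u" for f u using SG that by blast
  show "chart_ideal r S fc \<subseteq> Lid r G 0 fc"
  proof
    fix g assume "g \<in> chart_ideal r S fc"
    then obtain N f where g: "g \<in> chart_ring r fc" "f \<in> S" "Lm (\<Sum>i\<in>fc. psingle i N) * g = to_laurent f"
      unfolding chart_ideal_def prod_var_power[OF fin] by blast
    have "f \<in> G (card fc * N)" using SG g(2) chart_key[OF g(1) exponents_monoms(1)[OF fc] g(3)] by blast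
    thus "g \<in> Lid r G 0 fc" using LidI[OF exponents_monoms[OF fc, of N] _ g(3), of G 0] by (simp del: of_nat_mult)
  qed
  show "Lid r G 0 fc \<subseteq> chart_ideal r S fc"
  proof
    fix g assume g: "g \<in> Lid r G 0 fc"
    then obtain u m f where m: "m \<in> monoms r u" "pkeys m \<subseteq> fc" and f: "f \<in> G u" "Lm m * g = to_laurent f"
      by (auto elim: LidE)
    let ?n = "(\<Sum>i\<in>fc. psingle i u) - m"
    have le: "plookup m i \<le> u" for i
    proof (cases "i \<in> pkeys m")
      case True
      thus ?thesis using m(1) unfolding monoms_def monom_deg_def by (auto intro: member_le_sum)
    qed (simp add: in_keys_iff)
    have e: "?n + m = (\<Sum>i\<in>fc. psingle i u)"
      using le m(2) by (intro poly_mapping_eqI) (auto simp: lookup_add lookup_minus lookup_exponents[OF fin] in_keys_iff subset_iff)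
    have "pkeys ?n \<subseteq> pkeys (\<Sum>i\<in>fc. psingle i u)" by (auto simp: in_keys_iff lookup_minus)
    hence "?n \<in> monoms r (monom_deg ?n)" using exponents_monoms(1)[OF fc, of u] by (auto simp: monoms_def)
    hence "psingle ?n 1 * f \<in> G (monom_deg ?n + u)" by (rule gideal_mult[OF G hforms_single f(1)])
    moreover have "Lm (?n + m) * g = to_laurent (psingle ?n 1 * f)"
      unfolding Lm_add mult.assoc f(2) toL_mult by (simp add: Lm_toL)
    ultimately show "g \<in> chart_ideal r S fc"
      unfolding chart_ideal_def prod_var_power[OF fin] e
      using g SGf chart_ring_Lring[OF fc] Lid_mono[OF gideal_le_hforms[OF G]] by blast
  qed
qed

lemma simplices_faces: "simplices r (Suc n) = faces r (Suc n)"
  by (auto simp: simplices_def faces_def)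

lemma cochains_coch: "cochains r (Suc n) = coch r 0 (Suc n)"
proof -
  have "fc \<in> faces r (Suc n) ==> chart_ring r fc = Lring r 0 fc" for fc
    using chart_ring_Lring faces_sub by blast
  thus ?thesis by (simp add: cochains_def icoch_def fam_def simplices_faces cong: if_cong)
qed

lemma ideal_cochains_icoch: "ideal_cochains r S (Suc n) = icoch r G 0 (Suc n)"
proof -
  have "fc \<in> faces r (Suc n) ==> chart_ideal r S fc = Lid r G 0 fc" for fc
    using chart_ideal_Lid faces_sub by blast
  thus ?thesis by (simp add: ideal_cochains_def icoch_def fam_def simplices_faces cong: if_cong)
qed

lemma cocycles_cocyc: "cocycles r S (Suc n) = cocyc r G 0 (Suc n)"
  by (simp add: cocycles_def cv.cyc_def cochains_coch ideal_cochains_icoch)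

lemma coboundaries_cobdy: "coboundaries r S (Suc (Suc n)) = cobdy r G 0 (Suc (Suc n))"
  by (simp add: coboundaries_def cv.bdy_Suc cochains_coch ideal_cochains_icoch)

text \<open>Here the two complexes differ: \<open>cochains r 0\<close> is zero, while the augmented
  complex has the constants in index 0.\<close>

lemma coboundaries_1: "coboundaries r S 1 = icoch r G 0 1"
proof -
  have "cochains r 0 = {0}"
  proof -
    have "fc \<notin> simplices r 0" for fc using finite_subset[of fc "{..r}"] by (auto simp: simplices_def)
    thus ?thesis by (auto simp: cochains_def fun_eq_iff zero_apply)
  qed
  moreover have "cech_diff r 0 = 0" by (rule ext) (simp add: cech_diff_sg zero_apply)
  ultimately show ?thesis using ideal_cochains_icoch[of 0] by (simp add: coboundaries_def)
qed

lemma cohomology_dim_Suc: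
  "cohomology_dim r S (Suc p) = cv.qdim (cocyc r G 0 (Suc (Suc p))) (cobdy r G 0 (Suc (Suc p)))"
  unfolding cohomology_dim_def cocycles_cocyc coboundaries_cobdy
  by (rule quot_dim_qdim[OF cv.quot_space_axioms]) (rule cocyc_subspaces[OF G])+

text \<open>The augmentation term is the degree 0 part of the quotient ring. Its kernel into global
  sections is the augmented cohomology in index 0, and its image accounts for the coboundaries
  missing from the complex without augmentation.\<close>

lemma cohomology_dim_0:
  "cohomology_dim r S 0 + cv.qdim (cocyc r G 0 0) (cobdy r G 0 0) =
     cv.qdim (cocyc r G 0 1) (cobdy r G 0 1) + hz r G 0"
proof -
  let ?ZZ = "cocyc r G 0 0" and ?Z = "cocyc r G 0 1" and ?B = "cobdy r G 0 1" and ?I = "icoch r G 0 1"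
    and ?CC = "coch r 0 0" and ?II = "icoch r G 0 0"
  note sub = cocyc_subspaces[OF G] subspace_icoch[OF G] subspace_coch
  have b1: "?B = {cech_diff r x + b | x b. x \<in> ?CC \<and> b \<in> ?I}" using cv.bdy_Suc[of "cech_diff r" _ _ 0] by simp
  have IB: "?I \<subseteq> ?B" by (rule sub(4))
  have BZ: "?B \<subseteq> ?Z" by (rule sub(3))
  have ZC: "?ZZ \<subseteq> ?CC" by (auto simp: cv.cyc_def)
  have IZ: "?II \<subseteq> ?ZZ" using sub(3)[of 0 0] by (simp add: cv.bdy_0)
  have fC: "cv.finq ?CC ?II" and qC: "cv.qdim ?CC ?II = hz r G 0" by (rule coch_0[OF G])+
  have 1: "hz r G 0 = cv.qdim ?CC ?ZZ + cv.qdim ?ZZ ?II"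
    using cv.qdim_trans[OF sub(5,1,6) ZC IZ fC] qC by simp
  have fCZ: "cv.finq ?CC ?ZZ" using cv.finq_trans_iff[OF sub(5,1,6) ZC IZ] fC by blast
  have m1: "cech_diff r v \<in> ?B" if "v \<in> ?CC" for v
  proof -
    have "cech_diff r v = cech_diff r v + 0" by simp
    thus ?thesis unfolding b1 using that cv.subspace_0[OF subspace_icoch[OF G]] by (intro CollectI exI conjI)
  qed
  have m2: "\<exists>v\<in>?CC. u - cech_diff r v \<in> ?I" if u: "u \<in> ?B" for u
  proof -
    obtain x b where x: "u = cech_diff r x + b" "x \<in> ?CC" "b \<in> ?I" using u unfolding b1 by blast
    hence "u - cech_diff r x \<in> ?I" by simp
    thus ?thesis using x(2) by blast
  qed
  have m3: "v \<in> ?ZZ \<longleftrightarrow> cech_diff r v \<in> ?I" if "v \<in> ?CC" for v using that by (simp add: cv.cyc_def)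
  have fBI: "cv.finq ?B ?I" and qBI: "cv.qdim ?B ?I = cv.qdim ?CC ?ZZ"
    using cvp.finq_map[OF linear_cech sub(6,5,2) m1 m2 m3 ZC IB] fCZ by metis+
  have "cv.finq ?Z ?B" using good_gideal[OF G] by (simp add: good_def)
  hence fZI: "cv.finq ?Z ?I" using cv.finq_trans_iff[OF sub(5,2,1) BZ IB] fBI by blast
  have "cohomology_dim r S 0 = cv.qdim ?Z ?I"
    unfolding cohomology_dim_def cocycles_cocyc coboundaries_1[unfolded One_nat_def] One_nat_def
    by (rule quot_dim_qdim[OF cv.quot_space_axioms sub(5,1)]) (use IB BZ in auto)
  also have "\<dots> = cv.qdim ?Z ?B + cv.qdim ?B ?I" by (rule cv.qdim_trans[OF sub(5,2,1) BZ IB fZI])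
  finally show ?thesis using 1 qBI by (simp add: cv.bdy_0)
qed

text \<open>Undoing the augmentation writes the Euler characteristic of the structure sheaf as
  Hilbert function minus \<open>euler\<close> in degree 0, which is the value of the Hilbert
  polynomial.\<close>

lemma arith_genus_hpol: "real_of_int (arith_genus r S) = 1 - poly (hpol r G) 0"
proof -
  define q where "q n = int (cv.qdim (cocyc r G 0 n) (cobdy r G 0 n))" for n
  have a0: "int (cohomology_dim r S 0) + q 0 = q 1 + int (hz r G 0)"
    using arg_cong[OF cohomology_dim_0, of int] by (simp add: q_def)
  have "euler r G 0 = (\<Sum>n\<le>Suc r. (- 1) ^ n * q n)" by (simp add: euler_def q_def)
  also have "\<dots> = q 0 - (\<Sum>p\<le>r. (- 1) ^ p * q (Suc p))"
    by (subst sum.atMost_Suc_shift) (simp add: sum_negf)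
  finally have e: "euler r G 0 = q 0 - (\<Sum>p\<le>r. (- 1) ^ p * q (Suc p))" .
  have "(\<Sum>p\<le>r. (- 1) ^ p * q (Suc p)) = q 1 + (\<Sum>p\<in>{..r} - {0}. (- 1) ^ p * q (Suc p))"
    by (subst sum.remove[of _ 0]) simp_all
  moreover have "euler_char r S = int (cohomology_dim r S 0) + (\<Sum>p\<in>{..r} - {0}. (- 1) ^ p * int (cohomology_dim r S p))"
    unfolding euler_char_def by (subst sum.remove[of _ 0]) simp_all
  moreover have "(\<Sum>p\<in>{..r} - {0}. (- 1) ^ p * int (cohomology_dim r S p)) = (\<Sum>p\<in>{..r} - {0}. (- 1) ^ p * q (Suc p))"
  proof (rule sum.cong[OF refl])
    fix p assume "p \<in> {..r} - {0}"
    then obtain p' where "p = Suc p'" by (cases p) auto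
    thus "(- 1) ^ p * int (cohomology_dim r S p) = (- 1) ^ p * q (Suc p)"
      by (simp add: cohomology_dim_Suc q_def)
  qed
  ultimately have "euler_char r S = int (hz r G 0) - euler r G 0" using e a0 by linarith
  moreover have "real_of_int (euler r G 0) = real (hz r G 0) - poly (hpol r G) 0"
    using good_gideal[OF G] by (simp add: good_def)
  ultimately show ?thesis by (simp add: arith_genus_def)
qed

end

section \<open>Homogeneous ideals and their graded pieces\<close>

definition polys :: "nat => mpoly set" where
  "polys r = {p. \<forall>m\<in>pkeys p. pkeys m \<subseteq> {..r}}"

lemma carrier_polys: "carrier (coord_ring r) = polys r"
  by (simp add: polys_def)

interpretation R: cring "coord_ring r" for r
  by (rule cring_coord_ring)

lemma polys_add: "p \<in> polys r ==> q \<in> polys r ==> p + q \<in> polys r"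
  and polys_mult: "p \<in> polys r ==> q \<in> polys r ==> p * q \<in> polys r"
  and polys_0: "0 \<in> polys r" and polys_1: "1 \<in> polys r"
  using R.add.m_closed[of p r q] R.m_closed[of p r q] R.zero_closed[of r] R.one_closed[of r]
  unfolding carrier_polys by simp_all

lemma polys_uminus: "p \<in> polys r ==> - p \<in> polys r"
  by (simp add: polys_def in_keys_iff)

lemma hforms_polys: "p \<in> hforms r t ==> p \<in> polys r"
  by (auto simp: hforms_def monoms_def polys_def)

definition hcomp :: "nat => mpoly => mpoly" where
  "hcomp t p = (\<Sum>m\<in>{m \<in> pkeys p. monom_deg m = t}. psingle m (plookup p m))"

lemma lookup_hcomp: "plookup (hcomp t p) m = (if monom_deg m = t then plookup p m else 0)"
proof -
  have "plookup (hcomp t p) m = (\<Sum>n\<in>{m \<in> pkeys p. monom_deg m = t}. if n = m then plookup p n else 0)"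
    by (simp add: hcomp_def Poly_Mapping.lookup_sum lookup_single when_def)
  thus ?thesis by (auto simp: in_keys_iff)
qed

lemma hcomp_add: "hcomp t (p + q) = hcomp t p + hcomp t q"
  by (rule poly_mapping_eqI) (simp add: lookup_hcomp lookup_add)

lemma hcomp_0 [simp]: "hcomp t 0 = 0"
  by (rule poly_mapping_eqI) (simp add: lookup_hcomp)

lemma hcomp_sum: "hcomp t (sum f A) = (\<Sum>i\<in>A. hcomp t (f i))"
  by (induction A rule: infinite_finite_induct) (simp_all add: hcomp_add)

lemma hcomp_hforms: "p \<in> polys r ==> hcomp t p \<in> hforms r t"
  by (auto simp: hforms_iff monoms_def polys_def lookup_hcomp in_keys_iff split: if_splits)

lemma hcomp_form: "p \<in> hforms r u ==> hcomp t p = (if t = u then p else 0)"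
  by (rule poly_mapping_eqI) (auto simp: lookup_hcomp hforms_iff monoms_def)

lemma hcomp_bound: "\<exists>T. \<forall>t\<ge>T. hcomp t p = 0"
proof (intro exI allI impI)
  fix t assume t: "t \<ge> Suc (Max (insert 0 (monom_deg ` pkeys p)))"
  have "monom_deg m \<le> Max (insert 0 (monom_deg ` pkeys p))" if "m \<in> pkeys p" for m
    using that by (intro Max_ge) auto
  hence "{m \<in> pkeys p. monom_deg m = t} = {}" using t by fastforce
  thus "hcomp t p = 0" unfolding hcomp_def by (simp only: sum.empty)
qed

lemma hcomp_decomp:
  assumes "\<And>t. t \<ge> T ==> hcomp t p = 0"
  shows "p = (\<Sum>t<T. hcomp t p)"
proof (rule poly_mapping_eqI)
  fix m
  have "plookup (\<Sum>t<T. hcomp t p) m = (\<Sum>t<T. if t = monom_deg m then plookup p m else 0)"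
    by (simp add: Poly_Mapping.lookup_sum lookup_hcomp eq_commute)
  moreover have "plookup p m = 0" if "\<not> monom_deg m < T"
    using assms[of "monom_deg m"] lookup_hcomp[of "monom_deg m" p m] that by simp
  ultimately show "plookup p m = plookup (\<Sum>t<T. hcomp t p) m" by auto
qed

lemma hcomp_mult_form:
  assumes q: "q \<in> hforms r k" and p: "p \<in> polys r"
  shows "hcomp t (q * p) = (if k \<le> t then q * hcomp (t - k) p else 0)"
proof -
  obtain T where T: "\<And>t. t \<ge> T ==> hcomp t p = 0" using hcomp_bound by blast
  have "hcomp t (q * p) = (\<Sum>u<T. hcomp t (q * hcomp u p))"
    by (subst hcomp_decomp[OF T]) (simp_all add: sum_distrib_left hcomp_sum)
  also have "\<dots> = (\<Sum>u<T. if u = t - k then if k \<le> t then q * hcomp u p else 0 else 0)"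
    by (intro sum.cong refl) (auto simp: hcomp_form[OF hforms_mult[OF q hcomp_hforms[OF p]]])
  also have "\<dots> = (if k \<le> t then q * hcomp (t - k) p else 0)" using T[of "t - k"] by auto
  finally show ?thesis .
qed

lemma hcomp_mult:
  assumes p: "p \<in> polys r" and q: "q \<in> polys r"
  shows "hcomp t (p * q) = (\<Sum>u\<le>t. hcomp u p * hcomp (t - u) q)"
proof -
  obtain T where T: "\<And>t. t \<ge> T ==> hcomp t p = 0" using hcomp_bound by blast
  have "hcomp t (p * q) = (\<Sum>u<T + Suc t. hcomp t (hcomp u p * q))"
    by (subst hcomp_decomp[of "T + Suc t" p]) (simp_all add: T sum_distrib_right hcomp_sum del: add_Suc_right)
  also have "\<dots> = (\<Sum>u\<le>t. hcomp u p * hcomp (t - u) q)"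
    unfolding hcomp_mult_form[OF hcomp_hforms[OF p] q] by (rule sum.mono_neutral_cong_right) auto
  finally show ?thesis .
qed

lemma ideal_iff:
  "ideal I (coord_ring r) \<longleftrightarrow> I \<subseteq> polys r \<and> 0 \<in> I \<and> (\<forall>a\<in>I. \<forall>b\<in>I. a + b \<in> I) \<and> (\<forall>q\<in>polys r. \<forall>a\<in>I. q * a \<in> I)"
proof
  assume "ideal I (coord_ring r)"
  then interpret ideal I "coord_ring r" .
  show "I \<subseteq> polys r \<and> 0 \<in> I \<and> (\<forall>a\<in>I. \<forall>b\<in>I. a + b \<in> I) \<and> (\<forall>q\<in>polys r. \<forall>a\<in>I. q * a \<in> I)"
    using a_subset zero_closed a_closed I_l_closed unfolding carrier_polys by simp
next
  assume I: "I \<subseteq> polys r \<and> 0 \<in> I \<and> (\<forall>a\<in>I. \<forall>b\<in>I. a + b \<in> I) \<and> (\<forall>q\<in>polys r. \<forall>a\<in>I. q * a \<in> I)"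
  have neg: "- a \<in> I" if a: "a \<in> I" for a
  proof -
    have "- 1 * a \<in> I" using I a polys_uminus[OF polys_1] by blast
    thus ?thesis by simp
  qed
  have inv: "\<ominus>\<^bsub>coord_ring r\<^esub> a = - a" if "a \<in> polys r" for a
    using that polys_uminus[OF that] by (intro R.minus_equality) (simp_all add: polys_def)
  have "subgroup I (add_monoid (coord_ring r))"
  proof (rule R.add.subgroupI)
    show "\<ominus>\<^bsub>coord_ring r\<^esub> a \<in> I" if a: "a \<in> I" for a using inv neg a I by auto
  qed (use I in \<open>auto simp: carrier_polys simp del: coord_ring_simps(1)\<close>)
  thus "ideal I (coord_ring r)"
  proof (rule idealI[OF R.ring_axioms])
    fix a x assume "a \<in> I" "x \<in> carrier (coord_ring r)"
    hence "x * a \<in> I" using I unfolding carrier_polys by blast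
    thus "x \<otimes>\<^bsub>coord_ring r\<^esub> a \<in> I" "a \<otimes>\<^bsub>coord_ring r\<^esub> x \<in> I" by (simp_all add: mult.commute)
  qed
qed

lemma ideal_sum: "ideal I (coord_ring r) ==> (\<And>i. i \<in> A ==> f i \<in> I) ==> sum f A \<in> I"
  by (induction A rule: infinite_finite_induct) (simp_all add: ideal_iff)

section \<open>Passage between homogeneous ideals and graded families\<close>

definition gpart :: "nat => mpoly set => nat => mpoly set" where
  "gpart r I t = I \<inter> hforms r t"

text \<open>Inverse to \<open>gpart\<close> on homogeneous ideals: the ideal is recovered from its
  pieces through homogeneous components.\<close>

definition gunion :: "nat => (nat => mpoly set) => mpoly set" where
  "gunion r G = {p \<in> polys r. \<forall>t. hcomp t p \<in> G t}"

lemma gideal_gpart: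
  assumes I: "ideal I (coord_ring r)"
  shows "gideal r (gpart r I)"
proof -
  note i = I[unfolded ideal_iff]
  have "sc c p \<in> gpart r I t" if "p \<in> gpart r I t" for c p t
    using that i hforms_sc1[of c r] hforms_polys pv.subspace_scale[OF subspace_hforms, of p r t c] sc_mult_left[of c 1 p]
    unfolding gpart_def by fastforce
  moreover have "gpart r I t \<subseteq> hforms r t" for t by (auto simp: gpart_def)
  moreover have "0 \<in> gpart r I t" for t using i by (simp add: gpart_def)
  moreover have "p + q \<in> gpart r I t" if "p \<in> gpart r I t" "q \<in> gpart r I t" for p q t
    using that i by (simp add: gpart_def hforms_add)
  ultimately show ?thesis unfolding gideal_def
    using i hforms_mult hforms_polys by (auto intro!: pv.subspaceI simp: gpart_def)
qed

lemma gunion_forms: "gideal r G ==> p \<in> G t ==> p \<in> gunion r G"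
proof -
  assume G: "gideal r G" and p: "p \<in> G t"
  have "p \<in> hforms r t" using gideal_forms[OF G] p by blast
  thus ?thesis using p gideal_0[OF G] hcomp_form[of p r t] by (simp add: gunion_def hforms_polys)
qed

lemma ideal_gunion:
  assumes G: "gideal r G"
  shows "ideal (gunion r G) (coord_ring r)"
proof -
  have add: "a + b \<in> gunion r G" if "a \<in> gunion r G" "b \<in> gunion r G" for a b
    using that gideal_add[OF G] by (simp add: gunion_def polys_add hcomp_add)
  have z: "0 \<in> gunion r G" using gideal_0[OF G] by (simp add: gunion_def polys_0)
  have "q * a \<in> gunion r G" if q: "q \<in> polys r" and a: "a \<in> gunion r G" for q a
  proof -
    have p: "a \<in> polys r" "hcomp t a \<in> G t" for t using a by (auto simp: gunion_def)
    have "hcomp u q * hcomp (t - u) a \<in> G t" if "u \<le> t" for u t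
      using gideal_mult[OF G hcomp_hforms[OF q] p(2), of u "t - u"] that by simp
    hence "hcomp t (q * a) \<in> G t" for t unfolding hcomp_mult[OF q p(1)] by (intro gideal_sum[OF G]) simp
    thus ?thesis using polys_mult[OF q p(1)] by (simp add: gunion_def)
  qed
  thus ?thesis unfolding ideal_iff using add z by (auto simp: gunion_def)
qed

lemma gpart_gunion:
  assumes G: "gideal r G"
  shows "gpart r (gunion r G) = G"
proof (rule ext)
  fix t
  have "p \<in> G t" if "p \<in> gunion r G" "p \<in> hforms r t" for p
  proof -
    have "hcomp t p = p" using hcomp_form[OF that(2), of t] by simp
    moreover have "hcomp t p \<in> G t" using that(1) by (simp add: gunion_def)
    ultimately show ?thesis by simp
  qed
  thus "gpart r (gunion r G) t = G t"
    using gunion_forms[OF G, of _ t] gideal_forms[OF G, of t] unfolding gpart_def by blast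
qed

lemma gunion_mono: "G \<le> H ==> gunion r G \<subseteq> gunion r H"
  by (auto simp: gunion_def le_fun_def)

lemma gpart_mono: "I \<subseteq> J ==> gpart r I \<le> gpart r J"
  by (auto simp: gpart_def le_fun_def)

lemma gunion_le_iff: "gideal r G ==> gideal r H ==> gunion r G \<subseteq> gunion r H \<longleftrightarrow> G \<le> H"
  using gunion_mono gpart_mono gpart_gunion by metis

lemma gunion_subset_ideal:
  assumes I: "ideal I (coord_ring r)" and G: "\<And>t. G t \<subseteq> I"
  shows "gunion r G \<subseteq> I"
proof
  fix p assume p: "p \<in> gunion r G"
  obtain T where T: "\<And>t. t \<ge> T ==> hcomp t p = 0" using hcomp_bound by blast
  have "(\<Sum>t<T. hcomp t p) \<in> I" using p G by (intro ideal_sum[OF I]) (auto simp: gunion_def)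
  thus "p \<in> I" using hcomp_decomp[OF T] by simp
qed

lemma homogeneous_gunion:
  assumes "homogeneous_ideal r I"
  shows "gideal r (gpart r I)" "gunion r (gpart r I) = I"
proof -
  have I: "ideal I (coord_ring r)" "I = Idl\<^bsub>coord_ring r\<^esub> (I \<inter> (\<Union>e. hforms r e))"
    using assms unfolding homogeneous_ideal_def forms_hforms by blast+
  show g: "gideal r (gpart r I)" by (rule gideal_gpart[OF I(1)])
  have "I \<inter> (\<Union>e. hforms r e) \<subseteq> gunion r (gpart r I)"
    using gunion_forms[OF g] by (auto simp: gpart_def)
  hence "Idl\<^bsub>coord_ring r\<^esub> (I \<inter> (\<Union>e. hforms r e)) \<subseteq> gunion r (gpart r I)"
    by (rule R.genideal_minimal[OF ideal_gunion[OF g]])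
  thus "gunion r (gpart r I) = I"
    using I(2) gunion_subset_ideal[OF I(1), of "gpart r I"] by (auto simp: gpart_def)
qed

lemma homogeneous_ideal_gunion:
  assumes G: "gideal r G"
  shows "homogeneous_ideal r (gunion r G)"
proof -
  let ?F = "gunion r G \<inter> (\<Union>e. hforms r e)"
  have sub: "?F \<subseteq> carrier (coord_ring r)" unfolding carrier_polys by (auto simp: gunion_def)
  have "G t \<subseteq> Idl\<^bsub>coord_ring r\<^esub> ?F" for t
    using R.genideal_self[OF sub] gunion_forms[OF G] gideal_forms[OF G] by blast
  hence "gunion r G \<subseteq> Idl\<^bsub>coord_ring r\<^esub> ?F" by (intro gunion_subset_ideal R.genideal_ideal[OF sub])
  moreover have "Idl\<^bsub>coord_ring r\<^esub> ?F \<subseteq> gunion r G" by (rule R.genideal_minimal[OF ideal_gunion[OF G]]) blast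
  ultimately show ?thesis unfolding homogeneous_ideal_def forms_hforms using ideal_gunion[OF G] by blast
qed

text \<open>Pigeonhole: a monomial of degree \<open>(r + 1) * N\<close> in \<open>r + 1\<close>
  variables has some exponent at least \<open>N\<close>.\<close>

lemma full_degree_powers:
  assumes J: "gideal r (J :: nat => mpoly set)" and N: "\<And>i. i \<le> r ==> xv i ^ N \<in> J N"
  shows "J (Suc r * N) = hforms r (Suc r * N)"
proof
  show "hforms r (Suc r * N) \<subseteq> J (Suc r * N)"
  proof
    fix p :: mpoly assume p: "p \<in> hforms r (Suc r * N)"
    have "psingle m (plookup p m) \<in> J (Suc r * N)" if "m \<in> pkeys p" for m
    proof -
      have m: "pkeys m \<subseteq> {..r}" "(\<Sum>i\<le>r. plookup m i) = Suc r * N"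
        using p that monom_deg_superset[of "{..r}" m] by (auto simp: hforms_def monoms_def)
      have "\<exists>i\<le>r. N \<le> plookup m i"
      proof (rule ccontr)
        assume "\<not> ?thesis"
        hence "(\<Sum>i\<le>r. plookup m i) < (\<Sum>i\<le>r. N)" by (intro sum_strict_mono) auto
        thus False using m(2) by simp
      qed
      then obtain i where i: "i \<le> r" "N \<le> plookup m i" by blast
      let ?n = "m - psingle i N"
      have e: "psingle i N + ?n = m"
        using i(2) by (intro poly_mapping_eqI) (auto simp: lookup_add lookup_minus lookup_single when_def)
      have x: "xv i ^ k = psingle (psingle i k) (1::complex)" for k
        by (induction k) (simp_all add: xv_def mult_single flip: single_add)
      have "pkeys ?n \<subseteq> pkeys m" by (auto simp: in_keys_iff lookup_minus)
      moreover have "monom_deg ?n + N = Suc r * N"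
        using monom_deg_add[of "psingle i N" ?n] m e monom_deg_superset[of "{..r}" m] by simp
      ultimately have "?n \<in> monoms r (r * N)" using m(1) by (auto simp: monoms_def)
      hence "psingle ?n (plookup p m) * xv i ^ N \<in> J (r * N + N)"
        using gideal_mult[OF J hforms_single N[OF i(1)]] by blast
      moreover have "psingle ?n (plookup p m) * xv i ^ N = psingle m (plookup p m)"
        using e by (simp add: x mult_single add.commute)
      ultimately show ?thesis by (simp add: add.commute)
    qed
    hence "(\<Sum>m\<in>pkeys p. psingle m (plookup p m)) \<in> J (Suc r * N)" by (intro gideal_sum[OF J])
    thus "p \<in> J (Suc r * N)" using poly_mapping_sum_single[of p] by simp
  qed
qed (rule gideal_forms[OF J])

text \<open>The exponents in \<open>saturation\<close> depend on the variable, those in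
  \<open>gsat\<close> on the degree of the component. The sum of the finitely many exponents
  concerned, over the variables or over the nonzero components, serves as a common one.\<close>

lemma saturation_gunion:
  assumes G: "gideal r G"
  shows "saturation r (gunion r G) = gunion r (gsat r G)"
proof -
  have mem: "xv i ^ N * p \<in> gunion r G \<longleftrightarrow> (\<forall>t. xv i ^ N * hcomp t p \<in> G (N + t))"
    if i: "i \<le> r" and p: "p \<in> polys r" for i N p
  proof -
    have x: "xv i ^ N \<in> hforms r N" using hforms_power[OF xv_hforms[OF i], of N] by simp
    have "(\<forall>t. hcomp t (xv i ^ N * p) \<in> G t) \<longleftrightarrow> (\<forall>t. xv i ^ N * hcomp t p \<in> G (N + t))"
      unfolding hcomp_mult_form[OF x p] using gideal_0[OF G] by (auto dest: spec[of _ "N + _"]) (metis le_add_diff_inverse)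
    thus ?thesis using polys_mult[OF hforms_polys[OF x] p] by (simp add: gunion_def)
  qed
  show ?thesis
  proof
    show "saturation r (gunion r G) \<subseteq> gunion r (gsat r G)"
    proof
      fix p assume "p \<in> saturation r (gunion r G)"
      hence p: "p \<in> polys r" "\<forall>i\<le>r. \<exists>N. xv i ^ N * p \<in> gunion r G"
        unfolding saturation_def carrier_polys var_xv by auto
      then obtain f where f: "\<And>i. i \<le> r ==> xv i ^ f i * p \<in> gunion r G" by metis
      have "hcomp t p \<in> gsat r G t" for t
      proof -
        let ?h = "hcomp t p" and ?N = "\<Sum>i\<le>r. f i"
        let ?J = "gcolon r G ?h t"
        have J: "gideal r ?J" by (rule gideal_gcolon[OF G])
        have x: "xv i ^ ?N \<in> ?J ?N" if i: "i \<le> r" for i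
        proof -
          have "f i \<le> ?N" using i by (intro member_le_sum) auto
          then obtain k where k: "?N = k + f i" by (metis add.commute le_Suc_ex)
          have "xv i ^ f i * ?h \<in> G (f i + t)" using mem[OF i p(1)] f[OF i] by blast
          hence "xv i ^ k * (xv i ^ f i * ?h) \<in> G (k + (f i + t))"
            using gideal_mult[OF G] hforms_power[OF xv_hforms[OF i], of k] by simp
          thus ?thesis using hforms_power[OF xv_hforms[OF i], of ?N]
            by (simp add: gcolon_def k power_add mult_ac add_ac)
        qed
        have "?J (Suc r * ?N) = hforms r (Suc r * ?N)" by (rule full_degree_powers[OF J x])
        hence "\<forall>q\<in>hforms r (Suc r * ?N). q * ?h \<in> G (Suc r * ?N + t)"
          by (auto simp: gcolon_def mult.commute add.commute)
        thus ?thesis unfolding gsat_def using hcomp_hforms[OF p(1)] by blast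
      qed
      thus "p \<in> gunion r (gsat r G)" using p(1) by (simp add: gunion_def)
    qed
    show "gunion r (gsat r G) \<subseteq> saturation r (gunion r G)"
    proof
      fix p assume "p \<in> gunion r (gsat r G)"
      hence p: "p \<in> polys r" "\<And>t. hcomp t p \<in> gsat r G t" by (auto simp: gunion_def)
      have "\<exists>N. \<forall>q\<in>hforms r N. q * hcomp t p \<in> G (N + t)" for t using p(2)[of t] by (simp add: gsat_def)
      then obtain f where f: "\<And>t. \<forall>q\<in>hforms r (f t). q * hcomp t p \<in> G (f t + t)" by metis
      obtain T where T: "\<And>t. t \<ge> T ==> hcomp t p = 0" using hcomp_bound by blast
      let ?N = "\<Sum>t<T. f t"
      have "xv i ^ ?N * hcomp t p \<in> G (?N + t)" if i: "i \<le> r" for i t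
      proof (cases "t < T")
        case True
        hence "f t \<le> ?N" by (intro member_le_sum) auto
        from absorb_Suc[OF G f this] show ?thesis using hforms_power[OF xv_hforms[OF i], of ?N] by (metis mult.right_neutral)
      qed (simp add: T gideal_0[OF G])
      hence "\<forall>i\<le>r. \<exists>N. xv i ^ N * p \<in> gunion r G" using mem[OF _ p(1)] by blast
      thus "p \<in> saturation r (gunion r G)" unfolding saturation_def carrier_polys var_xv using p(1) by simp
    qed
  qed
qed

lemma closed_subschemeD:
  assumes "closed_subscheme r I"
  shows "gideal r (gpart r I)" "gunion r (gpart r I) = I" "gsat r (gpart r I) = gpart r I"
proof -
  show g: "gideal r (gpart r I)" and u: "gunion r (gpart r I) = I"
    using assms homogeneous_gunion unfolding closed_subscheme_def by blast+
  have "gunion r (gsat r (gpart r I)) = I"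
    using saturation_gunion[OF g] u assms unfolding closed_subscheme_def by simp
  thus "gsat r (gpart r I) = gpart r I" using gpart_gunion[OF gideal_gsat[OF g]] by simp
qed

lemma closed_subscheme_gunion:
  assumes "gideal r G" "gsat r G = G"
  shows "closed_subscheme r (gunion r G)"
  unfolding closed_subscheme_def using homogeneous_ideal_gunion[OF assms(1)] saturation_gunion[OF assms(1)] assms(2) by simp

lemma integral_subschemeD:
  assumes "integral_subscheme r P"
  shows "gprime r (gpart r P)" "relevant r (gpart r P)"
proof -
  have cl: "closed_subscheme r P" and pr: "primeideal P (coord_ring r)"
    using assms by (auto simp: integral_subscheme_def)
  note c = closed_subschemeD[OF cl]
  interpret primeideal P "coord_ring r" by (rule pr)
  have one: "1 \<notin> P" using I_notcarr one_imp_carrier by auto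
  have pr': "a \<in> P \<or> b \<in> P" if "a \<in> polys r" "b \<in> polys r" "a * b \<in> P" for a b
    using I_prime[of a b] that unfolding carrier_polys by simp
  show "gprime r (gpart r P)"
    unfolding gprime_def using c(1) one pr' hforms_polys by (auto simp: gpart_def)
  show "relevant r (gpart r P)"
  proof (rule ccontr)
    assume "\<not> ?thesis"
    hence "\<forall>i\<le>r. xv i \<in> P" using xv_hforms by (auto simp: relevant_def gpart_def)
    hence "\<forall>i\<le>r. \<exists>N. var i ^ N * 1 \<in> P" unfolding var_xv by (metis power_one_right mult.right_neutral)
    hence "1 \<in> saturation r P" unfolding saturation_def carrier_polys using polys_1 by blast
    thus False using cl one by (simp add: closed_subscheme_def)
  qed
qed

text \<open>Primality for forms gives primality for all elements: look at the highest component
  outside \<open>P\<close> of each factor. In the product degree all other contributions lie in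
  \<open>P\<close>.\<close>

lemma integral_subscheme_gunion:
  assumes P: "gprime r P" and rel: "relevant r P"
  shows "integral_subscheme r (gunion r P)"
proof -
  note gP = gprime_gideal[OF P]
  have "primeideal (gunion r P) (coord_ring r)"
  proof (rule primeidealI[OF ideal_gunion[OF gP] cring_coord_ring])
    have "hcomp 0 1 = 1" using hcomp_form[OF hforms_1, of 0] by simp
    moreover have "1 \<notin> P 0" using P by (simp add: gprime_def)
    ultimately have "1 \<notin> gunion r P" unfolding gunion_def by (metis (mono_tags, lifting) mem_Collect_eq)
    thus "carrier (coord_ring r) \<noteq> gunion r P" unfolding carrier_polys using polys_1 by blast
    fix a b assume "a \<in> carrier (coord_ring r)" "b \<in> carrier (coord_ring r)"
      and "a \<otimes>\<^bsub>coord_ring r\<^esub> b \<in> gunion r P"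
    hence ab: "a \<in> polys r" "b \<in> polys r" "a * b \<in> gunion r P" unfolding carrier_polys by simp_all
    show "a \<in> gunion r P \<or> b \<in> gunion r P"
    proof (rule ccontr)
      assume n: "\<not> ?thesis"
      obtain T where T: "\<And>t. t \<ge> T ==> hcomp t a = 0" using hcomp_bound by blast
      obtain U where U: "\<And>t. t \<ge> U ==> hcomp t b = 0" using hcomp_bound by blast
      have "\<exists>i. hcomp i a \<notin> P i" "\<exists>j. hcomp j b \<notin> P j" using n ab by (auto simp: gunion_def)
      moreover have "i < T" if "hcomp i a \<notin> P i" for i using that T[of i] gideal_0[OF gP] by (cases "i < T") auto
      moreover have "j < U" if "hcomp j b \<notin> P j" for j using that U[of j] gideal_0[OF gP] by (cases "j < U") auto
      ultimately obtain i j where i: "hcomp i a \<notin> P i" "\<And>i'. i < i' ==> hcomp i' a \<in> P i'"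
        and j: "hcomp j b \<notin> P j" "\<And>j'. j < j' ==> hcomp j' b \<in> P j'"
        using ex_has_greatest_nat[of "\<lambda>i. hcomp i a \<notin> P i" _ id T] ex_has_greatest_nat[of "\<lambda>j. hcomp j b \<notin> P j" _ id U]
        by (metis id_apply less_imp_le not_less)
      let ?f = "\<lambda>u. hcomp u a * hcomp (i + j - u) b"
      have "hcomp (i + j) (a * b) = ?f i + sum ?f ({..i + j} - {i})"
        unfolding hcomp_mult[OF ab(1,2)] by (intro sum.remove) auto
      hence e: "hcomp i a * hcomp j b = hcomp (i + j) (a * b) - sum ?f ({..i + j} - {i})" by simp
      have "?f u \<in> P (i + j)" if u: "u \<in> {..i + j} - {i}" for u
      proof (cases "i < u")
        case True
        thus ?thesis using gideal_mult[OF gP hcomp_hforms[OF ab(2)] i(2), of u "i + j - u"] u by (simp add: mult.commute)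
      next
        case False
        thus ?thesis using gideal_mult[OF gP hcomp_hforms[OF ab(1)] j(2), of "i + j - u" u] u by simp
      qed
      hence "hcomp i a * hcomp j b \<in> P (i + j)"
        unfolding e using ab(3) by (intro gideal_diff[OF gP] gideal_sum[OF gP]) (auto simp: gunion_def)
      thus False using gprimeD[OF P hcomp_hforms[OF ab(1)] hcomp_hforms[OF ab(2)]] i(1) j(1) by blast
    qed
  qed
  thus ?thesis unfolding integral_subscheme_def
    using closed_subscheme_gunion[OF gP gprime_saturated[OF P rel]] by blast
qed

lemma points_gunion:
  assumes "closed_subscheme r Z"
  shows "points r Z = gunion r ` {P. gprime r P \<and> relevant r P \<and> gpart r Z \<le> P}"
proof -
  note Z = closed_subschemeD[OF assms]
  have "gunion r P \<in> points r Z" if "gprime r P" "relevant r P" "gpart r Z \<le> P" for P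
    using integral_subscheme_gunion[OF that(1,2)] gunion_mono[OF that(3), of r] Z(2) by (simp add: points_def)
  moreover have "P \<in> gunion r ` {P. gprime r P \<and> relevant r P \<and> gpart r Z \<le> P}" if P: "P \<in> points r Z" for P
  proof (rule image_eqI)
    have i: "integral_subscheme r P" and ZP: "Z \<subseteq> P" using P by (auto simp: points_def)
    show "P = gunion r (gpart r P)" using i closed_subschemeD(2) by (simp add: integral_subscheme_def)
    show "gpart r P \<in> {P. gprime r P \<and> relevant r P \<and> gpart r Z \<le> P}"
      using integral_subschemeD[OF i] gpart_mono[OF ZP] by blast
  qed
  ultimately show ?thesis by blast
qed

lemma hilbert_fun_hilb:
  assumes "closed_subscheme r I"
  shows "hilbert_fun r I t = hilb r (gpart r I) t"
proof -
  note g = closed_subschemeD(1)[OF assms]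
  show ?thesis unfolding hilbert_fun_def hilb_def forms_hforms poly_scale_sc gpart_def
    using quot_dim_qdim[OF pv.quot_space_axioms gideal_subspace[OF g] subspace_hforms] by (simp add: gpart_def)
qed

lemma hilbert_poly_hpol: "closed_subscheme r I ==> hilbert_poly r I = hpol r (gpart r I)"
  unfolding hilbert_poly_def hpol_def by (simp add: hilbert_fun_hilb)

lemma arith_genus_closed:
  assumes "closed_subscheme r I"
  shows "real_of_int (arith_genus r I) = 1 - poly (hpol r (gpart r I)) 0"
  using arith_genus_hpol[OF closed_subschemeD(1)[OF assms], of I] by (simp add: gpart_def)

section \<open>Dimension and the degree of the Hilbert polynomial\<close>

lemma coeff_pcompose_shift:
  fixes p :: "real poly"
  shows "degree p \<le> n ==> coeff (pcompose p [:a, 1:]) n = coeff p n"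
    and "degree p \<le> Suc n ==> coeff (pcompose p [:a, 1:]) n = coeff p n + real (Suc n) * a * coeff p (Suc n)"
proof -
  have deg: "degree (pcompose p [:a, 1:]) = degree p" for p :: "real poly" by (simp add: degree_pcompose)
  have 1: "degree p \<le> n ==> coeff (pcompose p [:a, 1:]) n = coeff p n" for n and p :: "real poly"
    using lead_coeff_comp[of "[:a, 1:]" p] deg[of p] by (cases "degree p = n") (simp_all add: coeff_eq_0)
  show "degree p \<le> n ==> coeff (pcompose p [:a, 1:]) n = coeff p n" by (rule 1)
  show "degree p \<le> Suc n ==> coeff (pcompose p [:a, 1:]) n = coeff p n + real (Suc n) * a * coeff p (Suc n)"
  proof (induction p arbitrary: n)
    case (pCons c p)
    have dp: "degree p \<le> n" using pCons.prems by (auto simp: degree_pCons_eq_if split: if_splits)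
    show ?case
    proof (cases n)
      case 0
      thus ?thesis using 1[OF dp] by (simp add: pcompose_pCons)
    next
      case (Suc k)
      thus ?thesis using 1[OF dp] pCons.IH[of k] dp by (simp add: pcompose_pCons algebra_simps)
    qed
  qed simp
qed

lemma degree_shift_diff:
  fixes p :: "real poly" and a :: real
  defines "q \<equiv> pcompose p [:a, 1:] - p"
  shows "degree p = Suc n ==> degree q \<le> n" "degree p = Suc n ==> coeff q n = real (Suc n) * a * lead_coeff p"
    "degree p = 0 ==> q = 0"
proof -
  have dq: "degree (pcompose p [:a, 1:]) = degree p" by (simp add: degree_pcompose)
  assume n: "degree p = Suc n"
  show "degree q \<le> n"
  proof (rule degree_le, intro allI impI)
    fix i assume i: "n < i"
    show "coeff q i = 0"
    proof (cases "i = Suc n")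
      case True
      thus ?thesis using coeff_pcompose_shift(1)[of p i a] n by (simp add: q_def)
    next
      case False
      thus ?thesis using i n dq by (simp add: q_def coeff_eq_0)
    qed
  qed
  show "coeff q n = real (Suc n) * a * lead_coeff p" using coeff_pcompose_shift(2)[of p n a] n by (simp add: q_def)
next
  assume "degree p = 0"
  then obtain c where "p = [:c:]" by (rule degree_eq_zeroE)
  thus "q = 0" by (simp add: q_def pcompose_const)
qed

lemma lead_coeff_pos:
  fixes p :: "real poly"
  assumes "\<forall>\<^sub>F t in sequentially. 0 \<le> poly p (real t)" "p \<noteq> 0"
  shows "0 < lead_coeff p"
proof (rule ccontr)
  assume "\<not> ?thesis"
  hence "0 < lead_coeff (- p)" using assms(2) by (simp add: less_le)
  then obtain n where n: "\<forall>x\<ge>n. lead_coeff (- p) \<le> poly (- p) x" using poly_pinfty_gt_lc by blast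
  obtain N where N: "\<And>t. t \<ge> N ==> 0 \<le> poly p (real t)" using assms(1) unfolding eventually_sequentially by blast
  let ?t = "max N (nat \<lceil>n\<rceil>)"
  have "n \<le> real ?t" by linarith
  hence "lead_coeff (- p) \<le> poly (- p) (real ?t)" using n by blast
  thus False using N[of ?t] \<open>0 < lead_coeff (- p)\<close> by simp
qed

lemma degree_mono_eventually:
  fixes p q :: "real poly"
  assumes "\<forall>\<^sub>F t in sequentially. 0 \<le> poly p (real t) \<and> poly p (real t) \<le> poly q (real t)"
  shows "degree p \<le> degree q" "q = 0 ==> p = 0"
proof -
  have ev: "\<forall>\<^sub>F t in sequentially. 0 \<le> poly p (real t)" "\<forall>\<^sub>F t in sequentially. 0 \<le> poly (q - p) (real t)"
    using assms by (auto elim!: eventually_mono)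
  show "degree p \<le> degree q"
  proof (rule ccontr)
    assume n: "\<not> ?thesis"
    hence p: "p \<noteq> 0" by auto
    have "degree (q - p) = degree p" "lead_coeff (q - p) = - lead_coeff p"
      using n degree_add_eq_right[of q "- p"] lead_coeff_add_le[of q "- p"] by simp_all
    moreover from this have "lead_coeff (q - p) \<noteq> 0" using p by simp
    hence "q - p \<noteq> 0" by (metis coeff_0)
    ultimately show False using lead_coeff_pos[OF ev(1) p] lead_coeff_pos[OF ev(2)] by simp
  qed
  assume q: "q = 0"
  show "p = 0"
  proof (rule ccontr)
    assume p: "p \<noteq> 0"
    show False using lead_coeff_pos[OF ev(1) p] lead_coeff_pos[OF ev(2)] p q by simp
  qed
qed

lemma hpol_mono:
  fixes I J :: "nat => mpoly set"
  assumes "gideal r I" "gideal r J" "I \<le> J"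
  shows "degree (hpol r J) \<le> degree (hpol r I)" "hpol r I = 0 ==> hpol r J = 0"
proof -
  have "\<forall>\<^sub>F t in sequentially. 0 \<le> poly (hpol r J) (real t) \<and> poly (hpol r J) (real t) \<le> poly (hpol r I) (real t)"
    using eventually_conj[OF hpol_eventually[OF assms(1)] hpol_eventually[OF assms(2)]]
    by eventually_elim (use hilb_mono[OF assms(1,2)] assms(3) in \<open>auto simp: le_fun_def\<close>)
  from degree_mono_eventually[OF this]
  show "degree (hpol r J) \<le> degree (hpol r I)" "hpol r I = 0 ==> hpol r J = 0" by blast+
qed

lemma hpol_relevant:
  fixes I :: "nat => mpoly set"
  assumes I: "gideal r I" and "hpol r I \<noteq> 0"
  shows "relevant r I" "1 \<notin> I 0"
proof -
  have full: "I t \<noteq> hforms r t" for t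
  proof
    assume "I t = hforms r t"
    hence "\<forall>u\<ge>t. hilb r I u = 0" using hilb_full[OF I] by blast
    hence "hpol r I = 0" by (intro hpol_eqI) (auto simp: eventually_sequentially)
    thus False using assms(2) by blast
  qed
  show "relevant r I" using full[of 1] gideal_forms[OF I] by (auto simp: relevant_def)
  show "1 \<notin> I 0" using full[of 0] gideal_one_full[OF I] by blast
qed

lemma hpol_gadd_prime:
  fixes P :: "nat => mpoly set"
  assumes P: "gprime r P" and f: "f \<in> hforms r k" "f \<notin> P k"
  shows "pcompose (hpol r (gadd r P f k)) [:real k, 1:] = pcompose (hpol r P) [:real k, 1:] - hpol r P"
proof -
  have "poly (pcompose (hpol r (gadd r P f k)) [:real k, 1:]) x = poly (pcompose (hpol r P) [:real k, 1:] - hpol r P) x" for x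
    using hpol_add[OF gprime_gideal[OF P] f(1), of x] gprime_colon[OF P f] by (simp add: poly_pcompose add.commute)
  thus ?thesis by (rule poly_ext)
qed

lemma pcompose_shift_0_iff: "pcompose p [:a, 1:] = 0 \<longleftrightarrow> p = (0 :: real poly)"
  using pcompose_eq_0[of p "[:a, 1:]"] by auto

text \<open>Some form outside the prime \<open>P\<close> lies in \<open>Q\<close>. Adding it to
  \<open>P\<close> replaces the Hilbert polynomial by a difference of shifts, which lowers the
  degree.\<close>

lemma hpol_prime_less:
  fixes P :: "nat => mpoly set"
  assumes P: "gprime r P" and Q: "gideal r Q" and PQ: "P < Q" and nz: "hpol r Q \<noteq> 0"
  shows "degree (hpol r Q) < degree (hpol r P)"
proof -
  have le: "P \<le> Q" and "\<not> Q \<le> P" using PQ by auto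
  then obtain k f where f: "f \<in> Q k" "f \<notin> P k" by (auto simp: le_fun_def)
  have fh: "f \<in> hforms r k" using gideal_forms[OF Q] f(1) by blast
  let ?J = "gadd r P f k"
  have J: "gideal r ?J" "?J \<le> Q" using gideal_gadd[OF gprime_gideal[OF P] fh] gadd_least[OF Q le f(1)] by blast+
  have e: "pcompose (hpol r ?J) [:real k, 1:] = pcompose (hpol r P) [:real k, 1:] - hpol r P"
    by (rule hpol_gadd_prime[OF P fh f(2)])
  have J0: "hpol r ?J \<noteq> 0" using hpol_mono(2)[OF J(1) Q J(2)] nz by blast
  show ?thesis
  proof (cases "degree (hpol r P)")
    case 0
    hence "pcompose (hpol r ?J) [:real k, 1:] = 0" using e degree_shift_diff(3)[of "hpol r P" "real k"] by simp
    thus ?thesis using J0 by (simp add: pcompose_shift_0_iff)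
  next
    case (Suc n)
    have "degree (hpol r ?J) \<le> n"
      using degree_shift_diff(1)[OF Suc, of "real k"] arg_cong[OF e, of degree] by (simp add: degree_pcompose)
    thus ?thesis using hpol_mono(1)[OF J(1) Q J(2)] Suc by simp
  qed
qed

text \<open>An ideal maximal among those with this degree of the Hilbert polynomial is prime:
  otherwise \<open>I : f\<close> and \<open>I + (f)\<close> would both have Hilbert polynomials that
  are smaller in degree or zero, yet these add up, after shifts, to the one of
  \<open>I\<close>.\<close>

lemma exists_prime_same_degree:
  assumes "gideal r I" "hpol r I \<noteq> 0"
  shows "\<exists>P. gprime r P \<and> I \<le> P \<and> hpol r P \<noteq> 0 \<and> degree (hpol r P) = degree (hpol r (I :: nat => mpoly set))"
  using assms
proof (induction I rule: gideal_induct)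
  case (step I)
  show ?case
  proof (cases "\<exists>J. gideal r J \<and> I < J \<and> hpol r J \<noteq> 0 \<and> degree (hpol r J) = degree (hpol r I)")
    case True
    then obtain J where J: "gideal r J" "I < J" "hpol r J \<noteq> 0" "degree (hpol r J) = degree (hpol r I)" by blast
    then obtain P where P: "gprime r P" "J \<le> P" "hpol r P \<noteq> 0" "degree (hpol r P) = degree (hpol r J)"
      using step.IH[OF J(1,2,3)] by blast
    hence "I \<le> P" using J(2) by (meson less_imp_le order_trans)
    thus ?thesis using P J(4) by metis
  next
    case False
    have small: "hpol r J = 0 \<or> degree (hpol r J) < degree (hpol r I)" if J: "gideal r J" "I < J" for J
    proof -
      have "degree (hpol r J) \<le> degree (hpol r I)" using hpol_mono(1)[OF step.hyps J(1)] J(2) by simp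
      thus ?thesis using False J by (metis le_neq_implies_less)
    qed
    have "g \<in> I b" if f: "f \<in> hforms r a" "f \<notin> I a" and g: "g \<in> hforms r b" "f * g \<in> I (a + b)" for a b f g
    proof (rule ccontr)
      assume n: "g \<notin> I b"
      let ?K = "gcolon r I f a" and ?J = "gadd r I f a"
      have gK: "g \<in> ?K b" using g by (simp add: gcolon_def)
      have K: "gideal r ?K" "I < ?K"
      proof -
        show "gideal r ?K" by (rule gideal_gcolon[OF step.hyps])
        have "I \<le> ?K" by (rule gcolon_ge[OF step.hyps f(1)])
        moreover have "I \<noteq> ?K" using gK n by metis
        ultimately show "I < ?K" by simp
      qed
      have J: "gideal r ?J" "I < ?J" using gideal_gadd[OF step.hyps f(1)] gadd_greater[OF step.hyps f(2)] by blast+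
      have "poly (pcompose (hpol r I) [:real a, 1:]) x = poly (hpol r ?K + pcompose (hpol r ?J) [:real a, 1:]) x" for x
        using hpol_add[OF step.hyps f(1), of x] by (simp add: poly_pcompose add.commute)
      hence e: "pcompose (hpol r I) [:real a, 1:] = hpol r ?K + pcompose (hpol r ?J) [:real a, 1:]"
        by (rule poly_ext)
      show False
      proof (cases "degree (hpol r I)")
        case 0
        hence "hpol r ?K = 0" "hpol r ?J = 0" using small[OF K] small[OF J] by auto
        thus False using e step.prems by (simp add: pcompose_shift_0_iff)
      next
        case (Suc m)
        have "degree (hpol r ?K) < degree (hpol r I)" using small[OF K] Suc by auto
        moreover have "degree (pcompose (hpol r ?J) [:real a, 1:]) < degree (hpol r I)"
          using small[OF J] Suc by (auto simp: degree_pcompose)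
        ultimately have "degree (pcompose (hpol r I) [:real a, 1:]) < degree (hpol r I)"
          unfolding e by (rule degree_add_less)
        thus False by (simp add: degree_pcompose)
      qed
    qed
    hence "gprime r I" unfolding gprime_def using step.hyps hpol_relevant(2)[OF step.hyps step.prems] by blast
    thus ?thesis using step.prems by blast
  qed
qed

text \<open>Cut a prime of full degree by a linear form outside it. The leading coefficient of the
  difference shows that the degree of the Hilbert polynomial drops only by one.\<close>

lemma exists_prime_chain:
  assumes "gideal r I" "hpol r I \<noteq> 0" "n \<le> degree (hpol r (I :: nat => mpoly set))"
  shows "\<exists>P. (\<forall>i\<le>n. gprime r (P i) \<and> relevant r (P i) \<and> I \<le> P i) \<and> (\<forall>i<n. P i < P (Suc i))"
  using assms
proof (induction n arbitrary: I)
  case 0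
  then obtain P where "gprime r P" "I \<le> P" "hpol r P \<noteq> 0" using exists_prime_same_degree by blast
  thus ?case using hpol_relevant(1)[OF gprime_gideal] by (intro exI[of _ "\<lambda>_. P"]) simp
next
  case (Suc n)
  obtain P where P: "gprime r P" "I \<le> P" "hpol r P \<noteq> 0" "degree (hpol r P) = degree (hpol r I)"
    using exists_prime_same_degree[OF Suc.prems(1,2)] by blast
  note gP = gprime_gideal[OF P(1)]
  have rel: "relevant r P" by (rule hpol_relevant(1)[OF gP P(3)])
  then obtain l where l: "l \<in> hforms r 1" "l \<notin> P 1" by (auto simp: relevant_def)
  let ?J = "gadd r P l 1"
  have J: "gideal r ?J" "P < ?J" using gideal_gadd[OF gP l(1)] gadd_greater[OF gP l(2)] by blast+
  obtain m where m: "degree (hpol r P) = Suc m" using Suc.prems(3) P(4) by (metis Suc_le_D)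
  have e: "pcompose (hpol r ?J) [:real 1, 1:] = pcompose (hpol r P) [:real 1, 1:] - hpol r P"
    by (rule hpol_gadd_prime[OF P(1) l])
  have c: "coeff (pcompose (hpol r ?J) [:real 1, 1:]) m \<noteq> 0"
    unfolding e degree_shift_diff(2)[OF m] using P(3) by simp
  hence "m \<le> degree (pcompose (hpol r ?J) [:real 1, 1:])" by (rule le_degree)
  hence "m \<le> degree (hpol r ?J)" by (simp add: degree_pcompose)
  hence "n \<le> degree (hpol r ?J)" using m P(4) Suc.prems(3) by simp
  moreover have "hpol r ?J \<noteq> 0" using c by auto
  ultimately obtain Q where Q: "\<forall>i\<le>n. gprime r (Q i) \<and> relevant r (Q i) \<and> ?J \<le> Q i" "\<forall>i<n. Q i < Q (Suc i)"
    using Suc.IH[OF J(1)] by blast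
  let ?R = "\<lambda>i. case i of 0 => P | Suc i => Q i"
  have IQ: "I \<le> Q i" if "i \<le> n" for i using P(2) J(2) Q(1) that by (meson less_imp_le order_trans)
  have "gprime r (?R i) \<and> relevant r (?R i) \<and> I \<le> ?R i" if "i \<le> Suc n" for i
    using that P(1,2) rel Q(1) IQ by (cases i) simp_all
  moreover have "?R i < ?R (Suc i)" if "i < Suc n" for i
    using that Q J(2) by (cases i) (auto intro: less_le_trans)
  ultimately show ?case by (intro exI[of _ ?R]) blast
qed

lemma has_chain_graded:
  assumes Z: "closed_subscheme r Z"
  shows "has_chain r Z n \<longleftrightarrow>
    (\<exists>P. (\<forall>i\<le>n. gprime r (P i) \<and> relevant r (P i) \<and> gpart r Z \<le> P i) \<and> (\<forall>i<n. P i < P (Suc i)))"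
proof
  assume "has_chain r Z n"
  then obtain P where P: "\<forall>i\<le>n. P i \<in> points r Z" "\<forall>i<n. P i \<subset> P (Suc i)" by (auto simp: has_chain_def)
  have 1: "gprime r (gpart r (P i)) \<and> relevant r (gpart r (P i)) \<and> gpart r Z \<le> gpart r (P i) \<and>
      gunion r (gpart r (P i)) = P i" if "i \<le> n" for i
    using P(1) that integral_subschemeD[of r "P i"] gpart_mono[of Z "P i" r] closed_subschemeD(2)[of r "P i"]
    by (auto simp: points_def integral_subscheme_def)
  have "gpart r (P i) < gpart r (P (Suc i))" if i: "i < n" for i
  proof -
    have "gpart r (P i) \<le> gpart r (P (Suc i))" using P(2) i by (intro gpart_mono) blast
    moreover have "gpart r (P i) \<noteq> gpart r (P (Suc i))" using 1[of i] 1[of "Suc i"] P(2) i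
      by (metis Suc_leI less_imp_le_nat psubset_eq)
    ultimately show ?thesis by simp
  qed
  thus "\<exists>P. (\<forall>i\<le>n. gprime r (P i) \<and> relevant r (P i) \<and> gpart r Z \<le> P i) \<and> (\<forall>i<n. P i < P (Suc i))"
    using 1 by (intro exI[of _ "\<lambda>i. gpart r (P i)"]) blast
next
  assume "\<exists>P. (\<forall>i\<le>n. gprime r (P i) \<and> relevant r (P i) \<and> gpart r Z \<le> P i) \<and> (\<forall>i<n. P i < P (Suc i))"
  then obtain P where P: "\<forall>i\<le>n. gprime r (P i) \<and> relevant r (P i) \<and> gpart r Z \<le> P i" "\<forall>i<n. P i < P (Suc i)" by blast
  have "gunion r (P i) \<subset> gunion r (P (Suc i))" if i: "i < n" for i
  proof -
    have "gprime r (P i)" "gprime r (P (Suc i))" using P(1) i by auto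
    hence "gideal r (P i)" "gideal r (P (Suc i))" by (auto intro: gprime_gideal)
    thus ?thesis using gunion_le_iff P(2) i by (metis leD less_imp_le psubsetI subset_refl)
  qed
  moreover have "gunion r (P i) \<in> points r Z" if "i \<le> n" for i
    unfolding points_gunion[OF Z] using P(1) that by blast
  ultimately show "has_chain r Z n" unfolding has_chain_def by (intro exI[of _ "\<lambda>i. gunion r (P i)"]) blast
qed

lemma relevant_prime_hpol:
  fixes P :: "nat => mpoly set"
  assumes P: "gprime r P" and rel: "relevant r P"
  shows "hpol r P \<noteq> 0"
proof
  assume "hpol r P = 0"
  then obtain t0 where t0: "\<And>t. t \<ge> t0 ==> real (hilb r P t) = 0" using hpol_bound[OF gprime_gideal[OF P]] by (metis poly_0)
  hence "P t0 = hforms r t0" using hilb_0_iff[OF gprime_gideal[OF P], of t0] by simp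
  moreover obtain l where "l \<in> hforms r 1" "l \<notin> P 1" using rel by (auto simp: relevant_def)
  ultimately show False using gprime_power[OF P, of l 1 t0] hforms_power[of l r 1 t0] by simp
qed

text \<open>Strict descent along primes bounds the length of chains from above, and successive
  hyperplane cuts produce long ones.\<close>

lemma has_chain_hpol:
  assumes Z: "closed_subscheme r Z"
  shows "has_chain r Z n \<longleftrightarrow> hpol r (gpart r Z) \<noteq> 0 \<and> n \<le> degree (hpol r (gpart r Z))"
proof
  assume "has_chain r Z n"
  then obtain P where P: "\<forall>i\<le>n. gprime r (P i) \<and> relevant r (P i) \<and> gpart r Z \<le> P i" "\<forall>i<n. P i < P (Suc i)"
    unfolding has_chain_graded[OF Z] by blast
  have "i + degree (hpol r (P i)) \<le> degree (hpol r (P 0))" if "i \<le> n" for i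
    using that
  proof (induction i)
    case (Suc i)
    have p: "gprime r (P i)" "gprime r (P (Suc i))" "relevant r (P (Suc i))" "P i < P (Suc i)" using P Suc.prems by auto
    hence "gprime r (P i)" "gideal r (P (Suc i))" "P i < P (Suc i)" "hpol r (P (Suc i)) \<noteq> 0"
      by (auto intro: gprime_gideal dest: relevant_prime_hpol)
    from hpol_prime_less[OF this] show ?case using Suc by simp
  qed simp
  hence "n \<le> degree (hpol r (P 0))" by (metis add_leD1 order_refl)
  moreover have p0: "gprime r (P 0)" "relevant r (P 0)" "gpart r Z \<le> P 0" using P by auto
  hence "gideal r (P 0)" "hpol r (P 0) \<noteq> 0" by (auto intro: gprime_gideal dest: relevant_prime_hpol)
  ultimately show "hpol r (gpart r Z) \<noteq> 0 \<and> n \<le> degree (hpol r (gpart r Z))"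
    using hpol_mono[OF closed_subschemeD(1)[OF Z] _ p0(3)] by (meson order_trans)
next
  assume "hpol r (gpart r Z) \<noteq> 0 \<and> n \<le> degree (hpol r (gpart r Z))"
  thus "has_chain r Z n"
    unfolding has_chain_graded[OF Z] using exists_prime_chain[OF closed_subschemeD(1)[OF Z]] by blast
qed

lemma has_dim_hpol:
  assumes Z: "closed_subscheme r Z"
  shows "has_dim r Z n \<longleftrightarrow> hpol r (gpart r Z) \<noteq> 0 \<and> degree (hpol r (gpart r Z)) = n"
  unfolding has_dim_def has_chain_hpol[OF Z] by auto

section \<open>Evaluation and general hyperplanes\<close>

definition eval_mon :: "(nat => complex) => (nat \<Rightarrow>\<^sub>0 nat) => complex" where
  "eval_mon c m = (\<Prod>i\<in>pkeys m. c i ^ plookup m i)"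

lemma eval_mon_superset: "finite A ==> pkeys m \<subseteq> A ==> eval_mon c m = (\<Prod>i\<in>A. c i ^ plookup m i)"
  unfolding eval_mon_def by (rule prod.mono_neutral_left) (auto simp: in_keys_iff)

lemma eval_mon_add: "eval_mon c (m + n) = eval_mon c m * eval_mon c n"
proof -
  let ?A = "pkeys m \<union> pkeys n"
  have "pkeys (m + n) \<subseteq> ?A" by (rule Poly_Mapping.keys_add)
  thus ?thesis
    by (simp add: eval_mon_superset[of ?A] lookup_add power_add prod.distrib)
qed

lemma eval_at_superset: "finite A ==> pkeys p \<subseteq> A ==> eval_at c p = (\<Sum>m\<in>A. plookup p m * eval_mon c m)"
  unfolding eval_at_def eval_mon_def[symmetric] by (rule sum.mono_neutral_left) (auto simp: in_keys_iff)

lemma eval_at_add: "eval_at c (p + q) = eval_at c p + eval_at c q"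
proof -
  let ?A = "pkeys p \<union> pkeys q"
  have "pkeys (p + q) \<subseteq> ?A" by (rule Poly_Mapping.keys_add)
  thus ?thesis
    by (simp add: eval_at_superset[of ?A] lookup_add distrib_right sum.distrib)
qed

lemma eval_at_0 [simp]: "eval_at c 0 = 0"
  by (simp add: eval_at_def)

lemma eval_at_sum: "eval_at c (sum f A) = (\<Sum>i\<in>A. eval_at c (f i))"
  by (induction A rule: infinite_finite_induct) (simp_all add: eval_at_add)

lemma eval_at_single: "eval_at c (psingle m a) = a * eval_mon c m"
  using eval_at_superset[of "{m}" "psingle m a" c] by simp

lemma eval_at_mult: "eval_at c (p * q) = eval_at c p * eval_at c q"
  by (rule hom_multI) (simp_all add: eval_at_sum eval_at_single eval_mon_add mult_ac)

lemma eval_at_linear: "eval_at c (\<Sum>i\<in>A. sc (a i) (xv i)) = (\<Sum>i\<in>A. a i * c i)"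
  by (simp add: eval_at_sum sc_def xv_def mult_single eval_at_single eval_mon_def)

lemma base_digits:
  fixes f g :: "nat => nat"
  assumes "\<And>i. i < n ==> f i < B" "\<And>i. i < n ==> g i < B" "(\<Sum>i<n. f i * B ^ i) = (\<Sum>i<n. g i * B ^ i)" "i < n"
  shows "f i = g i"
  using assms
proof (induction n arbitrary: f g i)
  case (Suc n)
  have e: "(\<Sum>i<Suc n. h i * B ^ i) = h 0 + B * (\<Sum>i<n. h (Suc i) * B ^ i)" for h :: "nat => nat"
    by (subst sum.lessThan_Suc_shift) (simp add: sum_distrib_left mult_ac)
  have eq: "f 0 + B * (\<Sum>i<n. f (Suc i) * B ^ i) = g 0 + B * (\<Sum>i<n. g (Suc i) * B ^ i)"
    using Suc.prems(3) unfolding e .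
  have lt: "f 0 < B" "g 0 < B" using Suc.prems by auto
  have 0: "f 0 = g 0" using arg_cong[OF eq, of "\<lambda>x. x mod B"] lt by simp
  have B: "0 < B" using lt by simp
  have s: "(\<Sum>i<n. f (Suc i) * B ^ i) = (\<Sum>i<n. g (Suc i) * B ^ i)" using eq 0 B by simp
  have "f (Suc j) = g (Suc j)" if "j < n" for j
    using Suc.IH[of "\<lambda>i. f (Suc i)" "\<lambda>i. g (Suc i)" j] Suc.prems(1,2) s that by simp
  thus ?case using 0 Suc.prems(4) by (cases i) auto
qed simp

text \<open>Kronecker substitution \<open>x\<^sub>i \<mapsto> z ^ (B ^ i)\<close> turns the form into a nonzero polynomial in \<open>z\<close>.\<close>

lemma exists_nonvanishing_point:
  assumes F: "F \<in> hforms r e" "F \<noteq> (0 :: mpoly)"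
  shows "\<exists>c. eval_at c F \<noteq> 0"
proof -
  define B where "B = Suc e"
  define w where "w m = (\<Sum>i<Suc r. plookup m i * B ^ i)" for m :: "nat \<Rightarrow>\<^sub>0 nat"
  have le: "plookup m i < B" "pkeys m \<subseteq> {..<Suc r}" if "m \<in> pkeys F" for m i
  proof -
    have m: "pkeys m \<subseteq> {..r}" "monom_deg m = e" using F(1) that by (auto simp: hforms_def monoms_def)
    show "pkeys m \<subseteq> {..<Suc r}" using m(1) by auto
    have "plookup m i \<le> monom_deg m"
    proof (cases "i \<in> pkeys m")
      case True
      thus ?thesis unfolding monom_deg_def by (intro member_le_sum) auto
    qed (simp add: in_keys_iff)
    thus "plookup m i < B" using m by (simp add: B_def)
  qed
  have inj: "inj_on w (pkeys F)"
  proof (rule inj_onI)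
    fix m n assume mn: "m \<in> pkeys F" "n \<in> pkeys F" "w m = w n"
    show "m = n"
    proof (rule poly_mapping_eqI)
      fix i
      show "plookup m i = plookup n i"
      proof (cases "i < Suc r")
        case True
        show ?thesis by (rule base_digits[OF le(1)[OF mn(1)] le(1)[OF mn(2)] mn(3)[unfolded w_def] True])
      next
        case False
        hence "i \<notin> pkeys m" "i \<notin> pkeys n" using le(2)[OF mn(1)] le(2)[OF mn(2)] by auto
        thus ?thesis by (simp add: in_keys_iff)
      qed
    qed
  qed
  define q where "q = (\<Sum>m\<in>pkeys F. monom (plookup F m) (w m))"
  obtain m where m: "m \<in> pkeys F" using F(2) by (metis keys_eq_empty equals0I)
  have "coeff q (w m) = (\<Sum>n\<in>pkeys F. if n = m then plookup F n else 0)"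
    unfolding q_def coeff_sum coeff_monom
  proof (intro sum.cong refl)
    fix n assume "n \<in> pkeys F"
    thus "(if w n = w m then plookup F n else 0) = (if n = m then plookup F n else 0)"
      using inj_onD[OF inj _ _ m, of n] by auto
  qed
  hence "q \<noteq> 0" using m by (auto simp: in_keys_iff)
  hence "finite {z. poly q z = 0}" by (rule poly_roots_finite)
  then obtain z where z: "poly q z \<noteq> 0" using infinite_UNIV_complex by (metis (mono_tags, lifting) UNIV_I finite_subset mem_Collect_eq subsetI)
  have "eval_mon (\<lambda>i. z ^ (B ^ i)) m = z ^ w m" if "m \<in> pkeys F" for m
    using le(2)[OF that] by (simp add: eval_mon_superset[of "{..<Suc r}"] w_def power_sum mult.commute del: lessThan_Suc sum.lessThan_Suc prod.lessThan_Suc flip: power_mult)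
  hence "eval_at (\<lambda>i. z ^ (B ^ i)) F = poly q z"
    by (simp add: eval_at_superset[of "pkeys F"] q_def poly_sum poly_monom)
  thus ?thesis using z by metis
qed

lemma linear_form_eq: "linear_form r c = (\<Sum>i\<le>r. sc (c i) (xv i))"
  by (simp add: linear_form_def poly_scale_sc var_xv)

lemma linear_form_hforms: "linear_form r c \<in> hforms r 1"
  unfolding linear_form_eq
  by (intro pv.subspace_sum[OF subspace_hforms] pv.subspace_scale[OF subspace_hforms]) (simp add: xv_hforms del: One_nat_def)

lemma exists_vanishing_functional:
  fixes V :: "mpoly set"
  assumes V: "pv.subspace V" and v: "v \<notin> V"
  shows "\<exists>\<phi>. Vector_Spaces.linear sc (*) \<phi> \<and> (\<forall>x\<in>V. \<phi> x = 0) \<and> \<phi> v = (1 :: complex)"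
proof -
  obtain B where B: "B \<subseteq> V" "pv.independent B" "V \<subseteq> pv.span B" by (rule pv.maximal_independent_subset)
  have "pv.span B = V" using B V by (metis pv.span_minimal subset_antisym)
  hence ind: "pv.independent (insert v B)" using v B by (intro pv.independent_insertI) auto
  interpret vp: vector_space_pair "sc :: complex => mpoly => mpoly" "(*) :: complex => complex => complex"
    by (intro vector_space_pair.intro vector_space_sc)
      (unfold_locales, simp_all add: algebra_simps)
  obtain \<phi> where \<phi>: "Vector_Spaces.linear sc (*) \<phi>" "\<forall>x\<in>insert v B. \<phi> x = (if x = v then 1 else 0)"
    using vp.linear_independent_extend[OF ind, of "\<lambda>x. if x = v then 1 else 0"] by blast
  have "\<phi> x = 0" if x: "x \<in> V" for x
  proof (rule vp.linear_eq_0_on_span[OF \<phi>(1)])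
    show "x \<in> pv.span B" using x B(3) by blast
    show "\<phi> b = 0" if "b \<in> B" for b using that \<phi>(2) v B(1) by auto
  qed
  thus ?thesis using \<phi> by auto
qed

text \<open>A linear functional that kills \<open>G 1\<close> but not some variable is, as a
  function of the coefficients \<open>c\<close>, itself a linear form, and it cuts out the open
  set.\<close>

lemma general_hyperplane_avoids:
  assumes G: "gideal r (G :: nat => mpoly set)" and rel: "relevant r G"
  shows "\<exists>L\<in>hforms r 1. L \<noteq> 0 \<and> (\<forall>c. eval_at c L \<noteq> 0 --> linear_form r c \<notin> G 1)"
proof -
  obtain j where j: "j \<le> r" "xv j \<notin> G 1"
    using rel gideal_vars_full[OF G, of 1] by (auto simp: relevant_def)
  obtain \<phi> where \<phi>: "Vector_Spaces.linear sc (*) \<phi>" "\<forall>x\<in>G 1. \<phi> x = 0" "\<phi> (xv j) = (1 :: complex)"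
    using exists_vanishing_functional[OF gideal_subspace[OF G] j(2)] by blast
  interpret l: Vector_Spaces.linear sc "(*)" \<phi> by (rule \<phi>(1))
  let ?L = "linear_form r (\<lambda>i. \<phi> (xv i))"
  have e: "eval_at c ?L = \<phi> (linear_form r c)" for c
    unfolding linear_form_eq eval_at_linear by (simp add: l.sum l.scale mult.commute)
  have "linear_form r c \<notin> G 1" if "eval_at c ?L \<noteq> 0" for c using that \<phi>(2) unfolding e by blast
  moreover have "?L \<noteq> 0"
  proof
    assume "?L = 0"
    hence "\<phi> (linear_form r (\<lambda>i. if i = j then 1 else 0)) = 0" using e by (metis eval_at_0)
    moreover have "linear_form r (\<lambda>i. if i = j then 1 else 0) = xv j"
    proof -
      have "linear_form r (\<lambda>i. if i = j then 1 else 0) = (\<Sum>i\<le>r. if i = j then xv i else 0)"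
        unfolding linear_form_eq by (intro sum.cong) auto
      thus ?thesis using j(1) by simp
    qed
    ultimately show False using \<phi>(3) by simp
  qed
  ultimately show ?thesis using linear_form_hforms by blast
qed

text \<open>Two nonempty basic open sets meet, because a product of nonzero forms is nonzero and a
  nonzero form has a nonvanishing point.\<close>

lemma general_hyperplane_witness:
  assumes Q: "for_general_hyperplane r Q" and Q': "for_general_hyperplane r Q'"
  shows "\<exists>c. Q (linear_form r c) \<and> Q' (linear_form r c)"
proof -
  obtain e F where F: "F \<in> hforms r e" "F \<noteq> 0" "\<And>c. eval_at c F \<noteq> 0 ==> Q (linear_form r c)"
    using Q unfolding for_general_hyperplane_def forms_hforms by blast
  obtain e' F' where F': "F' \<in> hforms r e'" "F' \<noteq> 0" "\<And>c. eval_at c F' \<noteq> 0 ==> Q' (linear_form r c)"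
    using Q' unfolding for_general_hyperplane_def forms_hforms by blast
  have "F * F' \<in> hforms r (e + e')" "F * F' \<noteq> 0" using hforms_mult[OF F(1) F'(1)] F(2) F'(2) by auto
  then obtain c where "eval_at c (F * F') \<noteq> 0" using exists_nonvanishing_point by blast
  thus ?thesis using F(3) F'(3) by (auto simp: eval_at_mult)
qed

lemma general_hyperplane_notin:
  "gideal r (G :: nat => mpoly set) ==> relevant r G ==> for_general_hyperplane r (\<lambda>h. h \<notin> G 1)"
  unfolding for_general_hyperplane_def forms_hforms using general_hyperplane_avoids by blast

section \<open>Intersections\<close>

lemma gsum_ge:
  assumes "gideal r G" "gideal r H"
  shows "G \<le> gsum G H" "H \<le> gsum G H"
proof -
  have "a \<in> gsum G H t" if "a \<in> G t" for a t
    using that gideal_0[OF assms(2), of t] unfolding gsum_def by (intro CollectI exI[of _ a] exI[of _ 0]) simp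
  moreover have "a \<in> gsum G H t" if "a \<in> H t" for a t
    using that gideal_0[OF assms(1), of t] unfolding gsum_def by (intro CollectI exI[of _ 0] exI[of _ a]) simp
  ultimately show "G \<le> gsum G H" "H \<le> gsum G H" by (auto simp: le_fun_def)
qed

lemma gsum_least:
  assumes "gideal r J" "G \<le> J" "H \<le> J"
  shows "gsum G H \<le> J"
proof -
  have "a + b \<in> J t" if "a \<in> G t" "b \<in> H t" for a b t
    using that assms(2,3) gideal_add[OF assms(1), of a t b] by (auto simp: le_fun_def)
  thus ?thesis by (auto simp: gsum_def le_fun_def)
qed

lemma set_add_eq: "A <+>\<^bsub>coord_ring r\<^esub> B = {a + b | a b. a \<in> A \<and> b \<in> B}"
  unfolding set_add_def' by auto

lemma gunion_gsum:
  assumes G: "gideal r G" and H: "gideal r H"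
  shows "gunion r G <+>\<^bsub>coord_ring r\<^esub> gunion r H = gunion r (gsum G H)"
proof
  have "a + b \<in> gunion r (gsum G H)" if "a \<in> gunion r G" "b \<in> gunion r H" for a b
  proof -
    have "hcomp t (a + b) \<in> gsum G H t" for t
    proof -
      have "hcomp t a \<in> G t" "hcomp t b \<in> H t" using that by (simp_all add: gunion_def)
      thus ?thesis unfolding gsum_def hcomp_add by blast
    qed
    thus ?thesis using that by (simp add: gunion_def polys_add)
  qed
  thus "gunion r G <+>\<^bsub>coord_ring r\<^esub> gunion r H \<subseteq> gunion r (gsum G H)"
    unfolding set_add_eq by blast
  have "gsum G H t \<subseteq> gunion r G <+>\<^bsub>coord_ring r\<^esub> gunion r H" for t
    unfolding set_add_eq gsum_def using gunion_forms[OF G] gunion_forms[OF H] by blast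
  thus "gunion r (gsum G H) \<subseteq> gunion r G <+>\<^bsub>coord_ring r\<^esub> gunion r H"
    by (intro gunion_subset_ideal R.add_ideals ideal_gunion G H)
qed

lemma scheme_inter_gunion:
  assumes "closed_subscheme r C" "closed_subscheme r D"
  shows "scheme_inter r C D = gunion r (gsat r (gsum (gpart r C) (gpart r D)))"
proof -
  note c = closed_subschemeD[OF assms(1)] and d = closed_subschemeD[OF assms(2)]
  show ?thesis unfolding scheme_inter_def
    using gunion_gsum[OF c(1) d(1)] saturation_gunion[OF gideal_gsum[OF c(1) d(1)]] c(2) d(2) by simp
qed

lemma PIdl_eq: "PIdl\<^bsub>coord_ring r\<^esub> f = {q * f | q. q \<in> polys r}"
  unfolding cgenideal_def carrier_polys by simp

lemma gunion_principal:
  assumes G: "gideal r G" and f: "f \<in> hforms r k"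
  shows "gunion r G <+>\<^bsub>coord_ring r\<^esub> (PIdl\<^bsub>coord_ring r\<^esub> f) = gunion r (gadd r G f k)"
proof
  note J = gideal_gadd[OF G f]
  have fJ: "f \<in> gunion r (gadd r G f k)" using gunion_forms[OF J gadd_self[OF G]] .
  have "a + q * f \<in> gunion r (gadd r G f k)" if "a \<in> gunion r G" "q \<in> polys r" for a q
    using that gunion_mono[OF gadd_ge[OF G, of f k], of r] ideal_gunion[OF J] fJ unfolding ideal_iff by blast
  thus "gunion r G <+>\<^bsub>coord_ring r\<^esub> (PIdl\<^bsub>coord_ring r\<^esub> f) \<subseteq> gunion r (gadd r G f k)"
    unfolding set_add_eq PIdl_eq by blast
  have f': "f \<in> carrier (coord_ring r)" unfolding carrier_polys by (rule hforms_polys[OF f])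
  have "a + f * b \<in> gunion r G <+>\<^bsub>coord_ring r\<^esub> (PIdl\<^bsub>coord_ring r\<^esub> f)"
    if "a \<in> G t" "b \<in> (if k \<le> t then hforms r (t - k) else {0})" for a b t
  proof -
    have "b \<in> polys r" using that(2) hforms_polys by (auto simp: polys_0 split: if_splits)
    hence "b * f \<in> PIdl\<^bsub>coord_ring r\<^esub> f" unfolding PIdl_eq by blast
    thus ?thesis unfolding set_add_eq using gunion_forms[OF G that(1)] by (auto simp: mult.commute)
  qed
  hence "gadd r G f k t \<subseteq> gunion r G <+>\<^bsub>coord_ring r\<^esub> (PIdl\<^bsub>coord_ring r\<^esub> f)" for t
    unfolding gadd_def by blast
  thus "gunion r (gadd r G f k) \<subseteq> gunion r G <+>\<^bsub>coord_ring r\<^esub> (PIdl\<^bsub>coord_ring r\<^esub> f)"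
    by (intro gunion_subset_ideal R.add_ideals ideal_gunion G R.cgenideal_ideal f')
qed

lemma hpol_gsat:
  fixes I :: "nat => mpoly set"
  assumes I: "gideal r I"
  shows "hpol r (gsat r I) = hpol r I"
proof (rule hpol_eqI)
  obtain t0 where t0: "\<And>t. t \<ge> t0 ==> gsat r I t = I t" using gsat_eventually[OF infinite_UNIV_complex I] by metis
  hence "\<forall>\<^sub>F t in sequentially. hilb r (gsat r I) t = hilb r I t"
    unfolding eventually_sequentially hilb_def by (intro exI[of _ t0]) simp
  thus "\<forall>\<^sub>F t in sequentially. poly (hpol r I) (real t) = real (hilb r (gsat r I) t)"
    using hpol_eventually[OF I] by eventually_elim simp
qed

lemma hyperplane_section_gunion:
  assumes "closed_subscheme r D" and h: "h \<in> hforms r 1"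
  shows "hyperplane_section r D h = gunion r (gsat r (gadd r (gpart r D) h 1))"
proof -
  note d = closed_subschemeD[OF assms(1)]
  show ?thesis unfolding hyperplane_section_def scheme_inter_def
    using gunion_principal[OF d(1) h] saturation_gunion[OF gideal_gadd[OF d(1) h]] d(2) by simp
qed

lemma closed_gunion_gsat:
  assumes I: "gideal r I"
  shows "closed_subscheme r (gunion r (gsat r I))" "gpart r (gunion r (gsat r I)) = gsat r I"
  using closed_subscheme_gunion[OF gideal_gsat[OF I] gsat_idem[OF infinite_UNIV_complex I]]
    gpart_gunion[OF gideal_gsat[OF I]] by blast+

text \<open>Every hyperplane that does not contain \<open>D\<close> gives the same value, read off
  from the first difference of the Hilbert polynomial at \<open>-1\<close>. Uniqueness holds because
  two general conditions have a common hyperplane.\<close>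

lemma sectional_genus_eq:
  assumes D: "integral_subscheme r D"
    and v: "\<And>x. poly (hpol r (gpart r D)) (x + 1) - poly (hpol r (gpart r D)) x = s * (x + 1) + real_of_int v"
  shows "sectional_genus r D = 1 - v"
proof -
  have cl: "closed_subscheme r D" using D by (simp add: integral_subscheme_def)
  note d = closed_subschemeD[OF cl] and p = integral_subschemeD[OF D]
  have gen: "arith_genus r (hyperplane_section r D h) = 1 - v" if h: "h \<in> hforms r 1" "h \<notin> gpart r D 1" for h
  proof -
    let ?J = "gadd r (gpart r D) h 1"
    have J: "gideal r ?J" by (rule gideal_gadd[OF d(1) h(1)])
    have "poly (hpol r ?J) 0 = poly (hpol r (gpart r D)) 0 - poly (hpol r (gpart r D)) (-1)"
      using arg_cong[OF hpol_gadd_prime[OF p(1) h], of "\<lambda>q. poly q (-1)"] by (simp add: poly_pcompose)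
    also have "\<dots> = real_of_int v" using v[of "-1"] by simp
    finally have "real_of_int (arith_genus r (gunion r (gsat r ?J))) = 1 - real_of_int v"
      using arith_genus_closed[OF closed_gunion_gsat(1)[OF J]] closed_gunion_gsat(2)[OF J] hpol_gsat[OF J] by simp
    hence "real_of_int (arith_genus r (gunion r (gsat r ?J))) = real_of_int (1 - v)" by simp
    thus ?thesis unfolding hyperplane_section_gunion[OF cl h(1)] using of_int_eq_iff by blast
  qed
  have nin: "for_general_hyperplane r (\<lambda>h. h \<notin> gpart r D 1)" by (rule general_hyperplane_notin[OF d(1) p(2)])
  show ?thesis unfolding sectional_genus_def
  proof (rule the_equality)
    show "for_general_hyperplane r (\<lambda>h. arith_genus r (hyperplane_section r D h) = 1 - v)"
      using nin gen linear_form_hforms unfolding for_general_hyperplane_def by blast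
    fix g assume g: "for_general_hyperplane r (\<lambda>h. arith_genus r (hyperplane_section r D h) = g)"
    show "g = 1 - v" using general_hyperplane_witness[OF nin g] gen linear_form_hforms by blast
  qed
qed

section \<open>Hilbert polynomials of curves and surfaces\<close>

lemma degree_le_1_eq: "degree p \<le> 1 ==> p = [:coeff p 0, coeff p 1:]"
  by (rule poly_eqI) (auto simp: coeff_pCons coeff_eq_0 split: nat.splits)

text \<open>Two consecutive values of the Hilbert function show that slope and constant term are
  integers.\<close>

lemma hilb_linear:
  fixes I :: "nat => mpoly set"
  assumes I: "gideal r I" and deg: "degree (hpol r I) \<le> 1"
  obtains d :: nat and c :: int where "hpol r I = [:real_of_int c, real d:]"
    "\<exists>t0. \<forall>t\<ge>t0. int (hilb r I t) = int d * int t + c"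
proof -
  let ?p = "hpol r I"
  obtain t0 where t0: "\<And>t. t \<ge> t0 ==> real (hilb r I t) = poly ?p (real t)" using hpol_bound[OF I] by blast
  note p = degree_le_1_eq[OF deg]
  have val: "real (hilb r I t) = coeff ?p 0 + real t * coeff ?p 1" if "t \<ge> t0" for t
    using t0[OF that] arg_cong[OF p, of "\<lambda>q. poly q (real t)"] by simp
  define d where "d = int (hilb r I (Suc t0)) - int (hilb r I t0)"
  define c where "c = int (hilb r I t0) - d * int t0"
  have cd: "coeff ?p 1 = real_of_int d" "coeff ?p 0 = real_of_int c"
    using val[of t0] val[of "Suc t0"] by (simp_all add: d_def c_def algebra_simps)
  have "0 \<le> d"
  proof (cases "coeff ?p 1 = 0")
    case False
    hence "degree ?p = 1" using deg le_degree[of ?p 1] by simp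
    moreover have "\<forall>\<^sub>F t in sequentially. 0 \<le> poly ?p (real t)"
      using hpol_eventually[OF I] by eventually_elim simp
    moreover have "?p \<noteq> 0" using False by auto
    ultimately have "0 < coeff ?p 1" using lead_coeff_pos[of ?p] by metis
    thus ?thesis using cd by simp
  qed (use cd in simp)
  hence n: "real (nat d) = real_of_int d" by simp
  show ?thesis
  proof (rule that[of c "nat d"])
    show "?p = [:real_of_int c, real (nat d):]" using p cd n by simp
    have "int (hilb r I t) = int (nat d) * int t + c" if "t \<ge> t0" for t
    proof -
      have "real_of_int (int (hilb r I t)) = real_of_int (int (nat d) * int t + c)" using val[OF that] cd n by simp
      thus ?thesis by (rule of_int_eq_iff[THEN iffD1])
    qed
    thus "\<exists>t0. \<forall>t\<ge>t0. int (hilb r I t) = int (nat d) * int t + c" by blast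
  qed
qed

lemma curve_hilb:
  assumes C: "is_curve r C" and deg: "scheme_degree r C = real d"
  obtains c :: int where "hpol r (gpart r C) = [:real_of_int c, real d:]" "1 \<le> d"
    "\<exists>t0. \<forall>t\<ge>t0. int (hilb r (gpart r C) t) = int d * int t + c" "arith_genus r C = 1 - c"
proof -
  have cl: "closed_subscheme r C" and dim: "has_dim r C 1" using C by (auto simp: is_curve_def)
  note c = closed_subschemeD[OF cl]
  have d1: "degree (hpol r (gpart r C)) = 1" using dim has_dim_hpol[OF cl] by simp
  obtain d' c where h: "hpol r (gpart r C) = [:real_of_int c, real d':]"
    "\<exists>t0. \<forall>t\<ge>t0. int (hilb r (gpart r C) t) = int d' * int t + c"
    using hilb_linear[OF c(1)] d1 by (metis order_refl)
  have "d' \<noteq> 0" using h(1) d1 by (auto split: if_splits)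
  moreover have "d' = d" using deg d1 h(1) by (simp add: scheme_degree_def hilbert_poly_hpol[OF cl])
  moreover have "real_of_int (arith_genus r C) = real_of_int (1 - c)" using arith_genus_closed[OF cl] h(1) by simp
  ultimately show ?thesis using that[of c] h of_int_eq_iff by (metis One_nat_def Suc_leI neq0_conv)
qed

lemma is_curveI:
  assumes I: "gideal r (I :: nat => mpoly set)" and h: "hpol r I = [:c, real d:]" and d: "1 \<le> d"
  shows "is_curve r (gunion r (gsat r I))" "scheme_degree r (gunion r (gsat r I)) = real d"
proof -
  let ?C = "gunion r (gsat r I)"
  have p: "hpol r (gpart r ?C) = [:c, real d:]" using closed_gunion_gsat(2)[OF I] hpol_gsat[OF I] h by simp
  have cl: "closed_subscheme r ?C" by (rule closed_gunion_gsat(1)[OF I])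
  show "is_curve r ?C" unfolding is_curve_def has_dim_hpol[OF cl] p using cl d by simp
  show "scheme_degree r ?C = real d" unfolding scheme_degree_def hilbert_poly_hpol[OF cl] p using d by simp
qed

text \<open>The first difference at \<open>x\<close> is the Hilbert polynomial of a hyperplane
  section at \<open>x + 1\<close>; this is the origin of the shifted argument and of
  \<open>v\<close> as constant term of the section.\<close>

lemma surface_hilb:
  assumes D: "integral_surface r D" and deg: "scheme_degree r D = real s"
  obtains v :: int where "1 \<le> s"
    "\<And>x. poly (hpol r (gpart r D)) (x + 1) - poly (hpol r (gpart r D)) x = real s * (x + 1) + real_of_int v"
    "\<exists>t0. \<forall>t\<ge>t0. int (hilb r (gpart r D) (Suc t)) - int (hilb r (gpart r D) t) = int s * int (Suc t) + v"
    "sectional_genus r D = 1 - v"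
proof -
  have int: "integral_subscheme r D" and dim: "has_dim r D 2" using D by (auto simp: integral_surface_def)
  hence cl: "closed_subscheme r D" by (simp add: integral_subscheme_def)
  note g = closed_subschemeD(1)[OF cl]
  let ?p = "hpol r (gpart r D)" and ?q = "pcompose (hpol r (gpart r D)) [:1, 1:] - hpol r (gpart r D)"
  have d2: "degree ?p = Suc 1" "?p \<noteq> 0" using dim has_dim_hpol[OF cl] by simp_all
  have lc: "2 * lead_coeff ?p = real s"
    using deg d2(1) by (simp add: scheme_degree_def hilbert_poly_hpol[OF cl] numeral_2_eq_2)
  have "\<forall>\<^sub>F t in sequentially. 0 \<le> poly ?p (real t)" using hpol_eventually[OF g] by eventually_elim simp
  hence s: "1 \<le> s" using lead_coeff_pos[OF _ d2(2)] lc by (cases s) auto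
  have q1: "degree ?q \<le> 1" "coeff ?q 1 = real s"
    using degree_shift_diff(1,2)[OF d2(1), of 1] lc by simp_all
  have q: "poly ?p (x + 1) - poly ?p x = coeff ?q 0 + x * real s" for x
    using arg_cong[OF degree_le_1_eq[OF q1(1)], of "\<lambda>q. poly q x"] q1(2) by (simp add: poly_pcompose add.commute)
  obtain t0 where t0: "\<And>t. t \<ge> t0 ==> real (hilb r (gpart r D) t) = poly ?p (real t)" using hpol_bound[OF g] by blast
  define v where "v = int (hilb r (gpart r D) (Suc t0)) - int (hilb r (gpart r D) t0) - int s * int (Suc t0)"
  have c0: "coeff ?q 0 = real_of_int v + real s"
    using q[of "real t0"] t0[of t0] t0[of "Suc t0"] by (simp add: v_def algebra_simps)
  have 1: "poly ?p (x + 1) - poly ?p x = real s * (x + 1) + real_of_int v" for x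
    using q[of x] c0 by (simp add: algebra_simps)
  have "int (hilb r (gpart r D) (Suc t)) - int (hilb r (gpart r D) t) = int s * int (Suc t) + v" if t: "t \<ge> t0" for t
  proof -
    have "real_of_int (int (hilb r (gpart r D) (Suc t)) - int (hilb r (gpart r D) t)) = real_of_int (int s * int (Suc t) + v)"
      using 1[of "real t"] t0[of t] t0[of "Suc t"] t by (simp add: algebra_simps)
    thus ?thesis by (rule of_int_eq_iff[THEN iffD1])
  qed
  thus ?thesis using that[OF s 1 _ sectional_genus_eq[OF int 1]] by blast
qed

section \<open>Effective Cartier divisors\<close>

lemma gunion_form_iff:
  assumes "gideal r G" "p \<in> hforms r t"
  shows "p \<in> gunion r G \<longleftrightarrow> p \<in> G t"
  using gpart_gunion[OF assms(1)] assms(2) by (auto simp: gpart_def fun_eq_iff)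

lemma gmulI: "u \<in> G t ==> b * u \<in> gmul b e G (e + t)"
  unfolding gmul_def by (intro CollectI exI[of _ u]) simp

lemma gmulE:
  assumes "g \<in> gmul b e G (e + t)"
  obtains u where "g = b * u" "u \<in> G t"
  using assms unfolding gmul_def by auto

lemma gunion_gmulI:
  assumes G: "gideal r G" and b: "b \<in> hforms r e" and u: "u \<in> gunion r G"
  shows "b * u \<in> gunion r (gmul b e G)"
proof -
  obtain T where T: "\<And>t. t \<ge> T ==> hcomp t u = 0" using hcomp_bound by blast
  have "b * hcomp t u \<in> gunion r (gmul b e G)" for t
    using gunion_forms[OF gideal_gmul[OF G b] gmulI, of "hcomp t u" t] u by (simp add: gunion_def)
  hence "(\<Sum>t<T. b * hcomp t u) \<in> gunion r (gmul b e G)"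
    by (intro ideal_sum[OF ideal_gunion[OF gideal_gmul[OF G b]]])
  thus ?thesis using hcomp_decomp[OF T] by (metis sum_distrib_left)
qed

lemma principal_on_iff: "g \<in> principal_on r X f \<longleftrightarrow> (\<exists>x\<in>X. \<exists>p\<in>polys r. g = x + p * f)"
  unfolding principal_on_def set_add_eq PIdl_eq by blast

lemma stalk_iff: "g \<in> stalk r P J \<longleftrightarrow> g \<in> polys r \<and> (\<exists>e. \<exists>q\<in>hforms r e. q \<notin> P \<and> q * g \<in> J)"
  by (simp add: stalk_def carrier_polys forms_hforms del: coord_ring_simps(1))

lemma stalkI: "g \<in> polys r ==> q \<in> hforms r e ==> q \<notin> P ==> q * g \<in> J ==> g \<in> stalk r P J"
  unfolding stalk_iff by blast

lemma stalkE:
  assumes "g \<in> stalk r P J"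
  obtains e q where "q \<in> hforms r e" "q \<notin> P" "q * g \<in> J" "g \<in> polys r"
  using assms unfolding stalk_iff by blast

lemma integral_ideal: "integral_subscheme r P ==> ideal P (coord_ring r)"
  by (simp add: integral_subscheme_def primeideal.axioms(1))

lemma integral_prime:
  assumes P: "integral_subscheme r P" and "a \<in> polys r" "b \<in> polys r" "a \<notin> P" "b \<notin> P"
  shows "a * b \<notin> P"
proof -
  interpret primeideal P "coord_ring r" using P by (simp add: integral_subscheme_def)
  show ?thesis using I_prime[of a b] assms unfolding carrier_polys by auto
qed

lemma integral_one:
  assumes P: "integral_subscheme r P"
  shows "1 \<notin> P"
proof -
  interpret primeideal P "coord_ring r" using P by (simp add: integral_subscheme_def)
  show ?thesis using I_notcarr one_imp_carrier by auto
qed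

lemma integral_power:
  assumes P: "integral_subscheme r P" and a: "a \<in> hforms r e" "a \<notin> P"
  shows "a ^ n \<notin> P"
proof (induction n)
  case (Suc n)
  thus ?case using integral_prime[OF P hforms_polys[OF a(1)] hforms_polys[OF hforms_power[OF a(1)]] a(2)] by simp
qed (simp add: integral_one[OF P])

lemma stalk_self: "integral_subscheme r P ==> J \<subseteq> polys r ==> J \<subseteq> stalk r P J"
  using stalkI[OF _ hforms_1, of _ r P J] integral_one[of r P] by auto

lemma stalk_trans:
  assumes P: "integral_subscheme r P" and g: "q * g \<in> stalk r P J" and q: "q \<in> hforms r e" "q \<notin> P" "g \<in> polys r"
  shows "g \<in> stalk r P J"
proof -
  obtain e' q' where q': "q' \<in> hforms r e'" "q' \<notin> P" "q' * (q * g) \<in> J" using g by (rule stalkE)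
  show ?thesis
  proof (rule stalkI[OF q(3) hforms_mult[OF q'(1) q(1)]])
    show "q' * q \<notin> P" using integral_prime[OF P hforms_polys[OF q'(1)] hforms_polys[OF q(1)] q'(2) q(2)] .
    show "q' * q * g \<in> J" using q'(3) by (simp add: mult.assoc)
  qed
qed

lemma principal_subset: "ideal X (coord_ring r) ==> f \<in> polys r ==> principal_on r X f \<subseteq> polys r"
  unfolding principal_on_iff subset_iff using polys_add polys_mult by (auto simp: ideal_iff)

lemma principal_mult:
  assumes X: "ideal X (coord_ring r)" and g: "g \<in> principal_on r X f" and b: "b \<in> polys r"
  shows "b * g \<in> principal_on r X (b * f)"
proof -
  obtain x p where x: "g = x + p * f" "x \<in> X" "p \<in> polys r" using g unfolding principal_on_iff by blast
  have "b * g = b * x + p * (b * f)" by (simp add: x(1) distrib_left mult_ac)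
  thus ?thesis unfolding principal_on_iff using X b x(2,3) by (auto simp: ideal_iff)
qed

lemma principal_scale:
  assumes X: "ideal X (coord_ring r)" and g: "g \<in> principal_on r X f" and q: "q \<in> polys r"
  shows "q * g \<in> principal_on r X f"
proof -
  obtain x p where x: "g = x + p * f" "x \<in> X" "p \<in> polys r" using g unfolding principal_on_iff by blast
  have "q * g = q * x + (q * p) * f" by (simp add: x(1) distrib_left mult_ac)
  moreover have "q * x \<in> X" using X q x(2) by (simp add: ideal_iff)
  ultimately show ?thesis unfolding principal_on_iff using polys_mult[OF q x(3)] by blast
qed

lemma principal_self: "ideal X (coord_ring r) ==> f \<in> principal_on r X f"
  unfolding principal_on_iff by (intro bexI[of _ 0] bexI[of _ 1]) (auto simp: ideal_iff polys_1)

lemma stalk_principal_self: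
  "integral_subscheme r P ==> ideal X (coord_ring r) ==> f \<in> polys r ==> f \<in> stalk r P (principal_on r X f)"
  using stalk_self[of r P "principal_on r X f"] principal_subset[of X r f] principal_self[of X r f] by blast

lemma stalk_principal_mult:
  assumes P: "integral_subscheme r P" and X: "ideal X (coord_ring r)" and f: "f \<in> polys r"
    and g: "g \<in> stalk r P (principal_on r X f)" and g': "g' \<in> stalk r P (principal_on r X f')"
  shows "g * g' \<in> stalk r P (principal_on r X (f * f'))"
proof -
  obtain e q where q: "q \<in> hforms r e" "q \<notin> P" "q * g \<in> principal_on r X f" "g \<in> polys r" using g by (rule stalkE)
  obtain e' q' where q': "q' \<in> hforms r e'" "q' \<notin> P" "q' * g' \<in> principal_on r X f'" "g' \<in> polys r" using g' by (rule stalkE)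
  obtain x p where x: "q * g = x + p * f" "x \<in> X" "p \<in> polys r" using q(3) unfolding principal_on_iff by blast
  have q'g': "q' * g' \<in> polys r" by (rule polys_mult[OF hforms_polys[OF q'(1)] q'(4)])
  have "f * (q' * g') \<in> principal_on r X (f * f')" by (rule principal_mult[OF X q'(3) f])
  hence "p * (f * (q' * g')) \<in> principal_on r X (f * f')" by (rule principal_scale[OF X _ x(3)])
  then obtain y p' where y: "p * (f * (q' * g')) = y + p' * (f * f')" "y \<in> X" "p' \<in> polys r" unfolding principal_on_iff by blast
  have "q * q' * (g * g') = (q * g) * (q' * g')" by (simp add: mult_ac)
  also have "\<dots> = (q' * g') * x + p * (f * (q' * g'))" by (simp only: x(1)) (simp add: distrib_left distrib_right mult_ac)
  also have "\<dots> = ((q' * g') * x + y) + p' * (f * f')" by (simp only: y(1) add.assoc)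
  finally have e: "q * q' * (g * g') = ((q' * g') * x + y) + p' * (f * f')" .
  have "(q' * g') * x + y \<in> X" using X q'g' x(2) y(2) by (simp add: ideal_iff)
  hence "q * q' * (g * g') \<in> principal_on r X (f * f')" unfolding principal_on_iff using e y(3) by blast
  thus ?thesis
    using stalkI[OF polys_mult[OF q(4) q'(4)] hforms_mult[OF q(1) q'(1)]]
      integral_prime[OF P hforms_polys[OF q(1)] hforms_polys[OF q'(1)] q(2) q'(2)] by blast
qed

lemma stalk_principal_power:
  assumes P: "integral_subscheme r P" and X: "ideal X (coord_ring r)" and f: "f \<in> hforms r e"
    and g: "g \<in> stalk r P (principal_on r X f)"
  shows "g ^ n \<in> stalk r P (principal_on r X (f ^ n))"
proof (induction n)
  case 0
  show ?case using stalk_principal_self[OF P X polys_1] by simp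
next
  case (Suc n)
  show ?case using stalk_principal_mult[OF P X hforms_polys[OF f] g Suc.IH] by simp
qed

lemma stalk_principal_trans:
  assumes X: "ideal X (coord_ring r)" and w: "w \<in> stalk r P (principal_on r X f)" and g: "g \<in> principal_on r X w"
  shows "g \<in> stalk r P (principal_on r X f)"
proof -
  obtain e q where q: "q \<in> hforms r e" "q \<notin> P" "q * w \<in> principal_on r X f" "w \<in> polys r" using w by (rule stalkE)
  obtain x p where x: "g = x + p * w" "x \<in> X" "p \<in> polys r" using g unfolding principal_on_iff by blast
  obtain y p' where y: "p * (q * w) = y + p' * f" "y \<in> X" "p' \<in> polys r"
    using principal_scale[OF X q(3) x(3)] unfolding principal_on_iff by blast
  have "q * g = q * x + p * (q * w)" by (simp add: x(1) distrib_left mult_ac)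
  also have "\<dots> = (q * x + y) + p' * f" by (simp add: y(1) add.assoc)
  finally have "q * g \<in> principal_on r X f"
    unfolding principal_on_iff using X x(2) y(2,3) hforms_polys[OF q(1)] by (auto simp: ideal_iff)
  thus ?thesis using principal_subset[OF X q(4)] g q(1,2) by (blast intro: stalkI)
qed

lemma local_generatorD:
  assumes "local_generator r X D P f"
  obtains e where "f \<in> hforms r e" "f \<notin> X" "stalk r P D = stalk r P (principal_on r X f)"
  using assms unfolding local_generator_def forms_hforms by blast

text \<open>Saturating does not change stalks, since some variable is invertible at every relevant
  prime.\<close>

lemma local_generator_hyperplane:
  assumes X: "integral_subscheme r X" and h: "h \<in> hforms r 1" "h \<notin> X" and P: "P \<in> points r X"
  shows "local_generator r X (hyperplane_section r X h) P h"
proof -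
  have int: "integral_subscheme r P" using P by (simp add: points_def)
  have hs: "hyperplane_section r X h = saturation r (principal_on r X h)"
    by (simp add: hyperplane_section_def scheme_inter_def principal_on_def)
  let ?J = "principal_on r X h"
  note iX = integral_ideal[OF X]
  have Jp: "?J \<subseteq> polys r" by (rule principal_subset[OF iX hforms_polys[OF h(1)]])
  have sat: "g \<in> saturation r ?J \<longleftrightarrow> g \<in> polys r \<and> (\<forall>i\<le>r. \<exists>N. xv i ^ N * g \<in> ?J)" for g
    by (simp add: saturation_def carrier_polys var_xv del: coord_ring_simps(1))
  obtain i where i: "i \<le> r" "xv i \<notin> P"
  proof -
    have "relevant r (gpart r P)" by (rule integral_subschemeD(2)[OF int])
    moreover have "gideal r (gpart r P)" by (rule gideal_gpart[OF integral_ideal[OF int]])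
    ultimately have "\<not> (\<forall>i\<le>r. xv i \<in> gpart r P 1)"
      using gideal_vars_full[of r "gpart r P" 1] by (auto simp: relevant_def)
    thus ?thesis using that xv_hforms by (auto simp: gpart_def)
  qed
  have "stalk r P (saturation r ?J) = stalk r P ?J"
  proof
    show "stalk r P (saturation r ?J) \<subseteq> stalk r P ?J"
    proof
      fix g assume "g \<in> stalk r P (saturation r ?J)"
      then obtain e q where q: "q \<in> hforms r e" "q \<notin> P" "q * g \<in> saturation r ?J" "g \<in> polys r" by (rule stalkE)
      then obtain N where N: "xv i ^ N * (q * g) \<in> ?J" using sat i(1) by blast
      have "q * g \<in> stalk r P ?J"
        by (rule stalkI[OF _ hforms_power[OF xv_hforms[OF i(1)], of N] integral_power[OF int xv_hforms[OF i(1)] i(2)] N])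
          (use q sat in blast)
      thus "g \<in> stalk r P ?J" by (rule stalk_trans[OF int _ q(1,2,4)])
    qed
    have "xv j ^ 0 * g \<in> ?J" if "g \<in> ?J" for j g using that by simp
    hence "?J \<subseteq> saturation r ?J" unfolding subset_iff sat using Jp by blast
    thus "stalk r P ?J \<subseteq> stalk r P (saturation r ?J)" unfolding subset_iff stalk_iff by blast
  qed
  thus ?thesis unfolding local_generator_def forms_hforms hs using h by blast
qed

text \<open>Any local generator \<open>f\<close> of the section generates the same ideal as
  \<open>h\<close> at its point, so \<open>h ^ k\<close> lies in the ideal of \<open>f ^ k\<close>
  there, and thus in \<open>divisor_sum\<close>.\<close>

lemma local_generator_hyperplane_multiple:
  assumes X: "integral_subscheme r X" and h: "h \<in> hforms r 1" "h \<notin> X" and P: "P \<in> points r X"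
  shows "local_generator r X (divisor_sum r X (\<lambda>_. hyperplane_section r X h) (\<lambda>_. k) {()}) P (h ^ k)"
proof -
  let ?H = "hyperplane_section r X h" and ?B = "divisor_sum r X (\<lambda>_. hyperplane_section r X h) (\<lambda>_. k) {()}"
  note iX = integral_ideal[OF X]
  have hp: "h \<in> polys r" by (rule hforms_polys[OF h(1)])
  have hk: "h ^ k \<in> hforms r (k * 1)" by (rule hforms_power[OF h(1)])
  have int: "integral_subscheme r P" if "P \<in> points r X" for P using that by (simp add: points_def)
  have un: "(\<forall>f :: unit => mpoly. R (f ())) \<longleftrightarrow> (\<forall>f. R f)" for R
    by (auto dest: spec[of _ "\<lambda>_. _"])
  have B: "g \<in> ?B \<longleftrightarrow> g \<in> polys r \<and> (\<forall>P\<in>points r X. \<forall>f. local_generator r X ?H P f --> g \<in> stalk r P (principal_on r X (f ^ k)))" for g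
    unfolding divisor_sum_def carrier_polys
    by (simp add: un[of "\<lambda>f. local_generator r X ?H P f --> g \<in> stalk r P (principal_on r X (f ^ k))" for P])
  have sub: "principal_on r X (h ^ k) \<subseteq> ?B"
  proof
    fix g assume g: "g \<in> principal_on r X (h ^ k)"
    have gp: "g \<in> polys r" using principal_subset[OF iX hforms_polys[OF hk]] g by blast
    have "g \<in> stalk r Q (principal_on r X (f ^ k))" if Q: "Q \<in> points r X" and f: "local_generator r X ?H Q f" for Q f
    proof -
      obtain e where e: "f \<in> hforms r e" "stalk r Q ?H = stalk r Q (principal_on r X f)" using f by (rule local_generatorD)
      have "h \<in> stalk r Q (principal_on r X h)" by (rule stalk_principal_self[OF int[OF Q] iX hp])
      also have "\<dots> = stalk r Q (principal_on r X f)"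
        using local_generator_hyperplane[OF X h Q] e(2) unfolding local_generator_def by blast
      finally show ?thesis using stalk_principal_trans[OF iX stalk_principal_power[OF int[OF Q] iX e(1)] g] by blast
    qed
    thus "g \<in> ?B" unfolding B using gp by blast
  qed
  have "stalk r P ?B = stalk r P (principal_on r X (h ^ k))"
  proof
    show "stalk r P ?B \<subseteq> stalk r P (principal_on r X (h ^ k))"
    proof
      fix g assume "g \<in> stalk r P ?B"
      then obtain e q where q: "q \<in> hforms r e" "q \<notin> P" "q * g \<in> ?B" "g \<in> polys r" by (rule stalkE)
      have "q * g \<in> stalk r P (principal_on r X (h ^ k))" using q(3) P local_generator_hyperplane[OF X h P] unfolding B by blast
      thus "g \<in> stalk r P (principal_on r X (h ^ k))" by (rule stalk_trans[OF int[OF P] _ q(1,2,4)])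
    qed
    show "stalk r P (principal_on r X (h ^ k)) \<subseteq> stalk r P ?B" using sub unfolding subset_iff stalk_iff by blast
  qed
  thus ?thesis unfolding local_generator_def forms_hforms using hk integral_power[OF X h] by blast
qed

text \<open>An element of \<open>J\<close> at every point of \<open>X\<close> lies in the saturation of \<open>J\<close>: otherwise the
  proper ideal \<open>J : w\<close> would be contained in some relevant prime.\<close>

lemma local_to_global:
  assumes J: "gideal r J" and X: "closed_subscheme r X" and XJ: "gpart r X \<le> J" and w: "w \<in> hforms r t"
    and loc: "\<And>P. P \<in> points r X ==> w \<in> stalk r P (gunion r J)"
  shows "w \<in> gsat r J t"
proof (rule ccontr)
  assume n: "w \<notin> gsat r J t"
  let ?K = "gcolon r J w t"
  have K: "gideal r ?K" "J \<le> ?K" using gideal_gcolon[OF J] gcolon_ge[OF J w] by auto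
  have "?K u \<noteq> hforms r u" for u
  proof
    assume "?K u = hforms r u"
    hence "\<forall>q\<in>hforms r u. q * w \<in> J (u + t)" by (auto simp: gcolon_def mult.commute add.commute)
    thus False using n w by (auto simp: gsat_def)
  qed
  hence "hilb r ?K u \<noteq> 0" for u using hilb_0_iff[OF K(1)] by blast
  hence "hpol r ?K \<noteq> 0" using hpol_bound[OF K(1)] by (metis order_refl of_nat_eq_0_iff poly_0)
  then obtain P where P: "gprime r P" "?K \<le> P" "hpol r P \<noteq> 0" using exists_prime_same_degree[OF K(1)] by blast
  note gP = gprime_gideal[OF P(1)]
  have "gpart r X \<le> P" using XJ K(2) P(2) by (meson order_trans)
  hence "gunion r P \<in> points r X" unfolding points_gunion[OF X] using P(1) hpol_relevant(1)[OF gP P(3)] by blast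
  from loc[OF this] obtain e q where q: "q \<in> hforms r e" "q \<notin> gunion r P" "q * w \<in> gunion r J" by (rule stalkE)
  have "q * w \<in> J (e + t)" using q(3) gunion_form_iff[OF J hforms_mult[OF q(1) w]] by blast
  hence "q \<in> ?K e" using q(1) by (simp add: gcolon_def mult.commute add.commute)
  hence "q \<in> P e" using P(2) by (auto simp: le_fun_def)
  thus False using q(1,2) gunion_form_iff[OF gP q(1)] by blast
qed

text \<open>The ideal sheaf of \<open>D\<close> on \<open>X\<close> is the structure sheaf twisted
  by \<open>- k\<close>, through multiplication by the rational function \<open>b / a\<close>. Local
  information determines ideals only up to saturation, so the correspondence is demanded in large
  degrees.\<close>

definition divisor_relation :: "nat => (nat => mpoly set) => (nat => mpoly set) => nat => nat => mpoly => mpoly => nat => bool" where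
  "divisor_relation r X D k e a b t0 \<longleftrightarrow> a \<in> hforms r (e + k) \<and> b \<in> hforms r e \<and> a \<notin> X (e + k) \<and> b \<notin> X e \<and>
    (\<forall>t\<ge>t0. (\<forall>u\<in>D (k + t). \<exists>g\<in>hforms r t. b * u - a * g \<in> X (e + k + t)) \<and>
      (\<forall>g\<in>hforms r t. \<exists>u\<in>D (k + t). b * u - a * g \<in> X (e + k + t)))"

text \<open>Linear equivalence speaks about stalks. With \<open>A = a * h ^ k\<close> for a
  hyperplane \<open>h\<close> not containing \<open>X\<close>, it says that \<open>b\<close> times
  the ideal of \<open>D\<close> and the multiples of \<open>A\<close> have the same stalks on
  \<open>X\<close>; \<open>local_to_global\<close> in both directions makes them agree in large
  degrees.\<close>

lemma divisor_relation_exists: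
  assumes X: "integral_subscheme r X" and cart: "effective_cartier r X D" and eq: "equiv_hyperplane_multiple r X D"
  shows "\<exists>k e a b t0. divisor_relation r (gpart r X) (gpart r D) k e a b t0"
proof -
  have clX: "closed_subscheme r X" using X by (simp add: integral_subscheme_def)
  have clD: "closed_subscheme r D" and XD: "X \<subseteq> D" and gen: "\<And>P. P \<in> points r X ==> \<exists>f. local_generator r X D P f"
    using cart by (auto simp: effective_cartier_def subscheme_of_def)
  note gX = closed_subschemeD[OF clX] and gD = closed_subschemeD[OF clD] and iX = integral_ideal[OF X]
  have iD: "ideal D (coord_ring r)" using ideal_gunion[OF gD(1)] gD(2) by simp
  obtain k where k: "for_general_hyperplane r
     (\<lambda>h. lin_equiv r X D (divisor_sum r X (\<lambda>_. hyperplane_section r X h) (\<lambda>_. k) {()}))"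
    using eq by (auto simp: equiv_hyperplane_multiple_def)
  obtain c where c: "lin_equiv r X D (divisor_sum r X (\<lambda>_. hyperplane_section r X (linear_form r c)) (\<lambda>_. k) {()})"
    "linear_form r c \<notin> gpart r X 1"
    using general_hyperplane_witness[OF k general_hyperplane_notin[OF gX(1) integral_subschemeD(2)[OF X]]] by blast
  define h where "h = linear_form r c"
  have h: "h \<in> hforms r 1" "h \<notin> X" using c(2) linear_form_hforms by (auto simp: h_def gpart_def)
  obtain e a b where ab: "a \<in> hforms r e" "b \<in> hforms r e" "a \<notin> X" "b \<notin> X"
    and st: "\<And>P f. P \<in> points r X ==> local_generator r X D P f ==>
        stalk r P (principal_on r X (b * f)) = stalk r P (principal_on r X (a * h ^ k))"
    using c(1) local_generator_hyperplane_multiple[OF X h] unfolding lin_equiv_def forms_hforms h_def[symmetric] by blast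
  define A where "A = a * h ^ k"
  have hk: "h ^ k \<in> hforms r k" using hforms_power[OF h(1), of k] by simp
  have A: "A \<in> hforms r (e + k)" "A \<notin> X"
    unfolding A_def using hforms_mult[OF ab(1) hk]
      integral_prime[OF X hforms_polys[OF ab(1)] hforms_polys[OF hk] ab(3) integral_power[OF X h]] by auto
  have int: "integral_subscheme r P" if "P \<in> points r X" for P using that by (simp add: points_def)
  let ?J = "gadd r (gpart r X) A (e + k)" and ?M = "gsum (gpart r X) (gmul b e (gpart r D))"
  have J: "gideal r ?J" and M: "gideal r ?M" "gideal r (gmul b e (gpart r D))"
    using gideal_gadd[OF gX(1) A(1)] gideal_gsum[OF gX(1)] gideal_gmul[OF gD(1) ab(2)] by blast+
  have pJ: "principal_on r X A = gunion r ?J"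
    using gunion_principal[OF gX(1) A(1)] gX(2) by (simp add: principal_on_def)
  have bp: "b \<in> polys r" by (rule hforms_polys[OF ab(2)])
  have 1: "b * u \<in> gsat r ?J (e + t)" if u: "u \<in> gpart r D t" for u t
  proof (rule local_to_global[OF J clX gadd_ge[OF gX(1)]])
    have uD: "u \<in> hforms r t" "u \<in> D" using u by (auto simp: gpart_def)
    show "b * u \<in> hforms r (e + t)" by (rule hforms_mult[OF ab(2) uD(1)])
    fix P assume P: "P \<in> points r X"
    obtain f where f: "local_generator r X D P f" using gen[OF P] by blast
    obtain ef where ef: "f \<in> hforms r ef" "stalk r P D = stalk r P (principal_on r X f)" using f by (rule local_generatorD)
    have "u \<in> stalk r P D" using stalk_self[OF int[OF P], of D] iD uD by (auto simp: ideal_iff)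
    then obtain e' q where q: "q \<in> hforms r e'" "q \<notin> P" "q * u \<in> principal_on r X f" unfolding ef(2) by (rule stalkE)
    have "b * (q * u) \<in> principal_on r X (b * f)" by (rule principal_mult[OF iX q(3) bp])
    hence "q * (b * u) \<in> principal_on r X (b * f)" by (simp add: mult_ac)
    hence "b * u \<in> stalk r P (principal_on r X (b * f))"
      by (rule stalkI[OF polys_mult[OF bp hforms_polys[OF uD(1)]] q(1,2)])
    thus "b * u \<in> stalk r P (gunion r ?J)" unfolding st[OF P f] A_def[symmetric] pJ .
  qed
  have 2: "A * g \<in> gsat r ?M (e + k + t)" if g: "g \<in> hforms r t" for g t
  proof (rule local_to_global[OF M(1) clX gsum_ge(1)[OF gX(1) M(2)] hforms_mult[OF A(1) g]])
    fix P assume P: "P \<in> points r X"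
    obtain f where f: "local_generator r X D P f" using gen[OF P] by blast
    obtain ef where ef: "f \<in> hforms r ef" "stalk r P D = stalk r P (principal_on r X f)" using f by (rule local_generatorD)
    have fp: "f \<in> polys r" by (rule hforms_polys[OF ef(1)])
    have gp: "g \<in> polys r" "A \<in> polys r" using g A(1) hforms_polys by auto
    have "g * A \<in> stalk r P (principal_on r X A)"
      by (rule stalk_principal_trans[OF iX stalk_principal_self[OF int[OF P] iX gp(2)] principal_scale[OF iX principal_self[OF iX] gp(1)]])
    hence "g * A \<in> stalk r P (principal_on r X (b * f))" unfolding st[OF P f] A_def .
    then obtain e' q where q: "q \<in> hforms r e'" "q \<notin> P" "q * (g * A) \<in> principal_on r X (b * f)" by (rule stalkE)
    have "f \<in> stalk r P (principal_on r X f)" by (rule stalk_principal_self[OF int[OF P] iX fp])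
    then obtain e'' q' where q': "q' \<in> hforms r e''" "q' \<notin> P" "q' * f \<in> D" unfolding ef(2)[symmetric] by (rule stalkE)
    obtain x p where x: "q * (g * A) = x + p * (b * f)" "x \<in> X" "p \<in> polys r" using q(3) unfolding principal_on_iff by blast
    have "(q' * q) * (A * g) = q' * (q * (g * A))" by (simp add: mult_ac)
    also have "\<dots> = q' * x + b * (p * (q' * f))" by (simp only: x(1)) (simp add: distrib_left mult_ac)
    finally have e: "(q' * q) * (A * g) = q' * x + b * (p * (q' * f))" .
    have "q' * x \<in> X" using iX x(2) hforms_polys[OF q'(1)] by (simp add: ideal_iff)
    hence "q' * x \<in> gunion r ?M" using gunion_mono[OF gsum_ge(1)[OF gX(1) M(2)], of r] gX(2) by blast
    moreover have "p * (q' * f) \<in> gunion r (gpart r D)" using iD q'(3) x(3) gD(2) by (simp add: ideal_iff)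
    hence "b * (p * (q' * f)) \<in> gunion r ?M"
      using gunion_gmulI[OF gD(1) ab(2)] gunion_mono[OF gsum_ge(2)[OF gX(1) M(2)], of r] by blast
    ultimately have mem: "(q' * q) * (A * g) \<in> gunion r ?M" unfolding e using ideal_gunion[OF M(1)] by (simp add: ideal_iff)
    show "A * g \<in> stalk r P (gunion r ?M)"
    proof (rule stalkI[OF polys_mult[OF gp(2,1)] hforms_mult[OF q'(1) q(1)] _ mem])
      show "q' * q \<notin> P" using integral_prime[OF int[OF P] hforms_polys[OF q'(1)] hforms_polys[OF q(1)] q'(2) q(2)] .
    qed
  qed
  obtain t1 where t1: "\<And>t. t \<ge> t1 ==> gsat r ?J t = ?J t" using gsat_eventually[OF infinite_UNIV_complex J] by metis
  obtain t2 where t2: "\<And>t. t \<ge> t2 ==> gsat r ?M t = ?M t" using gsat_eventually[OF infinite_UNIV_complex M(1)] by metis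
  have "divisor_relation r (gpart r X) (gpart r D) k e A b (t1 + t2)"
    unfolding divisor_relation_def
  proof (intro conjI allI impI ballI)
    show "A \<in> hforms r (e + k)" "b \<in> hforms r e" "A \<notin> gpart r X (e + k)" "b \<notin> gpart r X e"
      using A ab by (auto simp: gpart_def)
    fix t u assume t: "t1 + t2 \<le> t" and u: "u \<in> gpart r D (k + t)"
    have "b * u \<in> ?J (e + k + t)" using 1[OF u] t1[of "e + k + t"] t by (simp add: add.assoc)
    then obtain x g where x: "b * u = x + A * g" "x \<in> gpart r X (e + k + t)" "g \<in> hforms r t" by (rule gadd_memberE)
    thus "\<exists>g\<in>hforms r t. b * u - A * g \<in> gpart r X (e + k + t)" by (intro bexI[of _ g]) simp_all
  next
    fix t and g :: mpoly assume t: "t1 + t2 \<le> t" and g: "g \<in> hforms r t"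
    have "A * g \<in> ?M (e + k + t)" using 2[OF g] t2[of "e + k + t"] t by simp
    then obtain x y where x: "A * g = x + y" "x \<in> gpart r X (e + k + t)" "y \<in> gmul b e (gpart r D) (e + (k + t))"
      by (auto simp: gsum_def add.assoc)
    obtain u where u: "y = b * u" "u \<in> gpart r D (k + t)" using x(3) by (rule gmulE)
    have "b * u - A * g = - x" using x(1) u(1) by simp
    thus "\<exists>u\<in>gpart r D (k + t). b * u - A * g \<in> gpart r X (e + k + t)"
      using u(2) gideal_uminus[OF gX(1) x(2)] by (intro bexI[of _ u]) simp_all
  qed
  thus ?thesis by blast
qed

section \<open>Residuation by a divisor\<close>

text \<open>The ideal quotient \<open>C : D\<close>, which defines the residual scheme of
  \<open>C\<close> with respect to \<open>D\<close>.\<close>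

definition gquot :: "nat => (nat => 'k::field mp set) => (nat => 'k mp set) => nat => 'k mp set" where
  "gquot r C D t = {g \<in> hforms r t. \<forall>t'. \<forall>u\<in>D t'. u * g \<in> C (t' + t)}"

lemma gquotD: "g \<in> gquot r C D t ==> u \<in> D t' ==> u * g \<in> C (t' + t)"
  by (simp add: gquot_def)

lemma gideal_gquot:
  assumes C: "gideal r C"
  shows "gideal r (gquot r C D)"
  unfolding gideal_def
proof (intro conjI allI ballI)
  fix t
  show "gquot r C D t \<subseteq> hforms r t" by (auto simp: gquot_def)
  show "pv.subspace (gquot r C D t)"
    by (rule pv.subspaceI)
      (auto simp: gquot_def gideal_0[OF C] hforms_add distrib_left gideal_add[OF C] sc_mult_right gideal_sc[OF C]
        pv.subspace_scale[OF subspace_hforms])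
next
  fix k t and q g :: "'a mp" assume q: "q \<in> hforms r k" and g: "g \<in> gquot r C D t"
  have "u * (q * g) \<in> C (t' + (k + t))" if "u \<in> D t'" for u t'
    using gideal_mult[OF C q gquotD[OF g that]] by (simp add: mult.left_commute add.left_commute)
  thus "q * g \<in> gquot r C D (k + t)" using g hforms_mult[OF q] by (simp add: gquot_def)
qed

lemma gquot_ge:
  assumes C: "gideal r C" and D: "\<And>t. D t \<subseteq> hforms r t"
  shows "C \<le> gquot r C D"
proof -
  have "g \<in> gquot r C D t" if "g \<in> C t" for g t
    using gideal_forms[OF C, of t] gideal_mult[OF C _ that] D that unfolding gquot_def by blast
  thus ?thesis by (auto simp: le_fun_def)
qed

lemma gsat_gquot:
  assumes C: "gideal r C" "gsat r C = C" and D: "\<And>t. D t \<subseteq> hforms r t"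
  shows "gsat r (gquot r C D) = gquot r C D"
proof (rule antisym)
  have "g \<in> gquot r C D t" if g: "g \<in> gsat r (gquot r C D) t" for g t
  proof -
    obtain N where N: "\<forall>q\<in>hforms r N. q * g \<in> gquot r C D (N + t)" and gf: "g \<in> hforms r t"
      using g by (auto simp: gsat_def)
    have "u * g \<in> C (t' + t)" if u: "u \<in> D t'" for u t'
    proof -
      have "q * (u * g) \<in> C (N + (t' + t))" if q: "q \<in> hforms r N" for q
        using gquotD[OF N[rule_format, OF q] u] by (simp add: mult.left_commute add.left_commute)
      hence "u * g \<in> gsat r C (t' + t)" using hforms_mult[OF subsetD[OF D u] gf] by (auto simp: gsat_def)
      thus ?thesis unfolding C(2) .
    qed
    thus ?thesis using gf by (simp add: gquot_def)
  qed
  thus "gsat r (gquot r C D) \<le> gquot r C D" by (auto simp: le_fun_def)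
qed (rule gsat_ge[OF gideal_gquot[OF C(1)]])

locale divisor_on =
  fixes r :: nat and X D :: "nat => mpoly set" and k e :: nat and a b :: mpoly and t0 :: nat
  assumes X: "gprime r X" and D: "gideal r D" "X \<le> D" and rel: "divisor_relation r X D k e a b t0"
begin

lemma gX: "gideal r X"
  using X gprime_gideal by blast

lemma ab: "a \<in> hforms r (e + k)" "b \<in> hforms r e" "a \<notin> X (e + k)" "b \<notin> X e"
  and to_form: "t \<ge> t0 ==> u \<in> D (k + t) ==> \<exists>g\<in>hforms r t. b * u - a * g \<in> X (e + k + t)"
  and of_form: "t \<ge> t0 ==> g \<in> hforms r t ==> \<exists>u\<in>D (k + t). b * u - a * g \<in> X (e + k + t)"
  using rel unfolding divisor_relation_def by blast+

text \<open>On \<open>X\<close> both \<open>g / u\<close> and \<open>g' / u'\<close> are the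
  function \<open>b / a\<close>; clear denominators and cancel \<open>a\<close>.\<close>

lemma cross:
  assumes u: "u \<in> D (k + t)" "g \<in> hforms r t" "b * u - a * g \<in> X (e + k + t)"
    and u': "u' \<in> D (k + t')" "g' \<in> hforms r t'" "b * u' - a * g' \<in> X (e + k + t')"
  shows "u' * g - u * g' \<in> X (k + t + t')"
proof -
  have uf: "u \<in> hforms r (k + t)" "u' \<in> hforms r (k + t')" using u(1) u'(1) gideal_forms[OF D(1)] by blast+
  have "u * (b * u' - a * g') \<in> X (k + t + (e + k + t'))" by (rule gideal_mult[OF gX uf(1) u'(3)])
  moreover have "u' * (b * u - a * g) \<in> X (k + t' + (e + k + t))" by (rule gideal_mult[OF gX uf(2) u(3)])
  ultimately have "u * (b * u' - a * g') - u' * (b * u - a * g) \<in> X (e + k + (k + t + t'))"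
    using gideal_diff[OF gX] by (simp add: add_ac)
  moreover have "u * (b * u' - a * g') - u' * (b * u - a * g) = a * (u' * g - u * g')" by (simp add: algebra_simps)
  ultimately have "a * (u' * g - u * g') \<in> X (e + k + (k + t + t'))" by simp
  moreover have "u' * g - u * g' \<in> hforms r (k + t + t')"
    using hforms_diff[of "u' * g" r "k + t + t'" "u * g'"] hforms_mult[OF uf(2) u(2)] hforms_mult[OF uf(1) u'(2)] by (simp add: add_ac)
  ultimately show ?thesis using gprimeD[OF X ab(1)] ab(3) by blast
qed

context
  fixes C :: "nat => mpoly set"
  assumes C: "gideal r C" "gsat r C = C" "X \<le> C"
begin

lemma XC: "x \<in> X t ==> x \<in> C t"
  using C(3) by (auto simp: le_fun_def)

text \<open>The partners \<open>g\<close> and \<open>u\<close> correspond under the twist. Since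
  partners are available only in large degrees, both directions first multiply by all forms of a
  large degree and then use that \<open>C\<close> is saturated.\<close>

lemma mem_iff:
  assumes u: "u \<in> D (k + t)" "g \<in> hforms r t" "b * u - a * g \<in> X (e + k + t)"
  shows "g \<in> gquot r C D t \<longleftrightarrow> u \<in> C (k + t)"
proof
  assume g: "g \<in> gquot r C D t"
  have uf: "u \<in> hforms r (k + t)" using u(1) gideal_forms[OF D(1)] by blast
  have "q * u \<in> C (t0 + (k + t))" if q: "q \<in> hforms r t0" for q
  proof -
    obtain u' where u': "u' \<in> D (k + t0)" "b * u' - a * q \<in> X (e + k + t0)" using of_form[OF order_refl q] by blast
    have "u' * g - u * q \<in> C (k + t + t0)" by (rule XC[OF cross[OF u u'(1) q u'(2)]])
    moreover have "u' * g \<in> C (k + t + t0)" using gquotD[OF g u'(1)] by (simp add: add_ac)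
    ultimately have "u' * g - (u' * g - u * q) \<in> C (k + t + t0)" using gideal_diff[OF C(1)] by blast
    thus ?thesis by (simp add: mult.commute add_ac)
  qed
  hence "u \<in> gsat r C (k + t)" using uf by (auto simp: gsat_def)
  thus "u \<in> C (k + t)" unfolding C(2) .
next
  assume uC: "u \<in> C (k + t)"
  have "w * g \<in> C (t' + t)" if w: "w \<in> D t'" for w t'
  proof -
    have wf: "w \<in> hforms r t'" using w gideal_forms[OF D(1)] by blast
    have "q * (w * g) \<in> C (k + t0 + (t' + t))" if q: "q \<in> hforms r (k + t0)" for q
    proof -
      have qw: "q * w \<in> D (k + (t0 + t'))" using gideal_mult[OF D(1) q w] by (simp add: add_ac)
      then obtain g' where g': "g' \<in> hforms r (t0 + t')" "b * (q * w) - a * g' \<in> X (e + k + (t0 + t'))"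
        using to_form[of "t0 + t'"] by auto
      have "q * w * g - u * g' \<in> C (k + t + (t0 + t'))" by (rule XC[OF cross[OF u qw g']])
      moreover have "u * g' \<in> C (k + t + (t0 + t'))" using gideal_mult[OF C(1) g'(1) uC] by (simp add: mult.commute add_ac)
      ultimately have "(q * w * g - u * g') + u * g' \<in> C (k + t + (t0 + t'))" by (rule gideal_add[OF C(1)])
      thus ?thesis by (simp add: mult_ac add_ac)
    qed
    hence "w * g \<in> gsat r C (t' + t)" using hforms_mult[OF wf u(2)] by (auto simp: gsat_def)
    thus ?thesis unfolding C(2) .
  qed
  thus "g \<in> gquot r C D t" using u(2) by (simp add: gquot_def)
qed

text \<open>The exact sequence of the residual scheme. Multiplication by \<open>b\<close> maps
  \<open>D / (C \<inter> D)\<close>, and multiplication by \<open>a\<close> maps the quotient by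
  \<open>C : D\<close> shifted by \<open>k\<close>, isomorphically onto the same space
  \<open>T / W\<close>; the former quotient is also \<open>(C + D) / C\<close>.\<close>

lemma hilb_residual:
  assumes t: "t \<ge> t0"
  shows "hilb r C (k + t) = hilb r (gsum C D) (k + t) + hilb r (gquot r C D) t"
proof -
  let ?T = "{b * u + x | u x. u \<in> D (k + t) \<and> x \<in> X (e + k + t)}"
  let ?W = "{y + x | y x. y \<in> (\<lambda>u. b * u) ` (C (k + t) \<inter> D (k + t)) \<and> x \<in> X (e + k + t)}"
  interpret l: Vector_Spaces.linear sc sc "\<lambda>u. b * u" by (rule linear_mult)
  have sI: "pv.subspace (C (k + t) \<inter> D (k + t))"
    by (rule pv.subspace_inter[OF gideal_subspace[OF C(1)] gideal_subspace[OF D(1)]])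
  have sW: "pv.subspace ?W"
    by (rule pv.subspace_sums[OF l.subspace_image[OF sI] gideal_subspace[OF gX]])
  have T: "?T = {y + x | y x. y \<in> (\<lambda>u. b * u) ` D (k + t) \<and> x \<in> X (e + k + t)}" by blast
  have sT: "pv.subspace ?T"
    unfolding T by (rule pv.subspace_sums[OF l.subspace_image[OF gideal_subspace[OF D(1)]] gideal_subspace[OF gX]])
  have WT: "?W \<subseteq> ?T" by blast
  have Wx: "x \<in> ?W" if "x \<in> X (e + k + t)" for x
  proof -
    have "0 \<in> (\<lambda>u. b * u) ` (C (k + t) \<inter> D (k + t))"
      using gideal_0[OF C(1)] gideal_0[OF D(1)] by (intro image_eqI[of _ _ 0]) auto
    moreover have "x = 0 + x" by simp
    ultimately show ?thesis using that by blast
  qed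
  have m1: "b * u \<in> ?T" if "u \<in> D (k + t)" for u
    using that gideal_0[OF gX, of "e + k + t"] by (intro CollectI exI[of _ u] exI[of _ 0]) simp
  have m2: "\<exists>u\<in>D (k + t). w - b * u \<in> ?W" if w: "w \<in> ?T" for w
  proof -
    obtain u x where u: "w = b * u + x" "u \<in> D (k + t)" "x \<in> X (e + k + t)" using w by blast
    hence "w - b * u = x" by simp
    hence "w - b * u \<in> ?W" using Wx[OF u(3)] by (simp only:)
    thus ?thesis using u(2) by (intro bexI[of _ u])
  qed
  have m3: "u \<in> C (k + t) \<inter> D (k + t) \<longleftrightarrow> b * u \<in> ?W" if u: "u \<in> D (k + t)" for u
  proof
    assume uc: "u \<in> C (k + t) \<inter> D (k + t)"
    have "b * u = b * u + 0" by simp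
    thus "b * u \<in> ?W" using uc gideal_0[OF gX, of "e + k + t"] by blast
  next
    assume "b * u \<in> ?W"
    then obtain u2 x where u2: "b * u = b * u2 + x" "u2 \<in> C (k + t)" "u2 \<in> D (k + t)" "x \<in> X (e + k + t)" by blast
    have "b * (u - u2) \<in> X (e + (k + t))" using u2(1,4) by (simp add: right_diff_distrib add.assoc)
    moreover have "u - u2 \<in> hforms r (k + t)" using u u2(3) gideal_forms[OF D(1), of "k + t"] hforms_diff by blast
    ultimately have "u - u2 \<in> C (k + t)" using gprimeD[OF X ab(2)] ab(4) XC by blast
    hence "(u - u2) + u2 \<in> C (k + t)" using u2(2) by (rule gideal_add[OF C(1)])
    thus "u \<in> C (k + t) \<inter> D (k + t)" using u by simp
  qed
  have q1: "pv.qdim (D (k + t)) (C (k + t) \<inter> D (k + t)) = pv.qdim ?T ?W"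
    using pvp.finq_map(2)[OF linear_mult gideal_subspace[OF D(1)] sW sT m1 m2 m3 Int_lower2 WT] .
  have n1: "a * g \<in> ?T" if g: "g \<in> hforms r t" for g
  proof -
    obtain u where u: "u \<in> D (k + t)" "b * u - a * g \<in> X (e + k + t)" using of_form[OF t g] by blast
    have "a * g = b * u + - (b * u - a * g)" by simp
    thus ?thesis using u(1) gideal_uminus[OF gX u(2)] by blast
  qed
  have n2: "\<exists>g\<in>hforms r t. w - a * g \<in> ?W" if w: "w \<in> ?T" for w
  proof -
    obtain u x where u: "w = b * u + x" "u \<in> D (k + t)" "x \<in> X (e + k + t)" using w by blast
    obtain g where g: "g \<in> hforms r t" "b * u - a * g \<in> X (e + k + t)" using to_form[OF t u(2)] by blast
    have "w - a * g = (b * u - a * g) + x" using u(1) by simp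
    hence "w - a * g \<in> ?W" using Wx[OF gideal_add[OF gX g(2) u(3)]] by (simp only:)
    thus ?thesis using g(1) by (intro bexI[of _ g])
  qed
  have n3: "g \<in> gquot r C D t \<longleftrightarrow> a * g \<in> ?W" if g: "g \<in> hforms r t" for g
  proof
    assume gq: "g \<in> gquot r C D t"
    obtain u where u: "u \<in> D (k + t)" "b * u - a * g \<in> X (e + k + t)" using of_form[OF t g] by blast
    have "u \<in> C (k + t)" using mem_iff[OF u(1) g u(2)] gq by blast
    moreover have "a * g = b * u + - (b * u - a * g)" by simp
    ultimately show "a * g \<in> ?W" using u(1) gideal_uminus[OF gX u(2)] by blast
  next
    assume "a * g \<in> ?W"
    then obtain u x where u: "a * g = b * u + x" "u \<in> C (k + t)" "u \<in> D (k + t)" "x \<in> X (e + k + t)" by blast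
    have "b * u - a * g \<in> X (e + k + t)" using u(1) gideal_uminus[OF gX u(4)] by simp
    thus "g \<in> gquot r C D t" using mem_iff[OF u(3) g] u(2) by blast
  qed
  have q2: "hilb r (gquot r C D) t = pv.qdim ?T ?W"
    unfolding hilb_def using pvp.finq_map(2)[OF linear_mult subspace_hforms sW sT n1 n2 n3 _ WT] by (simp add: gquot_def)
  note gS = gideal_gsum[OF C(1) D(1)]
  have CS: "C (k + t) \<subseteq> gsum C D (k + t)" "D (k + t) \<subseteq> gsum C D (k + t)"
    using gsum_ge[OF C(1) D(1)] by (auto simp: le_fun_def)
  have i2: "\<exists>u\<in>D (k + t). w - u \<in> C (k + t)" if w: "w \<in> gsum C D (k + t)" for w
  proof -
    obtain x u where "w = x + u" "x \<in> C (k + t)" "u \<in> D (k + t)" using w by (auto simp: gsum_def)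
    thus ?thesis by (intro bexI[of _ u]) simp_all
  qed
  have "pv.qdim (D (k + t)) (C (k + t) \<inter> D (k + t)) = pv.qdim (gsum C D (k + t)) (C (k + t))"
    using pvp.finq_map(2)[OF linear_id_sc gideal_subspace[OF D(1)] gideal_subspace[OF C(1)] gideal_subspace[OF gideal_gsum[OF C(1) D(1)]], of "k + t" "k + t" "k + t" "C (k + t) \<inter> D (k + t)"]
      CS i2 by blast
  thus ?thesis using hilb_split[OF C(1) gS CS(1)] q1 q2 by simp
qed

lemma hpol_residual:
  "poly (hpol r C) x = poly (hpol r (gsum C D)) x + poly (hpol r (gquot r C D)) (x - real k)"
proof -
  have "poly (hpol r C) ((x - real k) + real k) =
      poly (hpol r (gquot r C D)) (x - real k) + poly (hpol r (gsum C D)) ((x - real k) + real k)"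
    by (rule hpol_shift_add[OF C(1) gideal_gsum[OF C(1) D(1)] gideal_gquot[OF C(1)], where ?t0.0 = t0]) (simp add: hilb_residual)
  thus ?thesis by simp
qed

end

text \<open>Apply the residual sequence to \<open>X\<close> itself, where \<open>X : D = X\<close>
  because \<open>X\<close> is prime.\<close>

lemma hpol_divisor:
  assumes rel: "relevant r X" and ne: "D \<noteq> X"
  shows "poly (hpol r D) x = poly (hpol r X) x - poly (hpol r X) (x - real k)"
proof -
  obtain t u where u: "u \<in> D t" "u \<notin> X t" using ne D(2) by (auto simp: le_fun_def fun_eq_iff)
  have uf: "u \<in> hforms r t" using u(1) gideal_forms[OF D(1)] by blast
  have "gquot r X D \<le> X"
  proof -
    have "g \<in> X t'" if "g \<in> gquot r X D t'" for g t'
      using gprimeD[OF X uf, of g t'] that u by (auto simp: gquot_def)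
    thus ?thesis by (auto simp: le_fun_def)
  qed
  moreover have "X \<le> gquot r X D" by (rule gquot_ge[OF gX gideal_forms[OF D(1)]])
  ultimately have "gquot r X D = X" by simp
  moreover have "gsum X D = D"
    using gsum_ge[OF gX D(1)] gsum_least[OF D(1) D(2) order_refl] by (intro antisym) blast+
  ultimately show ?thesis using hpol_residual[OF gX gprime_saturated[OF X rel] order_refl, of x] by simp
qed

end

section \<open>Peeling off one divisor after another\<close>

lemma hpol_linear_mono:
  fixes I J :: "nat => mpoly set"
  assumes "gideal r I" "gideal r J" "I \<le> J" "hpol r I = [:c, real d:]" "hpol r J = [:c', real d':]"
  shows "d' \<le> d" "d' = d ==> c' \<le> c"
proof -
  obtain t1 where t1: "\<And>t. t \<ge> t1 ==> real (hilb r I t) = poly (hpol r I) (real t)" using hpol_bound[OF assms(1)] by blast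
  obtain t2 where t2: "\<And>t. t \<ge> t2 ==> real (hilb r J t) = poly (hpol r J) (real t)" using hpol_bound[OF assms(2)] by blast
  have le: "c' + real t * real d' \<le> c + real t * real d" if "t \<ge> t1 + t2" for t
    using hilb_mono[OF assms(1,2), of t] assms(3) t1[of t] t2[of t] that assms(4,5) by (simp add: le_fun_def)
  show "d' \<le> d"
  proof (rule ccontr)
    assume n: "\<not> d' \<le> d"
    define T where "T = t1 + t2 + nat \<lceil>c - c'\<rceil> + 1"
    have "real T * (real d + 1) \<le> real T * real d'" using n by (intro mult_left_mono) auto
    moreover have "c - c' < real T" unfolding T_def by linarith
    moreover have "t1 + t2 \<le> T" by (simp add: T_def)
    ultimately show False using le[of T] by (simp add: distrib_left)
  qed
  show "d' = d ==> c' \<le> c" using le[of "t1 + t2"] by simp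
qed

text \<open>Successive residuals by the listed divisors exhaust \<open>C\<close>. In this form the
  inclusion of \<open>C\<close> in \<open>S\<close> enters: products of elements from the ideals of
  the components lie in the ideal of \<open>S\<close>.\<close>

primrec annihilated :: "nat => (nat => nat => mpoly set) => nat list => (nat => mpoly set) => bool" where
  "annihilated r G [] C \<longleftrightarrow> 1 \<in> C 0"
| "annihilated r G (i # fc) C \<longleftrightarrow> annihilated r G fc (gquot r C (G i))"

lemma prod_forms:
  assumes "list_all2 (\<lambda>i (u, t). u \<in> G i t) fc us" "\<And>i t. G i t \<subseteq> hforms r t"
  shows "prod_list (map fst us) \<in> hforms r (sum_list (map snd us))"
  using assms(1)
proof (induction fc us rule: list_all2_induct)
  case (Cons i fc x us)
  thus ?case using hforms_mult[of "fst x" r "snd x"] assms(2)[of i "snd x"] by (auto split: prod.splits)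
qed simp

lemma annihilatedI:
  assumes "\<And>us. list_all2 (\<lambda>i (u, t). u \<in> G i t) fc us ==> prod_list (map fst us) \<in> C (sum_list (map snd us))"
    and forms: "\<And>i t. G i t \<subseteq> hforms r t"
  shows "annihilated r G fc C"
  using assms(1)
proof (induction fc arbitrary: C)
  case Nil
  thus ?case using Nil.prems[of "[]"] by simp
next
  case (Cons i fc)
  have "prod_list (map fst us) \<in> gquot r C (G i) (sum_list (map snd us))"
    if us: "list_all2 (\<lambda>i (u, t). u \<in> G i t) fc us" for us
    using prod_forms[OF us forms] Cons.prems[of "(_, _) # us"] us by (simp add: gquot_def)
  thus ?case using Cons.IH by simp
qed

text \<open>The list \<open>ds\<close> holds the degrees of the pieces cut out on the successive
  divisors. The first piece is the whole intersection with its divisor; a later one is cut from a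
  residual, hence no larger than the intersection with \<open>C\<close>. The twist of each residual
  costs \<open>k i\<close> times the degree still left, which is at most the degree left after the
  first cut.\<close>

lemma peel:
  fixes C X :: "nat => mpoly set" and B :: "nat => nat => real"
  assumes div: "\<And>i. i \<in> set fc ==> \<exists>e a b t0. divisor_on r X (G i) (k i) e a b t0"
    and B: "\<And>i Z c d. i \<in> set fc ==> gideal r Z ==> gsat r Z = Z ==> G i \<le> Z ==> hpol r Z = [:c, real d:] ==> - c \<le> B i d"
    and C: "gideal r C" "gsat r C = C" "X \<le> C" "hpol r C = [:c, real d:]" "annihilated r G fc C"
  shows "\<exists>ds. length ds = length fc \<and> sum_list ds = d \<and>
    (\<forall>(i, x)\<in>set (zip fc ds). \<forall>c' d'. hpol r (gsum C (G i)) = [:c', real d':] --> x \<le> d') \<and>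
    (fc \<noteq> [] --> (\<forall>c' d'. hpol r (gsum C (G (hd fc))) = [:c', real d':] --> hd ds = d')) \<and>
    - c \<le> sum_list (map2 B fc ds) + real (sum_list (map k fc)) * real (sum_list (tl ds))"
  using assms
proof (induction fc arbitrary: C c d)
  case Nil
  have "hpol r C = 0" using hpol_relevant(2)[OF Nil.prems(3)] Nil.prems(7) by auto
  thus ?case using Nil.prems(6) by (auto simp: pCons_eq_0_iff)
next
  case (Cons i fc)
  note C = Cons.prems(3-7)
  obtain e a b t0 where "divisor_on r X (G i) (k i) e a b t0" using Cons.prems(1)[of i] by auto
  then interpret d: divisor_on r X "G i" "k i" e a b t0 .
  let ?Z = "gsum C (G i)" and ?Q = "gquot r C (G i)"
  have Z: "gideal r ?Z" "C \<le> ?Z" "G i \<le> ?Z" using gideal_gsum[OF C(1) d.D(1)] gsum_ge[OF C(1) d.D(1)] by blast+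
  have Q: "gideal r ?Q" "gsat r ?Q = ?Q" "C \<le> ?Q"
    using gideal_gquot[OF C(1)] gsat_gquot[OF C(1,2) gideal_forms[OF d.D(1)]] gquot_ge[OF C(1) gideal_forms[OF d.D(1)]] by blast+
  have dC: "degree (hpol r C) \<le> 1" using C(4) by simp
  obtain d1 c1 where Z1: "hpol r ?Z = [:real_of_int c1, real d1:]"
    using hilb_linear[OF Z(1)] hpol_mono(1)[OF C(1) Z(1,2)] dC by (metis order_trans)
  obtain d2 c2 where Q1: "hpol r ?Q = [:real_of_int c2, real d2:]"
    using hilb_linear[OF Q(1)] hpol_mono(1)[OF C(1) Q(1,3)] dC by (metis order_trans)
  have pe: "c + x * real d = real_of_int c1 + x * real d1 + (real_of_int c2 + (x - real (k i)) * real d2)" for x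
    using d.hpol_residual[OF C(1,2,3), of x] C(4) Z1 Q1 by simp
  have ce: "c = real_of_int c1 + real_of_int c2 - real (k i) * real d2" using pe[of 0] by simp
  have "real d = real (d1 + d2)" using pe[of 0] pe[of 1] by (simp add: algebra_simps)
  hence de: "d = d1 + d2" by linarith
  have b1: "- real_of_int c1 \<le> B i d1"
  proof (rule Cons.prems(2)[of i "gsat r ?Z"])
    show "gideal r (gsat r ?Z)" "gsat r (gsat r ?Z) = gsat r ?Z"
      using gideal_gsat[OF Z(1)] gsat_idem[OF infinite_UNIV_complex Z(1)] by blast+
    show "G i \<le> gsat r ?Z" using Z(3) gsat_ge[OF Z(1)] by (rule order_trans)
    show "hpol r (gsat r ?Z) = [:real_of_int c1, real d1:]" using hpol_gsat[OF Z(1)] Z1 by simp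
  qed simp
  have "X \<le> ?Q" using C(3) Q(3) by (rule order_trans)
  then obtain ds where ds: "length ds = length fc" "sum_list ds = d2"
    "\<forall>(j, x)\<in>set (zip fc ds). \<forall>c' d'. hpol r (gsum ?Q (G j)) = [:c', real d':] --> x \<le> d'"
    "- real_of_int c2 \<le> sum_list (map2 B fc ds) + real (sum_list (map k fc)) * real (sum_list (tl ds))"
    using Cons.IH[OF _ _ Q(1,2) _ Q1] Cons.prems(1,2) C(5) by auto
  have tl: "sum_list (tl ds) \<le> d2" using ds(2) by (cases ds) auto
  have mono: "x \<le> d'" if x: "(j, x) \<in> set (zip fc ds)" and h: "hpol r (gsum C (G j)) = [:c', real d':]" for j x c' d'
  proof -
    have "j \<in> set fc" using x by (rule set_zip_leftD)
    then obtain e a b t0 where "divisor_on r X (G j) (k j) e a b t0" using Cons.prems(1)[of j] by auto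
    then interpret dj: divisor_on r X "G j" "k j" e a b t0 .
    have g: "gideal r (gsum C (G j))" "gideal r (gsum ?Q (G j))" using gideal_gsum[OF C(1) dj.D(1)] gideal_gsum[OF Q(1) dj.D(1)] by blast+
    have "C \<le> gsum ?Q (G j)" using gsum_ge(1)[OF Q(1) dj.D(1)] Q(3) by (rule order_trans[rotated])
    hence le: "gsum C (G j) \<le> gsum ?Q (G j)" using gsum_least[OF g(2)] gsum_ge(2)[OF Q(1) dj.D(1)] by blast
    have "degree (hpol r (gsum ?Q (G j))) \<le> 1" using hpol_mono(1)[OF g le] h by (simp split: if_splits)
    then obtain d3 c3 where h3: "hpol r (gsum ?Q (G j)) = [:real_of_int c3, real d3:]" using hilb_linear[OF g(2)] by metis
    have "x \<le> d3" using ds(3) x h3 by blast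
    also have "d3 \<le> d'" by (rule hpol_linear_mono(1)[OF g le h h3])
    finally show ?thesis .
  qed
  show ?case
  proof (intro exI[of _ "d1 # ds"] conjI)
    show "length (d1 # ds) = length (i # fc)" "sum_list (d1 # ds) = d" using ds(1,2) de by simp_all
    show "\<forall>(j, x)\<in>set (zip (i # fc) (d1 # ds)). \<forall>c' d'. hpol r (gsum C (G j)) = [:c', real d':] --> x \<le> d'"
      using mono Z1 by auto
    show "i # fc \<noteq> [] --> (\<forall>c' d'. hpol r (gsum C (G (hd (i # fc)))) = [:c', real d':] --> hd (d1 # ds) = d')"
      using Z1 by simp
    have "real (sum_list (map k fc)) * real (sum_list (tl ds)) \<le> real (sum_list (map k fc)) * real d2"
      using tl by (intro mult_left_mono) auto
    thus "- c \<le> sum_list (map2 B (i # fc) (d1 # ds)) + real (sum_list (map k (i # fc))) * real (sum_list (tl (d1 # ds)))"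
      using ce b1 ds(2,4) by (simp add: distrib_right)
  qed
qed

section \<open>Numerical invariants of the components\<close>

text \<open>The number \<nu> is the degree of \<open>X\<close>: six times the leading coefficient,
  and an integer because it is a third difference of the Hilbert function. It yields
  \<open>k \<le> s\<close> for each component and shows that equal degrees force equal
  twists.\<close>

lemma threefold_multiplier:
  fixes X :: "nat => mpoly set"
  assumes X: "gideal r X" and deg: "degree (hpol r X) = 3"
  obtains \<nu> :: nat where "1 \<le> \<nu>"
    "\<And>q s k. (\<And>x. poly q x = poly (hpol r X) x - poly (hpol r X) (x - real k)) ==> degree q = 2 ==>
      2 * lead_coeff q = real s ==> s = \<nu> * k"
proof -
  let ?p = "hpol r X"
  define \<Delta> where "\<Delta> q = pcompose q [:1, 1:] - q" for q :: "real poly"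
  have pd: "poly (\<Delta> q) x = poly q (x + 1) - poly q x" for q x by (simp add: \<Delta>_def poly_pcompose add.commute)
  have d3: "degree ?p = Suc 2" using deg by simp
  have nz: "?p \<noteq> 0" using deg by auto
  have "\<forall>\<^sub>F t in sequentially. 0 \<le> poly ?p (real t)" using hpol_eventually[OF X] by eventually_elim simp
  hence lc: "0 < lead_coeff ?p" using lead_coeff_pos nz by blast
  have c2: "coeff (\<Delta> ?p) 2 = 3 * lead_coeff ?p" "degree (\<Delta> ?p) \<le> 2"
    using degree_shift_diff(1,2)[OF d3, of 1] by (simp_all add: \<Delta>_def)
  hence d2: "degree (\<Delta> ?p) = Suc 1" using lc nz le_degree[of "\<Delta> ?p" 2] by simp
  have c1: "coeff (\<Delta> (\<Delta> ?p)) 1 = 6 * lead_coeff ?p" "degree (\<Delta> (\<Delta> ?p)) \<le> 1"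
    using degree_shift_diff(1,2)[OF d2, of 1] c2 d2 by (simp_all add: \<Delta>_def numeral_2_eq_2)
  hence d1: "degree (\<Delta> (\<Delta> ?p)) = Suc 0" using lc nz le_degree[of "\<Delta> (\<Delta> ?p)" 1] by simp
  have c0: "coeff (\<Delta> (\<Delta> (\<Delta> ?p))) 0 = 6 * lead_coeff ?p" "degree (\<Delta> (\<Delta> (\<Delta> ?p))) \<le> 0"
    using degree_shift_diff(1,2)[OF d1, of 1] c1 d1 by (simp_all add: \<Delta>_def)
  have const: "poly (\<Delta> (\<Delta> (\<Delta> ?p))) x = 6 * lead_coeff ?p" for x
  proof -
    obtain w where "\<Delta> (\<Delta> (\<Delta> ?p)) = [:w:]" using c0(2) degree_eq_zeroE by blast
    thus ?thesis using c0(1) by simp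
  qed
  obtain t0 where t0: "\<And>t. t \<ge> t0 ==> real (hilb r X t) = poly ?p (real t)" using hpol_bound[OF X] by blast
  define z where "z = int (hilb r X (t0 + 3)) - 3 * int (hilb r X (t0 + 2)) + 3 * int (hilb r X (t0 + 1)) - int (hilb r X t0)"
  have "6 * lead_coeff ?p = real_of_int z"
    using const[of "real t0"] t0[of "t0 + 3"] t0[of "t0 + 2"] t0[of "t0 + 1"] t0[of t0]
    by (simp add: pd z_def add.assoc) (simp add: add.commute)
  hence z: "6 * lead_coeff ?p = real (nat z)" "1 \<le> nat z" using lc by (simp_all)
  show ?thesis
  proof (rule that[OF z(2)])
    fix q s k assume q: "\<And>x. poly q x = poly ?p x - poly ?p (x - real k)" "degree q = 2" "2 * lead_coeff q = real s"
    have "q = - (pcompose ?p [:- real k, 1:] - ?p)"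
      by (rule poly_ext) (simp add: q(1) poly_pcompose)
    hence "coeff q 2 = - coeff (pcompose ?p [:- real k, 1:] - ?p) 2" by simp
    also have "\<dots> = 3 * real k * lead_coeff ?p"
      unfolding degree_shift_diff(2)[OF d3, of "- real k"] by simp
    finally have "coeff q 2 = 3 * real k * lead_coeff ?p" .
    hence "real s = (6 * lead_coeff ?p) * real k" using q(2,3) by (simp add: mult_ac)
    hence "real s = real (nat z) * real k" unfolding z(1) .
    hence "real s = real (nat z * k)" by simp
    thus "s = nat z * k" by (rule of_nat_eq_iff[THEN iffD1])
  qed
qed

lemma hpol_linear_int:
  fixes Z :: "nat => mpoly set"
  assumes Z: "gideal r Z" and h: "hpol r Z = [:c, real d:]"
  obtains ci where "c = real_of_int ci" "\<exists>t0. \<forall>t\<ge>t0. int (hilb r Z t) = int d * int t + ci"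
proof -
  have "degree (hpol r Z) \<le> 1" using h by simp
  then obtain d' ci where "hpol r Z = [:real_of_int ci, real d':]"
    "\<exists>t0. \<forall>t\<ge>t0. int (hilb r Z t) = int d' * int t + ci" using hilb_linear[OF Z] by metis
  thus ?thesis using that h by auto
qed

text \<open>A hyperplane section of \<open>D\<close>, a curve of degree \<open>s\<close>, is fed
  into \<open>curve_on_surface\<close>.\<close>

lemma surface_genus_bounds:
  fixes D :: "nat => mpoly set"
  assumes D: "gprime r D" "relevant r D" and s: "1 \<le> s"
    and v: "\<And>x. poly (hpol r D) (x + 1) - poly (hpol r D) x = real s * (x + 1) + real_of_int v"
    and hD: "\<exists>t0. \<forall>t\<ge>t0. int (hilb r D (Suc t)) - int (hilb r D t) = int s * int (Suc t) + v"
  shows "v \<le> int s" "0 \<le> 2 * v + int s * (int s - 3)"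
proof -
  note gD = gprime_gideal[OF D(1)]
  obtain l where l: "l \<in> hforms r 1" "l \<notin> D 1" using D(2) by (auto simp: relevant_def)
  let ?J = "gadd r D l 1" and ?C = "gsat r (gadd r D l 1)"
  have J: "gideal r ?J" by (rule gideal_gadd[OF gD l(1)])
  have C: "gideal r ?C" "gsat r ?C = ?C" "D \<le> ?C"
    using gideal_gsat[OF J] gsat_idem[OF infinite_UNIV_complex J] order_trans[OF gadd_ge[OF gD] gsat_ge[OF J]] by blast+
  have "hpol r ?J = [:real_of_int v, real s:]"
  proof (rule poly_ext)
    fix x
    have "poly (hpol r ?J) (1 + (x - 1)) = poly (hpol r D) (1 + (x - 1)) - poly (hpol r D) (x - 1)"
      using arg_cong[OF hpol_gadd_prime[OF D(1) l], of "\<lambda>q. poly q (x - 1)"] by (simp add: poly_pcompose)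
    thus "poly (hpol r ?J) x = poly [:real_of_int v, real s:] x" using v[of "x - 1"] by (simp add: algebra_simps)
  qed
  hence h: "hpol r ?C = [:real_of_int v, real s:]" using hpol_gsat[OF J] by simp
  obtain ci where "real_of_int v = real_of_int ci" "\<exists>t0. \<forall>t\<ge>t0. int (hilb r ?C t) = int s * int t + ci"
    using hpol_linear_int[OF C(1) h] by blast
  hence "\<exists>t0. \<forall>t\<ge>t0. int (hilb r ?C t) = int s * int t + v" by simp
  from curve_on_surface(1,2)[OF D C hD this s s] show "v \<le> int s" "0 \<le> 2 * v + int s * (int s - 3)" by blast+
qed

lemma curve_on_surface_real:
  fixes D Z :: "nat => mpoly set"
  assumes D: "gprime r D" "relevant r D" and s: "1 \<le> s"
    and hD: "\<exists>t0. \<forall>t\<ge>t0. int (hilb r D (Suc t)) - int (hilb r D t) = int s * int (Suc t) + v"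
    and Z: "gideal r Z" "gsat r Z = Z" "D \<le> Z" and h: "hpol r Z = [:c, real d:]" and d: "s * (s + s * s) < d"
  shows "1 - c \<le> real d ^ 2 / (2 * real s) + real d * (- (2 * real_of_int v + real s) / (2 * real s)) + real s ^ 4"
proof -
  obtain ci where ci: "c = real_of_int ci" "\<exists>t0. \<forall>t\<ge>t0. int (hilb r Z t) = int d * int t + ci"
    using hpol_linear_int[OF Z(1) h] by blast
  have "1 \<le> d" using d by simp
  moreover have "int s * (int s + int s * int s) < int d" using d by (simp flip: of_nat_mult of_nat_add)
  ultimately have "2 * int s * (1 - ci) \<le> int d ^ 2 - int d * (2 * v + int s) + 2 * int s ^ 5"
    using curve_on_surface(3)[OF D Z hD ci(2) s] by blast
  hence "real_of_int (2 * int s * (1 - ci)) \<le> real_of_int (int d ^ 2 - int d * (2 * v + int s) + 2 * int s ^ 5)"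
    by (rule of_int_le_iff[THEN iffD2])
  hence "2 * real s * (1 - c) \<le> real d ^ 2 - real d * (2 * real_of_int v + real s) + 2 * real s ^ 5" by (simp add: ci(1))
  moreover have "2 * real s * (real d ^ 2 / (2 * real s) + real d * (- (2 * real_of_int v + real s) / (2 * real s)) + real s ^ 4) =
      real d ^ 2 - real d * (2 * real_of_int v + real s) + 2 * real s ^ 5"
    using s by (simp add: field_simps power_numeral_reduce)
  ultimately have "2 * real s * (1 - c) \<le> 2 * real s *
      (real d ^ 2 / (2 * real s) + real d * (- (2 * real_of_int v + real s) / (2 * real s)) + real s ^ 4)" by simp
  thus ?thesis by (rule mult_left_le_imp_le) (use s in simp)
qed

text \<open>The genus bound weakened so as to hold in every degree, including 0. The constant covers
  degrees up to \<open>s * (s + s * s)\<close>, where the plane curve bound is used: there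
  \<open>d\<close> is at most \<open>2 * s ^ 3\<close>, so \<open>d ^ 2\<close> is at most
  \<open>4 * s ^ 6\<close>.\<close>

definition piece_bound :: "nat => real => nat => real" where
  "piece_bound s L d = real d ^ 2 / (2 * real s) + real d * L + 5 * real s ^ 6"

lemma piece_bound:
  fixes D Z :: "nat => mpoly set"
  assumes D: "gprime r D" "relevant r D" and s: "1 \<le> s"
    and hD: "\<exists>t0. \<forall>t\<ge>t0. int (hilb r D (Suc t)) - int (hilb r D t) = int s * int (Suc t) + v"
    and v: "v \<le> int s"
    and Z: "gideal r Z" "gsat r Z = Z" "D \<le> Z" and h: "hpol r Z = [:c, real d:]"
  shows "- c \<le> piece_bound s (- (2 * real_of_int v + real s) / (2 * real s)) d"
proof -
  let ?L = "- (2 * real_of_int v + real s) / (2 * real s)"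
  obtain ci where ci: "c = real_of_int ci" "\<exists>t0. \<forall>t\<ge>t0. int (hilb r Z t) = int d * int t + ci"
    using hpol_linear_int[OF Z(1) h] by blast
  have s1: "1 \<le> real s" using s by simp
  consider "d = 0" | "s * (s + s * s) < d" | "1 \<le> d" "d \<le> s * (s + s * s)" by linarith
  thus ?thesis
  proof cases
    case 1
    then obtain t where "int (hilb r Z t) = ci" using ci(2) by auto
    hence "0 \<le> ci" by (metis of_nat_0_le_iff)
    hence "- c \<le> 0" using ci(1) by simp
    moreover have "piece_bound s ?L d = 5 * real s ^ 6" using 1 by (simp add: piece_bound_def)
    ultimately show ?thesis using zero_le_power[of "real s" 6] by linarith
  next
    case 2
    have "real s ^ 4 \<le> real s ^ 6" using s1 by (intro power_increasing) auto
    thus ?thesis using curve_on_surface_real[OF D s hD Z h 2] zero_le_power[of "real s" 6] unfolding piece_bound_def by linarith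
  next
    case 3
    have "2 * (1 - ci) \<le> (int d - 1) * (int d - 2)" using curve_on_surface(4)[OF D Z hD ci(2) s 3(1)] .
    hence "real_of_int (2 * (1 - ci)) \<le> real_of_int ((int d - 1) * (int d - 2))" by (rule of_int_le_iff[THEN iffD2])
    hence c: "- c \<le> real d ^ 2 / 2 - 3 / 2 * real d" by (simp add: ci(1) algebra_simps power2_eq_square)
    have "- 3 / 2 \<le> ?L"
    proof -
      have "real_of_int v \<le> real s" using v by (metis of_int_le_iff of_int_of_nat_eq)
      hence "(2 * real_of_int v + real s) / (2 * real s) \<le> 3 / 2" using s1 by (simp add: divide_le_eq)
      hence "- 3 / 2 \<le> - ((2 * real_of_int v + real s) / (2 * real s))" by linarith
      thus ?thesis unfolding minus_divide_left .
    qed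
    hence L: "real d * (- 3 / 2) \<le> real d * ?L" by (intro mult_left_mono) auto
    have "real d \<le> real (s * (s + s * s))" using 3(2) by (rule of_nat_mono)
    also have "\<dots> \<le> 2 * real s ^ 3"
      using mult_left_mono[OF s1, of "real s * real s"] by (simp add: power3_eq_cube algebra_simps)
    finally have "real d \<le> 2 * real s ^ 3" .
    hence "real d ^ 2 \<le> (2 * real s ^ 3) ^ 2" by (intro power_mono) auto
    hence "real d ^ 2 \<le> 4 * real s ^ 6" by (simp add: power_mult_distrib flip: power_mult)
    moreover have "0 \<le> real d ^ 2 / (2 * real s)" by simp
    ultimately show ?thesis using c L zero_le_power[of "real s" 6] unfolding piece_bound_def by linarith
  qed
qed

section \<open>The bound for curves spread over several components\<close>

lemma sum_list_map2_bound:
  fixes F :: "'i => nat => real"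
  assumes "length es = length tq" "\<And>i x. (i, x) \<in> set (zip tq es) ==> F i x \<le> real x * c + G i"
  shows "sum_list (map2 F tq es) \<le> real (sum_list es) * c + sum_list (map G tq)"
  using assms
proof (induction es tq rule: list_induct2)
  case (Cons x es i tq)
  have "F i x \<le> real x * c + G i" using Cons.prems[of i x] by simp
  moreover have "sum_list (map2 F tq es) \<le> real (sum_list es) * c + sum_list (map G tq)"
    using Cons by simp
  ultimately show ?case by (simp add: distrib_right)
qed simp

lemma sum_list_power_le:
  fixes f :: "'i => real"
  assumes "\<And>i. i \<in> set fc ==> 0 \<le> f i"
  shows "sum_list (map (\<lambda>i. f i ^ Suc n) fc) \<le> sum_list (map f fc) ^ Suc n"
  using assms
proof (induction fc)
  case (Cons i fc)
  have 0: "0 \<le> f i" "0 \<le> sum_list (map f fc)" using Cons.prems by (auto intro!: sum_list_nonneg)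
  have "f i ^ Suc n + sum_list (map f fc) ^ Suc n \<le> (f i + sum_list (map f fc)) ^ Suc n"
  proof -
    have "f i * f i ^ n \<le> f i * (f i + sum_list (map f fc)) ^ n"
      "sum_list (map f fc) * sum_list (map f fc) ^ n \<le> sum_list (map f fc) * (f i + sum_list (map f fc)) ^ n"
      using 0 by (auto intro!: mult_left_mono power_mono)
    thus ?thesis by (simp add: distrib_right)
  qed
  thus ?case using Cons by fastforce
qed simp

text \<open>Here \<delta> is the degree off the first piece. In the first case convexity gains twice
  \<open>\<delta> * (d / (4 * s))\<close>: one half pays the claimed \<open>d / (4 * s)\<close>, the
  other, at least \<open>15 / 2 * S ^ 6\<close> per unit of \<delta>, pays the remaining terms. In
  the second the gain is \<open>d ^ 2\<close> times the difference of \<open>1 / (2 * s)\<close> and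
  \<open>1 / (2 * (s + 1))\<close>. Bounding the denominators by powers of \<open>S\<close> leads to
  \<open>30 * S ^ 7\<close> in both.\<close>

lemma spread_numeric:
  fixes d \<delta> s S L c :: real
  assumes s: "1 \<le> s" "s \<le> S" and d: "30 * S ^ 7 \<le> d" and \<delta>: "1 \<le> \<delta>" "\<delta> \<le> d"
  shows "\<delta> \<le> d / 2 ==>
      1 + (d - \<delta>)\<^sup>2 / (2 * s) + \<delta> * (\<delta> / (2 * s)) + \<delta> * (3 / 2 * S) + 5 * S ^ 6 \<le> d\<^sup>2 / (2 * s) - d / (4 * s)"
    and "d / 2 \<le> \<delta> ==>
      1 + (d - \<delta>)\<^sup>2 / (2 * s) + \<delta> * (d / (2 * (s + 1))) + \<delta> * (3 / 2 * S) + 5 * S ^ 6 \<le> d\<^sup>2 / (2 * s) - d / (4 * s)"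
proof -
  have S: "1 \<le> S" using s by simp
  have S6: "1 \<le> S ^ 6" "S \<le> S ^ 6" using S power_increasing[of 1 6 S] by (auto simp: one_le_power)
  have ds: "30 * S ^ 6 * s \<le> d"
  proof -
    have "30 * S ^ 6 * s \<le> 30 * S ^ 6 * S" using s by (intro mult_left_mono) auto
    also have "\<dots> = 30 * S ^ 7" by (simp add: power_numeral_reduce)
    finally show ?thesis using d by simp
  qed
  have q: "15 / 2 * S ^ 6 \<le> d / (4 * s)" using ds s by (simp add: field_simps)
  show "1 + (d - \<delta>)\<^sup>2 / (2 * s) + \<delta> * (\<delta> / (2 * s)) + \<delta> * (3 / 2 * S) + 5 * S ^ 6 \<le> d\<^sup>2 / (2 * s) - d / (4 * s)"
    if h: "\<delta> \<le> d / 2"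
  proof -
    have "\<delta> * \<delta> \<le> \<delta> * (d / 2)" using h \<delta> by (intro mult_left_mono) auto
    hence "(d - \<delta>)\<^sup>2 + \<delta> * \<delta> \<le> d\<^sup>2 - \<delta> * d" by (simp add: power2_eq_square algebra_simps)
    hence "((d - \<delta>)\<^sup>2 + \<delta> * \<delta>) / (2 * s) \<le> (d\<^sup>2 - \<delta> * d) / (2 * s)" using s by (intro divide_right_mono) auto
    hence 1: "(d - \<delta>)\<^sup>2 / (2 * s) + \<delta> * (\<delta> / (2 * s)) \<le> d\<^sup>2 / (2 * s) - 2 * (\<delta> * (d / (4 * s)))"
      by (simp add: add_divide_distrib diff_divide_distrib)
    have 2: "d / (4 * s) \<le> \<delta> * (d / (4 * s))" using \<delta> q S6 by (intro mult_le_cancel_right1[THEN iffD2]) auto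
    have 3: "\<delta> * (15 / 2 * S ^ 6) \<le> \<delta> * (d / (4 * s))" using q \<delta> by (intro mult_left_mono) auto
    have "\<delta> * (3 / 2 * S) \<le> \<delta> * (3 / 2 * S ^ 6)" using S6 \<delta> by (intro mult_left_mono) auto
    moreover have "S ^ 6 \<le> \<delta> * S ^ 6" using \<delta> S6 by (intro mult_le_cancel_right1[THEN iffD2]) auto
    ultimately have "1 + \<delta> * (3 / 2 * S) + 5 * S ^ 6 \<le> \<delta> * (15 / 2 * S ^ 6)" using S6 by (simp add: algebra_simps)
    thus ?thesis using 1 2 3 by linarith
  qed
  show "1 + (d - \<delta>)\<^sup>2 / (2 * s) + \<delta> * (d / (2 * (s + 1))) + \<delta> * (3 / 2 * S) + 5 * S ^ 6 \<le> d\<^sup>2 / (2 * s) - d / (4 * s)"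
    if h: "d / 2 \<le> \<delta>"
  proof -
    have d0: "0 < d" using \<delta> by simp
    have "(d - \<delta>) * (d - \<delta>) \<le> (d - \<delta>) * (d / 2)" using h \<delta> by (intro mult_left_mono) auto
    hence "(d - \<delta>)\<^sup>2 / (2 * s) \<le> (d - \<delta>) * (d / 2) / (2 * s)"
      using s by (intro divide_right_mono) (auto simp: power2_eq_square)
    also have "\<dots> = (d - \<delta>) * (d / (4 * s))" by simp
    also have "\<dots> \<le> (d - \<delta>) * (d / (2 * (s + 1)))"
      using s \<delta> d0 by (intro mult_left_mono divide_left_mono) auto
    finally have "(d - \<delta>)\<^sup>2 / (2 * s) \<le> (d - \<delta>) * (d / (2 * (s + 1)))" .
    moreover have "(d - \<delta>) * A + \<delta> * A = d * A" for A by (simp add: algebra_simps)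
    ultimately have 1: "(d - \<delta>)\<^sup>2 / (2 * s) + \<delta> * (d / (2 * (s + 1))) \<le> d * (d / (2 * (s + 1)))"
      by (metis add_le_cancel_right)
    have "d\<^sup>2 / (2 * s) - d * (d / (2 * (s + 1))) = d * (d / (2 * s * (s + 1)))"
      using s by (simp add: field_simps power2_eq_square)
    moreover have "15 / 2 * S ^ 5 \<le> d / (2 * s * (s + 1))"
    proof -
      have "s * (s + 1) \<le> S * (2 * S)" using s S by (intro mult_mono) auto
      hence "15 / 2 * S ^ 5 * (2 * (s * (s + 1))) \<le> 15 / 2 * S ^ 5 * (2 * (S * (2 * S)))"
        using S by (intro mult_left_mono) auto
      also have "\<dots> = 30 * S ^ 7" by (simp add: power_numeral_reduce)
      finally have "15 / 2 * S ^ 5 * (2 * s * (s + 1)) \<le> d" using d by (simp add: mult_ac)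
      thus ?thesis using s by (subst pos_le_divide_eq) auto
    qed
    hence "d * (15 / 2 * S ^ 5) \<le> d * (d / (2 * s * (s + 1)))" using d0 by (intro mult_left_mono) auto
    moreover have "\<delta> * (3 / 2 * S) \<le> d * (3 / 2 * S ^ 5)"
      using \<delta> S power_increasing[of 1 5 S] by (intro mult_mono) auto
    moreover have "5 * S ^ 6 + 1 \<le> d * S ^ 5"
    proof -
      have "S ^ 6 \<le> S ^ 7" using S by (intro power_increasing) auto
      hence "5 * S ^ 6 + 1 \<le> d" using d S6 by linarith
      also have "d \<le> d * S ^ 5" using d0 S by (simp add: one_le_power)
      finally show ?thesis .
    qed
    moreover have "d / (4 * s) \<le> d * S ^ 5"
    proof -
      have "d / (4 * s) \<le> d / 1" using d0 s by (intro divide_left_mono) auto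
      also have "\<dots> \<le> d * S ^ 5" using d0 S by (simp add: one_le_power)
      finally show ?thesis .
    qed
    moreover have "0 \<le> d * S ^ 5" using d0 S by simp
    ultimately show ?thesis using 1 by (simp add: algebra_simps)
  qed
qed

text \<open>The first piece has degree \<open>d1\<close> and lies on \<open>i0\<close>. The bounds
  on the slopes give \<open>L i - L i0 \<le> S / 2\<close>, and the twists cost at most
  \<open>S\<close> per unit of degree off the first piece; together this is the
  \<open>3 / 2 * S\<close> in \<open>spread_numeric\<close>.\<close>

lemma spread_bound:
  fixes s k :: "nat => nat" and L :: "nat => real" and c :: real
  assumes s: "1 \<le> s i0" "\<And>i. i \<in> set tq ==> s i0 \<le> s i" and k: "\<And>i. i \<in> set (i0 # tq) ==> k i \<le> s i"
    and L: "- 3 / 2 \<le> L i0" "\<And>i. i \<in> set tq ==> L i \<le> (real (s i) - 4) / 2"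
    and len: "length es = length tq" and sum: "d1 + sum_list es = d" and lt: "d1 < d"
    and max: "\<And>i x. (i, x) \<in> set (zip tq es) ==> s i = s i0 ==> x \<le> d1"
    and d: "30 * sum_list (map s (i0 # tq)) ^ 7 < d"
    and c: "- c \<le> sum_list (map2 (\<lambda>i. piece_bound (s i) (L i)) (i0 # tq) (d1 # es)) +
      real (sum_list (map k (i0 # tq))) * real (sum_list es)"
  shows "1 - c \<le> real d ^ 2 / (2 * real (s i0)) + real d * L i0 - real d / (4 * real (s i0))"
proof -
  define S where "S = sum_list (map s (i0 # tq))"
  define \<delta> where "\<delta> = sum_list es"
  have sS: "s i \<le> S" if "i \<in> set (i0 # tq)" for i unfolding S_def using that by (intro member_le_sum_list) auto
  have kS: "sum_list (map k (i0 # tq)) \<le> S" unfolding S_def using k by (intro sum_list_mono)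
  have \<delta>: "1 \<le> \<delta>" "\<delta> \<le> d" "real d1 = real d - real \<delta>" using sum lt by (auto simp: \<delta>_def)
  have xd: "x \<le> \<delta>" if "(i, x) \<in> set (zip tq es)" for i x
    unfolding \<delta>_def using set_zip_rightD[OF that] by (intro member_le_sum_list) auto
  have s0: "1 \<le> real (s i0)" using s(1) by simp
  have LL: "real x * L i \<le> real x * (L i0 + real S / 2)" if "i \<in> set tq" for i x
  proof -
    have "L i \<le> L i0 + real S / 2" using L(1) L(2)[OF that] sS[of i] that by simp
    thus ?thesis by (intro mult_left_mono) auto
  qed
  have six: "5 * real (s i0) ^ 6 + sum_list (map (\<lambda>i. 5 * real (s i) ^ 6) tq) \<le> 5 * real S ^ 6"
  proof -
    have "sum_list (map (\<lambda>i. real (s i) ^ Suc 5) (i0 # tq)) \<le> sum_list (map (\<lambda>i. real (s i)) (i0 # tq)) ^ Suc 5"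
      by (rule sum_list_power_le) simp
    also have "sum_list (map (\<lambda>i. real (s i)) (i0 # tq)) = real S"
      unfolding S_def by (induction tq) simp_all
    finally show ?thesis by (simp add: sum_list_const_mult)
  qed
  have K: "real (sum_list (map k (i0 # tq))) * real (sum_list es) \<le> real S * real \<delta>"
    unfolding \<delta>_def using kS by (intro mult_right_mono) auto
  have main: "1 - c \<le> 1 + (real d - real \<delta>)\<^sup>2 / (2 * real (s i0)) + real \<delta> * A + real \<delta> * (3 / 2 * real S) + 5 * real S ^ 6 + real d * L i0"
    if A: "\<And>i x. (i, x) \<in> set (zip tq es) ==> real x ^ 2 / (2 * real (s i)) \<le> real x * A" for A
  proof -
    have "sum_list (map2 (\<lambda>i. piece_bound (s i) (L i)) tq es) \<le>
        real (sum_list es) * (A + L i0 + real S / 2) + sum_list (map (\<lambda>i. 5 * real (s i) ^ 6) tq)"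
    proof (rule sum_list_map2_bound[OF len])
      fix i x assume ix: "(i, x) \<in> set (zip tq es)"
      show "piece_bound (s i) (L i) x \<le> real x * (A + L i0 + real S / 2) + 5 * real (s i) ^ 6"
        using A[OF ix] LL[OF set_zip_leftD[OF ix], of x] unfolding piece_bound_def by (simp add: distrib_left)
    qed
    hence "- c \<le> piece_bound (s i0) (L i0) d1 + real \<delta> * (A + L i0 + real S / 2) +
        sum_list (map (\<lambda>i. 5 * real (s i) ^ 6) tq) + real S * real \<delta>"
      using c K unfolding \<delta>_def by simp
    moreover have "piece_bound (s i0) (L i0) d1 = (real d - real \<delta>)\<^sup>2 / (2 * real (s i0)) + (real d - real \<delta>) * L i0 + 5 * real (s i0) ^ 6"
      unfolding piece_bound_def \<delta>(3) ..
    ultimately show ?thesis using six by (simp add: algebra_simps)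
  qed
  have dS: "30 * real S ^ 7 \<le> real d"
  proof -
    have "real (30 * S ^ 7) \<le> real d" using d unfolding S_def[symmetric] by (intro of_nat_mono) simp
    thus ?thesis by simp
  qed
  note num = spread_numeric[OF s0 _ dS, of "real \<delta>"]
  have s0S: "real (s i0) \<le> real S" using sS[of i0] by simp
  show ?thesis
  proof (cases "real \<delta> \<le> real d / 2")
    case True
    have "real x ^ 2 / (2 * real (s i)) \<le> real x * (real \<delta> / (2 * real (s i0)))" if ix: "(i, x) \<in> set (zip tq es)" for i x
    proof -
      have "real x * real x \<le> real x * real \<delta>" using xd[OF ix] by (intro mult_left_mono) auto
      moreover have "real (s i0) \<le> real (s i)" using s(2)[OF set_zip_leftD[OF ix]] by simp
      ultimately have "real x * real x / (2 * real (s i)) \<le> real x * real \<delta> / (2 * real (s i0))"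
        using s0 by (intro frac_le) auto
      thus ?thesis by (simp add: power2_eq_square)
    qed
    from main[OF this] show ?thesis using num(1)[OF s0S _ _ True] \<delta> by simp
  next
    case False
    \<comment> \<open>More than half of the degree is off the first piece. A piece on a component of
      the same degree is no larger than the first and so has degree below \<open>d / 2\<close>; any
      other lies on a surface of degree at least \<open>s i0 + 1\<close>. Both yield the denominator
      \<open>2 * (s i0 + 1)\<close>.\<close>
    have "real x ^ 2 / (2 * real (s i)) \<le> real x * (real d / (2 * (real (s i0) + 1)))" if ix: "(i, x) \<in> set (zip tq es)" for i x
    proof (cases "s i = s i0")
      case True
      have "real x \<le> real d1" using max[OF ix True] by simp
      hence "2 * real x \<le> real d" using False \<delta>(3) by simp
      hence "real x * (2 * real x) \<le> real x * real d" by (intro mult_left_mono) auto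
      hence "real x * (2 * real x) / (4 * real (s i0)) \<le> real x * real d / (2 * (real (s i0) + 1))"
        using s0 by (intro frac_le) auto
      thus ?thesis using True by (simp add: power2_eq_square)
    next
      case F: False
      have "real x * real x \<le> real x * real d" using xd[OF ix] \<delta>(2) by (intro mult_left_mono) auto
      moreover have "real (s i0) + 1 \<le> real (s i)" using s(2)[OF set_zip_leftD[OF ix]] F by simp
      ultimately have "real x * real x / (2 * real (s i)) \<le> real x * real d / (2 * (real (s i0) + 1))"
        using s0 by (intro frac_le) auto
      thus ?thesis by (simp add: power2_eq_square)
    qed
    from main[OF this] show ?thesis using num(2)[OF s0S] False \<delta> by simp
  qed
qed

section \<open>Curves on a sum of divisors\<close>

lemma prod_list_multiplicities:
  fixes f :: "'i => 'b::comm_monoid_mult"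
  assumes "finite J" "mset fc = (\<Sum>i\<in>J. replicate_mset (m i) i)"
  shows "prod_list (map f fc) = (\<Prod>i\<in>J. f i ^ m i)"
proof -
  have "prod_mset (image_mset f (\<Sum>i\<in>J. replicate_mset (m i) i)) = (\<Prod>i\<in>J. f i ^ m i)"
    using assms(1) by (induction J) simp_all
  thus ?thesis unfolding assms(2)[symmetric] by (simp flip: mset_map add: prod_mset_prod_list)
qed

lemma sum_list_multiplicities:
  fixes f :: "'i => nat"
  assumes "finite J" "mset fc = (\<Sum>i\<in>J. replicate_mset (m i) i)"
  shows "sum_list (map f fc) = (\<Sum>i\<in>J. m i * f i)"
proof -
  have "sum_mset (image_mset f (\<Sum>i\<in>J. replicate_mset (m i) i)) = (\<Sum>i\<in>J. m i * f i)"
    using assms(1) by (induction J) simp_all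
  thus ?thesis unfolding assms(2)[symmetric] by (simp flip: mset_map add: sum_mset_sum_list)
qed

text \<open>A product with one factor from the ideal of each component, counted with multiplicity,
  lies at every point of \<open>X\<close> in the ideal of the local equation of the sum.\<close>

lemma divisor_sum_annihilated:
  assumes X: "integral_subscheme r X" and D: "\<And>i. i \<in> J ==> closed_subscheme r (D i)"
    and J: "finite J" "mset fc = (\<Sum>i\<in>J. replicate_mset (m i) i)" and C: "divisor_sum r X D m J \<subseteq> C"
  shows "annihilated r (\<lambda>i. gpart r (D i)) fc (gpart r C)"
proof (rule annihilatedI)
  note iX = integral_ideal[OF X]
  have set: "set fc \<subseteq> J"
  proof -
    have "set fc = set_mset (\<Sum>i\<in>J. replicate_mset (m i) i)" using J(2) by (metis set_mset_mset)
    also have "\<dots> \<subseteq> J" using J(1) by (induction J) (auto split: if_splits)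
    finally show ?thesis .
  qed
  have Gf: "gpart r (D i) t \<subseteq> hforms r t" for i t by (simp add: gpart_def)
  fix us assume z: "list_all2 (\<lambda>i (u, t). u \<in> gpart r (D i) t) fc us"
  let ?u = "prod_list (map fst us)"
  note form = prod_forms[OF z Gf]
  have "?u \<in> divisor_sum r X D m J"
    unfolding divisor_sum_def carrier_polys
  proof (intro CollectI conjI ballI allI impI)
    show "?u \<in> polys r" by (rule hforms_polys[OF form])
    fix P f assume P: "P \<in> points r X" and f: "\<forall>i\<in>J. local_generator r X (D i) P (f i)"
    have int: "integral_subscheme r P" using P by (simp add: points_def)
    have "set fc \<subseteq> J --> ?u \<in> stalk r P (principal_on r X (prod_list (map f fc)))"
      using z
    proof (induction fc us rule: list_all2_induct)
      case Nil
      show ?case using stalk_principal_self[OF int iX polys_1] by simp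
    next
      case (Cons i fc x us)
      show ?case
      proof
        assume "set (i # fc) \<subseteq> J"
        hence iJ: "i \<in> J" "set fc \<subseteq> J" by auto
        obtain e where e: "f i \<in> hforms r e" "stalk r P (D i) = stalk r P (principal_on r X (f i))"
          using f iJ(1) by (meson local_generatorD)
        have "ideal (D i) (coord_ring r)" using closed_subschemeD(1,2)[OF D[OF iJ(1)]] ideal_gunion by metis
        hence "fst x \<in> stalk r P (D i)" using stalk_self[OF int, of "D i"] Cons.hyps(1) by (auto simp: ideal_iff gpart_def)
        hence "fst x \<in> stalk r P (principal_on r X (f i))" unfolding e(2) .
        from stalk_principal_mult[OF int iX hforms_polys[OF e(1)] this] Cons.IH iJ(2)
        show "prod_list (map fst (x # us)) \<in> stalk r P (principal_on r X (prod_list (map f (i # fc))))" by simp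
      qed
    qed
    thus "?u \<in> stalk r P (principal_on r X (\<Prod>i\<in>J. f i ^ m i))"
      using set unfolding prod_list_multiplicities[OF J] by blast
  qed
  thus "?u \<in> gpart r C (sum_list (map snd us))" using C form by (auto simp: gpart_def)
qed (auto simp: gpart_def)

lemma divisor_sum_contains:
  assumes X: "integral_subscheme r X"
  shows "X \<subseteq> divisor_sum r X D m J"
proof
  fix x assume x: "x \<in> X"
  have xp: "x \<in> polys r" using integral_ideal[OF X] x by (auto simp: ideal_iff)
  have "x \<in> stalk r P (principal_on r X f)" if P: "P \<in> points r X" for P f
  proof (rule stalkI[OF xp hforms_1])
    show "1 \<notin> P" using integral_one P by (auto simp: points_def)
    show "1 * x \<in> principal_on r X f" unfolding principal_on_iff using x polys_0 by (intro bexI[of _ x] bexI[of _ 0]) auto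
  qed
  thus "x \<in> divisor_sum r X D m J" unfolding divisor_sum_def carrier_polys using xp by blast
qed

text \<open>The part of \<open>A\<close> above a known element is finite, and its \<open>Max\<close>
  is what \<open>GREATEST\<close> denotes.\<close>

lemma Greatest_int_bounded:
  fixes A :: "int set"
  assumes g: "g \<in> A" and b: "\<And>x. x \<in> A ==> x \<le> M"
  shows "(GREATEST x. x \<in> A) \<in> A" "g \<le> (GREATEST x. x \<in> A)"
proof -
  let ?F = "{x \<in> A. g \<le> x}"
  have F: "finite ?F" "?F \<noteq> {}" using b g by (auto intro: finite_subset[of _ "{g..M}"])
  have "(GREATEST x. x \<in> A) = Max ?F"
  proof (rule Greatest_equality)
    show "Max ?F \<in> A" using Max_in[OF F] by blast
    show "y \<le> Max ?F" if "y \<in> A" for y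
    proof (cases "g \<le> y")
      case False
      thus ?thesis using Max_ge[OF F(1), of g] g by simp
    qed (use that F in \<open>auto intro: Max_ge\<close>)
  qed
  thus "(GREATEST x. x \<in> A) \<in> A" "g \<le> (GREATEST x. x \<in> A)" using Max_in[OF F] by auto
qed

theorem proposition2p10:
  fixes r l d degS :: nat
    and X S C :: "mpoly set"
    and D :: "nat \<Rightarrow> mpoly set"
    and s m :: "nat \<Rightarrow> nat"
    and \<pi>\<^sub>1 :: int
  assumes X: "integral_subscheme r X" "has_dim r X 3"
    and l: "1 \<le> l"
    and D_distinct: "inj_on D {1..l}"
    and D_cartier: "\<And>i. i \<in> {1..l} \<Longrightarrow> effective_cartier r X (D i)"
    and D_surface: "\<And>i. i \<in> {1..l} \<Longrightarrow> integral_surface r (D i)"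
    and D_equiv: "\<And>i. i \<in> {1..l} \<Longrightarrow> equiv_hyperplane_multiple r X (D i)"
    and D_degree: "\<And>i. i \<in> {1..l} \<Longrightarrow> scheme_degree r (D i) = real (s i)"
    and s_mono: "\<And>i j. 1 \<le> i \<Longrightarrow> i \<le> j \<Longrightarrow> j \<le> l \<Longrightarrow> s i \<le> s j"
    and m_pos: "\<And>i. i \<in> {1..l} \<Longrightarrow> 0 < m i"
    and S: "S = divisor_sum r X D m {1..l}"
    and pi1: "\<pi>\<^sub>1 = sectional_genus r (D 1)"
    and degS: "degS = (\<Sum>i=1..l. m i * s i)"
    and C: "is_curve r C" "subscheme_of C S" "scheme_degree r C = real d"
    and d_large: "d > 30 * degS ^ 7"
  shows
    "if \<exists>i\<in>{1..l}. s i = s 1 \<and> is_curve r (scheme_inter r C (D i)) \<and>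
          scheme_degree r (scheme_inter r C (D i)) = scheme_degree r C
     then arith_genus r C \<le> G_star r (D ` {1..l}) d \<and>
          real_of_int (G_star r (D ` {1..l}) d) \<le>
            real d ^ 2 / (2 * real (s 1))
            + real d / (2 * real (s 1)) * (2 * real_of_int \<pi>\<^sub>1 - 2 - real (s 1)) + real (s 1) ^ 4
     else real_of_int (arith_genus r C) \<le>
            real d ^ 2 / (2 * real (s 1))
            + real d / (2 * real (s 1)) * (2 * real_of_int \<pi>\<^sub>1 - 2 - real (s 1) - 1 / 2)"
proof -
  let ?I = "{1..l}"
  define GX where "GX = gpart r X"
  define G where "G i = gpart r (D i)" for i
  define GC where "GC = gpart r C"
  have clX: "closed_subscheme r X" using X(1) by (simp add: integral_subscheme_def)
  have pX: "gprime r GX" "relevant r GX" unfolding GX_def using integral_subschemeD[OF X(1)] .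
  have gX: "gideal r GX" by (rule gprime_gideal[OF pX(1)])
  have degX: "degree (hpol r GX) = 3" using X(2) has_dim_hpol[OF clX] by (simp add: GX_def)
  have intD: "integral_subscheme r (D i)" and clD: "closed_subscheme r (D i)" if "i \<in> ?I" for i
    using D_surface[OF that] by (auto simp: integral_surface_def integral_subscheme_def)
  have pD: "gprime r (G i)" "relevant r (G i)" if "i \<in> ?I" for i
    unfolding G_def using integral_subschemeD[OF intD[OF that]] .
  have gD: "gideal r (G i)" if "i \<in> ?I" for i by (rule gprime_gideal[OF pD(1)[OF that]])
  have degD: "degree (hpol r (G i)) = 2" if "i \<in> ?I" for i
    using D_surface[OF that] has_dim_hpol[OF clD[OF that]] by (simp add: integral_surface_def G_def)
  have XD: "GX \<le> G i" if "i \<in> ?I" for i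
    unfolding GX_def G_def using D_cartier[OF that] by (intro gpart_mono) (simp add: effective_cartier_def subscheme_of_def)
  have "\<forall>i\<in>?I. \<exists>v. 1 \<le> s i \<and> (\<forall>x. poly (hpol r (G i)) (x + 1) - poly (hpol r (G i)) x = real (s i) * (x + 1) + real_of_int v) \<and>
      (\<exists>t0. \<forall>t\<ge>t0. int (hilb r (G i) (Suc t)) - int (hilb r (G i) t) = int (s i) * int (Suc t) + v) \<and>
      sectional_genus r (D i) = 1 - v" (is "\<forall>i\<in>_. ?V i")
  proof
    show "?V i" if i: "i \<in> ?I" for i
      by (rule surface_hilb[OF D_surface[OF i] D_degree[OF i]]) (auto simp: G_def)
  qed
  from bchoice[OF this] obtain v where v: "\<And>i. i \<in> ?I ==> 1 \<le> s i"
    "\<And>i x. i \<in> ?I ==> poly (hpol r (G i)) (x + 1) - poly (hpol r (G i)) x = real (s i) * (x + 1) + real_of_int (v i)"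
    "\<And>i. i \<in> ?I ==> \<exists>t0. \<forall>t\<ge>t0. int (hilb r (G i) (Suc t)) - int (hilb r (G i) t) = int (s i) * int (Suc t) + v i"
    "\<And>i. i \<in> ?I ==> sectional_genus r (D i) = 1 - v i" by blast
  have vb: "v i \<le> int (s i)" "0 \<le> 2 * v i + int (s i) * (int (s i) - 3)" if "i \<in> ?I" for i
    using surface_genus_bounds[OF pD[OF that] v(1)[OF that] v(2)[OF that] v(3)[OF that]] .
  have "\<forall>i\<in>?I. \<exists>k e a b t0. divisor_on r GX (G i) k e a b t0" (is "\<forall>i\<in>_. ?V i")
  proof
    show "?V i" if i: "i \<in> ?I" for i
      using divisor_relation_exists[OF X(1) D_cartier[OF i] D_equiv[OF i]] pX(1) gD[OF i] XD[OF i]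
      unfolding divisor_on_def GX_def G_def by blast
  qed
  from bchoice[OF this] obtain k where k: "\<And>i. i \<in> ?I ==> \<exists>e a b t0. divisor_on r GX (G i) (k i) e a b t0" by blast
  have hpD: "poly (hpol r (G i)) x = poly (hpol r GX) x - poly (hpol r GX) (x - real (k i))" if i: "i \<in> ?I" for i x
  proof -
    obtain e a b t0 where "divisor_on r GX (G i) (k i) e a b t0" using k[OF i] by blast
    moreover have "G i \<noteq> GX" using degD[OF i] degX by auto
    ultimately show ?thesis using divisor_on.hpol_divisor pX(2) by blast
  qed
  obtain \<nu> where \<nu>: "1 \<le> \<nu>" "\<And>i. i \<in> ?I ==> s i = \<nu> * k i"
  proof -
    obtain \<nu> where n: "1 \<le> \<nu>" "\<And>q s k. (\<And>x. poly q x = poly (hpol r GX) x - poly (hpol r GX) (x - real k)) ==>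
        degree q = 2 ==> 2 * lead_coeff q = real s ==> s = \<nu> * k"
      using threefold_multiplier[OF gX degX] by metis
    have "2 * lead_coeff (hpol r (G i)) = real (s i)" if "i \<in> ?I" for i
      using D_degree[OF that] degD[OF that] hilbert_poly_hpol[OF clD[OF that]]
      by (simp add: scheme_degree_def G_def numeral_2_eq_2)
    thus ?thesis using that[OF n(1)] n(2)[OF hpD degD] by blast
  qed
  have ks: "k i \<le> s i" if "i \<in> ?I" for i using \<nu>(1) \<nu>(2)[OF that] by simp
  \<comment> \<open>Components of equal degree have equal twists, hence equal Hilbert polynomials
    and sectional genera; this justifies \<open>\<pi>\<^sub>1\<close> for all components of minimal
    degree.\<close>
  have v_eq: "v i = v j" if ij: "i \<in> ?I" "j \<in> ?I" "s i = s j" for i j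
  proof -
    have "k i = k j" using \<nu> ij by (metis mult_cancel1 not_one_le_zero)
    hence "poly (hpol r (G i)) x = poly (hpol r (G j)) x" for x using hpD[OF ij(1)] hpD[OF ij(2)] by simp
    thus ?thesis using v(2)[OF ij(1), of 0] v(2)[OF ij(2), of 0] ij(3) by simp
  qed
  have one: "1 \<in> ?I" using l by simp
  have s_min: "s 1 \<le> s i" if "i \<in> ?I" for i using s_mono[of 1 i] that by simp
  have s1: "1 \<le> s 1" by (rule v(1)[OF one])
  have pi: "real_of_int \<pi>\<^sub>1 = 1 - real_of_int (v 1)" using pi1 v(4)[OF one] by simp
  \<comment> \<open>The linear coefficient \<open>(2 * \<pi> - 2 - s) / (2 * s)\<close> of the genus
    bound on a component with sectional genus \<open>\<pi> = 1 - v\<close>.\<close>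
  define L where "L i = - (2 * real_of_int (v i) + real (s i)) / (2 * real (s i))" for i
  have L1: "real d / (2 * real (s 1)) * (2 * real_of_int \<pi>\<^sub>1 - 2 - real (s 1) - x) = real d * L 1 - real d / (2 * real (s 1)) * x" for x
    using s1 by (simp add: pi L_def field_simps)
  have sS: "s 1 \<le> degS"
  proof -
    have "m 1 * s 1 \<le> degS" unfolding degS using one by (intro member_le_sum) auto
    moreover have "1 * s 1 \<le> m 1 * s 1" using m_pos[OF one] by (intro mult_right_mono) auto
    ultimately show ?thesis by linarith
  qed
  have d_big: "s 1 * (s 1 + s 1 * s 1) < d"
  proof -
    have "s 1 * (s 1 + s 1 * s 1) \<le> degS * (degS + degS * degS)" using sS by (intro mult_mono add_mono) auto
    also have "\<dots> = degS ^ 2 + degS ^ 3" by (simp add: power2_eq_square power3_eq_cube distrib_left)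
    also have "\<dots> \<le> degS ^ 7 + degS ^ 7" using sS s1 by (intro add_mono power_increasing) auto
    finally show ?thesis using d_large by simp
  qed
  obtain c where c: "hpol r GC = [:real_of_int c, real d:]" "1 \<le> d" "arith_genus r C = 1 - c"
    using curve_hilb[OF C(1,3)] unfolding GC_def by metis
  have clC: "closed_subscheme r C" using C(1) by (simp add: is_curve_def)
  have gC: "gideal r GC" "gsat r GC = GC" unfolding GC_def using closed_subschemeD[OF clC] by blast+
  have SC: "S \<subseteq> C" using C(2) by (simp add: subscheme_of_def)
  have XC: "GX \<le> GC" unfolding GX_def GC_def
    using divisor_sum_contains[OF X(1), of D m ?I] SC S by (intro gpart_mono) blast
  \<comment> \<open>The unsaturated intersection of \<open>C\<close> with a component; passing to
    \<open>scheme_inter\<close> does not change the Hilbert polynomial.\<close>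
  define H where "H i = gsum GC (G i)" for i
  have gH: "gideal r (H i)" "GC \<le> H i" "G i \<le> H i" if "i \<in> ?I" for i
    unfolding H_def using gideal_gsum[OF gC(1) gD[OF that]] gsum_ge[OF gC(1) gD[OF that]] by blast+
  have inter: "scheme_inter r C (D i) = gunion r (gsat r (H i))" if "i \<in> ?I" for i
    unfolding H_def GC_def G_def by (rule scheme_inter_gunion[OF clC clD[OF that]])
  have "\<exists>dd cc. hpol r (H i) = [:real_of_int cc, real dd:]" if i: "i \<in> ?I" for i
  proof -
    have "degree (hpol r (H i)) \<le> 1" using hpol_mono(1)[OF gC(1) gH(1,2)[OF i]] c(1) by (simp split: if_splits)
    thus ?thesis using hilb_linear[OF gH(1)[OF i]] by metis
  qed
  hence "\<forall>i\<in>?I. \<exists>dd cc. hpol r (H i) = [:real_of_int cc, real dd:]" by blast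
  from bchoice[OF this] obtain dd where dd: "\<forall>i\<in>?I. \<exists>cc. hpol r (H i) = [:real_of_int cc, real (dd i):]" by blast
  have dd_le: "dd i \<le> d" if i: "i \<in> ?I" for i
    using dd i hpol_linear_mono(1)[OF gC(1) gH(1,2)[OF i] c(1)] by blast
  show ?thesis
  proof (cases "\<exists>i\<in>?I. s i = s 1 \<and> is_curve r (scheme_inter r C (D i)) \<and>
      scheme_degree r (scheme_inter r C (D i)) = scheme_degree r C")
    case True
    then obtain i where i: "i \<in> ?I" "s i = s 1" "is_curve r (scheme_inter r C (D i))"
      "scheme_degree r (scheme_inter r C (D i)) = real d" using C(3) by auto
    let ?Z = "scheme_inter r C (D i)" and ?A = "arith_genus r ` min_component_curves r (D ` ?I) d"
      and ?M = "real d ^ 2 / (2 * real (s 1)) + real d / (2 * real (s 1)) * (2 * real_of_int \<pi>\<^sub>1 - 2 - real (s 1)) + real (s 1) ^ 4"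
    have DZ: "D i \<subseteq> ?Z"
      using gunion_mono[OF order_trans[OF gH(3)[OF i(1)] gsat_ge[OF gH(1)[OF i(1)]]], of r] closed_subschemeD(2)[OF clD[OF i(1)]]
      unfolding inter[OF i(1)] G_def by simp
    have "\<forall>E\<in>D ` ?I. scheme_degree r (D i) \<le> scheme_degree r E"
      using D_degree[OF i(1)] D_degree s_min i(2) by auto
    hence "?Z \<in> min_component_curves r (D ` ?I) d"
      unfolding min_component_curves_def subscheme_of_def using i DZ by blast
    hence ZA: "arith_genus r ?Z \<in> ?A" by blast
    have bound: "real_of_int g \<le> ?M" if g: "g \<in> ?A" for g
    proof -
      obtain Y where Y: "g = arith_genus r Y" "Y \<in> min_component_curves r (D ` ?I) d" using g by blast
      obtain j where j: "j \<in> ?I" "\<forall>E\<in>D ` ?I. scheme_degree r (D j) \<le> scheme_degree r E" "D j \<subseteq> Y"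
        and Yc: "is_curve r Y" "scheme_degree r Y = real d"
        using Y(2) unfolding min_component_curves_def subscheme_of_def by blast
      have "real (s j) \<le> real (s 1)" using j(2) D_degree[OF j(1)] D_degree[OF one] one by (metis imageI)
      hence sj: "s j = s 1" using s_min[OF j(1)] by simp
      obtain cy where cy: "hpol r (gpart r Y) = [:real_of_int cy, real d:]" "arith_genus r Y = 1 - cy"
        using curve_hilb[OF Yc] by metis
      have clY: "closed_subscheme r Y" using Yc(1) by (simp add: is_curve_def)
      note y = closed_subschemeD[OF clY]
      have "G j \<le> gpart r Y" unfolding G_def by (rule gpart_mono[OF j(3)])
      from curve_on_surface_real[OF pD[OF j(1)] v(1)[OF j(1)] v(3)[OF j(1)] y(1,3) this cy(1)] d_big
      have "1 - real_of_int cy \<le> real d ^ 2 / (2 * real (s 1)) + real d * L 1 + real (s 1) ^ 4"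
        using sj v_eq[OF j(1) one sj] by (simp add: L_def)
      thus ?thesis using L1[of 0] Y(1) cy(2) by simp
    qed
    \<comment> \<open>An upper bound for the genera must come first: only then does
      \<open>G_star\<close> denote a maximum.\<close>
    have bound': "g \<le> \<lfloor>?M\<rfloor>" if "g \<in> ?A" for g unfolding le_floor_iff by (rule bound[OF that])
    have GS: "G_star r (D ` ?I) d \<in> ?A" "arith_genus r ?Z \<le> G_star r (D ` ?I) d"
      unfolding G_star_def using Greatest_int_bounded[OF ZA bound'] by blast+
    obtain cz where cz: "hpol r (gpart r ?Z) = [:real_of_int cz, real d:]" "arith_genus r ?Z = 1 - cz"
      using curve_hilb[OF i(3,4)] by metis
    have hH: "hpol r (H i) = [:real_of_int cz, real d:]"
      using cz(1) closed_gunion_gsat(2)[OF gH(1)[OF i(1)]] hpol_gsat[OF gH(1)[OF i(1)]] unfolding inter[OF i(1)] by simp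
    \<comment> \<open>The curve and its intersection have the same degree, so their Hilbert
      polynomials differ by a constant, and the subscheme has the smaller one; its genus is
      therefore at least that of \<open>C\<close>.\<close>
    have "cz \<le> c" using hpol_linear_mono(2)[OF gC(1) gH(1,2)[OF i(1)] c(1) hH] by simp
    hence "arith_genus r C \<le> arith_genus r ?Z" using c(3) cz(2) by simp
    hence "arith_genus r C \<le> G_star r (D ` ?I) d \<and> real_of_int (G_star r (D ` ?I) d) \<le> ?M"
      using GS(2) bound[OF GS(1)] by simp
    thus ?thesis using True by (simp only: if_True)
  next
    case False
    \<comment> \<open>Peel first the component of minimal degree that meets \<open>C\<close> in the
      largest degree; then no later piece on a component of degree \<open>s 1\<close> exceeds the
      first piece.\<close>
    let ?Min = "{i \<in> ?I. s i = s 1}"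
    have "finite (dd ` ?Min)" "dd ` ?Min \<noteq> {}" using one by auto
    hence "Max (dd ` ?Min) \<in> dd ` ?Min" by (rule Max_in)
    then obtain i0 where i0: "i0 \<in> ?I" "s i0 = s 1" "dd i0 = Max (dd ` ?Min)" by auto
    have dmax: "dd i \<le> dd i0" if "i \<in> ?I" "s i = s 1" for i
      unfolding i0(3) using that by (intro Max_ge) auto
    \<comment> \<open>An intersection of full degree would be a curve, and the first alternative of
      the theorem would apply.\<close>
    have lt: "dd i0 < d"
    proof (rule ccontr)
      assume "\<not> ?thesis"
      hence "dd i0 = d" using dd_le[OF i0(1)] by simp
      moreover obtain cc where "hpol r (H i0) = [:real_of_int cc, real (dd i0):]" using bspec[OF dd i0(1)] by blast
      ultimately have cc: "hpol r (H i0) = [:real_of_int cc, real d:]" by simp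
      have "is_curve r (scheme_inter r C (D i0))" "scheme_degree r (scheme_inter r C (D i0)) = real d"
        unfolding inter[OF i0(1)] using is_curveI[OF gH(1)[OF i0(1)] cc c(2)] by blast+
      thus False using False i0(1,2) C(3) by auto
    qed
    \<comment> \<open>The components repeated according to multiplicity; any ordering that starts
      with \<open>i0\<close> will do.\<close>
    let ?M = "\<Sum>i\<in>?I. replicate_mset (m i) i"
    have cnt: "count ?M i = (if i \<in> ?I then m i else 0)" for i by (simp add: count_sum)
    have "0 < count ?M i0" using m_pos[OF i0(1)] i0(1) cnt[of i0] by metis
    hence "i0 \<in># ?M" by (rule count_greater_zero_iff[THEN iffD1])
    then obtain tq where tq: "mset (i0 # tq) = ?M" by (metis ex_mset insert_DiffM mset.simps(2))
    have setfc: "set (i0 # tq) \<subseteq> ?I"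
    proof
      fix i assume "i \<in> set (i0 # tq)"
      hence "0 < count ?M i" using tq by (metis count_greater_zero_iff set_mset_mset)
      thus "i \<in> ?I" using cnt[of i] by presburger
    qed
    have ann: "annihilated r G (i0 # tq) GC"
      unfolding GC_def G_def using clD SC by (intro divisor_sum_annihilated[OF X(1) _ finite_atLeastAtMost tq]) (auto simp: S)
    have "\<exists>ds. length ds = length (i0 # tq) \<and> sum_list ds = d \<and>
      (\<forall>(i, x)\<in>set (zip (i0 # tq) ds). \<forall>c' d'. hpol r (gsum GC (G i)) = [:c', real d':] --> x \<le> d') \<and>
      (i0 # tq \<noteq> [] --> (\<forall>c' d'. hpol r (gsum GC (G (hd (i0 # tq)))) = [:c', real d':] --> hd ds = d')) \<and>
      - real_of_int c \<le> sum_list (map2 (\<lambda>i. piece_bound (s i) (L i)) (i0 # tq) ds) + real (sum_list (map k (i0 # tq))) * real (sum_list (tl ds))"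
    proof (rule peel[OF _ _ gC XC c(1) ann])
      show "\<exists>e a b t0. divisor_on r GX (G i) (k i) e a b t0" if "i \<in> set (i0 # tq)" for i
        using k setfc that by blast
      fix i Z c d assume i: "i \<in> set (i0 # tq)" and Z: "gideal r Z" "gsat r Z = Z" "G i \<le> Z" "hpol r Z = [:c, real d:]"
      have iI: "i \<in> ?I" using i setfc by blast
      show "- c \<le> piece_bound (s i) (L i) d"
        unfolding L_def by (rule piece_bound[OF pD[OF iI] v(1)[OF iI] v(3)[OF iI] vb(1)[OF iI] Z])
    qed
    then obtain ds where ds: "length ds = length (i0 # tq)" "sum_list ds = d"
      "\<forall>(i, x)\<in>set (zip (i0 # tq) ds). \<forall>c' d'. hpol r (H i) = [:c', real d':] --> x \<le> d'"
      "\<forall>c' d'. hpol r (H i0) = [:c', real d':] --> hd ds = d'"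
      "- real_of_int c \<le> sum_list (map2 (\<lambda>i. piece_bound (s i) (L i)) (i0 # tq) ds) + real (sum_list (map k (i0 # tq))) * real (sum_list (tl ds))"
      unfolding H_def by auto
    obtain d1 es where des: "ds = d1 # es" using ds(1) by (cases ds) auto
    have d1: "d1 = dd i0"
    proof -
      obtain cc where "hpol r (H i0) = [:real_of_int cc, real (dd i0):]" using bspec[OF dd i0(1)] by blast
      hence "hd ds = dd i0" using ds(4) by blast
      thus ?thesis using des by simp
    qed
    have "1 - real_of_int c \<le> real d ^ 2 / (2 * real (s i0)) + real d * L i0 - real d / (4 * real (s i0))"
    proof (rule spread_bound[of s i0 tq k L es d1 d])
      show "1 \<le> s i0" by (rule v(1)[OF i0(1)])
      show "s i0 \<le> s i" if "i \<in> set tq" for i using s_min i0(2) setfc that by auto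
      show "k i \<le> s i" if "i \<in> set (i0 # tq)" for i using ks setfc that by blast
      show "- 3 / 2 \<le> L i0"
      proof -
        have "real_of_int (v i0) \<le> real (s i0)" using vb(1)[OF i0(1)] by (metis of_int_le_iff of_int_of_nat_eq)
        hence "(2 * real_of_int (v i0) + real (s i0)) / (2 * real (s i0)) \<le> 3 / 2"
          using v(1)[OF i0(1)] by (simp add: divide_le_eq)
        thus ?thesis unfolding L_def minus_divide_left[symmetric] by linarith
      qed
      show "L i \<le> (real (s i) - 4) / 2" if "i \<in> set tq" for i
      proof -
        have i: "i \<in> ?I" using setfc that by auto
        have s: "0 < real (s i)" using v(1)[OF i] by simp
        have "0 \<le> real_of_int (2 * v i + int (s i) * (int (s i) - 3))" using vb(2)[OF i] by (rule of_int_0_le_iff[THEN iffD2])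
        hence "- (2 * real_of_int (v i) + real (s i)) \<le> (real (s i) - 4) / 2 * (2 * real (s i))" by (simp add: algebra_simps)
        thus ?thesis unfolding L_def using s by (subst pos_divide_le_eq) auto
      qed
      show "length es = length tq" "d1 + sum_list es = d" using ds(1,2) des by simp_all
      show "d1 < d" using d1 lt by simp
      show "x \<le> d1" if ix: "(i, x) \<in> set (zip tq es)" "s i = s i0" for i x
      proof -
        have i: "i \<in> ?I" using set_zip_leftD[OF ix(1)] setfc by auto
        have "(i, x) \<in> set (zip (i0 # tq) ds)" using ix(1) des by simp
        hence "x \<le> dd i" using ds(3) dd i by blast
        thus ?thesis using dmax[OF i] ix(2) i0(2) d1 by simp
      qed
      show "30 * sum_list (map s (i0 # tq)) ^ 7 < d"
        using d_large sum_list_multiplicities[OF finite_atLeastAtMost tq, of s] by (simp only: degS)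
      show "- real_of_int c \<le> sum_list (map2 (\<lambda>i. piece_bound (s i) (L i)) (i0 # tq) (d1 # es)) +
          real (sum_list (map k (i0 # tq))) * real (sum_list es)" using ds(5) des by simp
    qed
    \<comment> \<open>The gain \<open>d / (4 * s 1)\<close> is the summand \<open>- 1 / 2\<close>
      inside the bracket of the claim.\<close>
    moreover have "L i0 = L 1" using i0(2) v_eq[OF i0(1) one i0(2)] by (simp add: L_def)
    ultimately have "real_of_int (arith_genus r C) \<le> real d ^ 2 / (2 * real (s 1)) +
        real d / (2 * real (s 1)) * (2 * real_of_int \<pi>\<^sub>1 - 2 - real (s 1) - 1 / 2)"
      unfolding L1 using i0(2) c(3) by simp
    thus ?thesis using False by (simp only: if_False)
  qed
qed

end
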